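(* Let $s\in(0,1]$, $m>1$, and $n\in\mathbb N$ with $n>2s$. There exists a nonnegative $u_0\in L^1_{G^s_{\mathbb R^n},0}(\mathbb R^n)$ such that the corresponding weak dual solution $u$ of $$\partial_tu+(-\Delta)^s(u^m)=0\ \text{ in }(0,\infty)\times\mathbb R^n,\qquad u(0,\cdot)=u_0,$$ satisfies $$\|u(t)\|_{L^\infty(\mathbb R^n)}=+\infty\qquad\text{for every }t>0 .$$
   Context: For $s\in(0,1)$, $(-\Delta)^s$ is the spectral fractional power of $-\Delta$ on $\mathbb R^n$; $(-\Delta)^1=-\Delta$. The Green function is $G^s_{\mathbb R^n}(x,y)=\frac1{\Gamma(s)}\int_0^\infty p(t,x,y)t^{s-1}dt=c_{n,s}|x-y|^{-(n-2s)}$ with $p$ the heat kernel, and $(-\Delta)^{-s}\psi(x):=\int_{\mathbb R^n}G^s_{\mathbb R^n}(x,y)\psi(y)\,dy$. $L^1_{G^s_{\mathbb R^n},x_0}(\mathbb R^n)$ is the space of measurable $v$ with $\int_{B_1(x_0)}|v|\,dx+\int_{\mathbb R^n\setminus B_1(x_0)}|v(x)|G^s_{\mathbb R^n}(x,x_0)\,dx<\infty$ (this is its norm). Weak dual solution (WDS): a measurable $u\ge0$ such that for every $T>0$: (i) $u\in C([0,T];L^1_{G^s_{\mathbb R^n},x_0}(\mathbb R^n))$ for all $x_0$; (ii) $u^m\in L^1((0,T);L^1_{\rm loc}(\mathbb R^n))$; (iii) for all $\psi\in C^1_c((0,T);L^\infty_c(\mathbb R^n))$ (bounded, with spatial supports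 in a common compact set), $\int_0^T\int\partial_t\psi\,(-\Delta)^{-s}u\,dx\,dt=\int_0^T\int u^m\psi\,dx\,dt$; (iv) $u(0)=u_0$ a.e. "The weak dual solution with datum $u_0$" means the one obtained by monotone approximation: take any nondecreasing sequence $0\le u_{0,k}\in L^1\cap L^\infty$ with $u_{0,k}\uparrow u_0$ a.e., let $u_k$ be the mild solution with datum $u_{0,k}$ (the $L^1$ nonlinear semigroup solution, i.e. the limit in $C([0,T];L^1)$, for every $T>0$, of the implicit Euler scheme $\frac T\ell(-\Delta)^s(v_{j+1}^m)+v_{j+1}=v_j$, $v_0=u_{0,k}$, as $\ell\to\infty$), and set $u=\lim_ku_k$ (monotone limit). It is a WDS and does not depend on the chosen sequence. *)

theory Defs
  imports "HOL-Analysis.Analysis" "HOL-Probability.Essential_Supremum"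
begin

text \<open>
  Norms take values in the extended nonnegative reals, so that a function belongs to a space
  iff it is Lebesgue measurable and its norm is finite. Elements are functions rather than
  equivalence classes, and relations between them are imposed almost everywhere.
\<close>

definition L1_norm :: "(real^'n \<Rightarrow> real) \<Rightarrow> ennreal" where
  "L1_norm f = (\<integral>\<^sup>+x. ennreal \<bar>f x\<bar> \<partial>lebesgue)"

definition Linf_norm :: "(real^'n \<Rightarrow> real) \<Rightarrow> ennreal" where
  "Linf_norm f = esssup lebesgue (\<lambda>x. ennreal \<bar>f x\<bar>)"

definition L1 :: "(real^'n \<Rightarrow> real) set" where
  "L1 = {f \<in> borel_measurable lebesgue. L1_norm f < \<infinity>}"

definition L2 :: "(real^'n \<Rightarrow> real) set" where
  "L2 = {f \<in> borel_measurable lebesgue. (\<integral>\<^sup>+x. ennreal ((f x)\<^sup>2) \<partial>lebesgue) < \<infinity>}"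

definition Linf :: "(real^'n \<Rightarrow> real) set" where
  "Linf = {f \<in> borel_measurable lebesgue. Linf_norm f < \<infinity>}"

definition continuous_in_norm ::
    "((real^'n \<Rightarrow> real) \<Rightarrow> ennreal) \<Rightarrow> real set \<Rightarrow> (real \<Rightarrow> real^'n \<Rightarrow> real) \<Rightarrow> bool" where
  "continuous_in_norm N I u \<longleftrightarrow>
     (\<forall>t\<in>I. ((\<lambda>\<tau>. N (\<lambda>x. u \<tau> x - u t x)) \<longlongrightarrow> 0) (at t within I))"

definition heat_kernel :: "real \<Rightarrow> real^'n \<Rightarrow> real^'n \<Rightarrow> real" where
  "heat_kernel t x y =
     (4 * pi * t) powr (- real CARD('n) / 2) * exp (- (norm (x - y))\<^sup>2 / (4 * t))"

text \<open>
  On the diagonal the integral diverges and the value is the conventional \<open>0\<close>; only integrals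
  over \<open>x\<close> or \<open>y\<close> are used.
\<close>

definition green :: "real \<Rightarrow> real^'n \<Rightarrow> real^'n \<Rightarrow> real" where
  "green s x y = 1 / Gamma s * (LINT t:{0<..}|lebesgue. heat_kernel t x y * t powr (s - 1))"

definition inv_frac_laplacian :: "real \<Rightarrow> (real^'n \<Rightarrow> real) \<Rightarrow> real^'n \<Rightarrow> real" where
  "inv_frac_laplacian s f x = (LINT y|lebesgue. green s x y * f y)"

definition L1G_norm :: "real \<Rightarrow> real^'n \<Rightarrow> (real^'n \<Rightarrow> real) \<Rightarrow> ennreal" where
  "L1G_norm s x0 v =
     (\<integral>\<^sup>+x\<in>ball x0 1. ennreal \<bar>v x\<bar> \<partial>lebesgue) +
     (\<integral>\<^sup>+x\<in>- ball x0 1. ennreal (\<bar>v x\<bar> * green s x x0) \<partial>lebesgue)"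

definition L1G :: "real \<Rightarrow> real^'n \<Rightarrow> (real^'n \<Rightarrow> real) set" where
  "L1G s x0 = {v \<in> borel_measurable lebesgue. L1G_norm s x0 v < \<infinity>}"

text \<open>
  \<open>\<psi> \<in> C\<^sup>1\<^sub>c((0,T); L\<^sup>\<infinity>\<^sub>c)\<close>, with \<open>d\<psi>\<close> its time derivative in \<open>L\<^sup>\<infinity>\<close>.
\<close>

definition test_function ::
    "real \<Rightarrow> (real \<Rightarrow> real^'n \<Rightarrow> real) \<Rightarrow> (real \<Rightarrow> real^'n \<Rightarrow> real) \<Rightarrow> bool" where
  "test_function T \<psi> d\<psi> \<longleftrightarrow>
     (\<forall>t\<in>{0<..<T}. \<psi> t \<in> Linf \<and> d\<psi> t \<in> Linf) \<and>
     (\<forall>t\<in>{0<..<T}. ((\<lambda>h. Linf_norm (\<lambda>x. (\<psi> (t + h) x - \<psi> t x) / h - d\<psi> t x)) \<longlongrightarrow> 0) (at 0)) \<and>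
     continuous_in_norm Linf_norm {0<..<T} d\<psi> \<and>
     (\<exists>a b. 0 < a \<and> b < T \<and> (\<forall>t\<in>{0<..<T} - {a..b}. AE x in lebesgue. \<psi> t x = 0)) \<and>
     (\<exists>K. compact K \<and> (\<forall>t\<in>{0<..<T}. AE x in lebesgue. x \<notin> K \<longrightarrow> \<psi> t x = 0))"

definition weak_dual_solution ::
    "real \<Rightarrow> real \<Rightarrow> (real^'n \<Rightarrow> real) \<Rightarrow> (real \<Rightarrow> real^'n \<Rightarrow> real) \<Rightarrow> bool" where
  "weak_dual_solution s m u0 u \<longleftrightarrow>
     (\<lambda>(t, x). u t x) \<in> borel_measurable (lebesgue_on ({0<..} \<times> UNIV)) \<and>
     (\<forall>t\<ge>0. AE x in lebesgue. 0 \<le> u t x) \<and>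
     (\<forall>T>0.
        (\<forall>x0. (\<forall>t\<in>{0..T}. u t \<in> L1G s x0) \<and> continuous_in_norm (L1G_norm s x0) {0..T} u) \<and>
        (\<forall>K. compact K \<longrightarrow>
           (\<integral>\<^sup>+(t, x)\<in>{0<..<T} \<times> K. ennreal (u t x powr m) \<partial>lebesgue) < \<infinity>) \<and>
        (\<forall>\<psi> d\<psi>. test_function T \<psi> d\<psi> \<longrightarrow>
           (LINT t:{0<..<T}|lebesgue. LINT x|lebesgue. d\<psi> t x * inv_frac_laplacian s (u t) x) =
           (LINT t:{0<..<T}|lebesgue. LINT x|lebesgue. u t x powr m * \<psi> t x))) \<and>
     (AE x in lebesgue. u 0 x = u0 x)"

definition fourier :: "(real^'n \<Rightarrow> real) \<Rightarrow> real^'n \<Rightarrow> complex" where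
  "fourier w \<xi> = (LINT x|lebesgue. complex_of_real (w x) * cis (- (x \<bullet> \<xi>)))"

text \<open>
  \<open>(-\<Delta>)\<^sup>s w = g\<close>. The Fourier transform diagonalises the self-adjoint operator \<open>-\<Delta>\<close> on
  \<open>L\<^sup>2(\<real>\<^sup>n)\<close> as multiplication by \<open>|\<xi>|\<^sup>2\<close>, so its spectral power is multiplication by
  \<open>|\<xi>|\<^sup>2\<^sup>s\<close>. The graph is taken in \<open>L\<^sup>1 \<inter> L\<^sup>2\<close>, where the transform is an absolutely
  convergent integral; this contains the functions occurring in the scheme below, which lie in
  \<open>L\<^sup>1 \<inter> L\<^sup>\<infinity>\<close>.
\<close>

definition frac_laplacian_eq :: "real \<Rightarrow> (real^'n \<Rightarrow> real) \<Rightarrow> (real^'n \<Rightarrow> real) \<Rightarrow> bool" where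
  "frac_laplacian_eq s w g \<longleftrightarrow>
     w \<in> L1 \<inter> L2 \<and> g \<in> L1 \<inter> L2 \<and>
     (\<forall>\<xi>. fourier g \<xi> = complex_of_real (norm \<xi> powr (2 * s)) * fourier w \<xi>)"

definition euler_scheme ::
    "real \<Rightarrow> real \<Rightarrow> real \<Rightarrow> nat \<Rightarrow> (real^'n \<Rightarrow> real) \<Rightarrow> (nat \<Rightarrow> real^'n \<Rightarrow> real) \<Rightarrow> bool" where
  "euler_scheme s m h N f v \<longleftrightarrow>
     (AE x in lebesgue. v 0 x = f x) \<and>
     (\<forall>j\<le>N. v j \<in> L1 \<inter> Linf \<and> (AE x in lebesgue. 0 \<le> v j x)) \<and>
     (\<forall>j<N. \<exists>g. frac_laplacian_eq s (\<lambda>x. v (Suc j) x powr m) g \<and>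
                (AE x in lebesgue. h * g x + v (Suc j) x = v j x))"

text \<open>
  The scheme \<open>v l\<close> with \<open>l\<close> steps on \<open>[0,T]\<close> is read as the step function with value
  \<open>v l j\<close> on \<open>((j-1)T/l, jT/l]\<close>, and converges uniformly in time with values in \<open>L\<^sup>1\<close>.
\<close>

definition mild_solution ::
    "real \<Rightarrow> real \<Rightarrow> (real^'n \<Rightarrow> real) \<Rightarrow> (real \<Rightarrow> real^'n \<Rightarrow> real) \<Rightarrow> bool" where
  "mild_solution s m f u \<longleftrightarrow>
     (\<forall>T>0.
        (\<forall>t\<in>{0..T}. u t \<in> L1) \<and> continuous_in_norm L1_norm {0..T} u \<and>
        (\<exists>v. (\<forall>l\<ge>1. euler_scheme s m (T / real l) l f (v l)) \<and>
             (\<lambda>l. SUP t\<in>{0..T}. L1_norm (\<lambda>x. v l (nat \<lceil>t * real l / T\<rceil>) x - u t x))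
               \<longlonglongrightarrow> 0))"

definition approximating_data ::
    "(real^'n \<Rightarrow> real) \<Rightarrow> (nat \<Rightarrow> real^'n \<Rightarrow> real) \<Rightarrow> bool" where
  "approximating_data u0 w \<longleftrightarrow>
     (\<forall>k. w k \<in> L1 \<inter> Linf) \<and>
     (AE x in lebesgue. (\<forall>k. 0 \<le> w k x) \<and> incseq (\<lambda>k. w k x) \<and> (\<lambda>k. w k x) \<longlonglongrightarrow> u0 x)"

definition monotone_weak_dual_solution ::
    "real \<Rightarrow> real \<Rightarrow> (real^'n \<Rightarrow> real) \<Rightarrow> (real \<Rightarrow> real^'n \<Rightarrow> real) \<Rightarrow> bool" where
  "monotone_weak_dual_solution s m u0 u \<longleftrightarrow>
     weak_dual_solution s m u0 u \<and>
     (\<exists>w U. approximating_data u0 w \<and> (\<forall>k. mild_solution s m (w k) (U k)) \<and>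
        (\<forall>t\<ge>0. AE x in lebesgue. incseq (\<lambda>k. U k t x) \<and> (\<lambda>k. U k t x) \<longlonglongrightarrow> u t x))"

end

theory Submission
  imports Defs "HOL-Probability.Probability" "HOL-Complex_Analysis.Complex_Analysis" "HOL-Real_Asymp.Real_Asymp"
begin

text \<open>
 If \<open>(-\<Delta>)\<^sup>s F \<le> \<epsilon> F\<close>, then \<open>(\<lambda>/(t + 1))\<^bsup>1/(m-1)\<^esup> F\<^bsup>1/m\<^esup>\<close> is a subsolution for \<open>\<lambda> \<le> 1/((m - 1) \<epsilon>)\<close>.
 A very wide Gaussian satisfies this with \<open>\<epsilon>\<close> as small as we please, so its height at time \<open>t\<close> can be made arbitrarily
 large. The datum is built from infinitely many such bumps with \<open>\<epsilon> = 1/(j + 1)\<close>, centred so far away that, by the decay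
 of the Green function, the weighted norm stays finite. Comparison puts every subsolution below the solution, at all times.

 The weight is \<open>\<Phi> = G * e\<^bsup>-|x|\<^sup>2\<^esup>\<close>, which is comparable to the weight of the norm and satisfies \<open>K\<^sub>\<mu> * \<Phi> \<le> \<Phi>/\<mu>\<close> for the
 resolvent kernels \<open>K\<^sub>\<mu>\<close>; hence the implicit Euler scheme, and with it the mild solutions and their monotone limits, is contractive in
 the weighted space. As the comparison with the subsolution is done on the scheme, it applies to every admissible solution.
\<close>

text \<open>On the Fourier side the resolvent is 1/(\<mu> + |\<xi>|^(2s)), where its positivity is
  invisible. Writing it as a mixture of heat kernels gives at once \<open>K \<mu> >= 0\<close>,
  total mass 1/\<mu> and \<open>K \<mu> <= dc * G\<close>; comparison, contraction and all weighted
  bounds come from these three facts. The amplitude of a separable subsolution follows A' = -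
  \<epsilon> A^m. However large A(0) is, A(t) stays below ((m - 1) \<epsilon> t)^(-1/(m - 1)), so
  raising one bump of fixed width cannot keep it high: \<epsilon> must tend to 0 along infinitely
  many bumps. The operator acts on u^m, therefore the bumps are added at the level of m-th powers.
  Every partial sum then lies in the domain of the generator, which yields an explicit convergence
  rate for the scheme and an actual solution; with it the claim about all solutions is not vacuous.
  An arbitrary approximating sequence need not lie above a bump, so the comparison is quantitative:
  the integral of the deficit of the solution below the subsolution never exceeds that of the
  data.\<close>

abbreviation Lint :: "('a::euclidean_space \<Rightarrow> 'b::{banach,second_countable_topology}) \<Rightarrow> bool" where "Lint \<equiv> integrable lborel"

abbreviation bm :: "('a::topological_space \<Rightarrow> 'b::topological_space) set" where "bm \<equiv> borel_measurable borel"

abbreviation lborel2 :: "('a::euclidean_space \<times> 'b::euclidean_space) measure" where "lborel2 \<equiv> lborel \<Otimes>\<^sub>M lborel"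

abbreviation nn_lborel :: "('a::euclidean_space \<Rightarrow> ennreal) \<Rightarrow> ennreal" (binder "LBNN " 60) where
 "nn_lborel \<equiv> nn_integral lborel"

lemmas integrable_bound = Bochner_Integration.integrable_bound
lemmas integral_cong = Bochner_Integration.integral_cong
lemmas integrable_diff = Bochner_Integration.integrable_diff
lemmas integrable_add = Bochner_Integration.integrable_add
lemmas integrable_sum = Bochner_Integration.integrable_sum
lemmas integral_sum = Bochner_Integration.integral_sum
lemmas integral_nonneg = Bochner_Integration.integral_nonneg
lemmas integral_diff = Bochner_Integration.integral_diff
lemmas integral_add = Bochner_Integration.integral_add
lemmas integrable_cong = Bochner_Integration.integrable_cong

section \<open>Convolution and the Fourier transform of integrable functions\<close>

lemma Lint_measurable: "Lint f \<Longrightarrow> f \<in> bm"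
 using borel_measurable_integrable by fastforce

lemma distr_lborel_shift: "distr lborel borel (\<lambda>x. x - a) = (lborel :: 'a::euclidean_space measure)"
 using lborel_affine[of 1 "-a"] by (simp add: density_1 scaleR_one)

lemma distr_lborel_reflect: "distr lborel borel (\<lambda>x. a - x) = (lborel :: 'a::euclidean_space measure)"
 using lborel_affine[of "-1" a] by (simp add: density_1 scaleR_minus1_left)

lemma
 fixes f :: "'a::euclidean_space \<Rightarrow> 'b::{banach,second_countable_topology}"
 assumes "Lint f"
 shows integrable_lborel_shift: "Lint (\<lambda>x. f (x - a))"
  and integrable_lborel_reflect: "Lint (\<lambda>x. f (a - x))"
  and integral_lborel_shift: "(LBINT x. f (x - a)) = (LBINT x. f x)"
  and integral_lborel_reflect: "(LBINT x. f (a - x)) = (LBINT x. f x)"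
proof -
 have [measurable]: "f \<in> bm" by (rule Lint_measurable[OF assms(1)])
 note d1 = distr_lborel_shift[of a] and d2 = distr_lborel_reflect[of a]
 show "Lint (\<lambda>x. f (x - a))"
  using assms by (subst (asm) d1[symmetric], subst (asm) integrable_distr_eq) auto
 show "Lint (\<lambda>x. f (a - x))"
  using assms by (subst (asm) d2[symmetric], subst (asm) integrable_distr_eq) auto
 show "(LBINT x. f (x - a)) = (LBINT x. f x)"
  by (subst (2) d1[symmetric], subst integral_distr) auto
 show "(LBINT x. f (a - x)) = (LBINT x. f x)"
  by (subst (2) d2[symmetric], subst integral_distr) auto
qed

definition conv :: "('a::euclidean_space \<Rightarrow> real) \<Rightarrow> ('a \<Rightarrow> real) \<Rightarrow> 'a \<Rightarrow> real" where
 "conv k f x = (LBINT y. k (x - y) * f y)"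

definition ft :: "('a::euclidean_space \<Rightarrow> real) \<Rightarrow> 'a \<Rightarrow> complex" where
 "ft f \<xi> = (LBINT x. complex_of_real (f x) * cis (- (x \<bullet> \<xi>)))"

lemma measurable_cis [measurable]: "cis \<in> bm"
 by (intro borel_measurable_continuous_onI continuous_intros)

lemma measurable_conv [measurable]:
 assumes [measurable]: "k \<in> bm" "f \<in> bm"
 shows "conv k f \<in> bm"
 unfolding conv_def by measurable

lemma integrable_ft:
 assumes "Lint f" and [measurable]: "g \<in> bm"
 shows "Lint (\<lambda>x. complex_of_real (f x) * cis (g x))"
proof -
 have [measurable]: "f \<in> bm" by (rule Lint_measurable[OF assms(1)])
 show ?thesis by (rule integrable_bound[OF assms(1)]) (auto simp: norm_mult)
qed

text \<open>Tonelli with x integrated before y: by translation invariance the inner integral of |k(x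
  - y) f(y)| is the L1 norm of k times |f(y)|.\<close>

lemma integrable_conv_pair:
 fixes k f :: "'a::euclidean_space \<Rightarrow> real"
 assumes k: "Lint k" and f: "Lint f"
 shows "integrable lborel2 (\<lambda>(x,y). k (x - y) * f y)"
proof -
 have [measurable]: "f \<in> bm" "k \<in> bm"
  using assms by (auto intro: Lint_measurable)
 have "integrable lborel2 (\<lambda>(y,x). k (x - y) * f y)"
 proof (rule lborel_pair.Fubini_integrable)
  have "(\<lambda>y. LBINT x. norm (case (y, x) of (y, x) \<Rightarrow> k (x - y) * f y)) =
    (\<lambda>y. (LBINT x. \<bar>k x\<bar>) * \<bar>f y\<bar>)"
  proof
   fix y
   have "(LBINT x. norm (case (y, x) of (y, x) \<Rightarrow> k (x - y) * f y)) = (LBINT x. \<bar>k (x - y)\<bar> * \<bar>f y\<bar>)"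
    by (simp add: abs_mult)
   also have "\<dots> = (LBINT x. \<bar>k (x - y)\<bar>) * \<bar>f y\<bar>" by simp
   also have "(LBINT x. \<bar>k (x - y)\<bar>) = (LBINT x. \<bar>k x\<bar>)"
    using k by (intro integral_lborel_shift) auto
   finally show "(LBINT x. norm (case (y, x) of (y, x) \<Rightarrow> k (x - y) * f y)) = (LBINT x. \<bar>k x\<bar>) * \<bar>f y\<bar>" .
  qed
  thus "Lint (\<lambda>y. LBINT x. norm (case (y, x) of (y, x) \<Rightarrow> k (x - y) * f y))"
   using f by simp
  show "AE y in lborel. Lint (\<lambda>x. case (y, x) of (y, x) \<Rightarrow> k (x - y) * f y)"
   using k by (auto intro!: integrable_lborel_shift)
 qed measurable
 from lborel_pair.integrable_product_swap[OF this] show ?thesis by (simp add: case_prod_beta)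
qed

text \<open>All four claims are Fubini for the integrable function above. For \<open>ft_conv\<close>
  the phase splits as exp(-i (x - y).\<xi>) exp(-i y.\<xi>), so the x-integral is a translate of
  \<open>ft k\<close>.\<close>

lemma
 fixes k f :: "'a::euclidean_space \<Rightarrow> real"
 assumes k: "Lint k" and f: "Lint f"
 shows integrable_conv: "Lint (conv k f)"
  and AE_integrable_conv: "AE x in lborel. Lint (\<lambda>y. k (x - y) * f y)"
  and integral_conv: "(LBINT x. conv k f x) = (LBINT x. k x) * (LBINT x. f x)"
  and ft_conv: "ft (conv k f) \<xi> = ft k \<xi> * ft f \<xi>"
proof -
 have [measurable]: "f \<in> bm" "k \<in> bm"
  using assms by (auto intro: Lint_measurable)
 note I = integrable_conv_pair[OF k f]
 show "Lint (conv k f)"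
  using lborel_pair.integrable_fst'[OF I] by (simp add: conv_def[abs_def])
 show "AE x in lborel. Lint (\<lambda>y. k (x - y) * f y)"
  using lborel_pair.AE_integrable_fst'[OF I] by simp
 show "(LBINT x. conv k f x) = (LBINT x. k x) * (LBINT x. f x)"
 proof -
  have "(LBINT x. conv k f x) = (LBINT y. (LBINT x. k (x - y) * f y))"
   unfolding conv_def using lborel_pair.Fubini_integral[of "\<lambda>x y. k (x - y) * f y"] I by simp
  also have "\<dots> = (LBINT y. (LBINT x. k x) * f y)"
   using integral_lborel_shift[OF k] by simp
  finally show ?thesis by simp
 qed
 show "ft (conv k f) \<xi> = ft k \<xi> * ft f \<xi>"
 proof -
  define h where "h = (\<lambda>x y. complex_of_real (k (x - y) * f y) * cis (- (x \<bullet> \<xi>)))"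
  have hI: "integrable lborel2 (\<lambda>(x, y). h x y)"
   by (rule integrable_bound[OF I]) (auto simp: h_def norm_mult)
  have "ft (conv k f) \<xi> = (LBINT x. (LBINT y. h x y))"
  proof -
   have "complex_of_real (conv k f x) * cis (- (x \<bullet> \<xi>)) = (LBINT y. h x y)" for x
    by (simp add: conv_def h_def flip: integral_complex_of_real)
   thus ?thesis by (simp add: ft_def)
  qed
  also have "\<dots> = (LBINT y. (LBINT x. h x y))"
   using lborel_pair.Fubini_integral[OF hI] by simp
  also have "\<dots> = (LBINT y. ft k \<xi> * (complex_of_real (f y) * cis (- (y \<bullet> \<xi>))))"
  proof (rule integral_cong[OF refl])
   fix y
   have "(LBINT x. h x y) =
     (LBINT x. (complex_of_real (k (x - y)) * cis (- ((x - y) \<bullet> \<xi>))) * (complex_of_real (f y) * cis (- (y \<bullet> \<xi>))))"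
    by (intro integral_cong) (auto simp: h_def cis_mult inner_diff_left mult_ac)
   also have "\<dots> = (LBINT x. (complex_of_real (k (x - y)) * cis (- ((x - y) \<bullet> \<xi>)))) * (complex_of_real (f y) * cis (- (y \<bullet> \<xi>)))"
    by simp
   also have "(LBINT x. (complex_of_real (k (x - y)) * cis (- ((x - y) \<bullet> \<xi>)))) = ft k \<xi>"
    unfolding ft_def by (rule integral_lborel_shift[OF integrable_ft[OF k]]) measurable
   finally show "(LBINT x. h x y) = ft k \<xi> * (complex_of_real (f y) * cis (- (y \<bullet> \<xi>)))" .
  qed
  finally show ?thesis by (simp add: ft_def)
 qed
qed

lemma ft_add:
 assumes "Lint f" "Lint g"
 shows "ft (\<lambda>x. a * f x + b * g x) \<xi> = a * ft f \<xi> + b * ft g \<xi>"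
proof -
 have "ft (\<lambda>x. a * f x + b * g x) \<xi> = (LBINT x. a * (complex_of_real (f x) * cis (- (x \<bullet> \<xi>))) + b * (complex_of_real (g x) * cis (- (x \<bullet> \<xi>))))"
  by (simp add: ft_def algebra_simps)
 thus ?thesis
  using assms by (subst (asm) integral_add) (auto simp: ft_def intro!: integrable_ft)
qed

lemma ft_cong_AE:
 assumes "AE x in lborel. f x = g x" "f \<in> bm" "g \<in> bm"
 shows "ft f = ft g"
 unfolding ft_def using assms by (intro ext integral_cong_AE) auto

lemma
 fixes k f :: "'a::euclidean_space \<Rightarrow> real"
 assumes k: "Lint k" and [measurable]: "f \<in> bm" and f: "\<And>x. \<bar>f x\<bar> \<le> B"
 shows integrable_conv_bounded: "Lint (\<lambda>y. k (x - y) * f y)"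
  and conv_bounded: "\<bar>conv k f x\<bar> \<le> B * (LBINT x. \<bar>k x\<bar>)"
proof -
 have [measurable]: "k \<in> bm"
  using assms by (auto intro: Lint_measurable)
 have kr: "Lint (\<lambda>y. B * \<bar>k (x - y)\<bar>)"
  using integrable_lborel_reflect[OF k] by simp
 have b: "\<bar>k (x - y) * f y\<bar> \<le> B * \<bar>k (x - y)\<bar>" for y
  using mult_right_mono[OF f[of y], of "\<bar>k (x-y)\<bar>"] by (simp add: abs_mult mult.commute)
 show I: "Lint (\<lambda>y. k (x - y) * f y)"
  by (rule integrable_bound[OF kr]) (auto intro!: AE_I2 order.trans[OF b])
 have "\<bar>conv k f x\<bar> \<le> (LBINT y. \<bar>k (x - y) * f y\<bar>)"
  unfolding conv_def using integral_norm_bound[of lborel "\<lambda>y. k (x - y) * f y"] by simp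
 also have "\<dots> \<le> (LBINT y. B * \<bar>k (x - y)\<bar>)"
  using I kr b by (intro integral_mono) auto
 also have "\<dots> = B * (LBINT x. \<bar>k x\<bar>)"
  using integral_lborel_reflect[of "\<lambda>x. \<bar>k x\<bar>" x] k by simp
 finally show "\<bar>conv k f x\<bar> \<le> B * (LBINT x. \<bar>k x\<bar>)" .
qed

lemma conv_L1_bound:
 fixes k f :: "'a::euclidean_space \<Rightarrow> real"
 assumes k: "Lint k" and f: "Lint f"
 shows "(LBINT x. \<bar>conv k f x\<bar>) \<le> (LBINT x. \<bar>k x\<bar>) * (LBINT x. \<bar>f x\<bar>)"
proof -
 have "(LBINT x. \<bar>conv k f x\<bar>) \<le> (LBINT x. conv (\<lambda>x. \<bar>k x\<bar>) (\<lambda>x. \<bar>f x\<bar>) x)"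
 proof (intro integral_mono integrable_conv integrable_abs k f)
  show "\<bar>conv k f x\<bar> \<le> conv (\<lambda>x. \<bar>k x\<bar>) (\<lambda>x. \<bar>f x\<bar>) x" for x
   unfolding conv_def using integral_norm_bound[of lborel "\<lambda>y. k (x - y) * f y"] by (simp add: abs_mult)
 qed
 also have "\<dots> = (LBINT x. \<bar>k x\<bar>) * (LBINT x. \<bar>f x\<bar>)"
  using k f by (intro integral_conv) auto
 finally show ?thesis .
qed

text \<open>An even kernel is symmetric in (x, y), so Fubini moves the convolution to the other
  factor; the bound on \<phi> provides the integrable majorant on the product space.\<close>

lemma conv_adjoint:
 fixes k f \<phi> :: "'a::euclidean_space \<Rightarrow> real"
 assumes k: "Lint k" and f: "Lint f" and even: "\<And>x. k (- x) = k x"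
  and [measurable]: "\<phi> \<in> bm" and b: "\<And>x. \<bar>\<phi> x\<bar> \<le> B"
 shows "(LBINT x. conv k f x * \<phi> x) = (LBINT x. f x * conv k \<phi> x)"
proof -
 have [measurable]: "k \<in> bm" "f \<in> bm"
  using assms by (auto intro: Lint_measurable)
 have B: "B \<ge> 0" using b[of undefined] by linarith
 have I: "integrable lborel2 (\<lambda>(x,y). k (x - y) * f y * \<phi> x)"
 proof (rule integrable_bound)
  show "integrable lborel2 (\<lambda>z. B * (case z of (x,y) \<Rightarrow> k (x - y) * f y))"
   using integrable_conv_pair[OF k f] by auto
  show "AE z in lborel \<Otimes>\<^sub>M lborel. norm (case z of (x, y) \<Rightarrow> k (x - y) * f y * \<phi> x)
     \<le> norm (B * (case z of (x,y) \<Rightarrow> k (x - y) * f y))"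
   using b B by (auto simp: abs_mult mult_ac intro!: AE_I2 mult_right_mono)
 qed measurable
 have "(LBINT x. conv k f x * \<phi> x) = (LBINT x. (LBINT y. k (x - y) * f y * \<phi> x))"
  by (simp add: conv_def)
 also have "\<dots> = (LBINT y. (LBINT x. k (x - y) * f y * \<phi> x))"
  using lborel_pair.Fubini_integral[OF I] by simp
 also have "\<dots> = (LBINT y. f y * conv k \<phi> y)"
 proof (rule integral_cong[OF refl])
  fix y
  have "k (x - y) = k (y - x)" for x using even[of "x - y"] by simp
  hence "(LBINT x. k (x - y) * f y * \<phi> x) = (LBINT x. f y * (k (y - x) * \<phi> x))"
   by (simp add: mult_ac)
  thus "(LBINT x. k (x - y) * f y * \<phi> x) = f y * conv k \<phi> y" by (simp add: conv_def)
 qed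
 finally show ?thesis .
qed

lemma conv_diff:
 assumes "Lint (\<lambda>y. k (x - y) * f y)" "Lint (\<lambda>y. k (x - y) * g y)"
 shows "conv k (\<lambda>y. a * f y + b * g y) x = a * conv k f x + b * conv k g x"
proof -
 have "conv k (\<lambda>y. a * f y + b * g y) x = (LBINT y. a * (k (x - y) * f y) + b * (k (x - y) * g y))"
  by (simp add: conv_def algebra_simps)
 thus ?thesis using assms by (simp add: conv_def)
qed

lemma conv_scale: "conv k (\<lambda>x. c * f x) x = c * conv k f x"
proof -
 have "(LBINT y. k (x - y) * (c * f y)) = (LBINT y. c * (k (x - y) * f y))"
  by (intro integral_cong) auto
 thus ?thesis by (simp add: conv_def)
qed

text \<open>Concentration at the origin is tested against the single function exp(-|x|^2), because
  this integral is computable for heat and resolvent kernels and already controls the mass outside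
  every ball. Indicators are treated by outer regularity and the rest by density, using that the
  operators are bounded on L1 uniformly in i.\<close>

lemma approximate_identity:
 fixes k :: "nat \<Rightarrow> 'a::euclidean_space \<Rightarrow> real"
 assumes k: "\<And>i. Lint (k i)" and nn: "\<And>i x. 0 \<le> k i x"
  and mass: "\<And>i. (LBINT x. k i x) = 1"
  and conc: "(\<lambda>i. LBINT x. k i x * exp (- (norm x)\<^sup>2)) \<longlonglongrightarrow> 1"
  and f: "Lint f"
 shows "(\<lambda>i. LBINT x. \<bar>conv (k i) f x - f x\<bar>) \<longlonglongrightarrow> 0"
proof -
 let ?d = "\<lambda>i f. LBINT x. \<bar>conv (k i) f x - f x\<bar>"
 have [measurable]: "k i \<in> bm" for i
  using k by (auto intro: Lint_measurable)
 have contr: "(?d i g) \<le> 2 * (LBINT x. \<bar>g x\<bar>)" if g: "Lint g" for g i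
 proof -
  have I: "Lint (conv (k i) g)" by (rule integrable_conv[OF k g])
  have "(?d i g) \<le> (LBINT x. \<bar>conv (k i) g x\<bar> + \<bar>g x\<bar>)"
   using I g by (intro integral_mono) auto
  also have "\<dots> = (LBINT x. \<bar>conv (k i) g x\<bar>) + (LBINT x. \<bar>g x\<bar>)"
   using I g by (intro integral_add) auto
  also have "(LBINT x. \<bar>conv (k i) g x\<bar>) \<le> (LBINT x. \<bar>g x\<bar>)"
   using conv_L1_bound[OF k g, of i] nn mass by simp
  finally show ?thesis by simp
 qed
 \<comment> \<open>A measurable set has no interior to work with. Replacing A by an open superset U
   of almost the same measure makes the smoothed indicator converge to 1 at every point of
   A.\<close>
 have ind: "(\<lambda>i. ?d i (indicator A)) \<longlonglongrightarrow> 0"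
  if A[measurable]: "A \<in> sets lborel" and fin: "emeasure lborel A < \<infinity>" for A :: "'a set"
 proof (rule LIMSEQ_I)
  fix e :: real assume e: "0 < e"
  have [measurable]: "A \<in> sets borel" using A by simp
  obtain U where U: "open U" "A \<subseteq> U" "emeasure lborel (U - A) < ennreal (e/4)"
   using outer_regular_lborel[of A "e/4"] A e by auto
  have [measurable]: "U \<in> sets borel" using U by auto
  have finD: "emeasure lborel (U - A) < \<infinity>" using U(3) by (auto intro: less_trans)
  have mD: "measure lborel (U - A) < e/4"
   using U(3) finD e by (simp add: emeasure_eq_ennreal_measure ennreal_less_iff)
  define p where "p = (\<lambda>i. conv (k i) (indicator U))"
  define c where "c = (\<lambda>i. conv (k i) (indicator A))"
  define d where "d = (\<lambda>i. conv (k i) (indicator (U - A)))"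
  have iA: "Lint (indicator A :: 'a \<Rightarrow> real)" using A fin by (auto simp: integrable_indicator_iff)
  have iD: "Lint (indicator (U - A) :: 'a \<Rightarrow> real)" using finD by (auto simp: integrable_indicator_iff)
  have b01: "0 \<le> conv (k i) (indicator S) x \<and> conv (k i) (indicator S) x \<le> 1" if [measurable]: "S \<in> sets borel" for S i x
  proof
   show "0 \<le> conv (k i) (indicator S) x" unfolding conv_def by (intro integral_nonneg_AE) (auto simp: nn)
   have "\<bar>conv (k i) (indicator S) x\<bar> \<le> 1 * (LBINT x. \<bar>k i x\<bar>)"
    by (rule conv_bounded[OF k]) (auto simp: indicator_def)
   thus "conv (k i) (indicator S) x \<le> 1" using nn mass by simp
  qed
  have pcd: "p i x = c i x + d i x" for i x
  proof -
   have "(\<lambda>y. indicat_real U y) = (\<lambda>y. 1 * indicator A y + 1 * indicator (U - A) y)"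
    using U(2) by (auto simp: indicator_def fun_eq_iff)
   thus ?thesis unfolding p_def c_def d_def
    by (simp only:) (subst conv_diff, auto intro!: integrable_conv_bounded[OF k, where B=1] simp: indicator_def)
  qed
  have plim: "(\<lambda>i. p i x) \<longlonglongrightarrow> 1" if x: "x \<in> A" for x
  proof -
   obtain r where r: "r > 0" "ball x r \<subseteq> U" using U(1,2) x openE by blast
   define q where "q = 1 - exp (- r\<^sup>2)"
   have q: "q > 0" using r by (simp add: q_def)
   \<comment> \<open>Chebyshev: outside the ball of radius r the factor 1 - exp(-|z|^2) is at least
     q, so the mass escaping from U is at most the Gaussian deficit divided by q.\<close>
   have low: "p i x \<ge> 1 - (1 - (LBINT x. k i x * exp (- (norm x)\<^sup>2))) / q" for i
   proof -
    have ie: "Lint (\<lambda>x. k i x * exp (- (norm x)\<^sup>2))"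
     by (rule integrable_bound[OF k[of i]]) (auto simp: nn abs_mult mult_left_le)
    have "(LBINT y. k i (x - y) - k i (x-y) * indicator U y) \<le> (LBINT y. (k i (x - y) - k i (x - y) * exp (- (norm (x - y))\<^sup>2)) / q)"
    proof (rule integral_mono)
     show "Lint (\<lambda>y. k i (x - y) - k i (x-y) * indicator U y)"
      by (intro integrable_diff integrable_lborel_reflect k integrable_conv_bounded[OF k, where B=1]) (auto simp: indicator_def)
     show "Lint (\<lambda>y. (k i (x - y) - k i (x - y) * exp (- (norm (x - y))\<^sup>2)) / q)"
      using integrable_lborel_reflect[OF ie, of x] integrable_lborel_reflect[OF k, of i x] by auto
     fix y
     show "k i (x - y) - k i (x-y) * indicator U y \<le> (k i (x - y) - k i (x - y) * exp (- (norm (x - y))\<^sup>2)) / q"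
     proof (cases "y \<in> U")
      case True
      have "k i (x - y) * exp (- (norm (x - y))\<^sup>2) \<le> k i (x - y)" by (rule mult_left_le) (auto simp: nn)
      with True q show ?thesis by (simp add: indicator_def)
     next
      case False
      hence "norm (x - y) \<ge> r" using r(2) by (auto simp: dist_norm not_less[symmetric])
      hence "exp (- (norm (x - y))\<^sup>2) \<le> exp (- r\<^sup>2)" using r(1) by (simp add: power_mono)
      hence "k i (x - y) * q \<le> k i (x - y) * (1 - exp (- (norm (x - y))\<^sup>2))"
       unfolding q_def by (intro mult_left_mono) (auto simp: nn)
      with False q show ?thesis by (simp add: field_simps)
     qed
    qed
    also have "\<dots> = (1 - (LBINT x. k i x * exp (- (norm x)\<^sup>2))) / q"
     using integrable_lborel_reflect[OF ie, of x] integrable_lborel_reflect[OF k, of i x]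
      integral_lborel_reflect[OF ie, of x] integral_lborel_reflect[OF k, of i x] mass by simp
    also have "(LBINT y. k i (x - y) - k i (x-y) * indicator U y) = 1 - p i x"
     unfolding p_def conv_def
     by (subst integral_diff)
       (auto intro!: integrable_lborel_reflect k integrable_conv_bounded[OF k, where B=1] simp: integral_lborel_reflect[OF k] mass indicator_def)
    finally show ?thesis by linarith
   qed
   show ?thesis
   proof (rule tendsto_sandwich[where h="\<lambda>_. 1"])
    show "(\<lambda>i. 1 - (1 - (LBINT x. k i x * exp (- (norm x)\<^sup>2))) / q) \<longlonglongrightarrow> 1"
     using tendsto_diff[OF tendsto_const tendsto_divide[OF tendsto_diff[OF tendsto_const conc] tendsto_const[of q]], of 1 1] q by simp
    show "\<forall>\<^sub>F i in sequentially. p i x \<le> 1" using b01 by (auto simp: p_def)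
   qed (use low in auto)
  qed
  have pA: "(\<lambda>i. LBINT x. indicator A x * p i x) \<longlonglongrightarrow> (LBINT x. indicator A x)"
  proof (rule integral_dominated_convergence[where w="indicator A"])
   show "AE x in lborel. (\<lambda>i. indicator A x * p i x) \<longlonglongrightarrow> indicator A x"
    using plim by (intro AE_I2) (auto simp: indicator_def)
   show "AE x in lborel. norm (indicator A x * p i x) \<le> indicator A x" for i
    using b01 by (intro AE_I2) (auto simp: indicator_def p_def)
  qed (use iA in \<open>auto simp: p_def\<close>)
  obtain N where N: "\<And>i. i \<ge> N \<Longrightarrow> \<bar>(LBINT x. indicator A x * p i x) - measure lborel A\<bar> < e/4"
   using LIMSEQ_D[OF pA, of "e/4"] e by auto
  have lin: "I < e" if "I \<le> 2 * (a - b + c)" "a - b < e/4" "c < e/4" for I a b c :: real using that by argo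
  have "norm ((?d i (indicator A)) - 0) < e" if i: "i \<ge> N" for i
  proof -
   have ic: "Lint (c i)" and id: "Lint (d i)"
    unfolding c_def d_def using iA iD k by (auto intro: integrable_conv)
   have iAc: "Lint (\<lambda>x. indicator A x * g x)" if "Lint g" for g :: "'a \<Rightarrow> real"
    using integrable_mult_indicator[OF _ that, of A] by simp
   \<comment> \<open>Since 0 <= \<open>c i\<close> <= 1, the distance to the indicator is 1_A + c -
     2 1_A c. The total mass of c is that of A, so only the overlap with A matters, and it differs
     from that of p by at most the measure of U - A.\<close>
   have "(LBINT x. \<bar>c i x - indicator A x\<bar>) = (LBINT x. indicator A x + c i x - 2 * (indicator A x * c i x))"
    using b01[of A] by (intro integral_cong) (auto simp: indicator_def c_def)
   also have "\<dots> = measure lborel A + (LBINT x. c i x) - 2 * (LBINT x. indicator A x * c i x)"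
    using ic iA iAc[OF ic] by simp
   also have "(LBINT x. c i x) = measure lborel A"
    unfolding c_def using integral_conv[OF k iA] mass by simp
   also have "(LBINT x. indicator A x * c i x) = (LBINT x. indicator A x * p i x) - (LBINT x. indicator A x * d i x)"
    using iAc[OF ic] iAc[OF id] by (simp add: pcd distrib_left)
   also have "(LBINT x. indicator A x * d i x) \<le> (LBINT x. d i x)"
    using b01[of "U - A"] by (intro integral_mono iAc id) (auto simp: indicator_def d_def)
   also have "(LBINT x. d i x) = measure lborel (U - A)"
    unfolding d_def using integral_conv[OF k iD] mass by simp
   finally have "(LBINT x. \<bar>c i x - indicator A x\<bar>) \<le> 2 * (measure lborel A - (LBINT x. indicator A x * p i x) + measure lborel (U - A))"
    by simp
   moreover have "measure lborel A - (LBINT x. indicator A x * p i x) < e/4"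
    using conjunct2[OF N[OF i, unfolded abs_less_iff]] unfolding minus_diff_eq .
   ultimately have "(LBINT x. \<bar>c i x - indicator A x\<bar>) < e"
    using mD by (rule lin)
   moreover have "(LBINT x. \<bar>c i x - indicator A x\<bar>) \<ge> 0" by simp
   ultimately show ?thesis by (simp add: c_def)
  qed
  thus "\<exists>N. \<forall>i\<ge>N. norm ((?d i (indicator A)) - 0) < e" by blast
 qed
 show ?thesis using f
 proof (induct rule: integrable_induct)
  case (base A c)
  have "\<bar>conv (k i) (\<lambda>x. indicator A x *\<^sub>R c) x - indicator A x *\<^sub>R c\<bar> = \<bar>c\<bar> * \<bar>conv (k i) (indicator A) x - indicator A x\<bar>" for i x
   using conv_scale[of "k i" c "indicator A" x] by (simp add: mult.commute abs_mult[symmetric] right_diff_distrib)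
  hence "(LBINT x. \<bar>conv (k i) (\<lambda>x. indicator A x *\<^sub>R c) x - indicator A x *\<^sub>R c\<bar>) = \<bar>c\<bar> * (?d i (indicator A))" for i
   by simp
  thus ?case using tendsto_mult_right_zero[OF ind[OF base], of "\<bar>c\<bar>"] by simp
 next
  case (add f g)
  have le: "?d i (\<lambda>x. f x + g x) \<le> (?d i f) + (?d i g)" for i
  proof -
   have ae: "AE x in lborel. conv (k i) (\<lambda>x. f x + g x) x = conv (k i) f x + conv (k i) g x"
    using AE_integrable_conv[OF k add(1), of i] AE_integrable_conv[OF k add(3), of i]
   proof eventually_elim
    case (elim x) thus ?case using conv_diff[of "k i" x f g 1 1] by simp
   qed
   have I: "Lint (conv (k i) (\<lambda>x. f x + g x))" "Lint (conv (k i) f)" "Lint (conv (k i) g)"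
    using add k by (auto intro!: integrable_conv)
   have "?d i (\<lambda>x. f x + g x) \<le> (LBINT x. \<bar>conv (k i) f x - f x\<bar> + \<bar>conv (k i) g x - g x\<bar>)"
    using ae I add by (intro integral_mono_AE) auto
   also have "\<dots> = (?d i f) + (?d i g)"
    using I add by (intro integral_add) auto
   finally show ?thesis .
  qed
  show ?case
   by (rule tendsto_sandwich[where f="\<lambda>_. 0" and h="\<lambda>i. (?d i f) + (?d i g)"])
     (use le tendsto_add[OF add(2) add(4)] in auto)
 next
  case (lim f t)
  have [measurable]: "f \<in> bm" "t j \<in> bm" for j
   using lim by (auto intro: Lint_measurable)
  have "(\<lambda>j. LBINT x. \<bar>t j x - f x\<bar>) \<longlonglongrightarrow> (\<integral>x. 0 \<partial>(lborel::'a measure))"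
  proof (rule integral_dominated_convergence[where w="\<lambda>x. 3 * \<bar>f x\<bar>"])
   show "AE x in lborel. (\<lambda>j. \<bar>t j x - f x\<bar>) \<longlonglongrightarrow> 0"
    using lim(3) by (intro AE_I2 tendsto_rabs_zero) (simp add: LIM_zero_iff)
   show "AE x in lborel. norm \<bar>t j x - f x\<bar> \<le> 3 * \<bar>f x\<bar>" for j
   proof (rule AE_I2)
    fix x :: 'a
    show "norm \<bar>t j x - f x\<bar> \<le> 3 * \<bar>f x\<bar>" using lim(4)[of x j] by (auto simp: abs_if split: if_splits)
   qed
  qed (use lim in auto)
  hence tl: "(\<lambda>j. LBINT x. \<bar>t j x - f x\<bar>) \<longlonglongrightarrow> 0" by simp
  show ?case
  proof (rule LIMSEQ_I)
   fix e :: real assume e: "0 < e"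
   obtain j where j: "(LBINT x. \<bar>t j x - f x\<bar>) < e/4"
   proof -
    obtain j where "norm ((LBINT x. \<bar>t j x - f x\<bar>) - 0) < e/4"
     using LIMSEQ_D[OF tl, of "e/4"] e by (metis order_refl zero_less_divide_iff zero_less_numeral)
    thus ?thesis by (intro that[of j]) (simp add: abs_less_iff)
   qed
   obtain N where N: "\<And>i. i \<ge> N \<Longrightarrow> (?d i (t j)) < e/4"
    using LIMSEQ_D[OF lim(2)[of j], of "e/4"] e by auto
   have lin: "I < e" if "I \<le> X + Y" "X \<le> 2 * Z" "Z < e/4" "Y < e/4" for I X Y Z :: real using that e by argo
   have "norm ((?d i f) - 0) < e" if "i \<ge> N" for i
   proof -
    define g where "g = (\<lambda>x. f x - t j x)"
    have g: "Lint g" unfolding g_def using lim by auto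
    have ae: "AE x in lborel. conv (k i) g x = conv (k i) f x - conv (k i) (t j) x"
     using AE_integrable_conv[OF k lim(5), of i] AE_integrable_conv[OF k lim(1), of i j]
    proof eventually_elim
     case (elim x) thus ?case using conv_diff[of "k i" x f "t j" 1 "-1"] by (simp add: g_def)
    qed
    have I: "Lint (conv (k i) f)" "Lint (conv (k i) g)" "Lint (conv (k i) (t j))"
     using lim g k by (auto intro!: integrable_conv)
    have "(?d i f) \<le> (LBINT x. \<bar>conv (k i) g x - g x\<bar> + \<bar>conv (k i) (t j) x - t j x\<bar>)"
     using ae I lim g by (intro integral_mono_AE) (auto simp: g_def)
    also have "\<dots> = (?d i g) + (?d i (t j))"
     using I lim g by (intro integral_add) auto
    finally have 1: "(?d i f) \<le> (?d i g) + (?d i (t j))" .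
    have 2: "(LBINT x. \<bar>g x\<bar>) < e/4" using j by (simp add: g_def abs_minus_commute)
    have "(?d i f) < e" by (rule lin[OF 1 contr[OF g] 2 N[OF that]])
    moreover have "(?d i f) \<ge> 0" by simp
    ultimately show ?thesis by simp
   qed
   thus "\<exists>N. \<forall>i\<ge>N. norm ((?d i f) - 0) < e" by blast
  qed
 qed
qed

section \<open>Gaussians and injectivity of the Fourier transform\<close>

text \<open>A rescaling of the characteristic function of the standard normal law; c = sqrt(2 a)
  turns exp(-(c x)^2/2) into exp(-a x^2).\<close>

lemma
 fixes a \<xi> :: real
 assumes a: "a > 0"
 shows gauss_1d_integrable: "Lint (\<lambda>x. complex_of_real (exp (- a * x\<^sup>2)) * cis (- (x * \<xi>)))"
  and gauss_1d: "(LBINT x. complex_of_real (exp (- a * x\<^sup>2)) * cis (- (x * \<xi>)))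
   = complex_of_real (sqrt (pi / a) * exp (- \<xi>\<^sup>2 / (4 * a)))"
proof -
 have nI: "Lint (\<lambda>x. complex_of_real (std_normal_density x) * cis (t * x))" for t
  by (rule integrable_bound[of _ std_normal_density]) (auto simp: norm_mult)
 have nV: "(LBINT x. complex_of_real (std_normal_density x) * cis (t * x)) = complex_of_real (exp (- (t\<^sup>2) / 2))" for t
 proof -
  have "(LBINT x. complex_of_real (std_normal_density x) * cis (t * x)) = char std_normal_distribution t"
   unfolding char_def by (subst integral_density) (auto simp: cis_conv_exp scaleR_conv_of_real mult_ac)
  thus ?thesis by (simp add: char_std_normal_distribution)
 qed
 define c where "c = sqrt (2 * a)"
 have c: "c > 0" "c\<^sup>2 = 2 * a" using a by (auto simp: c_def)
 have eq: "sqrt (2 * pi) *\<^sub>R (complex_of_real (std_normal_density (0 + c * x)) * cis ((- \<xi> / c) * (0 + c * x)))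
   = complex_of_real (exp (- a * x\<^sup>2)) * cis (- (x * \<xi>))" for x
  using c by (simp add: std_normal_density_def power_mult_distrib scaleR_conv_of_real mult_ac)
 have "Lint (\<lambda>x. complex_of_real (std_normal_density (0 + c * x)) * cis ((- \<xi> / c) * (0 + c * x)))"
  using lborel_integrable_real_affine[OF nI[of "- \<xi> / c"], of c 0] c by simp
 from integrable_scaleR_right[OF this, of "sqrt (2 * pi)"]
 show "Lint (\<lambda>x. complex_of_real (exp (- a * x\<^sup>2)) * cis (- (x * \<xi>)))"
  unfolding eq .
 have "complex_of_real (exp (- ((- \<xi> / c)\<^sup>2) / 2)) =
   c *\<^sub>R (LBINT x. complex_of_real (std_normal_density (0 + c * x)) * cis ((- \<xi> / c) * (0 + c * x)))"
  using lborel_integral_real_affine[of c "\<lambda>x. complex_of_real (std_normal_density x) * cis ((- \<xi> / c) * x)" 0] c nV[of "- \<xi> / c"] by simp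
 hence "(sqrt (2 * pi) / c) *\<^sub>R complex_of_real (exp (- ((- \<xi> / c)\<^sup>2) / 2)) =
   (sqrt (2 * pi)) *\<^sub>R (LBINT x. complex_of_real (std_normal_density (0 + c * x)) * cis ((- \<xi> / c) * (0 + c * x)))"
  using c by simp
 also have "\<dots> = (LBINT x. sqrt (2 * pi) *\<^sub>R (complex_of_real (std_normal_density (0 + c * x)) * cis ((- \<xi> / c) * (0 + c * x))))"
  by (rule integral_scaleR_right[symmetric])
 also have "\<dots> = (LBINT x. complex_of_real (exp (- a * x\<^sup>2)) * cis (- (x * \<xi>)))"
  unfolding eq ..
 also have "sqrt (2 * pi) / c = sqrt (pi / a)"
  using a by (simp add: c_def real_sqrt_divide real_sqrt_mult)
 also have "- ((- \<xi> / c)\<^sup>2) / 2 = - \<xi>\<^sup>2 / (4 * a)" using c by (simp add: power_divide)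
 finally show "(LBINT x. complex_of_real (exp (- a * x\<^sup>2)) * cis (- (x * \<xi>)))
   = complex_of_real (sqrt (pi / a) * exp (- \<xi>\<^sup>2 / (4 * a)))" by (simp add: scaleR_conv_of_real)
qed

lemma
 fixes f :: "'a::euclidean_space \<Rightarrow> real \<Rightarrow> 'b::{real_normed_field,banach,second_countable_topology}"
 assumes f: "\<And>b. b \<in> Basis \<Longrightarrow> Lint (f b)"
 shows integrable_lborel_prod: "Lint (\<lambda>x. \<Prod>b\<in>Basis. f b (x \<bullet> b))"
  and integral_lborel_prod: "(LBINT x. (\<Prod>b\<in>Basis. f b (x \<bullet> b))) = (\<Prod>b\<in>Basis. LBINT x. f b x)"
proof -
 interpret product_sigma_finite "\<lambda>b::'a. lborel :: real measure" by standard
 have [measurable]: "b \<in> Basis \<Longrightarrow> f b \<in> bm" for b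
  using f by (auto dest: borel_measurable_integrable)
 have eq: "(\<Prod>b\<in>Basis. f b ((\<Sum>c\<in>Basis. y c *\<^sub>R c) \<bullet> b)) = (\<Prod>b\<in>Basis. f b (y b))" for y :: "'a \<Rightarrow> real"
  by (intro prod.cong) (auto simp: inner_sum_left inner_Basis if_distrib cong: if_cong)
 show "Lint (\<lambda>x. \<Prod>b\<in>Basis. f b (x \<bullet> b))"
  by (subst lborel_eq, subst integrable_distr_eq) (auto simp: eq intro!: product_integrable_prod f)
 show "(LBINT x. (\<Prod>b\<in>Basis. f b (x \<bullet> b))) = (\<Prod>b\<in>Basis. LBINT x. f b x)"
  by (subst lborel_eq, subst integral_distr) (auto simp: eq intro!: product_integral_prod f)
qed

lemma
 fixes \<xi> :: "'a::euclidean_space"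
 assumes a: "a > 0"
 shows integrable_gauss_cis: "Lint (\<lambda>x. complex_of_real (exp (- a * (norm x)\<^sup>2)) * cis (- (x \<bullet> \<xi>)))"
  and ft_gauss: "ft (\<lambda>x. exp (- a * (norm x)\<^sup>2)) \<xi> = complex_of_real (sqrt (pi / a) ^ DIM('a) * exp (- (norm \<xi>)\<^sup>2 / (4 * a)))"
proof -
 define f where "f = (\<lambda>b y. complex_of_real (exp (- a * y\<^sup>2)) * cis (- (y * (\<xi> \<bullet> b))))"
 have cis_sum: "cis (\<Sum>b\<in>S. g b) = (\<Prod>b\<in>S. cis (g b))" if "finite S" for S and g :: "'a \<Rightarrow> real"
  using that by (induction S) (auto simp: cis_mult[symmetric])
 have nrm: "(norm x)\<^sup>2 = (\<Sum>b\<in>Basis. (x \<bullet> b)\<^sup>2)" for x :: 'a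
  by (subst power2_norm_eq_inner, subst euclidean_inner) (simp add: power2_eq_square)
 have eq: "(\<Prod>b\<in>Basis. f b (x \<bullet> b)) = complex_of_real (exp (- a * (norm x)\<^sup>2)) * cis (- (x \<bullet> \<xi>))" for x
 proof -
  have "(\<Prod>b\<in>Basis. f b (x \<bullet> b)) = complex_of_real (\<Prod>b\<in>Basis. exp (- a * (x \<bullet> b)\<^sup>2)) * (\<Prod>b\<in>Basis. cis (- ((x \<bullet> b) * (\<xi> \<bullet> b))))"
   by (simp add: f_def prod.distrib)
  also have "(\<Prod>b\<in>Basis. exp (- a * (x \<bullet> b)\<^sup>2)) = exp (- a * (norm x)\<^sup>2)"
   unfolding nrm by (subst exp_sum[symmetric]) (auto simp: sum_distrib_left)
  also have "(\<Prod>b\<in>Basis. cis (- ((x \<bullet> b) * (\<xi> \<bullet> b)))) = cis (- (x \<bullet> \<xi>))"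
   by (subst cis_sum[symmetric], simp, subst euclidean_inner[of x \<xi>]) (simp add: sum_negf)
  finally show ?thesis .
 qed
 have fI: "Lint (f b)" for b unfolding f_def by (rule gauss_1d_integrable[OF a])
 show "Lint (\<lambda>x. complex_of_real (exp (- a * (norm x)\<^sup>2)) * cis (- (x \<bullet> \<xi>)))"
  using integrable_lborel_prod[of f] fI unfolding eq by simp
 have "ft (\<lambda>x. exp (- a * (norm x)\<^sup>2)) \<xi> = (\<Prod>b\<in>Basis. LBINT x. f b x)"
  unfolding ft_def using integral_lborel_prod[of f] fI unfolding eq by simp
 also have "\<dots> = (\<Prod>b\<in>Basis. complex_of_real (sqrt (pi / a)) * complex_of_real (exp (- (\<xi> \<bullet> b)\<^sup>2 / (4 * a))))"
  unfolding f_def gauss_1d[OF a] by simp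
 also have "\<dots> = complex_of_real (sqrt (pi / a) ^ DIM('a)) * complex_of_real (\<Prod>b\<in>Basis. exp (- (\<xi> \<bullet> b)\<^sup>2 / (4 * a)))"
  by (simp add: prod.distrib)
 also have "(\<Prod>b\<in>Basis. exp (- (\<xi> \<bullet> b)\<^sup>2 / (4 * a))) = exp (- (norm \<xi>)\<^sup>2 / (4 * a))"
  unfolding nrm by (subst exp_sum[symmetric]) (auto simp: sum_negf[symmetric] sum_divide_distrib)
 finally show "ft (\<lambda>x. exp (- a * (norm x)\<^sup>2)) \<xi> = complex_of_real (sqrt (pi / a) ^ DIM('a) * exp (- (norm \<xi>)\<^sup>2 / (4 * a)))"
  by simp
qed

lemma
 assumes a: "a > 0"
 shows integrable_gauss: "Lint (\<lambda>x::'a::euclidean_space. exp (- a * (norm x)\<^sup>2))"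
  and integral_gauss: "(LBINT x. exp (- a * (norm (x::'a))\<^sup>2)) = sqrt (pi / a) ^ DIM('a)"
proof -
 have I: "Lint (\<lambda>x::'a. complex_of_real (exp (- a * (norm x)\<^sup>2)))"
  using integrable_gauss_cis[OF a, of 0] by simp
 show J: "Lint (\<lambda>x::'a. exp (- a * (norm x)\<^sup>2))"
  by (rule complex_of_real_integrable_eq[THEN iffD1, OF I])
 have "complex_of_real (LBINT x. exp (- a * (norm (x::'a))\<^sup>2)) = complex_of_real (sqrt (pi / a) ^ DIM('a))"
  using ft_gauss[OF a, of "0::'a"] unfolding ft_def by (simp flip: integral_complex_of_real)
 thus "(LBINT x. exp (- a * (norm (x::'a))\<^sup>2)) = sqrt (pi / a) ^ DIM('a)"
  by (simp only: of_real_eq_iff)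
qed

section \<open>The heat kernel as a function of x - y, and injectivity of the Fourier
  transform\<close>

definition heat :: "real \<Rightarrow> 'a::euclidean_space \<Rightarrow> real" where
 "heat t x = (4 * pi * t) powr (- real DIM('a) / 2) * exp (- (norm x)\<^sup>2 / (4 * t))"

lemma heat_nonneg: "0 \<le> heat t x" by (simp add: heat_def)
lemma heat_even [simp]: "heat t (- x) = heat t x" by (simp add: heat_def)

lemma measurable_heat [measurable (raw)]:
 assumes [measurable]: "f \<in> borel_measurable M" "g \<in> borel_measurable M"
 shows "(\<lambda>x. heat (f x) (g x)) \<in> borel_measurable M"
 unfolding heat_def by measurable

lemma sqrt_power_powr: "x > 0 \<Longrightarrow> sqrt x ^ n = x powr (real n / 2)"
 by (simp add: powr_half_sqrt[symmetric] powr_realpow[symmetric] powr_powr)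

lemma ft_scale: "ft (\<lambda>x. c * f x) \<xi> = c * ft f \<xi>"
 unfolding ft_def by (simp add: mult.assoc)

text \<open>\<open>integral_heat_gauss\<close> is the concentration test of
  \<open>approximate_identity\<close>: its value tends to 1 as t tends to 0.\<close>

lemma
 assumes t: "t > 0"
 shows integrable_heat: "Lint (heat t :: 'a::euclidean_space \<Rightarrow> real)"
  and integral_heat: "(LBINT x. heat t (x::'a)) = 1"
  and ft_heat: "ft (heat t) (\<xi>::'a) = complex_of_real (exp (- t * (norm \<xi>)\<^sup>2))"
  and integral_heat_gauss: "(LBINT x. heat t (x::'a) * exp (- (norm x)\<^sup>2)) = (1 + 4 * t) powr (- real DIM('a) / 2)"
proof -
 define a where "a = 1 / (4 * t)"
 have a: "a > 0" using t by (simp add: a_def)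
 define c where "c = (4 * pi * t) powr (- real DIM('a) / 2)"
 have eq: "heat t = (\<lambda>x::'a. c * exp (- a * (norm x)\<^sup>2))"
  by (auto simp: heat_def a_def c_def fun_eq_iff)
 have c: "c * sqrt (pi / a) ^ DIM('a) = 1"
  using t by (simp add: sqrt_power_powr c_def a_def mult_ac powr_minus field_simps)
 show "Lint (heat t :: 'a \<Rightarrow> real)" unfolding eq using integrable_gauss[OF a, where 'a='a] by simp
 show "(LBINT x. heat t (x::'a)) = 1" unfolding eq using integral_gauss[OF a, where 'a='a] c by simp
 show "ft (heat t) \<xi> = complex_of_real (exp (- t * (norm \<xi>)\<^sup>2))"
  unfolding eq ft_scale ft_gauss[OF a] using c t by (simp add: a_def mult.assoc[symmetric] flip: of_real_mult)
 have "(LBINT x. heat t (x::'a) * exp (- (norm x)\<^sup>2)) = (LBINT x. c * exp (- (a + 1) * (norm (x::'a))\<^sup>2))"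
  unfolding eq by (simp add: exp_add[symmetric] algebra_simps)
 also have "\<dots> = c * (pi / (a + 1)) powr (DIM('a) / 2)"
  using integral_gauss[of "a+1", where 'a='a] a by (simp add: sqrt_power_powr)
 also have "pi / (a + 1) = 4 * pi * t / (1 + 4 * t)" using t by (simp add: a_def field_simps)
 also have "c * \<dots> powr (DIM('a) / 2) = (1 + 4 * t) powr (- real DIM('a) / 2)"
  using t by (simp add: c_def powr_divide powr_minus field_simps)
 finally show "(LBINT x. heat t (x::'a) * exp (- (norm x)\<^sup>2)) = (1 + 4 * t) powr (- real DIM('a) / 2)" .
qed

text \<open>The heat kernel is itself the Fourier transform of a Gaussian. By Fubini its convolution
  with f is an integral of \<open>ft f\<close> against that Gaussian, hence zero, and letting e tend
  to 0 recovers f in L1.\<close>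

lemma ft_injective_zero:
 fixes f :: "'a::euclidean_space \<Rightarrow> real"
 assumes f: "Lint f" and z: "\<And>\<xi>. ft f \<xi> = 0"
 shows "AE x in lborel. f x = 0"
proof -
 have [measurable]: "f \<in> bm" by (rule Lint_measurable[OF f])
 have conv0: "conv (heat e) f x = 0" if e: "e > 0" for e x
 proof -
  define c where "c = (4 * pi * e) powr (- real DIM('a) / 2) / sqrt (pi / e) ^ DIM('a)"
  define E where "E = (\<lambda>\<xi>::'a. complex_of_real (exp (- e * (norm \<xi>)\<^sup>2)))"
  have h: "complex_of_real (heat e z) = c * (LBINT \<xi>. E \<xi> * cis (- (\<xi> \<bullet> z)))" for z :: 'a
  proof -
   have "(LBINT \<xi>. E \<xi> * cis (- (\<xi> \<bullet> z))) = complex_of_real (sqrt (pi / e) ^ DIM('a) * exp (- (norm z)\<^sup>2 / (4 * e)))"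
    using ft_gauss[OF e, of z] by (simp add: ft_def E_def)
   thus ?thesis using e by (simp add: c_def heat_def)
  qed
  define F where "F = (\<lambda>\<xi> y. E \<xi> * cis (- (\<xi> \<bullet> (x - y))) * complex_of_real (f y))"
  have IE: "Lint (\<lambda>\<xi>. exp (- e * (norm \<xi>)\<^sup>2))" for \<xi> :: 'a by (rule integrable_gauss[OF e])
  have I: "integrable lborel2 (\<lambda>(\<xi>, y). F \<xi> y)"
  proof (rule lborel_pair.Fubini_integrable)
   show "(\<lambda>(\<xi>, y). F \<xi> y) \<in> borel_measurable lborel2" unfolding F_def E_def by measurable
   have "(LBINT y. norm (F \<xi> y)) = exp (- e * (norm \<xi>)\<^sup>2) * (LBINT y. \<bar>f y\<bar>)" for \<xi>
    by (simp add: F_def E_def norm_mult)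
   thus "Lint (\<lambda>\<xi>. LBINT y. norm (case (\<xi>, y) of (\<xi>, y) \<Rightarrow> F \<xi> y))"
    using integrable_gauss[OF e, where 'a='a] by simp
   show "AE \<xi> in lborel. Lint (\<lambda>y. case (\<xi>, y) of (\<xi>, y) \<Rightarrow> F \<xi> y)"
   proof (rule AE_I2)
    fix \<xi> :: 'a
    show "Lint (\<lambda>y. case (\<xi>, y) of (\<xi>, y) \<Rightarrow> F \<xi> y)"
     by (rule integrable_bound[OF f]) (auto simp: F_def E_def norm_mult mult_left_le_one_le e less_imp_le)
   qed
  qed
  have "complex_of_real (conv (heat e) f x) = (LBINT y. complex_of_real (heat e (x - y)) * complex_of_real (f y))"
   by (simp add: conv_def flip: integral_complex_of_real)
  also have "\<dots> = (LBINT y. c * (LBINT \<xi>. F \<xi> y))"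
   by (simp add: h F_def mult.assoc[symmetric])
  also have "\<dots> = c * (LBINT y. (LBINT \<xi>. F \<xi> y))" by simp
  also have "(LBINT y. (LBINT \<xi>. F \<xi> y)) = (LBINT \<xi>. (LBINT y. F \<xi> y))"
   using lborel_pair.Fubini_integral[OF I] by simp
  also have "(\<lambda>\<xi>. LBINT y. F \<xi> y) = (\<lambda>\<xi>. 0)"
  proof
   fix \<xi> :: 'a
   have "cis (- (\<xi> \<bullet> (x - y))) = cis (- (\<xi> \<bullet> x)) * cis (- (y \<bullet> (- \<xi>)))" for y
    unfolding cis_mult by (simp add: inner_diff_right inner_commute)
   hence "(LBINT y. F \<xi> y) = (LBINT y. (E \<xi> * cis (- (\<xi> \<bullet> x))) * (complex_of_real (f y) * cis (- (y \<bullet> (- \<xi>)))))"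
    by (intro integral_cong) (auto simp: F_def)
   also have "\<dots> = (E \<xi> * cis (- (\<xi> \<bullet> x))) * ft f (- \<xi>)"
    unfolding ft_def by simp
   finally show "(LBINT y. F \<xi> y) = 0" by (simp add: z)
  qed
  finally show ?thesis by simp
 qed
 have "(\<lambda>i. LBINT x. \<bar>conv (heat (1 / real (Suc i))) f x - f x\<bar>) \<longlonglongrightarrow> 0"
 proof (rule approximate_identity[OF integrable_heat heat_nonneg integral_heat _ f])
  have "(\<lambda>i. (1 + 4 * (1 / real (Suc i))) powr (- real DIM('a) / 2)) \<longlonglongrightarrow> (1 + 4 * 0) powr (- real DIM('a) / 2)"
   by (intro tendsto_intros LIMSEQ_Suc lim_1_over_n) auto
  thus "(\<lambda>i. LBINT x. heat (1 / real (Suc i)) (x::'a) * exp (- (norm x)\<^sup>2)) \<longlonglongrightarrow> 1"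
   by (subst integral_heat_gauss) auto
 qed auto
 hence "(\<lambda>i. LBINT x. \<bar>f x\<bar>) \<longlonglongrightarrow> 0" by (simp add: conv0)
 hence "(LBINT x. \<bar>f x\<bar>) = 0" by (simp add: LIMSEQ_const_iff)
 thus ?thesis using integral_nonneg_eq_0_iff_AE[of lborel "\<lambda>x. \<bar>f x\<bar>"] f by simp
qed

lemma ft_injective:
 assumes f: "Lint f" and g: "Lint g" and z: "\<And>\<xi>. ft f \<xi> = ft g \<xi>"
 shows "AE x in lborel. f x = g x"
proof -
 have "AE x in lborel. 1 * f x + (-1) * g x = 0"
  by (rule ft_injective_zero) (use f g z ft_add[OF f g, of 1 "-1"] in auto)
 thus ?thesis by auto
qed

section \<open>The resolvent of a fractional power as a mixture of exponentials\<close>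

text \<open>With \<open>z = - e\<^sup>y\<close>, Kato's weight is \<open>1/(2 \<pi> i)\<close> times the jump of \<open>1/(\<mu> + z\<^sup>s)\<close> across the negative half-line.\<close>

definition kato :: "real \<Rightarrow> real \<Rightarrow> real \<Rightarrow> real" where
 "kato s \<mu> y = sin (pi * s) / pi * exp (s * y) / (\<mu>\<^sup>2 + 2 * \<mu> * exp (s * y) * cos (pi * s) + (exp (s * y))\<^sup>2)"

lemma measurable_kato [measurable]: "kato s \<mu> \<in> bm"
 unfolding kato_def by measurable

text \<open>The difference of the two sides is the square (\<mu> + exp(s y) cos(\<pi> s))^2. The
  lower bound is free of \<mu>, which is what makes every later estimate uniform in \<mu>.\<close>

lemma kato_denominator:
 assumes s: "0 < s" "s < 1"
 shows "(exp (s * y))\<^sup>2 * (sin (pi * s))\<^sup>2 \<le> \<mu>\<^sup>2 + 2 * \<mu> * exp (s * y) * cos (pi * s) + (exp (s * y))\<^sup>2" (is "?l \<le> ?r")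
  and "0 < (exp (s * y))\<^sup>2 * (sin (pi * s))\<^sup>2"
proof -
 have "?r - ?l = (\<mu> + exp (s * y) * cos (pi * s))\<^sup>2"
  unfolding sin_squared_eq by (simp add: power2_eq_square algebra_simps)
 thus "?l \<le> ?r" by (metis diff_ge_0_iff_ge zero_le_power2)
 have "sin (pi * s) > 0" using s by (intro sin_gt_zero) auto
 thus "0 < ?l" by simp
qed

lemma sin_pi_pos: "0 < s \<Longrightarrow> s < 1 \<Longrightarrow> sin (pi * s) > 0"
 by (intro sin_gt_zero) auto

lemma
 assumes s: "0 < s" "s < 1"
 shows kato_nonneg: "0 \<le> kato s \<mu> y"
  and kato_le: "kato s \<mu> y \<le> exp (- s * y) / (pi * sin (pi * s))"
proof -
 let ?d = "\<mu>\<^sup>2 + 2 * \<mu> * exp (s * y) * cos (pi * s) + (exp (s * y))\<^sup>2"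
 have d: "0 < ?d" using kato_denominator[OF s, of y] kato_denominator(1)[OF s, of y \<mu>] by linarith
 have p: "sin (pi * s) > 0" by (rule sin_pi_pos[OF s])
 show "0 \<le> kato s \<mu> y" using d p unfolding kato_def by (intro divide_nonneg_nonneg mult_nonneg_nonneg) auto
 have "kato s \<mu> y \<le> sin (pi * s) / pi * exp (s * y) / ((exp (s * y))\<^sup>2 * (sin (pi * s))\<^sup>2)"
  unfolding kato_def by (intro divide_left_mono kato_denominator[OF s] mult_nonneg_nonneg divide_nonneg_nonneg mult_pos_pos d) (use p in auto)
 also have "\<dots> = exp (- s * y) / (pi * sin (pi * s))"
  using p by (simp add: power2_eq_square field_simps exp_minus)
 finally show "kato s \<mu> y \<le> exp (- s * y) / (pi * sin (pi * s))" .
qed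

section \<open>The contour integral behind Kato's weight\<close>

lemma contour_integral_linepath_same_Im:
 assumes "Im z = c" "Im z' = c" "Re z = a" "Re z' = b" "a < b"
 shows   "contour_integral (linepath z z') f = integral {a..b} (\<lambda>x. f (Complex x c))"
proof -
 have zz': "z = Complex a c" "z' = Complex b c"
  using assms by (auto simp: complex_eq_iff)
 have "contour_integral (linepath z z') f = (z' - z) * integral {0..1} (\<lambda>x. f (linepath z z' x))"
  by (simp add: contour_integral_integral)
 also have "z' - z = of_real (b - a)"
  by (simp add: zz' Complex_eq algebra_simps)
 also have "integral {0..1} (\<lambda>x. f (linepath z z' x)) =
       integral {0..1} (\<lambda>x. f (Complex (linepath a b x) c))"
  by (simp add: linepath_def Complex_eq scaleR_conv_of_real algebra_simps zz')
 also have "\<dots> = integral {0..(b - a) / (b - a)} (\<lambda>x. f (Complex (a + (b - a) * x) c))"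
  using \<open>a < b\<close> by (simp add: algebra_simps linepath_def)
 also have "{0..(b - a) / (b - a)} = (\<lambda>x. x / (b - a)) ` {0..b - a}"
  using \<open>a < b\<close> by simp
 also have "integral \<dots> (\<lambda>x. f (Complex (a + (b - a) * x) c)) =
       integral {a-a..b-a} (\<lambda>x. f (Complex (x + a) c)) / of_real (b - a)"
  using \<open>a < b\<close> by (subst integral_stretch_real) (auto simp: scaleR_conv_of_real add_ac)
 also have "\<dots> = integral {a..b} (\<lambda>x. f (Complex x c)) / of_real (b - a)"
  by (subst integral_shift_real_ivl) (rule refl)
 finally show ?thesis
  using \<open>a < b\<close> by simp
qed

text \<open>Residue theorem for F(z) exp z / (exp z - exp x) with F(z) = 1/(\<mu> + exp(s z)) on the
  rectangle with corners -L - i \<pi> and L + i \<pi>; in logarithmic coordinates this rectangle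
  replaces the keyhole contour. On the horizontal sides exp z = - exp y, the jump of F is 2 \<pi> i
  times the weight, and the only pole is x, with residue F(x).\<close>

lemma
 assumes s: "0 < s" "s < 1" and mu: "\<mu> > 0"
 shows kato_integrable: "Lint (\<lambda>y. kato s \<mu> y * exp y / (exp y + exp x))"
  and kato_integral: "(LBINT y. kato s \<mu> y * exp y / (exp y + exp x)) = 1 / (\<mu> + exp (s * x))"
proof -
 define k where "k = (\<lambda>y. kato s \<mu> y * exp y / (exp y + exp x))"
 have k_nonneg: "0 \<le> k y" for y unfolding k_def using kato_nonneg[OF s, of \<mu> y] by (simp add: add_pos_pos less_imp_le)
 have [measurable]: "k \<in> bm" unfolding k_def by measurable
 define F where "F = (\<lambda>z::complex. 1 / (of_real \<mu> + exp (of_real s * z)))"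
 define f where "f = (\<lambda>z::complex. F z * exp z / (exp z - exp (of_real x)))"
 \<comment> \<open>The strip has to contain the lines Im z = \<pi> and Im z = -\<pi>. |Im z| <
   \<pi>/s keeps \<mu> + exp(s z) away from 0, and |Im z| < 2 \<pi> leaves x as the only zero of exp
   z - exp x; both bounds exceed \<pi> because s < 1.\<close>
 define b where "b = min (pi / s) (2 * pi)"
 have b: "b > pi" using s by (auto simp: b_def field_simps)
 define S where "S = {z::complex. - b < Im z \<and> Im z < b}"
 have S_eq: "S = {z. - b < Im z} \<inter> {z. Im z < b}" by (auto simp: S_def)
 have "open S" unfolding S_eq by (intro open_Int open_halfspace_Im_gt open_halfspace_Im_lt)
 have "convex S" unfolding S_eq by (intro convex_Int convex_halfspace_Im_gt convex_halfspace_Im_lt)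
 hence "connected S" by (rule convex_connected)
 have den1: "of_real \<mu> + exp (of_real s * z) \<noteq> 0" if "z \<in> S" for z
 proof
  assume eq: "of_real \<mu> + exp (of_real s * z) = 0"
  have "Im (of_real \<mu> + exp (of_real s * z)) = exp (s * Re z) * sin (s * Im z)" by (simp add: Im_exp)
  with eq have s0: "sin (s * Im z) = 0" by simp
  have "s * b \<le> pi" using s by (auto simp: b_def min_def field_simps)
  moreover have "\<bar>s * Im z\<bar> < s * b" using that s by (simp add: S_def abs_mult abs_less_iff)
  ultimately have lt: "\<bar>s * Im z\<bar> < pi" by linarith
  have "s * Im z = 0"
  proof (rule ccontr)
   assume "s * Im z \<noteq> 0"
   then consider "s * Im z > 0" | "- (s * Im z) > 0" by linarith
   thus False
   proof cases
    case 1 with sin_gt_zero[of "s * Im z"] lt s0 show False by auto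
   next
    case 2 with sin_gt_zero[of "- (s * Im z)"] lt s0 show False by auto
   qed
  qed
  hence "cos (s * Im z) = 1" by (metis cos_zero)
  hence "Re (of_real \<mu> + exp (of_real s * z)) = \<mu> + exp (s * Re z)" by (simp add: Re_exp)
  with eq have "\<mu> + exp (s * Re z) = 0" by simp
  moreover have "exp (s * Re z) > 0" by simp
  ultimately show False using mu by linarith
 qed
 have den2: "exp z - exp (of_real x) \<noteq> 0" if "z \<in> S" "z \<noteq> of_real x" for z
 proof
  assume "exp z - exp (of_real x) = 0"
  then obtain n :: int where n: "z = of_real x + of_real (of_int (2 * n) * pi) * \<i>"
   by (auto simp: exp_eq)
  have "Im z = 2 * of_int n * pi" using n by simp
  moreover have "\<bar>Im z\<bar> < 2 * pi" using that by (auto simp: S_def b_def)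
  ultimately have "\<bar>of_int n :: real\<bar> < 1" by (auto simp: abs_mult)
  hence "n = 0" by linarith
  with n that show False by simp
 qed
 have F_holo: "F holomorphic_on S" unfolding F_def using den1 by (intro holomorphic_intros) auto
 have f_holo: "f holomorphic_on S - {of_real x}" unfolding f_def
  using den2 by (intro holomorphic_intros holomorphic_on_subset[OF F_holo]) auto
 have xS: "of_real x \<in> S" using order.strict_trans[OF pi_gt_zero b] by (simp add: S_def)
 have res: "residue f (of_real x) = F (of_real x)"
 proof (rule residue_simple'[OF \<open>open S\<close> xS f_holo])
  have "((\<lambda>w. (exp w - exp (of_real x)) / (w - of_real x)) \<longlongrightarrow> exp (of_real x :: complex)) (at (of_real x))"
   using DERIV_exp[of "of_real x :: complex"] by (simp add: has_field_derivative_iff)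
  moreover have "isCont F (of_real x)"
   using F_holo \<open>open S\<close> xS by (meson continuous_on_eq_continuous_at holomorphic_on_imp_continuous_on)
  hence "(F \<longlongrightarrow> F (of_real x)) (at (of_real x))" by (simp add: isCont_def)
  moreover have "((\<lambda>w. exp w) \<longlongrightarrow> exp (of_real x :: complex)) (at (of_real x))" by (intro tendsto_intros)
  ultimately have "((\<lambda>w. F w * exp w / ((exp w - exp (of_real x)) / (w - of_real x))) \<longlongrightarrow> F (of_real x) * exp (of_real x) / exp (of_real x)) (at (of_real x))"
   by (intro tendsto_intros) auto
  thus "((\<lambda>w. f w * (w - of_real x)) \<longlongrightarrow> F (of_real x)) (at (of_real x))"
   by (simp add: f_def)
 qed
 define R where "R = (\<lambda>L. Complex L (-pi))"
 define T where "T = (\<lambda>L. Complex L pi)"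
 define V where "V = (\<lambda>L. contour_integral (linepath (R L) (T L)) f)"
 \<comment> \<open>Anticlockwise, the bottom side minus the top side gives 2 \<pi> i times the
   integral of k, and the vertical sides contribute V(L) - V(-L).\<close>
 have key: "complex_of_real (2 * pi) * \<i> * of_real (integral {-L..L} k) + V L - V (-L) = 2 * pi * \<i> * F (of_real x)"
  and Vint: "f contour_integrable_on linepath (R L) (T L)" "f contour_integrable_on linepath (R (-L)) (T (-L))"
  if L: "L > \<bar>x\<bar>" for L
 proof -
  have Lp: "L > 0" using L by linarith
  have sub: "closed_segment (Complex a1 b1) (Complex a2 b2) \<subseteq> S - {of_real x}"
   if "\<bar>b1\<bar> = pi" "\<bar>b2\<bar> = pi" "(a1 = a2 \<and> \<bar>a1\<bar> = L) \<or> b1 = b2" for a1 a2 b1 b2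
  proof
   fix w assume w: "w \<in> closed_segment (Complex a1 b1) (Complex a2 b2)"
   then obtain u where u: "0 \<le> u" "u \<le> 1" "w = (1 - u) *\<^sub>R Complex a1 b1 + u *\<^sub>R Complex a2 b2"
    by (auto simp: closed_segment_def)
   have Im: "Im w = (1 - u) * b1 + u * b2" and Re: "Re w = (1 - u) * a1 + u * a2" using u(3) by auto
   have "\<bar>Im w\<bar> \<le> \<bar>(1 - u) * b1\<bar> + \<bar>u * b2\<bar>" unfolding Im by (rule abs_triangle_ineq)
   also have "\<dots> = pi" using u(1,2) that(1,2) by (simp add: abs_mult) (simp add: algebra_simps)
   finally have "w \<in> S" using b by (auto simp: S_def)
   moreover have "w \<noteq> of_real x"
    using that(3)
   proof
    assume "a1 = a2 \<and> \<bar>a1\<bar> = L"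
    hence "Re w = a1" "\<bar>a1\<bar> = L" unfolding Re by (auto simp: algebra_simps)
    thus ?thesis using L by auto
   next
    assume "b1 = b2"
    hence "\<bar>Im w\<bar> = pi" using that unfolding Im by (simp add: algebra_simps)
    thus ?thesis using pi_gt_zero by auto
   qed
   ultimately show "w \<in> S - {of_real x}" by auto
  qed
  have cs: "continuous_on (closed_segment (Complex a1 b1) (Complex a2 b2)) f"
   if "\<bar>b1\<bar> = pi" "\<bar>b2\<bar> = pi" "(a1 = a2 \<and> \<bar>a1\<bar> = L) \<or> b1 = b2" for a1 a2 b1 b2
   using sub[OF that] f_holo by (intro continuous_on_subset[OF holomorphic_on_imp_continuous_on]) auto
  have ci: "f contour_integrable_on linepath (Complex a1 b1) (Complex a2 b2)"
   if "\<bar>b1\<bar> = pi" "\<bar>b2\<bar> = pi" "(a1 = a2 \<and> \<bar>a1\<bar> = L) \<or> b1 = b2" for a1 a2 b1 b2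
   by (rule contour_integrable_continuous_linepath[OF cs[OF that]])
  show "f contour_integrable_on linepath (R L) (T L)" "f contour_integrable_on linepath (R (-L)) (T (-L))"
   unfolding R_def T_def using Lp by (auto intro!: ci)
  have xbox: "of_real x \<in> box (R (-L)) (T L)" using L Lp pi_gt_zero by (auto simp: in_box_complex_iff R_def T_def)
  have pim: "path_image (rectpath (R (-L)) (T L)) \<subseteq> S - {of_real x}"
   using Lp by (auto simp: rectpath_def Let_def path_image_join R_def T_def dest!: subsetD[OF sub, rotated 3])
  have "contour_integral (rectpath (R (-L)) (T L)) f = 2 * pi * \<i> * (\<Sum>p\<in>{of_real x}. winding_number (rectpath (R (-L)) (T L)) p * residue f p)"
  proof (rule Residue_theorem[OF \<open>open S\<close> \<open>connected S\<close> _ f_holo _ _ pim])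
   show "\<forall>z. z \<notin> S \<longrightarrow> winding_number (rectpath (R (-L)) (T L)) z = 0"
    using pim \<open>convex S\<close> by (intro allI impI winding_number_zero_outside[of _ S]) auto
  qed (auto)
  also have "\<dots> = 2 * pi * \<i> * F (of_real x)" using winding_number_rectpath[OF xbox] res by simp
  finally have 1: "contour_integral (rectpath (R (-L)) (T L)) f = 2 * pi * \<i> * F (of_real x)" .
  have 2: "contour_integral (rectpath (R (-L)) (T L)) f =
    contour_integral (linepath (R (-L)) (R L)) f + V L + contour_integral (linepath (T L) (T (-L))) f
    + contour_integral (linepath (T (-L)) (R (-L))) f"
   unfolding rectpath_def Let_def R_def T_def V_def
   using Lp by (simp add: contour_integral_join valid_path_join contour_integrable_joinI ci add.assoc)
  have 3: "contour_integral (linepath (T (-L)) (R (-L))) f = - V (-L)"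
   unfolding V_def using Lp by (intro contour_integral_reverse_linepath) (auto simp: R_def T_def intro!: cs)
  have 4: "contour_integral (linepath (R (-L)) (R L)) f = integral {-L..L} (\<lambda>y. f (Complex y (-pi)))"
   using Lp by (intro contour_integral_linepath_same_Im) (auto simp: R_def)
  have "contour_integral (linepath (T L) (T (-L))) f = - contour_integral (linepath (T (-L)) (T L)) f"
   using Lp by (intro contour_integral_reverse_linepath) (auto simp: T_def intro!: cs)
  also have "contour_integral (linepath (T (-L)) (T L)) f = integral {-L..L} (\<lambda>y. f (Complex y pi))"
   using Lp by (intro contour_integral_linepath_same_Im) (auto simp: T_def)
  finally have 5: "contour_integral (linepath (T L) (T (-L))) f = - integral {-L..L} (\<lambda>y. f (Complex y pi))" .
  have iof: "(\<lambda>y. f (Complex y c)) integrable_on {-L..L}" if "\<bar>c\<bar> = pi" for c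
  proof (rule integrable_continuous_interval)
   have "continuous_on (S - {of_real x}) f" using f_holo by (rule holomorphic_on_imp_continuous_on)
   moreover have "(\<lambda>y. Complex y c) ` {-L..L} \<subseteq> S - {of_real x}"
    using that b pi_gt_zero by (auto simp: S_def complex_eq_iff)
   moreover have "continuous_on {-L..L} (\<lambda>y. Complex y c)"
    unfolding Complex_eq by (intro continuous_intros)
   ultimately show "continuous_on {-L..L} (\<lambda>y. f (Complex y c))"
    by (metis continuous_on_compose2)
  qed
  have kdiff: "f (Complex y (-pi)) - f (Complex y pi) = complex_of_real (2 * pi) * \<i> * of_real (k y)" for y
  proof -
   define E where "E = exp (s * y)"
   define c where "c = cis (pi * s)"
   have e1: "exp (of_real s * Complex y pi) = of_real E * c"
   proof -
    have "of_real s * Complex y pi = of_real (s * y) + \<i> * of_real (pi * s)" by (simp add: complex_eq_iff)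
    thus ?thesis by (simp only: E_def c_def exp_add cis_conv_exp exp_of_real)
   qed
   have e2: "exp (of_real s * Complex y (-pi)) = of_real E * cnj c"
   proof -
    have "of_real s * Complex y (-pi) = of_real (s * y) + \<i> * of_real (- (pi * s))" by (simp add: complex_eq_iff)
    thus ?thesis by (simp only: E_def c_def cis_cnj) (simp only: exp_add cis_conv_exp exp_of_real)
   qed
   have e3: "exp (Complex y pi) = - of_real (exp y)" "exp (Complex y (-pi)) = - of_real (exp y)"
    by (simp_all add: exp_eq_polar complex_eq_iff)
   have n1: "of_real \<mu> + of_real E * c \<noteq> 0" using den1[of "Complex y pi"] b pi_gt_zero by (simp add: e1 S_def)
   have n2: "of_real \<mu> + of_real E * cnj c \<noteq> 0" using den1[of "Complex y (-pi)"] b pi_gt_zero by (simp add: e2 S_def)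
   have cc: "c - cnj c = 2 * \<i> * of_real (sin (pi * s))" "c + cnj c = of_real (2 * cos (pi * s))" "c * cnj c = 1"
    by (auto simp: c_def complex_eq_iff power2_eq_square[symmetric])
   have "(of_real \<mu> + of_real E * c) * (of_real \<mu> + of_real E * cnj c) = of_real \<mu> ^ 2 + of_real \<mu> * of_real E * (c + cnj c) + of_real E ^ 2 * (c * cnj c)"
    by (simp add: algebra_simps power2_eq_square)
   also have "\<dots> = of_real (\<mu>\<^sup>2 + 2 * \<mu> * E * cos (pi * s) + E\<^sup>2)" unfolding cc by simp
   finally have prod: "(of_real \<mu> + of_real E * c) * (of_real \<mu> + of_real E * cnj c) = of_real (\<mu>\<^sup>2 + 2 * \<mu> * E * cos (pi * s) + E\<^sup>2)" .
   have "F (Complex y (-pi)) - F (Complex y pi) = of_real E * (c - cnj c) / ((of_real \<mu> + of_real E * c) * (of_real \<mu> + of_real E * cnj c))"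
    unfolding F_def e1 e2 using n1 n2 by (simp add: field_simps)
   also have "\<dots> = complex_of_real (2 * pi) * \<i> * of_real (kato s \<mu> y)"
    unfolding prod cc kato_def E_def[symmetric] by simp
   finally have FF: "F (Complex y (-pi)) - F (Complex y pi) = complex_of_real (2 * pi) * \<i> * of_real (kato s \<mu> y)" .
   have q: "- of_real (exp y) / (- of_real (exp y) - exp (of_real x)) = complex_of_real (exp y / (exp y + exp x))"
   proof -
    have "- exp y / (- exp y - exp x) = exp y / (exp y + exp x)"
    proof -
     have "- exp y - exp x = - (exp y + exp x)" by simp
     thus ?thesis by (simp only: divide_minus_left minus_divide_right[symmetric] minus_minus)
    qed
    thus ?thesis by (metis exp_of_real of_real_diff of_real_divide of_real_minus)
   qed
   have "f (Complex y (-pi)) - f (Complex y pi) = (F (Complex y (-pi)) - F (Complex y pi)) * (- of_real (exp y) / (- of_real (exp y) - exp (of_real x)))"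
    unfolding f_def e3 by (simp add: diff_divide_distrib left_diff_distrib)
   thus ?thesis unfolding FF q k_def by simp
  qed
  have "integral {-L..L} (\<lambda>y. f (Complex y (-pi))) - integral {-L..L} (\<lambda>y. f (Complex y pi)) = integral {-L..L} (\<lambda>y. complex_of_real (2 * pi) * \<i> * of_real (k y))"
   using Henstock_Kurzweil_Integration.integral_diff[OF iof iof, of "-pi" pi] kdiff by simp
  also have "\<dots> = complex_of_real (2 * pi) * \<i> * integral {-L..L} (\<lambda>y. of_real (k y))"
   by (rule integral_mult_right)
  also have "integral {-L..L} (\<lambda>y. complex_of_real (k y)) = of_real (integral {-L..L} k)"
  proof -
   have "k integrable_on {-L..L}" unfolding k_def kato_def
    using kato_denominator[OF s] by (intro integrable_continuous_interval continuous_intros) (auto simp: add_pos_pos less_imp_neq[symmetric] intro!: less_imp_neq[OF less_le_trans[OF kato_denominator(2)[OF s] kato_denominator(1)[OF s]], symmetric])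
   from integral_linear[OF this bounded_linear_of_real, where 'a1=complex] show ?thesis by (simp add: o_def)
  qed
  finally show "complex_of_real (2 * pi) * \<i> * of_real (integral {-L..L} k) + V L - V (-L) = 2 * pi * \<i> * F (of_real x)"
   using 1 2 3 4 5 by (simp add: algebra_simps)
 qed
 have segRe: "Re w = L" if w: "w \<in> closed_segment (R L) (T L)" for w L
 proof -
  obtain u where "w = (1 - u) *\<^sub>R R L + u *\<^sub>R T L" using w by (auto simp: closed_segment_def)
  hence "Re w = (1 - u) * L + u * L" by (simp add: R_def T_def)
  thus ?thesis by (simp add: algebra_simps)
 qed
 have dist: "cmod (T L - R L) = 2 * pi" for L
 proof -
  have "T L - R L = \<i> * of_real (2 * pi)" by (simp add: R_def T_def complex_eq_iff)
  thus ?thesis by (simp add: norm_mult)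
 qed
 \<comment> \<open>The reverse triangle inequality bounds both denominators on Re w = L. At the
   right end the growth of exp(s L) makes this small, at the left end the factor exp L.\<close>
 have Vb: "norm (V L) \<le> 1 / \<bar>exp (s * L) - \<mu>\<bar> * (exp L / \<bar>exp L - exp x\<bar>) * (2 * pi)"
  if ci: "f contour_integrable_on linepath (R L) (T L)" and A: "exp (s * L) \<noteq> \<mu>" and B: "L \<noteq> x" for L
 proof -
  have "norm (V L) \<le> (1 / \<bar>exp (s * L) - \<mu>\<bar> * (exp L / \<bar>exp L - exp x\<bar>)) * cmod (T L - R L)"
   unfolding V_def
  proof (rule contour_integral_bound_linepath[OF ci])
   fix w assume "w \<in> closed_segment (R L) (T L)"
   hence w: "Re w = L" by (rule segRe)
   have "\<bar>exp (s * L) - \<mu>\<bar> \<le> cmod (of_real \<mu> + exp (of_real s * w))"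
    using norm_triangle_ineq3[of "exp (of_real s * w)" "- of_real \<mu>"] w mu by (simp add: norm_exp_eq_Re add.commute)
   hence 1: "cmod (F w) \<le> 1 / \<bar>exp (s * L) - \<mu>\<bar>"
    unfolding F_def norm_divide norm_one by (rule frac_le[rotated 3]) (use A in auto)
   have "\<bar>exp L - exp x\<bar> \<le> cmod (exp w - exp (of_real x))"
    using norm_triangle_ineq3[of "exp w" "exp (of_real x)"] w by (simp add: norm_exp_eq_Re)
   hence 2: "cmod (exp w / (exp w - exp (of_real x))) \<le> exp L / \<bar>exp L - exp x\<bar>"
    unfolding norm_divide norm_exp_eq_Re[of w] w by (rule frac_le[rotated 3]) (use B in auto)
   have "cmod (f w) = cmod (F w) * cmod (exp w / (exp w - exp (of_real x)))"
    by (simp add: f_def norm_mult norm_divide)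
   also have "\<dots> \<le> 1 / \<bar>exp (s * L) - \<mu>\<bar> * (exp L / \<bar>exp L - exp x\<bar>)"
    using 1 2 by (intro mult_mono) auto
   finally show "cmod (f w) \<le> 1 / \<bar>exp (s * L) - \<mu>\<bar> * (exp L / \<bar>exp L - exp x\<bar>)" .
  qed auto
  thus ?thesis by (simp add: dist)
 qed
 have Vp: "(\<lambda>i::nat. V (real i)) \<longlonglongrightarrow> 0"
 proof (rule Lim_null_comparison)
  show "(\<lambda>i::nat. 1 / (exp (s * real i) - \<mu>) * (exp (real i) / (exp (real i) - exp x)) * (2 * pi)) \<longlonglongrightarrow> 0"
   using s by real_asymp
  have "\<forall>\<^sub>F i::nat in sequentially. exp (s * real i) > \<mu>" "\<forall>\<^sub>F i::nat in sequentially. real i > \<bar>x\<bar>"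
   using s by real_asymp+
  thus "\<forall>\<^sub>F i in sequentially. norm (V (real i)) \<le> 1 / (exp (s * real i) - \<mu>) * (exp (real i) / (exp (real i) - exp x)) * (2 * pi)"
  proof eventually_elim
   case (elim i)
   hence "\<bar>exp (s * real i) - \<mu>\<bar> = exp (s * real i) - \<mu>" "\<bar>exp (real i) - exp x\<bar> = exp (real i) - exp x" by auto
   thus ?case using Vb[OF Vint(1)[OF elim(2)]] elim by auto
  qed
 qed
 have Vm: "(\<lambda>i::nat. V (- real i)) \<longlonglongrightarrow> 0"
 proof (rule Lim_null_comparison)
  show "(\<lambda>i::nat. 1 / (\<mu> - exp (s * - real i)) * (exp (- real i) / (exp x - exp (- real i))) * (2 * pi)) \<longlonglongrightarrow> 0"
   using s mu by real_asymp
  have "\<forall>\<^sub>F i::nat in sequentially. exp (s * - real i) < \<mu>" "\<forall>\<^sub>F i::nat in sequentially. real i > \<bar>x\<bar>"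
   using s mu by real_asymp+
  thus "\<forall>\<^sub>F i in sequentially. norm (V (- real i)) \<le> 1 / (\<mu> - exp (s * - real i)) * (exp (- real i) / (exp x - exp (- real i))) * (2 * pi)"
  proof eventually_elim
   case (elim i)
   hence "\<bar>exp (s * - real i) - \<mu>\<bar> = \<mu> - exp (s * - real i)" "\<bar>exp (- real i) - exp x\<bar> = exp x - exp (- real i)" by auto
   thus ?case using Vb[OF Vint(2)[OF elim(2)]] elim by auto
  qed
 qed
 have Fx: "F (of_real x) = complex_of_real (1 / (\<mu> + exp (s * x)))"
  by (simp add: F_def exp_of_real[symmetric] flip: of_real_mult)
 have lim: "(\<lambda>i::nat. integral {- real i..real i} k) \<longlonglongrightarrow> 1 / (\<mu> + exp (s * x))"
 proof -
  have "(\<lambda>i::nat. (2 * pi * \<i> * F (of_real x) - V (real i) + V (- real i)) / (2 * pi * \<i>)) \<longlonglongrightarrow> (2 * pi * \<i> * F (of_real x) - 0 + 0) / (2 * pi * \<i>)"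
   by (intro tendsto_intros Vp Vm) auto
  moreover have "\<forall>\<^sub>F i::nat in sequentially. (2 * pi * \<i> * F (of_real x) - V (real i) + V (- real i)) / (2 * pi * \<i>) = complex_of_real (integral {- real i..real i} k)"
  proof -
   have "\<forall>\<^sub>F i::nat in sequentially. real i > \<bar>x\<bar>" by real_asymp
   thus ?thesis
   proof eventually_elim
    case (elim i)
    show ?case unfolding key[OF elim, symmetric] by simp
   qed
  qed
  ultimately have "(\<lambda>i::nat. complex_of_real (integral {- real i..real i} k)) \<longlonglongrightarrow> F (of_real x)"
   by (subst tendsto_cong[symmetric]) auto
  thus ?thesis unfolding Fx by (simp only: tendsto_of_real_iff)
 qed
 have kint: "k absolutely_integrable_on {- real i..real i}" for i
  unfolding k_def kato_def
  using kato_denominator[OF s] by (intro absolutely_integrable_continuous_real continuous_intros) (auto simp: add_pos_pos less_imp_neq[symmetric] intro!: less_imp_neq[OF less_le_trans[OF kato_denominator(2)[OF s] kato_denominator(1)[OF s]], symmetric])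
 have set_int: "set_integrable lborel {- real i..real i} k" for i
  using kint[of i] by (simp add: set_integrable_def integrable_completion)
 have m1: "Lint (\<lambda>y. indicat_real {- real i..real i} y * k y)" for i
   using set_int[of i] by (simp add: set_integrable_def)
 have m2: "AE y in lborel. mono (\<lambda>n. indicat_real {- real n..real n} y * k y)"
   by (intro AE_I2 monoI) (auto simp: indicator_def k_nonneg)
 have m3: "AE y in lborel. (\<lambda>i. indicat_real {- real i..real i} y * k y) \<longlonglongrightarrow> k y"
  proof (intro AE_I2)
   fix y
   have "\<forall>\<^sub>F i::nat in sequentially. real i > \<bar>y\<bar>" by real_asymp
   hence "\<forall>\<^sub>F i in sequentially. indicat_real {- real i..real i} y * k y = k y"
    by eventually_elim (auto simp: indicator_def)
   thus "(\<lambda>i. indicat_real {- real i..real i} y * k y) \<longlonglongrightarrow> k y" by (rule tendsto_eventually)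
  qed
  have "(LBINT y. indicat_real {- real i..real i} y * k y) = integral {- real i..real i} k" for i
   using set_borel_integral_eq_integral(2)[OF set_int[of i]] by (simp add: set_lebesgue_integral_def)
 hence m4: "(\<lambda>i. LBINT y. indicat_real {- real i..real i} y * k y) \<longlonglongrightarrow> 1 / (\<mu> + exp (s * x))"
   using lim by simp
 have m5: "AE y in lborel. 0 \<le> indicat_real {- real i..real i} y * k y" for i by (simp add: k_nonneg)
 have m6: "k \<in> borel_measurable lborel" by simp
 show "Lint (\<lambda>y. kato s \<mu> y * exp y / (exp y + exp x))"
  "(LBINT y. kato s \<mu> y * exp y / (exp y + exp x)) = 1 / (\<mu> + exp (s * x))"
  using integral_monotone_convergence_nonneg[OF m1 m2 m5 m3 m4 m6] by (auto simp: k_def)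
qed

section \<open>Laplace transforms after the substitution t = exp y\<close>

lemma has_bochner_integral_exp_substitution:
 fixes f :: "real \<Rightarrow> real"
 assumes [measurable]: "f \<in> bm"
 shows "has_bochner_integral lborel (\<lambda>t. indicator {0<..} t * f t) b \<longleftrightarrow>
     has_bochner_integral lborel (\<lambda>y. exp y * f (exp y)) b"
proof -
 have img: "exp ` (UNIV::real set) = {0<..}"
  by (auto simp: image_iff) (metis exp_ln)
 have *: "(\<lambda>x. \<bar>exp x\<bar> * f (exp x)) absolutely_integrable_on UNIV \<and>
      integral UNIV (\<lambda>x. \<bar>exp x\<bar> * f (exp x)) = b
   \<longleftrightarrow> f absolutely_integrable_on (exp ` UNIV) \<and> integral (exp ` UNIV) f = b"
  by (rule has_absolute_integral_change_of_variables_1') (auto intro!: derivative_eq_intros inj_onI)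
 have 1: "(\<lambda>x. exp x * f (exp x)) absolutely_integrable_on UNIV \<longleftrightarrow> Lint (\<lambda>y. exp y * f (exp y))"
  unfolding set_integrable_def by (subst integrable_completion) auto
 have 2: "f absolutely_integrable_on {0<..} \<longleftrightarrow> Lint (\<lambda>t. indicator {0<..} t * f t)"
  unfolding set_integrable_def by (subst integrable_completion) auto
 have 3: "integral UNIV (\<lambda>x. exp x * f (exp x)) = (LBINT y. exp y * f (exp y))" if "Lint (\<lambda>y. exp y * f (exp y))"
  using that by (rule integral_lborel)
 have 4: "integral {0<..} f = (LBINT t. indicator {0<..} t * f t)" if "Lint (\<lambda>t. indicator {0<..} t * f t)"
  using set_borel_integral_eq_integral(2)[of "{0<..}" f] that by (simp add: set_integrable_def set_lebesgue_integral_def)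
 have tr: "(Q \<and> c2 = b) \<longleftrightarrow> (P \<and> a2 = b)"
  if "(P \<and> a = b) \<longleftrightarrow> (Q \<and> c = b)" "P \<Longrightarrow> a = a2" "Q \<Longrightarrow> c = c2" for P Q :: bool and a a2 c c2 :: real
  using that by auto
 show ?thesis
  unfolding has_bochner_integral_iff by (rule tr[OF *[unfolded img abs_exp_cancel 1 2] 3 4])
qed

lemma has_bochner_integral_exp_Gamma:
 fixes a t :: real
 assumes a: "a > 0" and t: "t > 0"
 shows "has_bochner_integral lborel (\<lambda>y. exp (a * y) * exp (- (t * exp y))) (Gamma a * t powr (- a))"
proof -
 have *: "((\<lambda>u. u powr (a - 1) / exp u) has_integral Gamma a) {0..}" by (rule Gamma_integral_real[OF a])
 have "has_bochner_integral lborel (\<lambda>u. indicator {0..} u * (u powr (a - 1) / exp u)) (Gamma a)"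
  by (rule has_bochner_integral_nn_integral)
    (use nn_integral_has_integral_lebesgue[OF _ *] Gamma_real_pos[OF a] in \<open>auto intro!: AE_I2\<close>)
 hence "has_bochner_integral lborel (\<lambda>u. indicator {0<..} u * (u powr (a - 1) / exp u)) (Gamma a)"
  by (subst has_bochner_integral_cong_AE[where g="\<lambda>u. indicator {0..} u * (u powr (a - 1) / exp u)"])
    (auto intro!: AE_I2 simp: indicator_def)
 hence "has_bochner_integral lborel (\<lambda>y. exp y * (exp y powr (a - 1) / exp (exp y))) (Gamma a)"
  by (subst (asm) has_bochner_integral_exp_substitution) auto
 also have "(\<lambda>y. exp y * (exp y powr (a - 1) / exp (exp y))) = (\<lambda>y. exp (a * y) * exp (- exp y))"
  by (auto simp: powr_def exp_add[symmetric] exp_minus field_simps)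
 finally have G: "has_bochner_integral lborel (\<lambda>y. exp (a * y) * exp (- exp y)) (Gamma a)" .
 have "has_bochner_integral lborel (\<lambda>y. exp (a * (ln t + 1 * y)) * exp (- exp (ln t + 1 * y))) (Gamma a)"
  using lborel_has_bochner_integral_real_affine_iff[of 1 "\<lambda>y. exp (a * y) * exp (- exp y)" "Gamma a" "ln t"] G by simp
 hence "has_bochner_integral lborel (\<lambda>y. t powr (-a) * (exp (a * (ln t + 1 * y)) * exp (- exp (ln t + 1 * y)))) (t powr (-a) * Gamma a)"
  by (intro has_bochner_integral_mult_right) auto
 also have "(\<lambda>y. t powr (-a) * (exp (a * (ln t + 1 * y)) * exp (- exp (ln t + 1 * y)))) = (\<lambda>y. exp (a * y) * exp (- (t * exp y)))"
  using t by (auto simp: powr_def exp_add exp_minus field_simps)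
 finally show ?thesis by (simp add: mult.commute)
qed

text \<open>The nonnegative density with Laplace transform 1/(\<mu> + r^s), that is t^(s-1) times
  the Mittag-Leffler function E_(s,s)(- \<mu> t^s). For s = 1 Kato's weight vanishes identically, as
  sin \<pi> = 0, so the exponential is given separately.\<close>

definition dens :: "real \<Rightarrow> real \<Rightarrow> real \<Rightarrow> real" where
 "dens s \<mu> t = (if t \<le> 0 then 0 else if s = 1 then exp (- (\<mu> * t))
   else (LBINT y. kato s \<mu> y * exp y * exp (- (t * exp y))))"

definition dens_const :: "real \<Rightarrow> real" where
 "dens_const s = (if s = 1 then 1 else Gamma (1 - s) / (pi * sin (pi * s)))"

lemma measurable_dens [measurable]: "dens s \<mu> \<in> bm"
 unfolding dens_def kato_def by measurable

lemma dens_nonpos [simp]: "t \<le> 0 \<Longrightarrow> dens s \<mu> t = 0" by (simp add: dens_def)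

lemma dens_integrable:
 assumes s: "0 < s" "s < 1" and t: "t > 0"
 shows "Lint (\<lambda>y. kato s \<mu> y * exp y * exp (- (t * exp y)))"
  and "kato s \<mu> y * exp y * exp (- (t * exp y)) \<le> exp ((1 - s) * y) * exp (- (t * exp y)) / (pi * sin (pi * s))"
  and "Lint (\<lambda>y. exp ((1 - s) * y) * exp (- (t * exp y)) / (pi * sin (pi * s)))"
proof -
 show b: "kato s \<mu> y * exp y * exp (- (t * exp y)) \<le> exp ((1 - s) * y) * exp (- (t * exp y)) / (pi * sin (pi * s))" for y
 proof -
  have "kato s \<mu> y * exp y * exp (- (t * exp y)) \<le> exp (- s * y) / (pi * sin (pi * s)) * exp y * exp (- (t * exp y))"
   by (intro mult_right_mono kato_le[OF s]) auto
  also have "\<dots> = exp ((1 - s) * y) * exp (- (t * exp y)) / (pi * sin (pi * s))"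
   by (simp add: exp_add[symmetric] algebra_simps)
  finally show ?thesis .
 qed
 show I: "Lint (\<lambda>y. exp ((1 - s) * y) * exp (- (t * exp y)) / (pi * sin (pi * s)))"
  using has_bochner_integral_exp_Gamma[of "1 - s" t] s t by (auto simp: has_bochner_integral_iff)
 show "Lint (\<lambda>y. kato s \<mu> y * exp y * exp (- (t * exp y)))"
 proof (rule integrable_bound[OF I])
  show "AE y in lborel. norm (kato s \<mu> y * exp y * exp (- (t * exp y))) \<le> norm (exp ((1 - s) * y) * exp (- (t * exp y)) / (pi * sin (pi * s)))"
  proof (rule AE_I2)
   fix y
   have "0 \<le> kato s \<mu> y * exp y * exp (- (t * exp y))" using kato_nonneg[OF s] by simp
   with b[of y] show "norm (kato s \<mu> y * exp y * exp (- (t * exp y))) \<le> norm (exp ((1 - s) * y) * exp (- (t * exp y)) / (pi * sin (pi * s)))"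
    by (metis abs_ge_self abs_of_nonneg order_trans real_norm_def)
  qed
 qed auto
qed

lemma dens_nonneg: "0 < s \<Longrightarrow> s \<le> 1 \<Longrightarrow> 0 \<le> dens s \<mu> t"
 unfolding dens_def using kato_nonneg[of s] by (auto intro!: integral_nonneg_AE)

lemma dens_const_nonneg: "0 < s \<Longrightarrow> s \<le> 1 \<Longrightarrow> 0 \<le> dens_const s"
 unfolding dens_const_def using sin_pi_pos[of s] Gamma_real_pos[of "1 - s"] by (auto intro!: divide_nonneg_nonneg)

text \<open>After the \<mu>-free bound \<open>kato_le\<close> only a Gamma integral is left;
  \<open>dens_const\<close> records its value. As a result one multiple of the Green density
  dominates the densities for all \<mu> >= 0.\<close>

lemma dens_le:
 assumes s: "0 < s" "s \<le> 1" and mu: "\<mu> \<ge> 0" and t: "t > 0"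
 shows "dens s \<mu> t \<le> dens_const s * t powr (s - 1)"
proof (cases "s = 1")
 case True thus ?thesis using t mu by (simp add: dens_def dens_const_def)
next
 case False
 hence s1: "s < 1" using s by simp
 have "dens s \<mu> t = (LBINT y. kato s \<mu> y * exp y * exp (- (t * exp y)))" using False t by (simp add: dens_def)
 also have "\<dots> \<le> (LBINT y. exp ((1 - s) * y) * exp (- (t * exp y)) / (pi * sin (pi * s)))"
  by (intro integral_mono dens_integrable[OF s(1) s1 t])
 also have "\<dots> = Gamma (1 - s) * t powr (- (1 - s)) / (pi * sin (pi * s))"
  using has_bochner_integral_exp_Gamma[of "1 - s" t] s1 t by (simp add: has_bochner_integral_iff)
 finally show ?thesis using False by (simp add: dens_const_def)
qed

lemma Gamma_reflection_real: "Gamma s * Gamma (1 - s) = pi / sin (pi * s)" for s :: real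
proof -
 have "complex_of_real (Gamma s * Gamma (1 - s)) = Gamma (of_real s) * Gamma (1 - of_real s)"
  by (metis Gamma_complex_of_real of_real_1 of_real_diff of_real_mult)
 also have "\<dots> = of_real pi / sin (of_real pi * of_real s)" by (rule Gamma_reflection_complex)
 also have "\<dots> = of_real (pi / sin (pi * s))" by (metis of_real_divide of_real_mult sin_of_real)
 finally have "complex_of_real (Gamma s * Gamma (1 - s)) = of_real (pi / sin (pi * s))" .
 thus ?thesis by (simp only: of_real_eq_iff)
qed

text \<open>At \<mu> = 0 the weight is sin(\<pi> s)/\<pi> exp(- s y), and the reflection formula
  collapses the constants to 1/Gamma(s). This is the density in the definition of
  \<open>green\<close>.\<close>

lemma dens_0:
 assumes s: "0 < s" "s \<le> 1" and t: "t > 0"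
 shows "dens s 0 t = t powr (s - 1) / Gamma s"
proof (cases "s = 1")
 case True thus ?thesis using t by (simp add: dens_def)
next
 case False
 hence s1: "s < 1" using s by simp
 have p: "sin (pi * s) > 0" by (rule sin_pi_pos[OF s(1) s1])
 have k: "kato s 0 y = sin (pi * s) / pi * exp (- (s * y))" for y
  by (simp add: kato_def power2_eq_square exp_minus field_simps)
 have e: "kato s 0 y * exp y * exp (- (t * exp y)) = sin (pi * s) / pi * (exp ((1 - s) * y) * exp (- (t * exp y)))" for y
  unfolding k by (simp add: exp_add[symmetric] algebra_simps)
 have "dens s 0 t = sin (pi * s) / pi * (Gamma (1 - s) * t powr (- (1 - s)))"
  using has_bochner_integral_exp_Gamma[of "1 - s" t] s1 t False unfolding dens_def e by (simp add: has_bochner_integral_iff)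
 also have "\<dots> = t powr (s - 1) / Gamma s"
  using Gamma_reflection_real[of s] p Gamma_real_pos[OF s(1)] by (simp add: field_simps)
 finally show ?thesis .
qed

lemma dens_tendsto:
 assumes s: "0 < s" "s \<le> 1" and m: "m \<longlonglongrightarrow> 0"
 shows "(\<lambda>i. dens s (m i) t) \<longlonglongrightarrow> dens s 0 t"
proof (cases "t \<le> 0 \<or> s = 1")
 case True
 have "(\<lambda>i. exp (- (m i * t))) \<longlonglongrightarrow> exp (- (0 * t))" by (intro tendsto_intros m)
 with True show ?thesis by (auto simp: dens_def)
next
 case False
 hence s1: "s < 1" and t: "t > 0" using s by auto
 have "(\<lambda>i. LBINT y. kato s (m i) y * exp y * exp (- (t * exp y))) \<longlonglongrightarrow> (LBINT y. kato s 0 y * exp y * exp (- (t * exp y)))"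
 proof (rule integral_dominated_convergence[where w="\<lambda>y. exp ((1 - s) * y) * exp (- (t * exp y)) / (pi * sin (pi * s))"])
  show "AE y in lborel. (\<lambda>i. kato s (m i) y * exp y * exp (- (t * exp y))) \<longlonglongrightarrow> kato s 0 y * exp y * exp (- (t * exp y))"
   unfolding kato_def by (intro AE_I2 tendsto_intros m) (auto simp: )
  show "AE y in lborel. norm (kato s (m i) y * exp y * exp (- (t * exp y))) \<le> exp ((1 - s) * y) * exp (- (t * exp y)) / (pi * sin (pi * s))" for i
  proof (rule AE_I2)
   fix y
   have "0 \<le> kato s (m i) y * exp y * exp (- (t * exp y))" using kato_nonneg[OF s(1) s1] by simp
   with dens_integrable(2)[OF s(1) s1 t, of "m i" y]
   show "norm (kato s (m i) y * exp y * exp (- (t * exp y))) \<le> exp ((1 - s) * y) * exp (- (t * exp y)) / (pi * sin (pi * s))"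
    by simp
  qed
 qed (use dens_integrable(3)[OF s(1) s1 t] in auto)
 with False show ?thesis by (simp add: dens_def)
qed

lemma nn_integral_exp_decay:
 assumes r: "r > (0::real)"
 shows "(LBNN t. ennreal (exp (- (r * t))) * indicator {0..} t) = ennreal (1 / r)"
proof -
 have "(LBNN t. ennreal (exp (- (r * t))) * indicator {0..} t) = ennreal (0 - (- exp (- (r * 0)) / r))"
 proof (rule nn_integral_FTC_atLeast)
  show "((\<lambda>t. - exp (- (r * t)) / r) \<longlongrightarrow> 0) at_top" using r by real_asymp
  show "((\<lambda>t. - exp (- (r * t)) / r) has_real_derivative exp (- (r * t))) (at t)" for t
   using r by (auto intro!: derivative_eq_intros)
 qed auto
 thus ?thesis by simp
qed

text \<open>By Tonelli the t-integral gives 1/(r + exp y), and what remains is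
  \<open>kato_integral\<close> at x = ln r.\<close>

lemma nn_integral_dens_pos:
 assumes s: "0 < s" "s \<le> 1" and mu: "\<mu> > 0" and r: "r > 0"
 shows "(LBNN t. ennreal (exp (- (r * t)) * dens s \<mu> t)) = ennreal (1 / (\<mu> + r powr s))"
proof (cases "s = 1")
 case True
 have "(LBNN t. ennreal (exp (- (r * t)) * dens s \<mu> t)) = (LBNN t. ennreal (exp (- ((\<mu> + r) * t))) * indicator {0..} t)"
 proof (rule nn_integral_cong_AE)
  show "AE t in lborel. ennreal (exp (- (r * t)) * dens s \<mu> t) = ennreal (exp (- ((\<mu> + r) * t))) * indicator {0..} t"
   using AE_lborel_singleton[of "0::real"]
   by eventually_elim (auto simp: dens_def True indicator_def exp_add[symmetric] algebra_simps)
 qed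
 thus ?thesis using nn_integral_exp_decay[of "\<mu> + r"] mu r True by simp
next
 case False
 hence s1: "s < 1" using s by simp
 define x where "x = ln r"
 have x: "exp x = r" "exp (s * x) = r powr s" using r by (auto simp: x_def powr_def)
 have "(LBNN t. ennreal (exp (- (r * t)) * dens s \<mu> t)) =
  (LBNN t. (LBNN y. ennreal (kato s \<mu> y * exp y) * (ennreal (exp (- ((r + exp y) * t))) * indicator {0..} t)))"
 proof (rule nn_integral_cong_AE)
  show "AE t in lborel. ennreal (exp (- (r * t)) * dens s \<mu> t) = (LBNN y. ennreal (kato s \<mu> y * exp y) * (ennreal (exp (- ((r + exp y) * t))) * indicator {0..} t))"
   using AE_lborel_singleton[of "0::real"]
  proof eventually_elim
   case (elim t)
   show ?case
   proof (cases "t > 0")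
    case True
    have "ennreal (exp (- (r * t)) * dens s \<mu> t) = ennreal (LBINT y. exp (- (r * t)) * (kato s \<mu> y * exp y * exp (- (t * exp y))))"
     using True False by (simp add: dens_def)
    also have "\<dots> = (LBNN y. ennreal (exp (- (r * t)) * (kato s \<mu> y * exp y * exp (- (t * exp y)))))"
     using dens_integrable(1)[OF s(1) s1 True] kato_nonneg[OF s(1) s1] by (intro nn_integral_eq_integral[symmetric]) auto
    also have "\<dots> = (LBNN y. ennreal (kato s \<mu> y * exp y) * (ennreal (exp (- ((r + exp y) * t))) * indicator {0..} t))"
    proof (rule nn_integral_cong)
     fix y
     have "exp (- ((r + exp y) * t)) = exp (- (r * t)) * exp (- (t * exp y))"
      by (simp add: exp_add[symmetric] algebra_simps)
     thus "ennreal (exp (- (r * t)) * (kato s \<mu> y * exp y * exp (- (t * exp y)))) = ennreal (kato s \<mu> y * exp y) * (ennreal (exp (- ((r + exp y) * t))) * indicator {0..} t)"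
      using True kato_nonneg[OF s(1) s1, of \<mu> y] by (simp add: ennreal_mult'[symmetric] mult_ac)
    qed
    finally show ?thesis .
   next
    case 2: False
    thus ?thesis using elim by simp
   qed
  qed
 qed
 also have "\<dots> = (LBNN y. (LBNN t. ennreal (kato s \<mu> y * exp y) * (ennreal (exp (- ((r + exp y) * t))) * indicator {0..} t)))"
  by (rule lborel_pair.Fubini'[symmetric]) measurable
 also have "\<dots> = (LBNN y. ennreal (kato s \<mu> y * exp y / (exp y + exp x)))"
 proof (rule nn_integral_cong)
  fix y :: real
  have p: "r + exp y > 0" using r by (simp add: add_pos_pos)
  have "(LBNN t. ennreal (kato s \<mu> y * exp y) * (ennreal (exp (- ((r + exp y) * t))) * indicator {0..} t)) = ennreal (kato s \<mu> y * exp y) * ennreal (1 / (r + exp y))"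
   using nn_integral_exp_decay[OF p] by (simp add: nn_integral_cmult)
  also have "\<dots> = ennreal (kato s \<mu> y * exp y / (exp y + exp x))"
   using p kato_nonneg[OF s(1) s1, of \<mu> y] by (simp add: ennreal_mult'[symmetric] x add.commute)
  finally show "(LBNN t. ennreal (kato s \<mu> y * exp y) * (ennreal (exp (- ((r + exp y) * t))) * indicator {0..} t)) = ennreal (kato s \<mu> y * exp y / (exp y + exp x))" .
 qed
 also have "\<dots> = ennreal (LBINT y. kato s \<mu> y * exp y / (exp y + exp x))"
  using kato_nonneg[OF s(1) s1]
  by (intro nn_integral_eq_integral kato_integrable[OF s(1) s1 mu]) (auto intro!: AE_I2 divide_nonneg_nonneg add_nonneg_nonneg)
 also have "\<dots> = ennreal (1 / (\<mu> + r powr s))" by (subst kato_integral[OF s(1) s1 mu]) (simp add: x)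
 finally show ?thesis .
qed

text \<open>The point r = 0 is not of the form exp x; it is reached by monotone convergence along r
  = 1/(i + 1) and gives the total mass 1/\<mu> of the density.\<close>

lemma
 assumes s: "0 < s" "s \<le> 1" and mu: "\<mu> > 0" and r: "r \<ge> 0"
 shows integrable_exp_dens: "Lint (\<lambda>t. exp (- (r * t)) * dens s \<mu> t)"
  and integral_exp_dens: "(LBINT t. exp (- (r * t)) * dens s \<mu> t) = 1 / (\<mu> + r powr s)"
proof -
 have nn: "(LBNN t. ennreal (exp (- (r * t)) * dens s \<mu> t)) = ennreal (1 / (\<mu> + r powr s))"
 proof (cases "r = 0")
  case False thus ?thesis using nn_integral_dens_pos[OF s mu] r by simp
 next
  case True
  let ?f = "\<lambda>i t. ennreal (exp (- (inverse (real (Suc i)) * t)) * dens s \<mu> t)"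
  have inc: "incseq ?f"
  proof (intro incseq_SucI le_funI ennreal_leI)
   fix i t
   have "exp (- (inverse (real (Suc i)) * t)) \<le> exp (- (inverse (real (Suc (Suc i))) * t))" if "t > 0"
    using that by (auto simp: field_simps)
   thus "exp (- (inverse (real (Suc i)) * t)) * dens s \<mu> t \<le> exp (- (inverse (real (Suc (Suc i))) * t)) * dens s \<mu> t"
    using dens_nonneg[OF s, of \<mu> t] by (cases "t > 0") (auto intro!: mult_right_mono)
  qed
  have sup: "(\<lambda>i. ?f i t) \<longlonglongrightarrow> ennreal (exp (- (0 * t)) * dens s \<mu> t)" for t
   by (intro tendsto_ennrealI tendsto_intros LIMSEQ_inverse_real_of_nat)
  have "(\<lambda>i. LBNN t. ?f i t) \<longlonglongrightarrow> (LBNN t. ennreal (exp (- (0 * t)) * dens s \<mu> t))"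
   by (intro nn_integral_LIMSEQ inc sup) auto
  moreover have "(\<lambda>i. LBNN t. ?f i t) \<longlonglongrightarrow> ennreal (1 / (\<mu> + 0))"
  proof -
   have "(\<lambda>i. inverse (real (Suc i)) powr s) \<longlonglongrightarrow> 0 powr s"
    using s LIMSEQ_inverse_real_of_nat by (intro tendsto_powr2) auto
   hence "(\<lambda>i. ennreal (1 / (\<mu> + inverse (real (Suc i)) powr s))) \<longlonglongrightarrow> ennreal (1 / (\<mu> + 0))"
    using s mu by (intro tendsto_ennrealI tendsto_intros) auto
   thus ?thesis using nn_integral_dens_pos[OF s mu, of "inverse (real (Suc _))"] by simp
  qed
  ultimately have "(LBNN t. ennreal (exp (- (0 * t)) * dens s \<mu> t)) = ennreal (1 / (\<mu> + 0))"
   by (rule LIMSEQ_unique)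
  thus ?thesis using True by simp
 qed
 have "has_bochner_integral lborel (\<lambda>t. exp (- (r * t)) * dens s \<mu> t) (1 / (\<mu> + r powr s))"
  by (rule has_bochner_integral_nn_integral[OF _ _ _ nn]) (use dens_nonneg[OF s] mu in \<open>auto intro!: divide_nonneg_nonneg add_nonneg_nonneg\<close>)
 thus "Lint (\<lambda>t. exp (- (r * t)) * dens s \<mu> t)" "(LBINT t. exp (- (r * t)) * dens s \<mu> t) = 1 / (\<mu> + r powr s)"
  by (auto simp: has_bochner_integral_iff)
qed

section \<open>Resolvent and Green kernels\<close>

text \<open>Subordination: for \<mu> > 0 this is the kernel of the resolvent of (-\<Delta>)^s at -
  \<mu>, and for \<mu> = 0 the Green function.\<close>

definition kern :: "real \<Rightarrow> real \<Rightarrow> 'a::euclidean_space \<Rightarrow> real" where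
 "kern s \<mu> x = (LBINT t. dens s \<mu> t * heat t x)"

lemma measurable_kern [measurable]: "kern s \<mu> \<in> bm"
 unfolding kern_def by measurable

lemma kern_even [simp]: "kern s \<mu> (- x) = kern s \<mu> x" by (simp add: kern_def)

locale frac =
 fixes s n :: real and TA :: "'a::euclidean_space itself"
 assumes s_pos: "0 < s" and s_le: "s \<le> 1" and dim: "2 * s < n" and dim_eq: "n = real DIM('a)"
begin

lemma n_pos: "0 < n" using s_pos dim by simp

abbreviation K :: "real \<Rightarrow> 'a \<Rightarrow> real" where "K \<equiv> kern s"

abbreviation G :: "'a \<Rightarrow> real" where "G \<equiv> kern s 0"

text \<open>The Riesz constant Gamma(n/2 - s) / (4^s \<pi>^(n/2) Gamma(s)), in the form in which the
  time integral produces it.\<close>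

definition gc :: real where
 "gc = (4 * pi) powr (- n / 2) * Gamma (n / 2 - s) * 4 powr (n / 2 - s) / Gamma s"

lemma gc_pos: "gc > 0"
 unfolding gc_def using s_pos dim by (intro divide_pos_pos mult_pos_pos Gamma_real_pos) auto

lemma kern_nonneg: "0 \<le> kern s \<mu> (x::'a)"
 unfolding kern_def by (intro integral_nonneg_AE AE_I2 mult_nonneg_nonneg heat_nonneg dens_nonneg s_pos s_le)

text \<open>With r = |x|^2/4 the integrand is a multiple of t^(-a-1) exp(-r/t), where a = n/2 - s is
  positive because 2 s < n. Substituting t = exp y and reflecting y turns it into a Gamma
  integral.\<close>

lemma
 fixes x :: 'a
 assumes x: "x \<noteq> 0"
 shows integrable_dens_heat: "Lint (\<lambda>t. dens s 0 t * heat t x)"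
  and green_eq: "G x = gc * norm x powr (- (n - 2 * s))"
proof -
 define a where "a = n / 2 - s"
 define r where "r = (norm x)\<^sup>2 / 4"
 have a: "a > 0" using dim by (simp add: a_def)
 have r: "r > 0" using x by (simp add: r_def)
 define f where "f = (\<lambda>t. (4 * pi) powr (- n / 2) / Gamma s * (t powr (- a - 1) * exp (- (r / t))))"
 have [measurable]: "f \<in> bm" unfolding f_def by measurable
 have eq: "dens s 0 t * heat t x = indicator {0<..} t * f t" for t
 proof (cases "t > 0")
  case True
  have "t powr (s - 1) * t powr (- n / 2) = t powr (- a - 1)"
   unfolding powr_add[symmetric] a_def by (simp add: algebra_simps)
  hence "t powr (s - 1) * (4 * pi * t) powr (- n / 2) = (4 * pi) powr (- n / 2) * t powr (- a - 1)"
   using True by (simp add: powr_mult mult_ac)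
  moreover have "(norm x)\<^sup>2 / (4 * t) = r / t" by (simp add: r_def)
  ultimately show ?thesis using True by (simp add: dens_0[OF s_pos s_le] heat_def f_def mult.assoc[symmetric] dim_eq[symmetric])
 qed simp
 have "has_bochner_integral lborel (\<lambda>y. exp (a * (0 + (-1) * y)) * exp (- (r * exp (0 + (-1) * y)))) (Gamma a * r powr (- a))"
  using lborel_has_bochner_integral_real_affine_iff[of "-1" "\<lambda>y. exp (a * y) * exp (- (r * exp y))" "Gamma a * r powr (- a)" 0] has_bochner_integral_exp_Gamma[OF a r]
  by simp
 hence "has_bochner_integral lborel (\<lambda>y. (4 * pi) powr (- n / 2) / Gamma s * (exp (a * (0 + (-1) * y)) * exp (- (r * exp (0 + (-1) * y)))))
   ((4 * pi) powr (- n / 2) / Gamma s * (Gamma a * r powr (- a)))"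
  by (intro has_bochner_integral_mult_right) auto
 also have "(\<lambda>y. (4 * pi) powr (- n / 2) / Gamma s * (exp (a * (0 + (-1) * y)) * exp (- (r * exp (0 + (-1) * y))))) = (\<lambda>y. exp y * f (exp y))"
 proof
  fix y :: real
  have r1: "r / exp y = r * exp (0 + (-1) * y)" by (simp add: exp_minus divide_inverse)
  have e: "exp y * exp y powr (- a - 1) = exp (a * (0 + (-1) * y))"
   by (simp add: powr_def exp_add[symmetric] algebra_simps)
  have "exp y * f (exp y) = (4 * pi) powr (- n / 2) / Gamma s * ((exp y * exp y powr (- a - 1)) * exp (- (r / exp y)))"
   by (simp add: f_def)
  thus "(4 * pi) powr (- n / 2) / Gamma s * (exp (a * (0 + (-1) * y)) * exp (- (r * exp (0 + (-1) * y)))) = exp y * f (exp y)"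
   unfolding e r1 by (rule sym)
 qed
 finally have *: "has_bochner_integral lborel (\<lambda>t. dens s 0 t * heat t x) ((4 * pi) powr (- n / 2) / Gamma s * (Gamma a * r powr (- a)))"
  unfolding eq by (subst has_bochner_integral_exp_substitution) auto
 have "r powr (- a) = 4 powr a * norm x powr (- (n - 2 * s))"
 proof -
  have "(norm x)\<^sup>2 powr (- a) = norm x powr (- (n - 2 * s))"
   using x by (subst powr_realpow[symmetric], simp, subst powr_powr) (simp add: a_def algebra_simps)
  thus ?thesis using x by (simp add: r_def powr_divide powr_minus field_simps)
 qed
 with * show "Lint (\<lambda>t. dens s 0 t * heat t x)" "G x = gc * norm x powr (- (n - 2 * s))"
  by (auto simp: has_bochner_integral_iff kern_def gc_def a_def)
qed

definition dc :: real where "dc = dens_const s * Gamma s"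

lemma dc_nonneg: "0 \<le> dc" using dens_const_nonneg[OF s_pos s_le] Gamma_real_pos[OF s_pos] by (simp add: dc_def)

lemma dens_le_0: "\<mu> \<ge> 0 \<Longrightarrow> dens s \<mu> t \<le> dc * dens s 0 t"
 using dens_le[OF s_pos s_le, of \<mu> t] Gamma_real_pos[OF s_pos]
 by (cases "t > 0") (auto simp: dens_0[OF s_pos s_le] dc_def)

text \<open>Integrating \<open>dens_le_0\<close> against the heat kernel compares the kernels for
  all \<mu> at once; the same majorant justifies the limit \<mu> -> 0 away from the origin.\<close>

lemma
 fixes x :: 'a
 assumes x: "x \<noteq> 0"
 shows kern_le: "\<mu> \<ge> 0 \<Longrightarrow> K \<mu> x \<le> dc * G x"
  and kern_tendsto: "m \<longlonglongrightarrow> 0 \<Longrightarrow> (\<And>i. m i \<ge> 0) \<Longrightarrow> (\<lambda>i. K (m i) x) \<longlonglongrightarrow> G x"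
proof -
 have I0: "Lint (\<lambda>t. dc * dens s 0 t * heat t x)"
  using integrable_dens_heat[OF x] by (simp add: mult.assoc)
 have b: "norm (dens s \<mu> t * heat t x) \<le> dc * dens s 0 t * heat t x" if "\<mu> \<ge> 0" for t \<mu>
  using dens_le_0[OF that, of t] heat_nonneg[of t x] dens_nonneg[OF s_pos s_le, of \<mu> t] by (simp add: mult_right_mono)
 have I: "Lint (\<lambda>t. dens s \<mu> t * heat t x)" if "\<mu> \<ge> 0" for \<mu>
 proof (rule integrable_bound[OF I0])
  show "AE t in lborel. norm (dens s \<mu> t * heat t x) \<le> norm (dc * dens s 0 t * heat t x)"
   unfolding real_norm_def[of "dc * _ * _"] by (intro AE_I2 order.trans[OF b[OF that] abs_ge_self])
 qed measurable
 show "K \<mu> x \<le> dc * G x" if "\<mu> \<ge> 0" for \<mu>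
 proof -
  have "K \<mu> x \<le> (LBINT t. dc * dens s 0 t * heat t x)"
   unfolding kern_def using b[OF that] by (intro integral_mono I that I0) (auto simp: abs_le_iff)
  thus ?thesis by (simp add: kern_def mult.assoc)
 qed
 show "(\<lambda>i. K (m i) x) \<longlonglongrightarrow> G x" if m: "m \<longlonglongrightarrow> 0" "\<And>i. m i \<ge> 0" for m
  unfolding kern_def
 proof (rule integral_dominated_convergence[OF _ _ I0])
  show "AE t in lborel. (\<lambda>i. dens s (m i) t * heat t x) \<longlonglongrightarrow> dens s 0 t * heat t x"
   by (intro AE_I2 tendsto_intros dens_tendsto s_pos s_le m)
 qed (use b m in auto)
qed

context
 fixes \<mu> :: real assumes mu: "\<mu> > 0"
begin

lemma integrable_dens: "Lint (dens s \<mu>)"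
 using integrable_exp_dens[OF s_pos s_le mu, of 0] by simp

lemma integrable_dens_heat_pair: "integrable lborel2 (\<lambda>(t, x::'a). dens s \<mu> t * heat t x)"
proof (rule lborel_pair.Fubini_integrable)
 have "(LBINT x. norm (dens s \<mu> t * heat t (x::'a))) = dens s \<mu> t" for t
 proof (cases "t > 0")
  case True
  have "(LBINT x. norm (dens s \<mu> t * heat t (x::'a))) = (LBINT x. dens s \<mu> t * heat t (x::'a))"
   using dens_nonneg[OF s_pos s_le, of \<mu> t] by (simp add: abs_mult heat_nonneg)
  thus ?thesis using integral_heat[OF True, where 'a='a] by simp
 qed simp
 thus "Lint (\<lambda>t. LBINT x. norm (case (t, x::'a) of (t, x) \<Rightarrow> dens s \<mu> t * heat t x))"
  using integrable_dens by simp
 show "AE t in lborel. Lint (\<lambda>x. case (t, x::'a) of (t, x) \<Rightarrow> dens s \<mu> t * heat t x)"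
 proof (rule AE_I2)
  fix t :: real
  show "Lint (\<lambda>x. case (t, x::'a) of (t, x) \<Rightarrow> dens s \<mu> t * heat t x)"
   using integrable_heat[of t, where 'a='a] by (cases "t > 0") auto
 qed
qed measurable

lemma integrable_kern: "Lint (K \<mu>)"
 using lborel_pair.integrable_snd[OF integrable_dens_heat_pair] by (simp add: kern_def[abs_def])

text \<open>The transform of the heat kernel is exp(- t |\<xi>|^2), so the time integral is the
  Laplace transform of the density at r = |\<xi>|^2.\<close>

lemma ft_kern: "ft (K \<mu>) \<xi> = complex_of_real (1 / (\<mu> + norm \<xi> powr (2 * s)))"
proof -
 define h where "h = (\<lambda>t x. complex_of_real (dens s \<mu> t * heat t x) * cis (- (x \<bullet> \<xi>)))"
 have I: "integrable lborel2 (\<lambda>(t, x). h t x)"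
  by (rule integrable_bound[OF integrable_dens_heat_pair]) (auto simp: h_def norm_mult)
 have "ft (K \<mu>) \<xi> = (LBINT x. (LBINT t. h t x))"
 proof -
  have "complex_of_real (K \<mu> x) * cis (- (x \<bullet> \<xi>)) = (LBINT t. h t x)" for x
   by (simp add: kern_def h_def flip: integral_complex_of_real)
  thus ?thesis by (simp add: ft_def)
 qed
 also have "\<dots> = (LBINT t. (LBINT x. h t x))"
  by (rule lborel_pair.Fubini_integral[OF I])
 also have "\<dots> = (LBINT t. complex_of_real (exp (- ((norm \<xi>)\<^sup>2 * t)) * dens s \<mu> t))"
 proof (rule integral_cong[OF refl])
  fix t :: real
  show "(LBINT x. h t x) = complex_of_real (exp (- ((norm \<xi>)\<^sup>2 * t)) * dens s \<mu> t)"
  proof (cases "t > 0")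
   case True
   have "(LBINT x. h t x) = complex_of_real (dens s \<mu> t) * ft (heat t) \<xi>"
    by (simp add: h_def ft_def mult.assoc)
   thus ?thesis by (simp add: ft_heat[OF True] mult_ac)
  qed (simp add: h_def)
 qed
 also have "\<dots> = complex_of_real (1 / (\<mu> + ((norm \<xi>)\<^sup>2) powr s))"
  unfolding integral_complex_of_real by (subst integral_exp_dens[OF s_pos s_le mu]) auto
 also have "((norm \<xi>)\<^sup>2) powr s = norm \<xi> powr (2 * s)"
 proof (cases "\<xi> = 0")
  case False
  hence "(norm \<xi>)\<^sup>2 = norm \<xi> powr 2" by simp
  thus ?thesis by (simp only: powr_powr)
 qed (use s_pos in simp)
 finally show ?thesis .
qed

lemma integral_kern: "(LBINT x. K \<mu> x) = 1 / \<mu>"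
proof -
 have "complex_of_real (LBINT x. K \<mu> x) = complex_of_real (1 / \<mu>)"
  using ft_kern[of 0] s_pos unfolding ft_def by simp
 thus ?thesis by (simp only: of_real_eq_iff)
qed

text \<open>From ln(1 + 4 t) <= 4 t one gets (1 + 4 t)^(-n/2) >= exp(- 2 n t), and the integral is
  bounded below by the Laplace transform of the density at r = 2 n. Multiplied by \<mu> it tends to
  1 as \<mu> grows, the concentration needed for \<open>kern_approximate_identity\<close>.\<close>

lemma integral_kern_gauss_ge:
 "1 / (\<mu> + (2 * n) powr s) \<le> (LBINT x. K \<mu> x * exp (- (norm x)\<^sup>2))"
proof -
 have I: "integrable lborel2 (\<lambda>(t, x::'a). dens s \<mu> t * heat t x * exp (- (norm x)\<^sup>2))"
  by (rule integrable_bound[OF integrable_dens_heat_pair])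
    (auto simp: abs_mult mult_left_le intro!: AE_I2)
 have J: "(LBINT x. dens s \<mu> t * heat t x * exp (- (norm (x::'a))\<^sup>2)) = dens s \<mu> t * (1 + 4 * t) powr (- n / 2)" for t
 proof (cases "t > 0")
  case True thus ?thesis using integral_heat_gauss[OF True, where 'a='a, folded dim_eq] by (simp add: mult.assoc)
 qed simp
 have J2: "Lint (\<lambda>t. dens s \<mu> t * (1 + 4 * t) powr (- n / 2))"
  using lborel_pair.integrable_fst'[OF I] unfolding J[symmetric] by simp
 have "1 / (\<mu> + (2 * n) powr s) = (LBINT t. exp (- ((2 * n) * t)) * dens s \<mu> t)"
  using integral_exp_dens[OF s_pos s_le mu, of "2 * n"] n_pos by simp
 also have "\<dots> \<le> (LBINT t. dens s \<mu> t * (1 + 4 * t) powr (- n / 2))"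
 proof (rule integral_mono[OF integrable_exp_dens[OF s_pos s_le mu] J2])
  fix t :: real
  show "exp (- ((2 * n) * t)) * dens s \<mu> t \<le> dens s \<mu> t * (1 + 4 * t) powr (- n / 2)"
  proof (cases "t > 0")
   case True
   have "ln (1 + 4 * t) \<le> 4 * t" using ln_le_minus_one[of "1 + 4 * t"] True by simp
   hence "n / 2 * ln (1 + 4 * t) \<le> n / 2 * (4 * t)" using n_pos by (intro mult_left_mono) auto
   hence "exp (- ((2 * n) * t)) \<le> (1 + 4 * t) powr (- n / 2)"
    using True by (simp add: powr_def)
   thus ?thesis using dens_nonneg[OF s_pos s_le, of \<mu> t] by (simp add: mult.commute mult_left_mono)
  qed simp
 qed (use n_pos in simp)
 also have "\<dots> = (LBINT t. (LBINT x. dens s \<mu> t * heat t x * exp (- (norm (x::'a))\<^sup>2)))"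
  unfolding J ..
 also have "\<dots> = (LBINT x. (LBINT t. dens s \<mu> t * heat t x * exp (- (norm (x::'a))\<^sup>2)))"
  by (rule lborel_pair.Fubini_integral[OF I, symmetric])
 also have "\<dots> = (LBINT x. K \<mu> x * exp (- (norm x)\<^sup>2))"
  by (simp add: kern_def)
 finally show ?thesis .
qed

end

lemma kern_approximate_identity:
 fixes f :: "'a \<Rightarrow> real"
 assumes f: "Lint f"
 shows "(\<lambda>i. LBINT x. \<bar>real (Suc i) * conv (K (real (Suc i))) f x - f x\<bar>) \<longlonglongrightarrow> 0"
proof -
 let ?k = "\<lambda>i x. real (Suc i) * K (real (Suc i)) x"
 have p: "real (Suc i) > 0" for i by simp
 have eq: "real (Suc i) * conv (K (real (Suc i))) f x = conv (?k i) f x" for i x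
  by (simp add: conv_def mult.assoc)
 show ?thesis unfolding eq
 proof (rule approximate_identity[OF _ _ _ _ f])
  show "Lint (?k i)" for i using integrable_kern[OF p] by simp
  show "0 \<le> ?k i x" for i x using kern_nonneg by simp
  show "(LBINT x. ?k i x) = 1" for i using integral_kern[OF p] by simp
  show "(\<lambda>i. LBINT x. ?k i x * exp (- (norm x)\<^sup>2)) \<longlonglongrightarrow> 1"
  proof (rule tendsto_sandwich[where f="\<lambda>i. real (Suc i) * (1 / (real (Suc i) + (2 * n) powr s))" and h="\<lambda>_. 1"])
   show "(\<lambda>i. real (Suc i) * (1 / (real (Suc i) + (2 * n) powr s))) \<longlonglongrightarrow> 1"
    by real_asymp
   show "\<forall>\<^sub>F i in sequentially. real (Suc i) * (1 / (real (Suc i) + (2 * n) powr s)) \<le> (LBINT x. ?k i x * exp (- (norm x)\<^sup>2))"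
    using integral_kern_gauss_ge[OF p] by (intro always_eventually allI) (simp only: mult.assoc integral_mult_right_zero mult_left_mono of_nat_0_le_iff)
   show "\<forall>\<^sub>F i in sequentially. (LBINT x. ?k i x * exp (- (norm x)\<^sup>2)) \<le> 1"
   proof (intro always_eventually allI)
    fix i
    have I: "Lint (?k i)" using integrable_kern[OF p] by simp
    have "(LBINT x. ?k i x * exp (- (norm x)\<^sup>2)) \<le> (LBINT x. ?k i x)"
    proof (rule integral_mono[OF _ I])
     show "Lint (\<lambda>x. ?k i x * exp (- (norm x)\<^sup>2))"
      by (rule integrable_bound[OF I]) (auto simp: abs_mult mult_left_le intro!: AE_I2)
     show "?k i x * exp (- (norm x)\<^sup>2) \<le> ?k i x" for x
      using kern_nonneg by (intro mult_left_le) auto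
    qed
    thus "(LBINT x. ?k i x * exp (- (norm x)\<^sup>2)) \<le> 1" using integral_kern[OF p] by simp
   qed
  qed auto
 qed
qed

end

section \<open>The fractional Laplacian on integrable functions\<close>

context frac
begin

text \<open>The realisation of the operator in L1: the Fourier condition of
  \<open>frac_laplacian_eq\<close> for functions integrable on \<open>lborel\<close>, without the L2
  requirement.\<close>

definition fpair :: "('a \<Rightarrow> real) \<Rightarrow> ('a \<Rightarrow> real) \<Rightarrow> bool" where
 "fpair w g \<longleftrightarrow> Lint w \<and> Lint g \<and>
   (\<forall>\<xi>. ft g \<xi> = complex_of_real (norm \<xi> powr (2 * s)) * ft w \<xi>)"

lemma fpairD: "fpair w g \<Longrightarrow> Lint w" "fpair w g \<Longrightarrow> Lint g"
 by (auto simp: fpair_def)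

lemma fpair_lin:
 assumes "fpair w1 g1" "fpair w2 g2"
 shows "fpair (\<lambda>x. a * w1 x + b * w2 x) (\<lambda>x. a * g1 x + b * g2 x)"
 using assms by (auto simp: fpair_def ft_add algebra_simps)

lemma fpair_scale: "fpair w g \<Longrightarrow> fpair (\<lambda>x. a * w x) (\<lambda>x. a * g x)"
 using fpair_lin[of w g w g a 0] by simp

lemma fpair_diff: "fpair w1 g1 \<Longrightarrow> fpair w2 g2 \<Longrightarrow> fpair (\<lambda>x. w1 x - w2 x) (\<lambda>x. g1 x - g2 x)"
 using fpair_lin[of w1 g1 w2 g2 1 "-1"] by simp

lemma fpair_add: "fpair w1 g1 \<Longrightarrow> fpair w2 g2 \<Longrightarrow> fpair (\<lambda>x. w1 x + w2 x) (\<lambda>x. g1 x + g2 x)"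
 using fpair_lin[of w1 g1 w2 g2 1 1] by simp

lemma fpair_zero: "fpair (\<lambda>x. 0) (\<lambda>x. 0)"
 by (simp add: fpair_def ft_def)

lemma fpair_sum:
 assumes "finite I" "\<And>i. i \<in> I \<Longrightarrow> fpair (w i) (g i)"
 shows "fpair (\<lambda>x. \<Sum>i\<in>I. w i x) (\<lambda>x. \<Sum>i\<in>I. g i x)"
 using assms by (induction I) (auto intro: fpair_zero fpair_add)

lemma fpair_cong_AE:
 assumes "fpair w g" "AE x in lborel. w x = w' x" "AE x in lborel. g x = g' x"
  and [measurable]: "w' \<in> bm" "g' \<in> bm"
 shows "fpair w' g'"
proof -
 have [measurable]: "w \<in> bm" "g \<in> bm"
  using fpairD[OF assms(1)] by (auto intro: Lint_measurable)
 have "Lint w'" "Lint g'"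
  by (rule integrable_cong_AE_imp[OF fpairD(1)[OF assms(1)]], simp, use assms(2) in simp)
    (rule integrable_cong_AE_imp[OF fpairD(2)[OF assms(1)]], simp, use assms(3) in simp)
 moreover have "ft w = ft w'" "ft g = ft g'" using assms(2,3) by (auto intro!: ft_cong_AE)
 ultimately show ?thesis using assms(1) by (simp add: fpair_def)
qed

text \<open>On the Fourier side the right-hand side is (\<mu> + |\<xi>|^(2s)) \<open>ft w\<close>
  divided by the same factor, and \<open>ft_injective\<close> concludes. This is the passage from
  the multiplier to a positive kernel; \<open>resolvent_fpair\<close> is the way back.\<close>

lemma fpair_resolvent:
 assumes mu: "\<mu> > 0" and p: "fpair w g"
 shows "AE x in lborel. w x = conv (K \<mu>) (\<lambda>x. g x + \<mu> * w x) x"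
proof -
 have i: "Lint (\<lambda>x. g x + \<mu> * w x)" using fpairD[OF p] by auto
 show ?thesis
 proof (rule ft_injective[OF fpairD(1)[OF p] integrable_conv[OF integrable_kern[OF mu] i]])
  fix \<xi> :: 'a
  define r where "r = norm \<xi> powr (2 * s)"
  have r: "r \<ge> 0" by (simp add: r_def)
  have "ft (conv (K \<mu>) (\<lambda>x. g x + \<mu> * w x)) \<xi> = of_real (1 / (\<mu> + r)) * ft (\<lambda>x. 1 * g x + \<mu> * w x) \<xi>"
   using ft_conv[OF integrable_kern[OF mu] i] ft_kern[OF mu] by (simp add: r_def)
  also have "ft (\<lambda>x. 1 * g x + \<mu> * w x) \<xi> = of_real (\<mu> + r) * ft w \<xi>"
   using p by (subst ft_add[OF fpairD(2)[OF p] fpairD(1)[OF p]]) (simp add: fpair_def r_def algebra_simps)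
  also have "of_real (1 / (\<mu> + r)) * (of_real (\<mu> + r) * ft w \<xi>) = ft w \<xi>"
  proof -
   have "1 / (\<mu> + r) * (\<mu> + r) = 1" using mu r by (simp add: add_pos_nonneg)
   thus ?thesis by (metis mult.assoc mult_1 of_real_1 of_real_mult)
  qed
  finally show "ft w \<xi> = ft (conv (K \<mu>) (\<lambda>x. g x + \<mu> * w x)) \<xi>" by simp
 qed
qed

lemma resolvent_fpair:
 assumes mu: "\<mu> > 0" and h: "Lint h" and w: "Lint w"
  and eq: "AE x in lborel. w x = conv (K \<mu>) h x"
 shows "fpair w (\<lambda>x. h x - \<mu> * w x)"
proof -
 have [measurable]: "w \<in> bm" "h \<in> bm"
  using h w by (auto intro: Lint_measurable)
 have "ft (\<lambda>x. h x - \<mu> * w x) \<xi> = complex_of_real (norm \<xi> powr (2 * s)) * ft w \<xi>" for \<xi>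
 proof -
  define r where "r = norm \<xi> powr (2 * s)"
  have r: "\<mu> + r > 0" using mu by (simp add: r_def add_pos_nonneg)
  have "ft w \<xi> = ft (conv (K \<mu>) h) \<xi>" using ft_cong_AE[OF eq] by simp
  also have "\<dots> = of_real (1 / (\<mu> + r)) * ft h \<xi>"
   using ft_conv[OF integrable_kern[OF mu] h] ft_kern[OF mu] by (simp add: r_def)
  finally have "of_real (\<mu> + r) * ft w \<xi> = of_real (\<mu> + r) * of_real (1 / (\<mu> + r)) * ft h \<xi>" by simp
  also have "\<dots> = ft h \<xi>"
  proof -
   have "(\<mu> + r) * (1 / (\<mu> + r)) = 1" using r by simp
   thus ?thesis by (metis mult_1 of_real_1 of_real_mult)
  qed
  finally have "ft h \<xi> = of_real (\<mu> + r) * ft w \<xi>" ..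
  thus ?thesis using ft_add[OF h w, of 1 "- \<mu>" \<xi>] by (simp add: r_def algebra_simps)
 qed
 thus ?thesis using h w by (simp add: fpair_def)
qed

section \<open>Bounded excessive weights and accretivity of the fractional Laplacian\<close>

definition excessive :: "('a \<Rightarrow> real) \<Rightarrow> bool" where
 "excessive \<Phi> \<longleftrightarrow> \<Phi> \<in> bm \<and> (\<forall>x. 0 \<le> \<Phi> x) \<and> (\<exists>B. \<forall>x. \<Phi> x \<le> B) \<and>
   (\<forall>\<mu>>0. AE x in lborel. \<mu> * conv (K \<mu>) \<Phi> x \<le> \<Phi> x)"

lemma excessive_one: "excessive (\<lambda>x. 1)"
proof -
 have "\<mu> * conv (K \<mu>) (\<lambda>x. 1) x = 1" if "\<mu> > 0" for \<mu> x
  using that integral_lborel_reflect[OF integrable_kern[OF that], of x] integral_kern[OF that] by (simp add: conv_def)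
 thus ?thesis by (auto simp: excessive_def)
qed

text \<open>As the kernel is nonnegative, replacing w by its positive part only increases the
  convolution term. Symmetry then moves the convolution onto the weight, where excessivity bounds
  \<mu> K_\<mu> \<Phi> by \<Phi>.\<close>

lemma kern_accretive:
 assumes mu: "\<mu> > 0" and w: "Lint w" and ex: "excessive \<Phi>"
 shows "0 \<le> (LBINT x. (w x - \<mu> * conv (K \<mu>) w x) * (indicator {x. 0 < w x} x * \<Phi> x))"
proof -
 obtain B where B: "\<And>x. \<Phi> x \<le> B" using ex by (auto simp: excessive_def)
 have nn: "0 \<le> \<Phi> x" for x using ex by (auto simp: excessive_def)
 have [measurable]: "\<Phi> \<in> bm" "w \<in> bm"
  using ex w by (auto simp: excessive_def intro: Lint_measurable)
 define p where "p = (\<lambda>x. max 0 (w x))"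
 have p: "Lint p" unfolding p_def using w by auto
 have mulB: "Lint (\<lambda>x. f x * g x)" if f: "Lint f" and [measurable]: "g \<in> bm"
  and g: "\<And>x. \<bar>g x\<bar> \<le> B" for f g :: "'a \<Rightarrow> real"
 proof (rule integrable_bound[of _ "\<lambda>x. B * f x"])
  have [measurable]: "f \<in> bm" using f by (auto intro: Lint_measurable)
  show "(\<lambda>x. f x * g x) \<in> borel_measurable lborel" by measurable
  have "B \<ge> 0" using g[of undefined] by linarith
  thus "AE x in lborel. norm (f x * g x) \<le> norm (B * f x)"
   using g by (intro AE_I2) (simp add: abs_mult mult.commute[of B] mult_left_mono)
 qed (use f in auto)
 have abB: "\<bar>\<Phi> x\<bar> \<le> B" for x using B nn by (simp add: abs_of_nonneg)
 note iK = integrable_conv[OF integrable_kern[OF mu]]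
 have "(LBINT x. conv (K \<mu>) w x * (indicator {x. 0 < w x} x * \<Phi> x)) \<le> (LBINT x. conv (K \<mu>) p x * \<Phi> x)"
 proof (rule integral_mono_AE)
  show "Lint (\<lambda>x. conv (K \<mu>) w x * (indicator {x. 0 < w x} x * \<Phi> x))"
   by (rule mulB[OF iK[OF w]]) (auto simp: abB indicator_def intro: order_trans[OF abs_ge_zero abB])
  show "Lint (\<lambda>x. conv (K \<mu>) p x * \<Phi> x)" by (rule mulB[OF iK[OF p]]) (auto simp: abB)
  show "AE x in lborel. conv (K \<mu>) w x * (indicator {x. 0 < w x} x * \<Phi> x) \<le> conv (K \<mu>) p x * \<Phi> x"
   using AE_integrable_conv[OF integrable_kern[OF mu] w] AE_integrable_conv[OF integrable_kern[OF mu] p]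
  proof eventually_elim
   case (elim x)
   have 1: "conv (K \<mu>) w x \<le> conv (K \<mu>) p x" unfolding conv_def
    using elim by (intro integral_mono) (auto simp: p_def intro!: mult_left_mono kern_nonneg)
   have 2: "0 \<le> conv (K \<mu>) p x" unfolding conv_def by (intro integral_nonneg_AE AE_I2) (auto simp: p_def kern_nonneg)
   show ?case using mult_right_mono[OF 1 nn[of x]] mult_nonneg_nonneg[OF 2 nn[of x]] by (auto simp: indicator_def)
  qed
 qed
 also have "\<dots> = (LBINT x. p x * conv (K \<mu>) \<Phi> x)"
  by (rule conv_adjoint[OF integrable_kern[OF mu] p _ _ abB]) auto
 finally have "\<mu> * (LBINT x. conv (K \<mu>) w x * (indicator {x. 0 < w x} x * \<Phi> x)) \<le> (LBINT x. p x * (\<mu> * conv (K \<mu>) \<Phi> x))"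
  using mu by (simp add: mult_left_mono mult.left_commute)
 also have "\<dots> \<le> (LBINT x. p x * \<Phi> x)"
 proof (rule integral_mono_AE)
  have cb: "\<bar>\<mu> * conv (K \<mu>) \<Phi> x\<bar> \<le> B" for x
   using conv_bounded[OF integrable_kern[OF mu], where f=\<Phi> and B=B and x=x] abB mu kern_nonneg integral_kern[OF mu]
   by (simp add: abs_mult field_simps)
  show "Lint (\<lambda>x. p x * (\<mu> * conv (K \<mu>) \<Phi> x))" by (rule mulB[OF p _ cb]) auto
  show "Lint (\<lambda>x. p x * \<Phi> x)" by (rule mulB[OF p _ abB]) auto
  have "AE x in lborel. \<mu> * conv (K \<mu>) \<Phi> x \<le> \<Phi> x" using ex mu by (auto simp: excessive_def)
  thus "AE x in lborel. p x * (\<mu> * conv (K \<mu>) \<Phi> x) \<le> p x * \<Phi> x"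
   by eventually_elim (auto simp: p_def intro!: mult_left_mono)
 qed
 also have "\<dots> = (LBINT x. w x * (indicator {x. 0 < w x} x * \<Phi> x))"
  by (intro integral_cong) (auto simp: p_def indicator_def)
 finally have le: "\<mu> * (LBINT x. conv (K \<mu>) w x * (indicator {x. 0 < w x} x * \<Phi> x)) \<le> (LBINT x. w x * (indicator {x. 0 < w x} x * \<Phi> x))" .
 have i1: "Lint (\<lambda>x. w x * (indicator {x. 0 < w x} x * \<Phi> x))"
  by (rule mulB[OF w]) (auto simp: abB indicator_def intro: order_trans[OF abs_ge_zero abB])
 have i2: "Lint (\<lambda>x. conv (K \<mu>) w x * (indicator {x. 0 < w x} x * \<Phi> x))"
  by (rule mulB[OF iK[OF w]]) (auto simp: abB indicator_def intro: order_trans[OF abs_ge_zero abB])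
 have "(LBINT x. (w x - \<mu> * conv (K \<mu>) w x) * (indicator {x. 0 < w x} x * \<Phi> x)) =
  (LBINT x. w x * (indicator {x. 0 < w x} x * \<Phi> x) - \<mu> * (conv (K \<mu>) w x * (indicator {x. 0 < w x} x * \<Phi> x)))"
  by (simp add: left_diff_distrib mult.assoc)
 also have "\<dots> = (LBINT x. w x * (indicator {x. 0 < w x} x * \<Phi> x)) - \<mu> * (LBINT x. conv (K \<mu>) w x * (indicator {x. 0 < w x} x * \<Phi> x))"
  using i1 i2 by simp
 finally show ?thesis using le by simp
qed

text \<open>A weighted Kato inequality. The Yosida approximation \<mu> K_\<mu> g equals \<mu> (w -
  \<mu> K_\<mu> w), whose pairing is nonnegative by \<open>kern_accretive\<close>, and it converges
  to g in L1 as \<mu> grows. L1 convergence suffices since the sign function times the weight is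
  bounded.\<close>

lemma fpair_accretive:
 assumes p: "fpair w g" and ex: "excessive \<Phi>"
 shows "0 \<le> (LBINT x. g x * (indicator {x. 0 < w x} x * \<Phi> x))"
proof -
 note w = fpairD(1)[OF p] and g = fpairD(2)[OF p]
 obtain B where B: "\<And>x. \<Phi> x \<le> B" using ex by (auto simp: excessive_def)
 have nn: "0 \<le> \<Phi> x" for x using ex by (auto simp: excessive_def)
 have [measurable]: "\<Phi> \<in> bm" "w \<in> bm" "g \<in> bm"
  using ex w g by (auto simp: excessive_def intro: Lint_measurable)
 have B0: "B \<ge> 0" using B nn order_trans by blast
 define q where "q = (\<lambda>x. indicator {x. 0 < w x} x * \<Phi> x)"
 have [measurable]: "q \<in> bm" unfolding q_def by measurable
 have q: "0 \<le> q x" "q x \<le> B" for x using B nn B0 by (auto simp: q_def indicator_def)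
 have mulB: "Lint (\<lambda>x. f x * q x)" if f: "Lint f" for f :: "'a \<Rightarrow> real"
 proof (rule integrable_bound[of _ "\<lambda>x. B * f x"])
  have [measurable]: "f \<in> bm" using f by (auto intro: Lint_measurable)
  show "(\<lambda>x. f x * q x) \<in> borel_measurable lborel" by measurable
  show "AE x in lborel. norm (f x * q x) \<le> norm (B * f x)"
   using q B0 by (intro AE_I2) (simp add: abs_mult mult.commute[of B] mult_left_mono)
 qed (use f in auto)
 \<comment> \<open>The L1 error of the Yosida approximation at \<mu> = i + 1; because 0 <= q <= B it
   changes the pairing by at most B times this.\<close>
 define d where "d = (\<lambda>i. LBINT x. \<bar>real (Suc i) * conv (K (real (Suc i))) g x - g x\<bar>)"
 have "- B * d i \<le> (LBINT x. g x * q x)" for i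
 proof -
  define \<mu> where "\<mu> = real (Suc i)"
  have mu: "\<mu> > 0" by (simp add: \<mu>_def)
  note kI = integrable_kern[OF mu]
  have ae: "AE x in lborel. \<mu> * conv (K \<mu>) g x = \<mu> * (w x - \<mu> * conv (K \<mu>) w x)"
   using fpair_resolvent[OF mu p] AE_integrable_conv[OF kI w] AE_integrable_conv[OF kI g]
  proof eventually_elim
   case (elim x)
   have "w x = conv (K \<mu>) g x + \<mu> * conv (K \<mu>) w x"
    using elim(1) conv_diff[OF elim(3,2), of 1 \<mu>] by simp
   thus ?case by (simp add: algebra_simps)
  qed
  have "0 \<le> \<mu> * (LBINT x. (w x - \<mu> * conv (K \<mu>) w x) * q x)"
   using kern_accretive[OF mu w ex] mu by (simp add: q_def)
  also have "\<dots> = (LBINT x. \<mu> * (w x - \<mu> * conv (K \<mu>) w x) * q x)" by (simp add: mult.assoc)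
  also have "\<dots> = (LBINT x. \<mu> * conv (K \<mu>) g x * q x)"
   using ae by (intro integral_cong_AE) auto
  also have "\<dots> \<le> (LBINT x. g x * q x + \<bar>\<mu> * conv (K \<mu>) g x - g x\<bar> * B)"
  proof (rule integral_mono)
   have iK: "Lint (conv (K \<mu>) g)" by (rule integrable_conv[OF kI g])
   show "Lint (\<lambda>x. \<mu> * conv (K \<mu>) g x * q x)" using iK by (intro mulB) auto
   show "Lint (\<lambda>x. g x * q x + \<bar>\<mu> * conv (K \<mu>) g x - g x\<bar> * B)" using iK g by (auto intro!: mulB)
   fix x
   have "(\<mu> * conv (K \<mu>) g x - g x) * q x \<le> \<bar>\<mu> * conv (K \<mu>) g x - g x\<bar> * B"
    using q[of x] by (intro mult_mono) auto
   thus "\<mu> * conv (K \<mu>) g x * q x \<le> g x * q x + \<bar>\<mu> * conv (K \<mu>) g x - g x\<bar> * B" by (simp add: algebra_simps)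
  qed
  also have "\<dots> = (LBINT x. g x * q x) + d i * B"
  proof -
   have iK: "Lint (conv (K \<mu>) g)" by (rule integrable_conv[OF kI g])
   show ?thesis unfolding d_def \<mu>_def[symmetric]
    using iK g by (subst integral_add) (auto intro!: mulB)
  qed
  finally show ?thesis by (simp add: mult.commute)
 qed
 moreover have "(\<lambda>i. - B * d i) \<longlonglongrightarrow> - B * 0"
  unfolding d_def by (intro tendsto_intros kern_approximate_identity g)
 ultimately have "- B * 0 \<le> (LBINT x. g x * q x)"
  by (intro LIMSEQ_le_const2) auto
 thus ?thesis by (simp add: q_def)
qed

section \<open>Convolution with the Green function on bounded integrable functions\<close>

definition gauss1 :: "'a \<Rightarrow> real" where "gauss1 x = exp (- (norm x)\<^sup>2)"

lemma measurable_gauss1 [measurable]: "gauss1 \<in> bm" unfolding gauss1_def by measurable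
lemma gauss1_bounds: "0 \<le> gauss1 x" "gauss1 x \<le> 1" by (auto simp: gauss1_def)
lemma integrable_gauss1: "Lint gauss1"
 using integrable_gauss[of 1, where 'a='a] by (simp add: gauss1_def[abs_def])

text \<open>By Tonelli the integral is that of \<open>dens s 0 t\<close> (1 + 4 t)^(-n/2):
  comparable to t^(s-1) near 0, integrable as s > 0, and to t^(s-1-n/2) at infinity, integrable as 2
  s < n.\<close>

lemma integrable_green_gauss: "Lint (\<lambda>y. G y * gauss1 y)"
proof -
 have dens_nn: "0 \<le> dens s 0 t" for t by (rule dens_nonneg[OF s_pos s_le])
 have a: "((\<lambda>t. t powr (s - 1)) has_integral (1 powr (s - 1 + 1) / (s - 1 + 1))) {0..1}"
  using s_pos by (intro has_integral_powr_from_0) auto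
 have b: "((\<lambda>t. t powr (s - 1 - n / 2)) has_integral - (1 powr (s - 1 - n / 2 + 1)) / (s - 1 - n / 2 + 1)) {1..}"
  using dim by (intro has_integral_powr_to_inf) auto
 have nna: "(LBNN t. ennreal (t powr (s - 1)) * indicator {0..1} t) < \<infinity>"
  using nn_integral_has_integral_lebesgue'[OF _ a] by simp
 have nnb: "(LBNN t. ennreal (t powr (s - 1 - n / 2)) * indicator {1..} t) < \<infinity>"
  using nn_integral_has_integral_lebesgue'[OF _ b] by simp
 have "(LBNN t. ennreal (dens s 0 t * (1 + 4 * t) powr (- n / 2))) \<le>
   (LBNN t. ennreal (1 / Gamma s) * (ennreal (t powr (s - 1)) * indicator {0..1} t + ennreal (t powr (s - 1 - n / 2)) * indicator {1..} t))"
 proof (rule nn_integral_mono)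
  fix t :: real
  show "ennreal (dens s 0 t * (1 + 4 * t) powr (- n / 2)) \<le> ennreal (1 / Gamma s) * (ennreal (t powr (s - 1)) * indicator {0..1} t + ennreal (t powr (s - 1 - n / 2)) * indicator {1..} t)"
  proof (cases "t > 0")
   case True
   have G: "1 / Gamma s \<ge> 0" using Gamma_real_pos[OF s_pos] by simp
   have d: "dens s 0 t * (1 + 4 * t) powr (- n / 2) = 1 / Gamma s * (t powr (s - 1) * (1 + 4 * t) powr (- n / 2))"
    by (simp add: dens_0[OF s_pos s_le True])
   show ?thesis
   proof (cases "t \<le> 1")
    case t1: True
    have "(1 + 4 * t) powr (- n / 2) \<le> 1 powr (- n / 2)" using True n_pos by (intro powr_mono2') auto
    hence "t powr (s - 1) * (1 + 4 * t) powr (- n / 2) \<le> t powr (s - 1)" by (simp add: mult_left_le)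
    hence "ennreal (1 / Gamma s * (t powr (s - 1) * (1 + 4 * t) powr (- n / 2))) \<le> ennreal (1 / Gamma s) * ennreal (t powr (s - 1))"
     using G by (subst ennreal_mult[symmetric]) (auto intro!: ennreal_leI divide_right_mono simp: mult_left_le)
    also have "\<dots> \<le> ennreal (1 / Gamma s) * (ennreal (t powr (s - 1)) * indicator {0..1} t + ennreal (t powr (s - 1 - n / 2)) * indicator {1..} t)"
     using True t1 by (intro mult_left_mono) auto
    finally show ?thesis unfolding d .
   next
    case False
    have "(1 + 4 * t) powr (- n / 2) \<le> t powr (- n / 2)" using True n_pos by (intro powr_mono2') auto
    hence "t powr (s - 1) * (1 + 4 * t) powr (- n / 2) \<le> t powr (s - 1) * t powr (- n / 2)" by (simp add: mult_left_mono)
    also have "\<dots> = t powr (s - 1 - n / 2)" by (simp add: powr_add[symmetric])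
    finally have "ennreal (1 / Gamma s * (t powr (s - 1) * (1 + 4 * t) powr (- n / 2))) \<le> ennreal (1 / Gamma s) * ennreal (t powr (s - 1 - n / 2))"
     using G by (subst ennreal_mult[symmetric]) (auto intro!: ennreal_leI mult_left_mono simp: divide_right_mono)
    thus ?thesis unfolding d using True False by (auto simp: indicator_def)
   qed
  qed simp
 qed
 also have "\<dots> < \<infinity>" using nna nnb by (simp add: nn_integral_cmult nn_integral_add ennreal_mult_less_top)
 finally have fin: "(LBNN t. ennreal (dens s 0 t * (1 + 4 * t) powr (- n / 2))) < \<infinity>" .
 have "(LBNN y. ennreal (G y * gauss1 y)) \<le> (LBNN y. (LBNN t. ennreal (dens s 0 t * heat t y * gauss1 y)))"
 proof (rule nn_integral_mono_AE)
  show "AE y in lborel. ennreal (G y * gauss1 y) \<le> (LBNN t. ennreal (dens s 0 t * heat t y * gauss1 y))"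
   using AE_lborel_singleton[of "0::'a"]
  proof eventually_elim
   case (elim y)
   have "(LBNN t. ennreal (dens s 0 t * heat t y * gauss1 y)) = ennreal (LBINT t. dens s 0 t * heat t y * gauss1 y)"
    using integrable_dens_heat[OF elim] dens_nn heat_nonneg[of _ y] gauss1_bounds by (intro nn_integral_eq_integral) auto
   thus ?case by (simp add: kern_def)
  qed
 qed
 also have "\<dots> = (LBNN t. (LBNN y. ennreal (dens s 0 t * heat t y * gauss1 y)))"
  by (rule lborel_pair.Fubini') measurable
 also have "\<dots> = (LBNN t. ennreal (dens s 0 t * (1 + 4 * t) powr (- n / 2)))"
 proof (rule nn_integral_cong)
  fix t :: real
  show "(LBNN y. ennreal (dens s 0 t * heat t y * gauss1 y)) = ennreal (dens s 0 t * (1 + 4 * t) powr (- n / 2))"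
  proof (cases "t > 0")
   case True
   have I: "Lint (\<lambda>y::'a. dens s 0 t * (heat t y * gauss1 y))"
    by (rule integrable_bound[of _ "\<lambda>y. dens s 0 t * heat t (y::'a)"])
      (use integrable_heat[OF True, where 'a='a] dens_nn heat_nonneg[of t] gauss1_bounds in \<open>auto simp: abs_mult intro!: AE_I2 mult_left_mono mult_left_le\<close>)
   have "(LBNN y. ennreal (dens s 0 t * (heat t y * gauss1 y))) = ennreal (LBINT y. dens s 0 t * (heat t y * gauss1 y))"
    by (intro nn_integral_eq_integral I AE_I2 mult_nonneg_nonneg dens_nn heat_nonneg gauss1_bounds)
   thus ?thesis using integral_heat_gauss[OF True, where 'a='a, folded dim_eq] by (simp add: gauss1_def mult.assoc)
  qed simp
 qed
 finally have "(LBNN y. ennreal (G y * gauss1 y)) < \<infinity>" using fin by (auto intro: le_less_trans)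
 thus ?thesis
  by (intro integrableI_bounded) (auto simp: abs_of_nonneg kern_nonneg gauss1_bounds)
qed

text \<open>Inside the unit ball e times \<open>gauss1\<close> is at least 1 and absorbs the
  singularity; outside G is at most \<open>gc\<close>. The bounded part is paired with the L1 norm
  of f and the integrable part with its supremum.\<close>

lemma green_split: "G z \<le> gc + exp 1 * (G z * gauss1 z)"
proof (cases "norm z < 1")
 case True
 have "(norm z)\<^sup>2 \<le> 1" using True by (simp add: power_le_one)
 hence "1 \<le> exp 1 * gauss1 z" by (simp add: gauss1_def exp_add[symmetric])
 hence "G z * 1 \<le> G z * (exp 1 * gauss1 z)" by (intro mult_left_mono kern_nonneg)
 thus ?thesis using gc_pos by (simp add: mult_ac)
next
 case False
 hence z: "z \<noteq> 0" by auto
 have "norm z powr (- (n - 2 * s)) \<le> 1 powr (- (n - 2 * s))" using False dim by (intro powr_mono2') auto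
 hence "G z \<le> gc" using gc_pos by (simp add: green_eq[OF z] mult_left_le)
 thus ?thesis using mult_nonneg_nonneg[OF kern_nonneg gauss1_bounds(1), of 0 z z] by (simp add: add_increasing2)
qed

definition gm :: real where "gm = exp 1 * (LBINT y. G y * gauss1 y)"

lemma
 assumes f: "Lint f" and M: "\<And>x. \<bar>f x\<bar> \<le> M"
 shows integrable_green_conv: "Lint (\<lambda>y. G (x - y) * f y)"
  and green_conv_bound: "\<bar>conv G f x\<bar> \<le> gc * (LBINT y. \<bar>f y\<bar>) + gm * M"
proof -
 have [measurable]: "f \<in> bm" by (rule Lint_measurable[OF f])
 have M0: "M \<ge> 0" using M[of undefined] by linarith
 have gr: "Lint (\<lambda>y. G (x - y) * gauss1 (x - y))" "(LBINT y. G (x - y) * gauss1 (x - y)) = (LBINT y. G y * gauss1 y)"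
  using integrable_lborel_reflect[OF integrable_green_gauss, of x] integral_lborel_reflect[OF integrable_green_gauss, of x] by auto
 have I: "Lint (\<lambda>y. gc * \<bar>f y\<bar> + exp 1 * M * (G (x - y) * gauss1 (x - y)))"
  using f gr(1) by auto
 have b: "\<bar>G (x - y) * f y\<bar> \<le> gc * \<bar>f y\<bar> + exp 1 * M * (G (x - y) * gauss1 (x - y))" for y
 proof -
  have "\<bar>G (x - y) * f y\<bar> = G (x - y) * \<bar>f y\<bar>" by (simp add: abs_mult kern_nonneg)
  also have "\<dots> \<le> (gc + exp 1 * (G (x - y) * gauss1 (x - y))) * \<bar>f y\<bar>"
   by (intro mult_right_mono green_split) auto
  also have "\<dots> = gc * \<bar>f y\<bar> + exp 1 * (G (x - y) * gauss1 (x - y)) * \<bar>f y\<bar>" by (simp add: algebra_simps)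
  also have "\<dots> \<le> gc * \<bar>f y\<bar> + exp 1 * (G (x - y) * gauss1 (x - y)) * M"
   using M by (intro add_left_mono mult_left_mono) (auto simp: kern_nonneg gauss1_bounds)
  finally show ?thesis by (simp add: mult_ac)
 qed
 show J: "Lint (\<lambda>y. G (x - y) * f y)"
  by (rule integrable_bound[OF I]) (use b in \<open>auto intro!: AE_I2 order_trans[OF _ abs_ge_self]\<close>)
 have "\<bar>conv G f x\<bar> \<le> (LBINT y. \<bar>G (x - y) * f y\<bar>)"
  unfolding conv_def using integral_norm_bound[of lborel "\<lambda>y. G (x - y) * f y"] by simp
 also have "\<dots> \<le> (LBINT y. gc * \<bar>f y\<bar> + exp 1 * M * (G (x - y) * gauss1 (x - y)))"
  using J b by (intro integral_mono I) auto
 also have "\<dots> = gc * (LBINT y. \<bar>f y\<bar>) + gm * M"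
  using f gr by (simp add: gm_def)
 finally show "\<bar>conv G f x\<bar> \<le> gc * (LBINT y. \<bar>f y\<bar>) + gm * M" .
qed

lemma kern_conv_tendsto:
 assumes f: "Lint f" and M: "\<And>x. \<bar>f x\<bar> \<le> M" and m: "m \<longlonglongrightarrow> 0" "\<And>i. m i \<ge> 0"
 shows "(\<lambda>i. conv (K (m i)) f x) \<longlonglongrightarrow> conv G f x"
 unfolding conv_def
proof (rule integral_dominated_convergence)
 have [measurable]: "f \<in> bm" by (rule Lint_measurable[OF f])
 show "(\<lambda>y. G (x - y) * f y) \<in> borel_measurable lborel" "(\<lambda>y. K (m i) (x - y) * f y) \<in> borel_measurable lborel" for i by measurable
 have "Lint (\<lambda>y. G (x - y) * \<bar>f y\<bar>)"
  using f M by (intro integrable_green_conv[where M=M]) auto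
 thus "Lint (\<lambda>y. dc * (G (x - y) * \<bar>f y\<bar>))" by simp
 have ne: "AE y in lborel. y \<noteq> x" by (rule AE_lborel_singleton)
 show "AE y in lborel. (\<lambda>i. K (m i) (x - y) * f y) \<longlonglongrightarrow> G (x - y) * f y"
  using ne by eventually_elim (auto intro!: tendsto_intros kern_tendsto m)
 show "AE y in lborel. norm (K (m i) (x - y) * f y) \<le> dc * (G (x - y) * \<bar>f y\<bar>)" for i
  using ne
 proof eventually_elim
  case (elim y)
  have "K (m i) (x - y) * \<bar>f y\<bar> \<le> (dc * G (x - y)) * \<bar>f y\<bar>"
   using elim by (intro mult_right_mono kern_le m) auto
  thus ?case by (simp add: abs_mult kern_nonneg mult.assoc)
 qed
qed

lemma kern_conv_bound:
 assumes f: "Lint f" and M: "\<And>x. \<bar>f x\<bar> \<le> M" and mu: "\<mu> > 0"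
 shows "\<bar>conv (K \<mu>) f x\<bar> \<le> dc * (gc * (LBINT y. \<bar>f y\<bar>) + gm * M)"
proof -
 have [measurable]: "f \<in> bm" by (rule Lint_measurable[OF f])
 have I: "Lint (\<lambda>y. G (x - y) * \<bar>f y\<bar>)"
  using f M by (intro integrable_green_conv[where M=M]) auto
 have "\<bar>conv (K \<mu>) f x\<bar> \<le> (LBINT y. \<bar>K \<mu> (x - y) * f y\<bar>)"
  unfolding conv_def using integral_norm_bound[of lborel "\<lambda>y. K \<mu> (x - y) * f y"] by simp
 also have "\<dots> \<le> (LBINT y. dc * (G (x - y) * \<bar>f y\<bar>))"
 proof (rule integral_mono_AE)
  show "Lint (\<lambda>y. \<bar>K \<mu> (x - y) * f y\<bar>)"
   using integrable_conv_bounded[OF integrable_kern[OF mu] _ M] by auto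
  show "Lint (\<lambda>y. dc * (G (x - y) * \<bar>f y\<bar>))" using I by simp
  show "AE y in lborel. \<bar>K \<mu> (x - y) * f y\<bar> \<le> dc * (G (x - y) * \<bar>f y\<bar>)"
   using AE_lborel_singleton[of x]
  proof eventually_elim
   case (elim y)
   have "K \<mu> (x - y) * \<bar>f y\<bar> \<le> (dc * G (x - y)) * \<bar>f y\<bar>"
    using elim mu by (intro mult_right_mono kern_le) auto
   thus ?case by (simp add: abs_mult kern_nonneg mult.assoc)
  qed
 qed
 also have "\<dots> = dc * conv G (\<lambda>y. \<bar>f y\<bar>) x" by (simp add: conv_def)
 also have "\<dots> \<le> dc * (gc * (LBINT y. \<bar>f y\<bar>) + gm * M)"
  using green_conv_bound[of "\<lambda>y. \<bar>f y\<bar>" M x] f M dc_nonneg by (intro mult_left_mono) auto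
 finally show ?thesis .
qed

text \<open>Let \<mu> tend to 0 in w = K_\<mu> g + \<mu> K_\<mu> w: domination by the Green kernel
  bounds K_\<mu> w uniformly in \<mu>, so the last term disappears and the first tends to the Green
  potential.\<close>

lemma fpair_green:
 assumes p: "fpair w g" and M: "\<And>x. \<bar>w x\<bar> \<le> M" "\<And>x. \<bar>g x\<bar> \<le> M"
 shows "AE x in lborel. w x = conv G g x"
proof -
 note w = fpairD(1)[OF p] and g = fpairD(2)[OF p]
 have [measurable]: "w \<in> bm" "g \<in> bm" using w g by (auto intro: Lint_measurable)
 define m where "m = (\<lambda>i. inverse (real (Suc i)))"
 have m: "m \<longlonglongrightarrow> 0" "\<And>i. m i > 0" unfolding m_def using LIMSEQ_inverse_real_of_nat by auto
 have "AE x in lborel. \<forall>i. w x = conv (K (m i)) (\<lambda>x. g x + m i * w x) x"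
  unfolding AE_all_countable using fpair_resolvent[OF m(2) p] by blast
 thus ?thesis
 proof eventually_elim
  case (elim x)
  have eq: "w x = conv (K (m i)) g x + m i * conv (K (m i)) w x" for i
  proof -
   have "Lint (\<lambda>y. K (m i) (x - y) * g y)" "Lint (\<lambda>y. K (m i) (x - y) * w y)"
    by (rule integrable_conv_bounded[OF integrable_kern[OF m(2)] _ M(2)], measurable)
      (rule integrable_conv_bounded[OF integrable_kern[OF m(2)] _ M(1)], measurable)
   from conv_diff[OF this, of 1 "m i"] elim show ?thesis by simp
  qed
  define C where "C = dc * (gc * (LBINT y. \<bar>w y\<bar>) + gm * M)"
  have "(\<lambda>i. m i * conv (K (m i)) w x) \<longlonglongrightarrow> 0"
  proof (rule Lim_null_comparison)
   show "\<forall>\<^sub>F i in sequentially. norm (m i * conv (K (m i)) w x) \<le> m i * C"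
    unfolding C_def using kern_conv_bound[OF w M(1) m(2)] m(2)[THEN less_imp_le] by (intro always_eventually allI) (simp add: abs_mult mult_left_mono)
   show "(\<lambda>i. m i * C) \<longlonglongrightarrow> 0" using tendsto_mult_left_zero[OF m(1)] by simp
  qed
  moreover have "(\<lambda>i. conv (K (m i)) g x) \<longlonglongrightarrow> conv G g x"
   using m by (intro kern_conv_tendsto[OF g M(2)]) (auto intro: less_imp_le)
  ultimately have "(\<lambda>i. conv (K (m i)) g x + m i * conv (K (m i)) w x) \<longlonglongrightarrow> conv G g x + 0"
   by (intro tendsto_add)
  hence "(\<lambda>i. w x) \<longlonglongrightarrow> conv G g x + 0" using eq by simp
  thus "w x = conv G g x" by (simp add: LIMSEQ_const_iff)
 qed
qed

section \<open>The Green potential of a Gaussian as weight: excessivity and decay\<close>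

definition \<Phi> :: "'a \<Rightarrow> real" where "\<Phi> = conv G gauss1"

lemma measurable_Phi [measurable]: "\<Phi> \<in> bm"
 unfolding \<Phi>_def by measurable

lemma Phi_nonneg: "0 \<le> \<Phi> x"
 unfolding \<Phi>_def conv_def by (simp add: kern_nonneg gauss1_bounds)

definition PhiB :: real where "PhiB = gc * (LBINT y. gauss1 y) + gm"

lemma Phi_le: "\<Phi> x \<le> PhiB"
 using green_conv_bound[OF integrable_gauss1, of 1 x] by (simp add: \<Phi>_def gauss1_bounds PhiB_def)

text \<open>The resolvent identity K_m g = K_\<mu> g + (\<mu> - m) K_\<mu> K_m g becomes \<Phi> =
  K_\<mu> g + \<mu> K_\<mu> \<Phi> as m -> 0 (here g is \<open>gauss1\<close>), and the first term
  on the right is nonnegative.\<close>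

lemma excessive_Phi: "excessive \<Phi>"
proof -
 have "AE x in lborel. \<mu> * conv (K \<mu>) \<Phi> x \<le> \<Phi> x" if mu: "\<mu> > 0" for \<mu>
 proof -
  define m where "m = (\<lambda>i. inverse (real (Suc i)))"
  have m: "m \<longlonglongrightarrow> 0" "\<And>i. m i > 0" unfolding m_def using LIMSEQ_inverse_real_of_nat by auto
  have ab: "\<bar>gauss1 x\<bar> \<le> 1" for x by (simp add: gauss1_bounds)
  have iw: "Lint (conv (K (m i)) gauss1)" for i
   by (intro integrable_conv integrable_kern m integrable_gauss1)
  define C where "C = dc * (gc * (LBINT y. \<bar>gauss1 y\<bar>) + gm * 1)"
  have cb: "\<bar>conv (K (m i)) gauss1 x\<bar> \<le> C" for i x
   unfolding C_def by (rule kern_conv_bound[OF integrable_gauss1 ab m(2)])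
  have "AE x in lborel. conv (K (m i)) gauss1 x = conv (K \<mu>) gauss1 x + (\<mu> - m i) * conv (K \<mu>) (conv (K (m i)) gauss1) x" for i
  proof -
   let ?w = "conv (K (m i)) gauss1"
   have "fpair ?w (\<lambda>x. gauss1 x - m i * ?w x)"
    by (rule resolvent_fpair[OF m(2) integrable_gauss1 iw]) auto
   from fpair_resolvent[OF mu this]
   show ?thesis
   proof eventually_elim
    case (elim x)
    have "(\<lambda>x. gauss1 x - m i * ?w x + \<mu> * ?w x) = (\<lambda>x. 1 * gauss1 x + (\<mu> - m i) * ?w x)"
     by (simp add: algebra_simps)
    moreover have "Lint (\<lambda>y. K \<mu> (x - y) * gauss1 y)" "Lint (\<lambda>y. K \<mu> (x - y) * ?w y)"
     by (rule integrable_conv_bounded[OF integrable_kern[OF mu] _ ab], measurable)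
       (rule integrable_conv_bounded[OF integrable_kern[OF mu] _ cb[of i]], measurable)
    note conv_diff[OF this, of 1 "\<mu> - m i"]
    ultimately show ?case using elim by simp
   qed
  qed
  hence "AE x in lborel. \<forall>i. conv (K (m i)) gauss1 x = conv (K \<mu>) gauss1 x + (\<mu> - m i) * conv (K \<mu>) (conv (K (m i)) gauss1) x"
   unfolding AE_all_countable by blast
  thus ?thesis
  proof eventually_elim
   case (elim x)
   have lim: "(\<lambda>i. conv (K (m i)) gauss1 y) \<longlonglongrightarrow> \<Phi> y" for y
    unfolding \<Phi>_def using m by (intro kern_conv_tendsto[OF integrable_gauss1 ab]) (auto intro: less_imp_le)
   have "(\<lambda>i. conv (K \<mu>) (conv (K (m i)) gauss1) x) \<longlonglongrightarrow> conv (K \<mu>) \<Phi> x"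
    unfolding conv_def[of "K \<mu>"]
   proof (rule integral_dominated_convergence)
    show "Lint (\<lambda>y. C * K \<mu> (x - y))"
     using integrable_lborel_reflect[OF integrable_kern[OF mu]] by simp
    show "AE y in lborel. (\<lambda>i. K \<mu> (x - y) * conv (K (m i)) gauss1 y) \<longlonglongrightarrow> K \<mu> (x - y) * \<Phi> y"
     by (intro AE_I2 tendsto_intros lim)
    show "AE y in lborel. norm (K \<mu> (x - y) * conv (K (m i)) gauss1 y) \<le> C * K \<mu> (x - y)" for i
     using cb[of i] by (intro AE_I2) (simp add: abs_mult kern_nonneg mult.commute[of C] mult_left_mono)
   qed measurable
   hence "(\<lambda>i. conv (K \<mu>) gauss1 x + (\<mu> - m i) * conv (K \<mu>) (conv (K (m i)) gauss1) x) \<longlonglongrightarrow> conv (K \<mu>) gauss1 x + (\<mu> - 0) * conv (K \<mu>) \<Phi> x"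
    by (intro tendsto_intros m)
   hence "(\<lambda>i. conv (K (m i)) gauss1 x) \<longlonglongrightarrow> conv (K \<mu>) gauss1 x + \<mu> * conv (K \<mu>) \<Phi> x"
    using elim by simp
   with lim[of x] have "\<Phi> x = conv (K \<mu>) gauss1 x + \<mu> * conv (K \<mu>) \<Phi> x" by (rule LIMSEQ_unique)
   moreover have "0 \<le> conv (K \<mu>) gauss1 x" unfolding conv_def by (simp add: kern_nonneg gauss1_bounds)
   ultimately show ?case by simp
  qed
 qed
 thus ?thesis unfolding excessive_def using Phi_nonneg Phi_le by (auto intro: exI[of _ PhiB])
qed

text \<open>Only y in the unit ball is kept, where |x - y| <= 1 + |x| and the Gaussian is at least
  1/e. This is the half of the comparability through which a bound in the weight \<Phi> controls the
  norm of \<open>L1G\<close>.\<close>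

lemma Phi_lower: "\<exists>c>0. \<forall>x. c * (1 + norm x) powr (- (n - 2 * s)) \<le> \<Phi> x"
proof -
 define c where "c = gc * exp (- 1) * measure lborel (ball (0::'a) 1)"
 have fin: "emeasure lborel (ball (0::'a) 1) < \<infinity>" by (rule emeasure_lborel_ball_finite)
 have "measure lborel (ball (0::'a) 1) > 0" by (simp add: content_ball_pos)
 hence c: "c > 0" using gc_pos by (simp add: c_def)
 have "c * (1 + norm x) powr (- (n - 2 * s)) \<le> \<Phi> x" for x
 proof -
  have "c * (1 + norm x) powr (- (n - 2 * s)) = (\<integral>y. (gc * exp (- 1) * (1 + norm x) powr (- (n - 2 * s))) * indicator (ball 0 1) y \<partial>(lborel::'a measure))"
   by (simp add: c_def)
  also have "\<dots> \<le> \<Phi> x" unfolding \<Phi>_def conv_def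
  proof (rule integral_mono_AE)
   show "Lint (\<lambda>y::'a. (gc * exp (- 1) * (1 + norm x) powr (- (n - 2 * s))) * indicator (ball 0 1) y)"
    using fin by (intro integrable_mult_right) (auto simp: integrable_indicator_iff)
   show "Lint (\<lambda>y. G (x - y) * gauss1 y)"
    by (rule integrable_green_conv[OF integrable_gauss1, of 1]) (simp add: gauss1_bounds)
   show "AE y in lborel. (gc * exp (- 1) * (1 + norm x) powr (- (n - 2 * s))) * indicator (ball 0 1) y \<le> G (x - y) * gauss1 y"
    using AE_lborel_singleton[of x]
   proof eventually_elim
    case (elim y)
    show ?case
    proof (cases "y \<in> ball 0 1")
     case True
     hence ny: "norm y < 1" by simp
     have "norm (x - y) \<le> 1 + norm x" using norm_triangle_ineq4[of x y] ny by simp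
     hence "(1 + norm x) powr (- (n - 2 * s)) \<le> norm (x - y) powr (- (n - 2 * s))"
      using elim dim by (intro powr_mono2') auto
     hence 1: "gc * (1 + norm x) powr (- (n - 2 * s)) \<le> G (x - y)"
      using elim gc_pos by (simp add: green_eq)
     have "(norm y)\<^sup>2 \<le> 1" using ny by (simp add: power_le_one)
     hence 2: "exp (- 1) \<le> gauss1 y" by (simp add: gauss1_def)
     have "gc * (1 + norm x) powr (- (n - 2 * s)) * exp (- 1) \<le> G (x - y) * gauss1 y"
      using gc_pos by (intro mult_mono 1 2 kern_nonneg) auto
     thus ?thesis using True by (simp add: mult_ac)
    qed (simp add: kern_nonneg gauss1_bounds)
   qed
  qed
  finally show ?thesis .
 qed
 with c show ?thesis by blast
qed

text \<open>For |y| < |x|/2 the Green kernel is small. Otherwise half of the Gaussian exponent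
  supplies the factor exp(-|x|^2/8), and the other half, called h, still has a bounded
  potential.\<close>

lemma Phi_vanishes: "(\<Phi> \<longlongrightarrow> 0) at_infinity"
proof -
 define A where "A = (LBINT y. gauss1 y)"
 define h where "h = (\<lambda>y::'a. exp (- (1/2) * (norm y)\<^sup>2))"
 have h: "Lint h" unfolding h_def by (rule integrable_gauss) simp
 have h1: "\<bar>h y\<bar> \<le> 1" for y by (simp add: h_def)
 define C where "C = gc * (LBINT y. \<bar>h y\<bar>) + gm * 1"
 have hC: "conv G h x \<le> C" for x using green_conv_bound[OF h h1, of x] by (simp add: C_def)
 have le: "\<Phi> x \<le> gc * (norm x / 2) powr (- (n - 2 * s)) * A + exp (- (norm x)\<^sup>2 / 8) * C" if x: "x \<noteq> 0" for x
 proof -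
  have Ih: "Lint (\<lambda>y. G (x - y) * h y)" by (rule integrable_green_conv[OF h h1])
  have "\<Phi> x \<le> (LBINT y. gc * (norm x / 2) powr (- (n - 2 * s)) * gauss1 y + exp (- (norm x)\<^sup>2 / 8) * (G (x - y) * h y))"
   unfolding \<Phi>_def conv_def
  proof (rule integral_mono)
   show "Lint (\<lambda>y. G (x - y) * gauss1 y)"
    by (rule integrable_green_conv[OF integrable_gauss1, of 1]) (simp add: gauss1_bounds)
   show "Lint (\<lambda>y. gc * (norm x / 2) powr (- (n - 2 * s)) * gauss1 y + exp (- (norm x)\<^sup>2 / 8) * (G (x - y) * h y))"
    using integrable_gauss1 Ih by auto
   fix y
   show "G (x - y) * gauss1 y \<le> gc * (norm x / 2) powr (- (n - 2 * s)) * gauss1 y + exp (- (norm x)\<^sup>2 / 8) * (G (x - y) * h y)"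
   proof (cases "norm y < norm x / 2")
    case True
    have "norm x / 2 \<le> norm (x - y)" using norm_triangle_ineq2[of x y] True by simp
    moreover from this x have "x - y \<noteq> 0" by auto
    ultimately have "G (x - y) \<le> gc * (norm x / 2) powr (- (n - 2 * s))"
     using x dim gc_pos by (subst green_eq) (auto intro!: mult_left_mono powr_mono2')
    hence "G (x - y) * gauss1 y \<le> gc * (norm x / 2) powr (- (n - 2 * s)) * gauss1 y"
     by (intro mult_right_mono gauss1_bounds)
    moreover have "0 \<le> exp (- (norm x)\<^sup>2 / 8) * (G (x - y) * h y)" by (simp add: kern_nonneg h_def)
    ultimately show ?thesis by linarith
   next
    case False
    hence "(norm x / 2)\<^sup>2 \<le> (norm y)\<^sup>2" by (intro power_mono) auto
    hence "gauss1 y \<le> exp (- (norm x)\<^sup>2 / 8) * h y"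
     by (simp add: gauss1_def h_def exp_add[symmetric] power_divide)
    hence "G (x - y) * gauss1 y \<le> G (x - y) * (exp (- (norm x)\<^sup>2 / 8) * h y)"
     by (intro mult_left_mono kern_nonneg)
    moreover have "0 \<le> gc * (norm x / 2) powr (- (n - 2 * s)) * gauss1 y" using gc_pos by (simp add: gauss1_bounds)
    ultimately show ?thesis by (simp add: mult_ac)
   qed
  qed
  also have "\<dots> = gc * (norm x / 2) powr (- (n - 2 * s)) * A + exp (- (norm x)\<^sup>2 / 8) * conv G h x"
   using integrable_gauss1 Ih by (simp add: A_def conv_def)
  finally have "\<Phi> x \<le> gc * (norm x / 2) powr (- (n - 2 * s)) * A + exp (- (norm x)\<^sup>2 / 8) * conv G h x" .
  also have "\<dots> \<le> gc * (norm x / 2) powr (- (n - 2 * s)) * A + exp (- (norm x)\<^sup>2 / 8) * C"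
   by (intro add_left_mono mult_left_mono hC) simp
  finally show ?thesis .
 qed
 have "((\<lambda>r. gc * (r / 2) powr (- (n - 2 * s)) * A + exp (- r\<^sup>2 / 8) * C) \<longlongrightarrow> 0) at_top"
  using dim by real_asymp
 hence lim: "((\<lambda>x::'a. gc * (norm x / 2) powr (- (n - 2 * s)) * A + exp (- (norm x)\<^sup>2 / 8) * C) \<longlongrightarrow> 0) at_infinity"
  by (rule filterlim_compose[OF _ filterlim_norm_at_top])
 show ?thesis
 proof (rule Lim_null_comparison[OF _ lim])
  have "\<forall>\<^sub>F x::'a in at_infinity. x \<noteq> 0" unfolding eventually_at_infinity by (intro exI[of _ 1]) auto
  thus "\<forall>\<^sub>F x in at_infinity. norm (\<Phi> x) \<le> gc * (norm x / 2) powr (- (n - 2 * s)) * A + exp (- (norm x)\<^sup>2 / 8) * C"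
   by eventually_elim (use le Phi_nonneg in auto)
 qed
qed

end

section \<open>One step of the implicit Euler scheme\<close>

lemma L1_fatou:
 fixes f :: "nat \<Rightarrow> 'b \<Rightarrow> real"
 assumes f: "\<And>i. integrable M (f i)" and b: "\<And>i. (\<integral>x. \<bar>f i x\<bar> \<partial>M) \<le> c"
  and lim: "AE x in M. (\<lambda>i. f i x) \<longlonglongrightarrow> g x" and [measurable]: "g \<in> borel_measurable M"
 shows "integrable M g" "(\<integral>x. \<bar>g x\<bar> \<partial>M) \<le> c"
proof -
 have [measurable]: "f i \<in> borel_measurable M" for i using f by auto
 have c: "c \<ge> 0" using order_trans[OF _ b[of 0]] by simp
 have "(\<integral>\<^sup>+x. ennreal \<bar>g x\<bar> \<partial>M) = (\<integral>\<^sup>+x. liminf (\<lambda>i. ennreal \<bar>f i x\<bar>) \<partial>M)"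
 proof (rule nn_integral_cong_AE)
  show "AE x in M. ennreal \<bar>g x\<bar> = liminf (\<lambda>i. ennreal \<bar>f i x\<bar>)"
   using lim
  proof eventually_elim
   case (elim x)
   hence "(\<lambda>i. ennreal \<bar>f i x\<bar>) \<longlonglongrightarrow> ennreal \<bar>g x\<bar>" by (intro tendsto_ennrealI tendsto_rabs)
   thus ?case by (intro lim_imp_Liminf[symmetric]) auto
  qed
 qed
 also have "\<dots> \<le> liminf (\<lambda>i. \<integral>\<^sup>+x. ennreal \<bar>f i x\<bar> \<partial>M)" by (rule nn_integral_liminf) simp
 also have "\<dots> \<le> ennreal c"
 proof -
  have "(\<integral>\<^sup>+x. ennreal \<bar>f i x\<bar> \<partial>M) \<le> ennreal c" for i
   using b[of i] f[of i] by (subst nn_integral_eq_integral) (auto intro: ennreal_leI)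
  thus ?thesis by (intro Liminf_le) auto
 qed
 finally have *: "(\<integral>\<^sup>+x. ennreal \<bar>g x\<bar> \<partial>M) \<le> ennreal c" .
 thus g: "integrable M g" by (intro integrableI_bounded) (auto intro: le_less_trans)
 have "ennreal (\<integral>x. \<bar>g x\<bar> \<partial>M) \<le> ennreal c" using * g by (subst (asm) nn_integral_eq_integral) auto
 thus "(\<integral>x. \<bar>g x\<bar> \<partial>M) \<le> c" using c by (simp add: ennreal_le_iff)
qed

locale pme = frac s n TA for s n :: real and TA :: "'a::euclidean_space itself" +
 fixes m :: real
 assumes m_gt: "1 < m"
begin

text \<open>The step is solved for w = v^m, so the nonlinearity is w^(1/m), whose slope is infinite
  at 0. Cutting it off by the line w/d makes w/d - \<open>beta d w\<close> nondecreasing, hence the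
  fixed point map monotone; d -> 0 restores the power.\<close>

definition beta :: "real \<Rightarrow> real \<Rightarrow> real" where "beta d w = min (w / d) (w powr (1 / m))"

definition gam :: "real \<Rightarrow> real \<Rightarrow> real" where "gam d w = w / d - beta d w"

lemma measurable_beta [measurable]: "beta d \<in> bm" unfolding beta_def by measurable
lemma measurable_gam [measurable]: "gam d \<in> bm" unfolding gam_def by measurable

lemma beta_nonneg: "d > 0 \<Longrightarrow> w \<ge> 0 \<Longrightarrow> 0 \<le> beta d w" by (simp add: beta_def)

lemma beta_antimono: "0 < d' \<Longrightarrow> d' \<le> d \<Longrightarrow> w \<ge> 0 \<Longrightarrow> beta d w \<le> beta d' w"
 unfolding beta_def by (intro min.mono divide_left_mono) auto

lemma gam_eq: "gam d w = max 0 (w / d - w powr (1 / m))" by (simp add: gam_def beta_def max_def min_def)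

lemma powr_inverse_split: "w > 0 \<Longrightarrow> w powr (1 / m) = w * w powr (1 / m - 1)"
 by (simp add: powr_diff)

text \<open>Where the difference is positive it is w (1/d - w^(1/m - 1)), a product of two positive
  factors that both increase with w because 1/m < 1.\<close>

lemma gam_mono:
 assumes d: "d > 0" and w: "0 \<le> w" "w \<le> w'"
 shows "gam d w \<le> gam d w'"
proof (cases "w / d - w powr (1 / m) > 0")
 case True
 hence w0: "w > 0" using w d by (cases "w = 0") auto
 have 1: "w / d - w powr (1 / m) = w * (1 / d - w powr (1 / m - 1))" using powr_inverse_split[OF w0] by (simp add: algebra_simps)
 have 2: "w' / d - w' powr (1 / m) = w' * (1 / d - w' powr (1 / m - 1))" using powr_inverse_split[of w'] w0 w by (simp add: algebra_simps)
 have p: "1 / d - w powr (1 / m - 1) > 0" using True w0 unfolding 1 by (simp add: zero_less_mult_iff)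
 have "w' powr (1 / m - 1) \<le> w powr (1 / m - 1)" using w0 w m_gt by (intro powr_mono2') auto
 hence "w * (1 / d - w powr (1 / m - 1)) \<le> w' * (1 / d - w' powr (1 / m - 1))" using p w by (intro mult_mono) auto
 thus ?thesis unfolding gam_eq 1 2 by linarith
qed (auto simp: gam_eq)

lemma gam_bounds: "0 \<le> gam d w" "d > 0 \<Longrightarrow> w \<ge> 0 \<Longrightarrow> gam d w \<le> w / d"
 by (simp_all add: gam_eq)

lemma beta_mono: "d > 0 \<Longrightarrow> 0 \<le> w \<Longrightarrow> w \<le> w' \<Longrightarrow> beta d w \<le> beta d w'"
 unfolding beta_def using m_gt by (intro min.mono divide_right_mono powr_mono2) auto

context
 fixes h M :: real and f :: "'a \<Rightarrow> real"
 assumes h: "h > 0" and M: "M > 0" and f: "Lint f" and f_bounds: "\<And>x. 0 \<le> f x" "\<And>x. f x \<le> M"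
begin

lemma measurable_step_f [measurable]: "f \<in> bm" by (rule Lint_measurable[OF f])

text \<open>The graph lies above its chord over [0, M^m], by concavity of the power and since d <=
  M^m / M for the line. It turns bounds on the integral of \<open>beta d w\<close> into bounds on
  that of w, uniformly in d.\<close>

lemma beta_bound:
 assumes d: "0 < d" "d \<le> M powr m / M" and w: "0 \<le> w" "w \<le> M powr m"
 shows "M / M powr m * w \<le> beta d w"
proof (cases "w = 0")
 case False
 hence w0: "w > 0" using w by simp
 have "1 / (M powr m / M) \<le> 1 / d" using d M by (intro divide_left_mono) auto
 hence 1: "M / M powr m * w \<le> w / d" using mult_right_mono[OF _ w(1)] by fastforce
 have "M / M powr m = (M powr m) powr (1 / m - 1)"
  using M m_gt by (simp add: powr_powr powr_diff algebra_simps)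
 also have "\<dots> \<le> w powr (1 / m - 1)" using w0 w m_gt by (intro powr_mono2') auto
 finally have "M / M powr m \<le> w powr (1 / m - 1)" .
 from mult_right_mono[OF this w(1)] have "M / M powr m * w \<le> w powr (1 / m)"
  using powr_inverse_split[OF w0] by (simp only: mult.commute)
 with 1 show ?thesis by (simp add: beta_def)
qed (simp add: beta_def)

lemma beta_top: "0 < d \<Longrightarrow> d \<le> M powr m / M \<Longrightarrow> beta d (M powr m) = M"
 using M m_gt by (simp add: beta_def powr_powr min_def field_simps)

definition rhs :: "real \<Rightarrow> ('a \<Rightarrow> real) \<Rightarrow> 'a \<Rightarrow> real" where
 "rhs d w x = (f x + gam d (w x)) / h"

lemma measurable_rhs [measurable]:
 assumes [measurable]: "w \<in> bm" shows "rhs d w \<in> bm"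
 unfolding rhs_def by measurable

text \<open>With \<open>\<mu> = 1 / (d h)\<close> the equation \<open>h (-\<Delta>)\<^sup>s w + beta d w = f\<close> reads \<open>w = K\<^sub>\<mu> * rhs d w\<close>,
 and \<open>rhs\<close> is increasing in \<open>w\<close>.\<close>

primrec iter :: "real \<Rightarrow> nat \<Rightarrow> 'a \<Rightarrow> real" where
 "iter d 0 = (\<lambda>x. 0)"
| "iter d (Suc i) = conv (K (1 / (d * h))) (rhs d (iter d i))"

lemma measurable_iter [measurable]: "iter d i \<in> bm"
 by (induction i) auto

context
 fixes d :: real assumes d: "0 < d" "d \<le> M powr m / M"
begin

lemma mu_pos: "1 / (d * h) > 0" using d h by simp

lemma rhs_mono: "0 \<le> w x \<Longrightarrow> w x \<le> w' x \<Longrightarrow> rhs d w x \<le> rhs d w' x"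
 unfolding rhs_def using gam_mono[OF d(1)] h by (intro divide_right_mono) auto

lemma rhs_nonneg: "0 \<le> rhs d w x"
 unfolding rhs_def using gam_bounds(1) h f_bounds by simp

text \<open>The constant M^m is a supersolution, as \<open>beta d (M powr m) = M\<close> dominates
  f. The kernel has mass d h, so convolving this bound gives back M^m and the iteration stays in
  [0, M^m].\<close>

lemma rhs_le:
 assumes "0 \<le> w x" "w x \<le> M powr m" shows "rhs d w x \<le> M powr m / (d * h)"
proof -
 have "f x + gam d (w x) \<le> M + gam d (M powr m)"
  using gam_mono[OF d(1) assms] f_bounds by (intro add_mono) auto
 also have "\<dots> = M powr m / d" using beta_top[OF d] by (simp add: gam_def)
 finally show ?thesis unfolding rhs_def using divide_right_mono[of _ _ h] h by fastforce
qed

lemma rhs_abs: "0 \<le> w x \<Longrightarrow> w x \<le> M powr m \<Longrightarrow> \<bar>rhs d w x\<bar> \<le> M powr m / (d * h)"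
 using rhs_nonneg rhs_le by (simp add: abs_of_nonneg)

lemma conv_rhs_integrable:
 assumes "\<And>x. 0 \<le> w x" "\<And>x. w x \<le> M powr m" and [measurable]: "w \<in> bm"
 shows "Lint (\<lambda>y. K (1 / (d * h)) (x - y) * rhs d w y)"
 by (rule integrable_conv_bounded[OF integrable_kern[OF mu_pos], where B="M powr m / (d * h)"])
   (auto intro!: rhs_abs assms)

lemma iter_bounds: "0 \<le> iter d i x \<and> iter d i x \<le> M powr m"
proof (induction i arbitrary: x)
 case (Suc i)
 have "0 \<le> conv (K (1 / (d * h))) (rhs d (iter d i)) x"
  unfolding conv_def by (intro integral_nonneg_AE AE_I2 mult_nonneg_nonneg kern_nonneg rhs_nonneg)
 moreover have "\<bar>conv (K (1 / (d * h))) (rhs d (iter d i)) x\<bar> \<le> M powr m / (d * h) * (LBINT x. \<bar>K (1 / (d * h)) x\<bar>)"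
  by (rule conv_bounded[OF integrable_kern[OF mu_pos]]) (use Suc in \<open>auto intro!: rhs_abs\<close>)
 ultimately show ?case using integral_kern[OF mu_pos] d h by (simp add: kern_nonneg)
qed simp

lemma conv_rhs_mono:
 assumes w: "\<And>x. 0 \<le> w x" "\<And>x. w x \<le> M powr m" and w': "\<And>x. 0 \<le> w' x" "\<And>x. w' x \<le> M powr m"
  and ae: "AE x in lborel. w x \<le> w' x" and [measurable]: "w \<in> bm" "w' \<in> bm"
 shows "conv (K (1 / (d * h))) (rhs d w) x \<le> conv (K (1 / (d * h))) (rhs d w') x"
 unfolding conv_def
proof (rule integral_mono_AE[OF conv_rhs_integrable conv_rhs_integrable])
 show "AE y in lborel. K (1 / (d * h)) (x - y) * rhs d w y \<le> K (1 / (d * h)) (x - y) * rhs d w' y"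
  using ae by eventually_elim (auto intro!: mult_left_mono kern_nonneg rhs_mono w)
qed (use w w' in auto)

lemma iter_mono: "iter d i x \<le> iter d (Suc i) x"
proof (induction i arbitrary: x)
 case 0 show ?case using iter_bounds[of "Suc 0" x] by simp
next
 case (Suc i)
 have "conv (K (1 / (d * h))) (rhs d (iter d i)) x \<le> conv (K (1 / (d * h))) (rhs d (iter d (Suc i))) x"
  by (rule conv_rhs_mono) (use iter_bounds[of i] iter_bounds[of "Suc i"] Suc in \<open>auto simp del: iter.simps\<close>)
 thus ?case by (simp only: iter.simps)
qed

lemma integrable_rhs:
 assumes w: "\<And>x. 0 \<le> w x" and I: "Lint w"
 shows "Lint (rhs d w)" "Lint (\<lambda>x. gam d (w x))" "Lint (\<lambda>x. beta d (w x))"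
proof -
 have [measurable]: "w \<in> bm" by (rule Lint_measurable[OF I])
 have I': "Lint (\<lambda>x. w x / d)" using I by simp
 show g: "Lint (\<lambda>x. gam d (w x))"
  by (rule integrable_bound[OF I'])
    (use gam_bounds d(1) w in \<open>auto simp: abs_of_nonneg intro!: AE_I2\<close>)
 show "Lint (\<lambda>x. beta d (w x))"
  using integrable_diff[OF I' g] by (simp add: gam_def)
 show "Lint (rhs d w)" unfolding rhs_def using f g by simp
qed

lemma iter_integrable: "Lint (iter d i)"
proof (induction i)
 case (Suc i)
 thus ?case using iter_bounds by (auto intro!: integrable_conv integrable_kern mu_pos integrable_rhs)
qed simp

lemma integral_conv_rhs:
 assumes w: "\<And>x. 0 \<le> w x" and I: "Lint w"
 shows "(LBINT x. conv (K (1 / (d * h))) (rhs d w) x) = d * (LBINT x. f x) + d * (LBINT x. gam d (w x))"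
proof -
 have "(LBINT x. conv (K (1 / (d * h))) (rhs d w) x) = d * h * (LBINT x. rhs d w x)"
  using integral_conv[OF integrable_kern[OF mu_pos] integrable_rhs(1)[OF w I]] integral_kern[OF mu_pos] by simp
 also have "(LBINT x. rhs d w x) = ((LBINT x. f x) + (LBINT x. gam d (w x))) / h"
  unfolding rhs_def using f integrable_rhs(2)[OF w I] by simp
 also have "d * h * (((LBINT x. f x) + (LBINT x. gam d (w x))) / h) = d * ((LBINT x. f x) + (LBINT x. gam d (w x)))"
  using h by simp
 finally show ?thesis by (simp only: distrib_left)
qed

text \<open>Integrating the recursion gives \<integral> w_(i+1) = d \<integral> f + d \<integral>
  \<open>gam d\<close> w_i. Monotonicity of the iterates allows w_(i+1) inside \<open>gam\<close>,
  so that \<integral> \<open>beta d\<close> w_(i+1) <= \<integral> f, and \<open>beta_bound\<close>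
  converts this into a bound uniform in i.\<close>

lemma integral_iter: "(LBINT x. \<bar>iter d i x\<bar>) \<le> M powr m / M * (LBINT x. f x)"
proof -
 have nn: "\<And>x. 0 \<le> iter d i x" for i using iter_bounds by blast
 note I = iter_integrable and R = integrable_rhs[OF nn iter_integrable]
 have main: "(LBINT x. beta d (iter d (Suc i) x)) \<le> (LBINT x. f x)" for i
 proof -
  have "(LBINT x. iter d (Suc i) x) = d * (LBINT x. f x) + d * (LBINT x. gam d (iter d i x))"
   using integral_conv_rhs[OF nn I, of i] by simp
  also have "\<dots> \<le> d * (LBINT x. f x) + d * (LBINT x. gam d (iter d (Suc i) x))"
   using d iter_mono iter_bounds by (intro add_left_mono mult_left_mono integral_mono R(2) gam_mono) auto
  also have "(LBINT x. gam d (iter d (Suc i) x)) = (LBINT x. iter d (Suc i) x / d) - (LBINT x. beta d (iter d (Suc i) x))"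
   unfolding gam_def using I[of "Suc i"] R(3)[of "Suc i"] by (intro integral_diff) auto
  finally have "d * (LBINT x. beta d (iter d (Suc i) x)) \<le> d * (LBINT x. f x)"
   using d(1) by (simp add: algebra_simps del: iter.simps)
  thus ?thesis using d(1) by simp
 qed
 have "(LBINT x. iter d (Suc i) x) \<le> M powr m / M * (LBINT x. f x)"
 proof -
  have "M / M powr m * (LBINT x. iter d (Suc i) x) = (LBINT x. M / M powr m * iter d (Suc i) x)" by simp
  also have "\<dots> \<le> (LBINT x. beta d (iter d (Suc i) x))"
  proof (rule integral_mono)
   show "Lint (\<lambda>x. M / M powr m * iter d (Suc i) x)" using I[of "Suc i"] by (intro integrable_mult_right)
   show "Lint (\<lambda>x. beta d (iter d (Suc i) x))" by (rule R(3))
   show "M / M powr m * iter d (Suc i) x \<le> beta d (iter d (Suc i) x)" for x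
    using iter_bounds[of "Suc i" x] by (intro beta_bound d) auto
  qed
  also note main
  finally show ?thesis using M by (simp add: field_simps del: iter.simps)
 qed
 moreover have "(LBINT x. iter d i x) \<le> (LBINT x. iter d (Suc i) x)"
  by (intro integral_mono I iter_mono)
 ultimately show ?thesis using nn by simp
qed

definition wd :: "'a \<Rightarrow> real" where "wd x = lim (\<lambda>i. iter d i x)"

lemma wd_lim: "(\<lambda>i. iter d i x) \<longlonglongrightarrow> wd x"
proof -
 have "incseq (\<lambda>i. iter d i x)" by (intro incseq_SucI iter_mono)
 moreover have "bdd_above (range (\<lambda>i. iter d i x))" using iter_bounds by (auto intro!: bdd_aboveI)
 ultimately show ?thesis unfolding wd_def convergent_LIMSEQ_iff[symmetric]
  using LIMSEQ_incseq_SUP convergentI by blast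
qed

lemma measurable_wd [measurable]: "wd \<in> bm"
 by (rule borel_measurable_LIMSEQ_real[OF wd_lim]) auto

lemma wd_bounds: "0 \<le> wd x" "wd x \<le> M powr m"
 using LIMSEQ_le_const[OF wd_lim] LIMSEQ_le_const2[OF wd_lim] iter_bounds by blast+

lemma wd_integrable: "Lint wd"
 by (rule L1_fatou(1)[OF iter_integrable integral_iter]) (auto intro!: wd_lim)

lemma continuous_gam: "w \<ge> 0 \<Longrightarrow> x \<longlonglongrightarrow> w \<Longrightarrow> (\<And>i. 0 \<le> x i) \<Longrightarrow> (\<lambda>i. gam d (x i)) \<longlonglongrightarrow> gam d w"
 unfolding gam_eq using d m_gt by (intro tendsto_intros tendsto_max tendsto_powr2) (auto simp: always_eventually)

lemma wd_eq: "wd x = conv (K (1 / (d * h))) (rhs d wd) x"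
proof -
 have "(\<lambda>i. conv (K (1 / (d * h))) (rhs d (iter d i)) x) \<longlonglongrightarrow> conv (K (1 / (d * h))) (rhs d wd) x"
  unfolding conv_def
 proof (rule integral_dominated_convergence[where w="\<lambda>y. M powr m / (d * h) * K (1 / (d * h)) (x - y)"])
  show "Lint (\<lambda>y. M powr m / (d * h) * K (1 / (d * h)) (x - y))"
   using integrable_lborel_reflect[OF integrable_kern[OF mu_pos]] by (intro integrable_mult_right)
  show "AE y in lborel. (\<lambda>i. K (1 / (d * h)) (x - y) * rhs d (iter d i) y) \<longlonglongrightarrow> K (1 / (d * h)) (x - y) * rhs d wd y"
   unfolding rhs_def using iter_bounds wd_bounds h by (intro AE_I2 tendsto_intros continuous_gam wd_lim) auto
  show "AE y in lborel. norm (K (1 / (d * h)) (x - y) * rhs d (iter d i) y) \<le> M powr m / (d * h) * K (1 / (d * h)) (x - y)" for i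
   using iter_bounds by (intro AE_I2) (simp add: abs_mult kern_nonneg mult.commute[of "M powr m / (d * h)"] mult_left_mono rhs_abs del: iter.simps times_divide_eq_left times_divide_eq_right)
 qed measurable
 hence "(\<lambda>i. iter d (Suc i) x) \<longlonglongrightarrow> conv (K (1 / (d * h))) (rhs d wd) x" by simp
 moreover have "(\<lambda>i. iter d (Suc i) x) \<longlonglongrightarrow> wd x" by (rule LIMSEQ_Suc[OF wd_lim])
 ultimately show ?thesis using LIMSEQ_unique by blast
qed

lemma wd_fpair: "fpair wd (\<lambda>x. (f x - beta d (wd x)) / h)"
proof -
 have "fpair wd (\<lambda>x. rhs d wd x - 1 / (d * h) * wd x)"
  by (rule resolvent_fpair[OF mu_pos integrable_rhs(1)[OF wd_bounds(1) wd_integrable] wd_integrable]) (use wd_eq in auto)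
 also have "(\<lambda>x. rhs d wd x - 1 / (d * h) * wd x) = (\<lambda>x. (f x - beta d (wd x)) / h)"
  using h d by (auto simp: rhs_def gam_def fun_eq_iff field_simps)
 finally show ?thesis .
qed

lemma integral_beta_wd: "(LBINT x. \<bar>beta d (wd x)\<bar>) \<le> (LBINT x. f x)"
proof -
 note R = integrable_rhs[OF wd_bounds(1) wd_integrable]
 have "(LBINT x. wd x) = (LBINT x. conv (K (1 / (d * h))) (rhs d wd) x)" using wd_eq by simp
 also have "\<dots> = d * (LBINT x. f x) + d * (LBINT x. gam d (wd x))"
  by (rule integral_conv_rhs[OF wd_bounds(1) wd_integrable])
 also have "(LBINT x. gam d (wd x)) = (LBINT x. wd x / d) - (LBINT x. beta d (wd x))"
  unfolding gam_def using wd_integrable R(3) by (intro integral_diff) auto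
 finally have "d * (LBINT x. beta d (wd x)) = d * (LBINT x. f x)" using d(1) by (simp add: algebra_simps)
 thus ?thesis using d(1) beta_nonneg[OF d(1) wd_bounds(1)] by simp
qed

end

text \<open>Since \<open>beta\<close> grows as d decreases, the solution for d is a supersolution
  for the smaller d'. The iteration for d' starts at 0 and is monotone, so it never rises above that
  supersolution.\<close>

lemma wd_antimono:
 assumes d: "0 < d" "d \<le> M powr m / M" and d': "0 < d'" "d' \<le> d"
 shows "AE x in lborel. wd d' x \<le> wd d x"
proof -
 have d2: "d' \<le> M powr m / M" using d d' by simp
 note wb = wd_bounds[OF d] and wb' = iter_bounds[OF d'(1) d2]
 note [measurable] = measurable_wd[OF d]
 let ?k = "K (1 / (d' * h))"
 have mu: "1 / (d' * h) > 0" using d' h by simp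
 have ev: "AE x in lborel. conv ?k (rhs d' (wd d)) x \<le> wd d x"
  using fpair_resolvent[OF mu wd_fpair[OF d]]
 proof eventually_elim
  case (elim x)
  have eq: "(\<lambda>x. (f x - beta d (wd d x)) / h + 1 / (d' * h) * wd d x) = (\<lambda>x. rhs d' (wd d) x + (beta d' (wd d x) - beta d (wd d x)) / h)"
   using h d' by (auto simp: rhs_def gam_def fun_eq_iff field_simps)
  have bd: "\<bar>(beta d' (wd d y) - beta d (wd d y)) / h\<bar> \<le> M / h" for y
  proof -
   have "beta d' (wd d y) \<le> M" using beta_mono[OF d'(1) wb] beta_top[OF d'(1) d2] by simp
   moreover have "beta d (wd d y) \<le> beta d' (wd d y)" using beta_antimono[OF d' wb(1)] .
   moreover have "0 \<le> beta d (wd d y)" using beta_nonneg[OF d(1) wb(1)] .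
   ultimately show ?thesis using h by (simp add: abs_div divide_right_mono)
  qed
  have I2: "Lint (\<lambda>y. ?k (x - y) * ((beta d' (wd d y) - beta d (wd d y)) / h))"
   by (rule integrable_conv_bounded[OF integrable_kern[OF mu] _ bd]) measurable
  have I1: "Lint (\<lambda>y. ?k (x - y) * rhs d' (wd d) y)"
   by (rule conv_rhs_integrable[OF d'(1) d2]) (use wb in auto)
  have "wd d x = conv ?k (rhs d' (wd d)) x + conv ?k (\<lambda>x. (beta d' (wd d x) - beta d (wd d x)) / h) x"
   using elim conv_diff[OF I1 I2, of 1 1] unfolding eq by simp
  moreover have "0 \<le> conv ?k (\<lambda>x. (beta d' (wd d x) - beta d (wd d x)) / h) x"
   unfolding conv_def using h beta_antimono[OF d' wb(1)] by (intro integral_nonneg_AE AE_I2 mult_nonneg_nonneg kern_nonneg divide_nonneg_nonneg) auto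
  ultimately show ?case by linarith
 qed
 have "AE x in lborel. iter d' i x \<le> wd d x" for i
 proof (induction i)
  case 0 show ?case using wb by simp
 next
  case (Suc i)
  have "iter d' (Suc i) x \<le> conv ?k (rhs d' (wd d)) x" for x
   unfolding iter.simps using wb wb' Suc by (intro conv_rhs_mono[OF d'(1) d2]) auto
  with ev show ?case by (auto elim!: eventually_mono intro: order_trans)
 qed
 hence "AE x in lborel. \<forall>i. iter d' i x \<le> wd d x" unfolding AE_all_countable by blast
 thus ?thesis by eventually_elim (auto intro: LIMSEQ_le_const2[OF wd_lim[OF d'(1) d2]])
qed

text \<open>The regularised solutions decrease as d -> 0. Their limit w is the m-th power of the
  step, because \<open>beta d\<close> of the approximations tends to w^(1/m).\<close>

lemma step_exists:
 "\<exists>v. Lint v \<and> (\<forall>x. 0 \<le> v x \<and> v x \<le> M) \<and> fpair (\<lambda>x. v x powr m) (\<lambda>x. (f x - v x) / h)"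
proof -
 \<comment> \<open>A sequence decreasing to 0 that starts at M^m / M, the largest value for which
   the bounds on [0, M^m] are available.\<close>
 define \<delta> where "\<delta> = (\<lambda>k. M powr m / M / real (Suc k))"
 have d: "0 < \<delta> k" "\<delta> k \<le> M powr m / M" for k
 proof -
  have x: "M powr m / M > 0" using M by simp
  show "0 < \<delta> k" unfolding \<delta>_def by (rule divide_pos_pos[OF x]) simp
  show "\<delta> k \<le> M powr m / M" unfolding \<delta>_def using divide_left_mono[of 1 "real (Suc k)" "M powr m / M"] x M by auto
 qed
 have dm: "\<delta> (Suc k) \<le> \<delta> k" for k unfolding \<delta>_def using M by (intro divide_left_mono) auto
 have dl: "\<delta> \<longlonglongrightarrow> 0" unfolding \<delta>_def by real_asymp
 define u where "u = (\<lambda>k. wd (\<delta> k))"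
 note [measurable] = measurable_wd[OF d]
 have [measurable]: "u k \<in> bm" for k unfolding u_def by measurable
 have ub: "0 \<le> u k x" "u k x \<le> M powr m" for k x using wd_bounds[OF d] by (auto simp: u_def)
 have bdd: "bdd_below (range (\<lambda>k. u k x))" for x using ub by (auto intro!: bdd_belowI)
 define w where "w = (\<lambda>x. INF k. u k x)"
 have [measurable]: "w \<in> bm" unfolding w_def
  by (rule borel_measurable_cINF) (use bdd in auto)
 have wb: "0 \<le> w x" "w x \<le> M powr m" for x
  using ub bdd unfolding w_def by (auto intro!: cINF_greatest cINF_lower2[where x=0])
 have wu: "w x \<le> u k x" for k x unfolding w_def using bdd by (intro cINF_lower) auto
 have "AE x in lborel. \<forall>k. u (Suc k) x \<le> u k x"
  unfolding AE_all_countable u_def using wd_antimono[OF d d(1) dm] by blast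
 hence ulim: "AE x in lborel. (\<lambda>k. u k x) \<longlonglongrightarrow> w x"
 proof eventually_elim
  case (elim x)
  show ?case unfolding w_def by (intro LIMSEQ_decseq_INF bdd decseq_SucI) (use elim in auto)
 qed
 define v where "v = (\<lambda>x. w x powr (1 / m))"
 have [measurable]: "v \<in> bm" unfolding v_def by measurable
 have vM: "0 \<le> v x" "v x \<le> M" for x
 proof -
  have "v x \<le> (M powr m) powr (1 / m)" unfolding v_def using wb m_gt by (intro powr_mono2) auto
  thus "v x \<le> M" using M m_gt by (simp add: powr_powr)
 qed (simp add: v_def)
 have vm: "v x powr m = w x" for x using wb m_gt by (cases "w x = 0") (auto simp: v_def powr_powr)
 have blim: "AE x in lborel. (\<lambda>k. beta (\<delta> k) (u k x)) \<longlonglongrightarrow> v x"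
  using ulim
 proof eventually_elim
  case (elim x)
  have p: "(\<lambda>k. u k x powr (1 / m)) \<longlonglongrightarrow> v x"
   unfolding v_def using ub m_gt by (intro tendsto_powr2 elim tendsto_const) auto
  show ?case
  proof (cases "w x = 0")
   case True
   hence "v x = 0" by (simp add: v_def)
   show ?thesis unfolding \<open>v x = 0\<close>
    by (rule tendsto_sandwich[OF _ _ tendsto_const p[unfolded \<open>v x = 0\<close>]])
      (use beta_nonneg[OF d(1) ub(1)] in \<open>auto simp: beta_def\<close>)
  next
   case False
   \<comment> \<open>As u_k >= w > 0, the power is the smaller branch of the minimum as soon as
     \<delta>_k < w^(1 - 1/m).\<close>
   hence w0: "w x > 0" using wb[of x] by simp
   have "\<forall>\<^sub>F k in sequentially. \<delta> k < w x powr (1 - 1 / m)"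
    using order_tendstoD(2)[OF dl, of "w x powr (1 - 1 / m)"] w0 by simp
   hence "\<forall>\<^sub>F k in sequentially. u k x powr (1 / m) = beta (\<delta> k) (u k x)"
   proof eventually_elim
    case (elim k)
    have u0: "u k x > 0" using wu[of x k] w0 by simp
    have "\<delta> k \<le> u k x powr (1 - 1 / m)"
     using elim powr_mono2[of "1 - 1 / m" "w x" "u k x"] wu[of x k] w0 m_gt by simp
    hence "u k x powr (1 / m) * \<delta> k \<le> u k x powr (1 / m) * u k x powr (1 - 1 / m)" by (intro mult_left_mono) auto
    also have "\<dots> = u k x" using u0 by (simp add: powr_add[symmetric])
    finally have "u k x powr (1 / m) \<le> u k x / \<delta> k" using d(1)[of k] by (simp add: field_simps)
    thus ?case by (simp add: beta_def)
   qed
   with p show ?thesis by (rule Lim_transform_eventually)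
  qed
 qed
 have vI: "Lint v"
  by (rule L1_fatou(1)[OF integrable_rhs(3)[OF d wd_bounds(1)[OF d] wd_integrable[OF d]] integral_beta_wd[OF d]])
    (use blim in \<open>auto simp: u_def\<close>)
 have wI: "Lint w"
  by (rule integrable_bound[OF wd_integrable[OF d[of 0]]])
    (use wb wu[of _ 0] ub in \<open>auto simp: u_def abs_of_nonneg intro!: AE_I2 order_trans[OF _ abs_ge_self]\<close>)
 \<comment> \<open>The natural resolvent parameter 1/(\<delta>_k h) diverges. Restating all
   equations with the fixed parameter 1 keeps one kernel and permits dominated convergence.\<close>
 have one: "(1::real) > 0" by simp
 have "AE x in lborel. \<forall>k. u k x = conv (K 1) (\<lambda>x. (f x - beta (\<delta> k) (u k x)) / h + 1 * u k x) x"
  unfolding AE_all_countable u_def using fpair_resolvent[OF one wd_fpair[OF d]] by blast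
 hence "AE x in lborel. w x = conv (K 1) (\<lambda>x. (f x - v x) / h + w x) x"
  using ulim
 proof eventually_elim
  case (elim x)
  have "(\<lambda>k. conv (K 1) (\<lambda>x. (f x - beta (\<delta> k) (u k x)) / h + 1 * u k x) x) \<longlonglongrightarrow> conv (K 1) (\<lambda>x. (f x - v x) / h + w x) x"
   unfolding conv_def
  proof (rule integral_dominated_convergence)
   show "Lint (\<lambda>y. (M / h + M powr m) * K 1 (x - y))"
    using integrable_lborel_reflect[OF integrable_kern[OF one]] by (intro integrable_mult_right)
   show "AE y in lborel. (\<lambda>k. K 1 (x - y) * ((f y - beta (\<delta> k) (u k y)) / h + 1 * u k y)) \<longlonglongrightarrow> K 1 (x - y) * ((f y - v y) / h + w y)"
    using ulim blim
   proof eventually_elim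
    case (elim y)
    have "(\<lambda>k. K 1 (x - y) * ((f y - beta (\<delta> k) (u k y)) / h + 1 * u k y)) \<longlonglongrightarrow> K 1 (x - y) * ((f y - v y) / h + 1 * w y)"
     using h by (intro tendsto_intros elim) auto
    thus ?case by simp
   qed
   show "AE y in lborel. norm (K 1 (x - y) * ((f y - beta (\<delta> k) (u k y)) / h + 1 * u k y)) \<le> (M / h + M powr m) * K 1 (x - y)" for k
   proof (rule AE_I2)
    fix y
    have "beta (\<delta> k) (u k y) \<le> M" using beta_mono[OF d(1) ub] beta_top[OF d] by simp
    moreover have "0 \<le> beta (\<delta> k) (u k y)" using beta_nonneg[OF d(1) ub(1)] .
    ultimately have "\<bar>f y - beta (\<delta> k) (u k y)\<bar> \<le> M" using f_bounds[of y] by (simp add: abs_le_iff)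
    hence "\<bar>(f y - beta (\<delta> k) (u k y)) / h\<bar> \<le> M / h" using h by (simp add: abs_div divide_right_mono)
    moreover have "\<bar>u k y\<bar> \<le> M powr m" using ub by (simp add: abs_of_nonneg)
    ultimately have "\<bar>(f y - beta (\<delta> k) (u k y)) / h + 1 * u k y\<bar> \<le> M / h + M powr m" by linarith
    thus "norm (K 1 (x - y) * ((f y - beta (\<delta> k) (u k y)) / h + 1 * u k y)) \<le> (M / h + M powr m) * K 1 (x - y)"
     by (simp add: abs_mult kern_nonneg mult.commute[of "M / h + M powr m"] mult_left_mono)
   qed
  qed measurable
  moreover have "(\<lambda>k. u k x) \<longlonglongrightarrow> w x" by (rule elim(2))
  ultimately show ?case using elim(1) LIMSEQ_unique by force
 qed
 hence "fpair w (\<lambda>x. ((f x - v x) / h + w x) - 1 * w x)"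
  by (intro resolvent_fpair[OF one _ wI]) (use f vI wI in auto)
 hence "fpair (\<lambda>x. v x powr m) (\<lambda>x. (f x - v x) / h)" by (simp add: vm)
 with vI vM show ?thesis by blast
qed

end

section \<open>Weighted contraction and accretivity of a step\<close>

lemma excessive_integrable:
 assumes ex: "excessive P" and f: "Lint f"
 shows "Lint (\<lambda>x. f x * P x)"
proof -
 obtain B where B: "\<And>x. P x \<le> B" "\<And>x. 0 \<le> P x" using ex by (auto simp: excessive_def)
 have [measurable]: "P \<in> bm" "f \<in> bm"
  using ex f by (auto simp: excessive_def intro: Lint_measurable)
 show ?thesis
 proof (rule integrable_bound)
  show "Lint (\<lambda>x. B * f x)" using f by simp
  have "B \<ge> 0" using B order_trans by blast
  thus "AE x in lborel. norm (f x * P x) \<le> norm (B * f x)"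
   using B by (intro AE_I2) (simp add: abs_mult mult.commute[of B] mult_left_mono)
 qed measurable
qed

text \<open>The difference of the two equations is tested with the indicator of v1 > v2 times the
  weight. The power is increasing, so this is also the set where v1^m - v2^m > 0, and
  \<open>fpair_accretive\<close> makes the operator term nonnegative. Stating it for a sub- and a
  supersolution lets it serve the Gaussian subsolutions as well.\<close>

lemma step_contraction:
 assumes p1: "fpair (\<lambda>x. v1 x powr m) g1" and p2: "fpair (\<lambda>x. v2 x powr m) g2"
  and v1: "Lint v1" "\<And>x. 0 \<le> v1 x" and v2: "Lint v2" "\<And>x. 0 \<le> v2 x"
  and f1: "Lint f1" and f2: "Lint f2" and h: "h \<ge> 0"
  and sub: "AE x in lborel. v1 x + h * g1 x \<le> f1 x" and super: "AE x in lborel. f2 x \<le> v2 x + h * g2 x"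
  and ex: "excessive P"
 shows "(LBINT x. max 0 (v1 x - v2 x) * P x) \<le> (LBINT x. max 0 (f1 x - f2 x) * P x)"
proof -
 note d = fpair_diff[OF p1 p2]
 have [measurable]: "P \<in> bm" using ex by (simp add: excessive_def)
 have nn: "0 \<le> P x" for x using ex by (simp add: excessive_def)
 have [measurable]: "v1 \<in> bm" "v2 \<in> bm" "f1 \<in> bm" "f2 \<in> bm"
  "g1 \<in> bm" "g2 \<in> bm"
  using v1 v2 f1 f2 fpairD[OF p1] fpairD[OF p2] by (auto intro: Lint_measurable)
 have iff: "0 < v1 x powr m - v2 x powr m \<longleftrightarrow> v2 x < v1 x" for x
  using powr_less_mono2[of m "v2 x" "v1 x"] powr_mono2[of m "v1 x" "v2 x"] v1(2)[of x] v2(2)[of x] m_gt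
  by (cases "v2 x < v1 x") auto
 define q where "q = (\<lambda>x. indicator {x. v2 x < v1 x} x * P x)"
 have [measurable]: "q \<in> bm" unfolding q_def by measurable
 have accr: "0 \<le> (LBINT x. (g1 x - g2 x) * q x)"
  using fpair_accretive[OF d ex] unfolding iff q_def .
 have Iq: "Lint (\<lambda>x. g x * q x)" if g: "Lint g" for g
 proof (rule integrable_bound[OF excessive_integrable[OF ex g]])
  have [measurable]: "g \<in> bm" using g by (auto intro: Lint_measurable)
  show "(\<lambda>x. g x * q x) \<in> borel_measurable lborel" by measurable
  show "AE x in lborel. norm (g x * q x) \<le> norm (g x * P x)" by (intro AE_I2) (auto simp: q_def indicator_def)
 qed
 have i12: "Lint (\<lambda>x. (v1 x - v2 x) * q x)" using v1 v2 by (intro Iq) auto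
 have ig: "Lint (\<lambda>x. (g1 x - g2 x) * q x)" using fpairD[OF p1] fpairD[OF p2] by (intro Iq) auto
 have "(LBINT x. max 0 (v1 x - v2 x) * P x) = (LBINT x. (v1 x - v2 x) * q x)"
  by (intro integral_cong) (auto simp: q_def indicator_def)
 also have "\<dots> \<le> (LBINT x. (v1 x - v2 x) * q x) + h * (LBINT x. (g1 x - g2 x) * q x)"
  using accr h by simp
 also have "\<dots> = (LBINT x. (v1 x - v2 x) * q x + h * ((g1 x - g2 x) * q x))"
  using i12 ig by simp
 also have "\<dots> \<le> (LBINT x. max 0 (f1 x - f2 x) * P x)"
 proof (rule integral_mono_AE)
  show "Lint (\<lambda>x. (v1 x - v2 x) * q x + h * ((g1 x - g2 x) * q x))" using i12 ig by simp
  show "Lint (\<lambda>x. max 0 (f1 x - f2 x) * P x)" using f1 f2 by (intro excessive_integrable ex) auto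
  show "AE x in lborel. (v1 x - v2 x) * q x + h * ((g1 x - g2 x) * q x) \<le> max 0 (f1 x - f2 x) * P x"
   using sub super
  proof eventually_elim
   case (elim x)
   have "(v1 x - v2 x) * q x + h * ((g1 x - g2 x) * q x) = ((v1 x + h * g1 x) - (v2 x + h * g2 x)) * q x"
    by (simp add: algebra_simps)
   also have "\<dots> \<le> max 0 (f1 x - f2 x) * P x"
   proof (cases "v2 x < v1 x")
    case True
    thus ?thesis using elim nn[of x] by (auto simp: q_def intro!: mult_right_mono)
   qed (simp add: q_def nn)
   finally show ?case .
  qed
 qed
 finally show ?thesis .
qed

lemma integral_abs_max:
 fixes f :: "'a \<Rightarrow> real"
 assumes "Lint f"
 shows "(LBINT x. \<bar>f x\<bar>) = (LBINT x. max 0 (f x)) + (LBINT x. max 0 (- f x))"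
proof -
 have "(LBINT x. \<bar>f x\<bar>) = (LBINT x. max 0 (f x) + max 0 (- f x))"
  by (intro integral_cong) auto
 thus ?thesis using assms by simp
qed

text \<open>Contraction with weight 1 in both directions, for the data v + h g. Here h is arbitrary
  and need not be the size of the step that produced g; \<open>aa_step\<close> depends on that
  freedom.\<close>

lemma step_accretive:
 assumes p1: "fpair (\<lambda>x. v1 x powr m) g1" and p2: "fpair (\<lambda>x. v2 x powr m) g2"
  and v1: "Lint v1" "\<And>x. 0 \<le> v1 x" and v2: "Lint v2" "\<And>x. 0 \<le> v2 x"
  and h: "h \<ge> 0"
 shows "(LBINT x. \<bar>v1 x - v2 x\<bar>) \<le> (LBINT x. \<bar>v1 x - v2 x + h * (g1 x - g2 x)\<bar>)"
proof -
 have I: "Lint (\<lambda>x. v1 x + h * g1 x)" "Lint (\<lambda>x. v2 x + h * g2 x)"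
  using v1 v2 fpairD[OF p1] fpairD[OF p2] by auto
 have c1: "(LBINT x. max 0 (v1 x - v2 x) * 1) \<le> (LBINT x. max 0 ((v1 x + h * g1 x) - (v2 x + h * g2 x)) * 1)"
  by (rule step_contraction[OF p1 p2 _ _ _ _ _ _ h _ _ excessive_one]) (use v1 v2 I in auto)
 have c2: "(LBINT x. max 0 (v2 x - v1 x) * 1) \<le> (LBINT x. max 0 ((v2 x + h * g2 x) - (v1 x + h * g1 x)) * 1)"
  by (rule step_contraction[OF p2 p1 _ _ _ _ _ _ h _ _ excessive_one]) (use v1 v2 I in auto)
 have e: "v1 x - v2 x + h * (g1 x - g2 x) = (v1 x + h * g1 x) - (v2 x + h * g2 x)" for x by (simp add: algebra_simps)
 have J: "Lint (\<lambda>x. v1 x - v2 x)" "Lint (\<lambda>x. (v1 x + h * g1 x) - (v2 x + h * g2 x))"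
  using v1 v2 I by auto
 show ?thesis unfolding e integral_abs_max[OF J(1)] integral_abs_max[OF J(2)] minus_diff_eq
  using c1 c2 by (simp only: mult_1_right add_mono)
qed

end

section \<open>Convergence of the implicit Euler scheme\<close>

abbreviation nL1 :: "('a::euclidean_space \<Rightarrow> real) \<Rightarrow> real" where
 "nL1 f \<equiv> (LBINT x. \<bar>f x\<bar>)"

lemma nL1_triangle:
 assumes "Lint (\<lambda>x. f x - g x)" "Lint (\<lambda>x. g x - k x)"
 shows "nL1 (\<lambda>x. f x - k x) \<le> nL1 (\<lambda>x. f x - g x) + nL1 (\<lambda>x. g x - k x)"
proof -
 have I: "Lint (\<lambda>x. f x - k x)"
  using integrable_add[OF assms] by simp
 have "nL1 (\<lambda>x. f x - k x) \<le> (LBINT x. \<bar>f x - g x\<bar> + \<bar>g x - k x\<bar>)"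
  using assms I by (intro integral_mono) auto
 thus ?thesis using assms by simp
qed

lemma AE_convergent_of_summable_L1:
 fixes f :: "nat \<Rightarrow> 'b \<Rightarrow> real"
 assumes f: "\<And>i. integrable M (f i)" and b: "\<And>i. (\<integral>x. \<bar>f (Suc i) x - f i x\<bar> \<partial>M) \<le> c i" and c: "summable c"
 shows "AE x in M. convergent (\<lambda>i. f i x)"
proof -
 have [measurable]: "f i \<in> borel_measurable M" for i using f by auto
 have c0: "c i \<ge> 0" for i using order_trans[OF _ b[of i]] by simp
 have "(\<integral>\<^sup>+x. (\<Sum>i. ennreal \<bar>f (Suc i) x - f i x\<bar>) \<partial>M) = (\<Sum>i. \<integral>\<^sup>+x. ennreal \<bar>f (Suc i) x - f i x\<bar> \<partial>M)"
  by (rule nn_integral_suminf) simp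
 also have "\<dots> \<le> (\<Sum>i. ennreal (c i))"
 proof (rule suminf_le)
  show "(\<integral>\<^sup>+x. ennreal \<bar>f (Suc i) x - f i x\<bar> \<partial>M) \<le> ennreal (c i)" for i
   using b[of i] f by (subst nn_integral_eq_integral) (auto intro: ennreal_leI)
 qed auto
 also have "\<dots> = ennreal (\<Sum>i. c i)" using c0 c by (rule suminf_ennreal2)
 finally have "(\<integral>\<^sup>+x. (\<Sum>i. ennreal \<bar>f (Suc i) x - f i x\<bar>) \<partial>M) \<noteq> \<infinity>" by (auto simp: top_unique)
 hence "AE x in M. (\<Sum>i. ennreal \<bar>f (Suc i) x - f i x\<bar>) \<noteq> \<infinity>" by (intro nn_integral_noteq_infinite) auto
 thus ?thesis
 proof eventually_elim
  case (elim x)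
  have "summable (\<lambda>i. \<bar>f (Suc i) x - f i x\<bar>)"
   by (rule summable_suminf_not_top) (use elim in auto)
  hence "summable (\<lambda>i. f (Suc i) x - f i x)" by (rule summable_rabs_cancel)
  hence "convergent (\<lambda>n. \<Sum>i<n. f (Suc i) x - f i x)" by (simp add: summable_iff_convergent)
  hence "convergent (\<lambda>n. f n x - f 0 x)" by (simp only: sum_lessThan_telescope[of "\<lambda>i. f i x"])
  hence "convergent (\<lambda>n. (f n x - f 0 x) + f 0 x)" by (intro convergent_add convergent_const)
  thus ?case by simp
 qed
qed

text \<open>For p + q = 1 and p h = q k the right-hand side is D (S + E): the terms linear in d
  cancel, which closes the induction of \<open>crandall_liggett_square\<close>.\<close>

lemma weighted_identity:
 fixes p q D d h k E S :: real
 shows "p * (D * (S - 2 * d * h + E)) + q * (D * (S + 2 * d * k + E)) = D * ((p + q) * (S + E) - 2 * d * (p * h - q * k))"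
 by algebra

context pme
begin

definition is_step :: "real \<Rightarrow> real \<Rightarrow> ('a \<Rightarrow> real) \<Rightarrow> ('a \<Rightarrow> real) \<Rightarrow> bool" where
 "is_step M h f v \<longleftrightarrow> Lint v \<and> (\<forall>x. 0 \<le> v x \<and> v x \<le> M) \<and> fpair (\<lambda>x. v x powr m) (\<lambda>x. (f x - v x) / h)"

primrec eul :: "real \<Rightarrow> ('a \<Rightarrow> real) \<Rightarrow> real \<Rightarrow> nat \<Rightarrow> 'a \<Rightarrow> real" where
 "eul M w h 0 = w"
| "eul M w h (Suc j) = (SOME v. is_step M h (eul M w h j) v)"

text \<open>A datum in the domain of the generator, so that the scheme converges at an explicit rate.\<close>

definition nice :: "real \<Rightarrow> ('a \<Rightarrow> real) \<Rightarrow> ('a \<Rightarrow> real) \<Rightarrow> bool" where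
 "nice M w g \<longleftrightarrow> M > 0 \<and> Lint w \<and> (\<forall>x. 0 \<le> w x \<and> w x \<le> M) \<and> fpair (\<lambda>x. w x powr m) g"

context
 fixes M :: real and w g :: "'a \<Rightarrow> real"
 assumes nice: "nice M w g"
begin

abbreviation V where "V \<equiv> eul M w"

lemma eul_basic: "h > 0 \<Longrightarrow> Lint (V h j) \<and> (\<forall>x. 0 \<le> V h j x \<and> V h j x \<le> M)"
proof (induction j)
 case 0 thus ?case using nice by (simp add: nice_def)
next
 case (Suc j)
 have "\<exists>v. is_step M h (V h j) v" unfolding is_step_def
  using Suc nice by (intro step_exists) (auto simp: nice_def)
 from someI_ex[OF this] show ?case by (simp add: is_step_def)
qed

lemma eul_step: "h > 0 \<Longrightarrow> is_step M h (V h j) (V h (Suc j))"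
proof -
 assume h: "h > 0"
 have "\<exists>v. is_step M h (V h j) v" unfolding is_step_def
  using eul_basic[OF h, of j] nice h by (intro step_exists) (auto simp: nice_def)
 from someI_ex[OF this] show ?thesis by simp
qed

lemma eul_integrable: "h > 0 \<Longrightarrow> Lint (V h j)" using eul_basic by blast
lemma eul_bounds: "h > 0 \<Longrightarrow> 0 \<le> V h j x" "h > 0 \<Longrightarrow> V h j x \<le> M" using eul_basic by blast+
lemma eul_fpair: "h > 0 \<Longrightarrow> fpair (\<lambda>x. V h (Suc j) x powr m) (\<lambda>x. (V h j x - V h (Suc j) x) / h)"
 using eul_step unfolding is_step_def by blast

definition D0 :: real where "D0 = nL1 g"

lemma D0_nonneg: "0 \<le> D0" by (simp add: D0_def)

text \<open>The datum w is itself a step of size h from w + h g, because w^m lies in the domain;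
  accretivity bounds the initial increment by h times the L1 norm of g. Each later increment is at
  most the preceding one, again by accretivity.\<close>

lemma eul_increment: "h > 0 \<Longrightarrow> nL1 (\<lambda>x. V h (Suc j) x - V h j x) \<le> h * D0"
proof (induction j)
 case 0
 have g: "fpair (\<lambda>x. w x powr m) g" "Lint g" and w: "Lint w" "\<And>x. 0 \<le> w x"
  using nice fpairD(2) by (auto simp: nice_def)
 have "nL1 (\<lambda>x. V h (Suc 0) x - w x) \<le> (LBINT x. \<bar>V h (Suc 0) x - w x + h * ((V h 0 x - V h (Suc 0) x) / h - g x)\<bar>)"
  by (rule step_accretive[OF eul_fpair[OF 0] g(1)]) (use eul_basic[OF 0] w 0 in \<open>auto simp del: eul.simps(2)\<close>)
 also have "\<dots> = (LBINT x. h * \<bar>g x\<bar>)"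
 proof (intro integral_cong refl)
  fix x
  have "h * ((V h 0 x - V h (Suc 0) x) / h - g x) = (w x - V h (Suc 0) x) - h * g x"
   using 0 by (simp add: right_diff_distrib[of h "_ / _"] del: eul.simps(2))
  thus "\<bar>V h (Suc 0) x - w x + h * ((V h 0 x - V h (Suc 0) x) / h - g x)\<bar> = h * \<bar>g x\<bar>"
   using 0 by (simp add: abs_mult del: eul.simps)
 qed
 finally show ?case by (simp add: D0_def)
next
 case (Suc j)
 have "nL1 (\<lambda>x. V h (Suc (Suc j)) x - V h (Suc j) x) \<le> (LBINT x. \<bar>V h (Suc (Suc j)) x - V h (Suc j) x + h * ((V h (Suc j) x - V h (Suc (Suc j)) x) / h - (V h j x - V h (Suc j) x) / h)\<bar>)"
  by (rule step_accretive[OF eul_fpair[OF Suc.prems] eul_fpair[OF Suc.prems]])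
    (use eul_basic[OF Suc.prems] Suc.prems in \<open>auto simp del: eul.simps\<close>)
 also have "\<dots> = nL1 (\<lambda>x. V h (Suc j) x - V h j x)"
 proof (intro integral_cong refl)
  fix x
  define a b c where "a = V h (Suc (Suc j)) x" and "b = V h (Suc j) x" and "c = V h j x"
  have "h * ((b - a) / h - (c - b) / h) = (b - a) - (c - b)"
   using Suc.prems by (simp add: right_diff_distrib[of h "_ / _"])
  thus "\<bar>V h (Suc (Suc j)) x - V h (Suc j) x + h * ((V h (Suc j) x - V h (Suc (Suc j)) x) / h - (V h j x - V h (Suc j) x) / h)\<bar> = \<bar>V h (Suc j) x - V h j x\<bar>"
   unfolding a_def[symmetric] b_def[symmetric] c_def[symmetric] by simp
 qed
 finally show ?case using Suc by simp
qed

lemma eul_from_start: "h > 0 \<Longrightarrow> nL1 (\<lambda>x. V h j x - w x) \<le> real j * h * D0"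
proof (induction j)
 case (Suc j)
 have "nL1 (\<lambda>x. V h (Suc j) x - w x) \<le> nL1 (\<lambda>x. V h (Suc j) x - V h j x) + nL1 (\<lambda>x. V h j x - w x)"
  using eul_integrable[OF Suc.prems] eul_integrable[OF Suc.prems, of 0]
  by (intro nL1_triangle) (auto simp del: eul.simps(2))
 thus ?case using Suc.IH[OF Suc.prems] eul_increment[OF Suc.prems, of j] by (simp add: algebra_simps del: eul.simps)
qed simp

text \<open>The Crandall-Liggett matrix: distances between iterates of the schemes with steps h and
  k.\<close>

definition aa :: "real \<Rightarrow> real \<Rightarrow> nat \<Rightarrow> nat \<Rightarrow> real" where
 "aa h k i j = nL1 (\<lambda>x. V h i x - V k j x)"

lemma aa_nonneg: "0 \<le> aa h k i j" by (simp add: aa_def)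

text \<open>Accretivity with an intermediate step \<sigma>: moving each iterate back by \<sigma>
  along its discrete generator gives a convex combination of it and its predecessor, and the two
  combinations regroup into the two neighbouring differences.\<close>

lemma aa_step:
 assumes h: "h > 0" and k: "k > 0"
 shows "aa h k (Suc i) (Suc j) \<le> k / (h + k) * aa h k i (Suc j) + h / (h + k) * aa h k (Suc i) j"
proof -
 \<comment> \<open>Chosen so that \<sigma>/h and \<sigma>/k add up to 1; the terms containing both
   new iterates then cancel.\<close>
 define \<sigma> where "\<sigma> = h * k / (h + k)"
 have \<sigma>: "\<sigma> \<ge> 0" "\<sigma> / h = k / (h + k)" "\<sigma> / k = h / (h + k)" using h k by (auto simp: \<sigma>_def)
 have sum1: "1 - k / (h + k) = h / (h + k)" "1 - h / (h + k) = k / (h + k)" using h k by (auto simp: field_simps)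
 note IV = eul_integrable[OF h] eul_integrable[OF k]
 have "aa h k (Suc i) (Suc j) \<le> (LBINT x. \<bar>V h (Suc i) x - V k (Suc j) x + \<sigma> * ((V h i x - V h (Suc i) x) / h - (V k j x - V k (Suc j) x) / k)\<bar>)"
  unfolding aa_def by (rule step_accretive[OF eul_fpair[OF h] eul_fpair[OF k]])
   (use eul_basic[OF h] eul_basic[OF k] \<sigma> in \<open>auto simp del: eul.simps\<close>)
 also have "\<dots> \<le> (LBINT x. k / (h + k) * \<bar>V h i x - V k (Suc j) x\<bar> + h / (h + k) * \<bar>V h (Suc i) x - V k j x\<bar>)"
 proof (rule integral_mono)
  show "Lint (\<lambda>x. \<bar>V h (Suc i) x - V k (Suc j) x + \<sigma> * ((V h i x - V h (Suc i) x) / h - (V k j x - V k (Suc j) x) / k)\<bar>)"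
   using IV[of i] IV[of "Suc i"] IV[of j] IV[of "Suc j"] by (auto simp del: eul.simps)
  show "Lint (\<lambda>x. k / (h + k) * \<bar>V h i x - V k (Suc j) x\<bar> + h / (h + k) * \<bar>V h (Suc i) x - V k j x\<bar>)"
   using IV[of i] IV[of "Suc i"] IV[of j] IV[of "Suc j"] by (auto simp del: eul.simps)
  fix x
  have "V h (Suc i) x - V k (Suc j) x + \<sigma> * ((V h i x - V h (Suc i) x) / h - (V k j x - V k (Suc j) x) / k)
    = (1 - \<sigma> / h) * V h (Suc i) x + \<sigma> / h * V h i x - (1 - \<sigma> / k) * V k (Suc j) x - \<sigma> / k * V k j x"
   by (simp add: algebra_simps diff_divide_distrib del: eul.simps)
  also have "\<dots> = k / (h + k) * (V h i x - V k (Suc j) x) + h / (h + k) * (V h (Suc i) x - V k j x)"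
   unfolding \<sigma> sum1 by (simp add: algebra_simps del: eul.simps)
  finally have e: "V h (Suc i) x - V k (Suc j) x + \<sigma> * ((V h i x - V h (Suc i) x) / h - (V k j x - V k (Suc j) x) / k)
    = k / (h + k) * (V h i x - V k (Suc j) x) + h / (h + k) * (V h (Suc i) x - V k j x)" .
  have "\<bar>k / (h + k) * (V h i x - V k (Suc j) x) + h / (h + k) * (V h (Suc i) x - V k j x)\<bar> \<le> \<bar>k / (h + k) * (V h i x - V k (Suc j) x)\<bar> + \<bar>h / (h + k) * (V h (Suc i) x - V k j x)\<bar>"
   by (rule abs_triangle_ineq)
  also have "\<dots> = k / (h + k) * \<bar>V h i x - V k (Suc j) x\<bar> + h / (h + k) * \<bar>V h (Suc i) x - V k j x\<bar>"
   using h k by (simp add: abs_mult del: eul.simps)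
  finally show "\<bar>V h (Suc i) x - V k (Suc j) x + \<sigma> * ((V h i x - V h (Suc i) x) / h - (V k j x - V k (Suc j) x) / k)\<bar> \<le> k / (h + k) * \<bar>V h i x - V k (Suc j) x\<bar> + h / (h + k) * \<bar>V h (Suc i) x - V k j x\<bar>"
   unfolding e .
 qed
 also have "\<dots> = k / (h + k) * aa h k i (Suc j) + h / (h + k) * aa h k (Suc i) j"
  unfolding aa_def using IV[of i] IV[of "Suc i"] IV[of j] IV[of "Suc j"] by (simp del: eul.simps)
 finally show ?thesis .
qed

section \<open>The Crandall-Liggett estimate and its rate\<close>

lemma convex_square:
 fixes p q x y :: real
 assumes "0 \<le> p" "0 \<le> q" "p + q = 1"
 shows "(p * x + q * y)\<^sup>2 \<le> p * x\<^sup>2 + q * y\<^sup>2"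
proof -
 have q: "q = 1 - p" using assms by simp
 have "p * x\<^sup>2 + q * y\<^sup>2 - (p * x + q * y)\<^sup>2 = p * q * (x - y)\<^sup>2"
  unfolding q by (simp add: power2_eq_square algebra_simps)
 moreover have "0 \<le> p * q * (x - y)\<^sup>2" using assms by simp
 ultimately show ?thesis by linarith
qed

text \<open>Squares are kept because the recursion then needs only convexity of x^2. The average
  over the two neighbours displaces d = i h - j k by - p h + q k = 0 in the mean, and the variance p
  h^2 + q k^2 is exactly what i h^2 + j k^2 loses on average.\<close>

lemma crandall_liggett_square:
 assumes h: "h > 0" and k: "k > 0"
 shows "(aa h k i j)\<^sup>2 \<le> D0\<^sup>2 * ((real i * h - real j * k)\<^sup>2 + real i * h\<^sup>2 + real j * k\<^sup>2)"
proof (induction "i + j" arbitrary: i j rule: less_induct)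
 case less
 show ?case
 proof (cases i)
  case 0
  \<comment> \<open>On the edges i = 0 and j = 0 one scheme still sits at the datum and
    \<open>eul_from_start\<close> bounds the other.\<close>
  have "aa h k 0 j = nL1 (\<lambda>x. V k j x - w x)" unfolding aa_def by (simp add: abs_minus_commute)
  hence "aa h k 0 j \<le> real j * k * D0" using eul_from_start[OF k, of j] by simp
  hence "(aa h k 0 j)\<^sup>2 \<le> (real j * k * D0)\<^sup>2" using aa_nonneg by (intro power_mono)
  also have "\<dots> = D0\<^sup>2 * (real j * k)\<^sup>2" by (simp add: power_mult_distrib mult_ac)
  also have "\<dots> \<le> D0\<^sup>2 * ((real i * h - real j * k)\<^sup>2 + real i * h\<^sup>2 + real j * k\<^sup>2)"
   using 0 by (intro mult_left_mono) (auto simp: power_mult_distrib)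
  finally show ?thesis using 0 by simp
 next
  case i: (Suc i')
  show ?thesis
  proof (cases j)
   case 0
   have "aa h k i 0 \<le> real i * h * D0" using eul_from_start[OF h, of i] by (simp add: aa_def)
   hence "(aa h k i 0)\<^sup>2 \<le> (real i * h * D0)\<^sup>2" using aa_nonneg by (intro power_mono)
   also have "\<dots> = D0\<^sup>2 * (real i * h)\<^sup>2" by (simp add: power_mult_distrib mult_ac)
   also have "\<dots> \<le> D0\<^sup>2 * ((real i * h - real j * k)\<^sup>2 + real i * h\<^sup>2 + real j * k\<^sup>2)"
    using 0 by (intro mult_left_mono) (auto simp: power_mult_distrib)
   finally show ?thesis using 0 by simp
  next
   case j: (Suc j')
   define p q where "p = k / (h + k)" and "q = h / (h + k)"
   have pq: "0 \<le> p" "0 \<le> q" "p + q = 1" using h k by (auto simp: p_def q_def add_divide_distrib[symmetric])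
   have ph: "p * h = q * k" by (simp add: p_def q_def)
   define d where "d = real i * h - real j * k"
   have 1: "(aa h k i' j)\<^sup>2 \<le> D0\<^sup>2 * ((d - h)\<^sup>2 + (real i - 1) * h\<^sup>2 + real j * k\<^sup>2)"
    using less[of i' j] i by (simp add: d_def algebra_simps)
   have 2: "(aa h k i j')\<^sup>2 \<le> D0\<^sup>2 * ((d + k)\<^sup>2 + real i * h\<^sup>2 + (real j - 1) * k\<^sup>2)"
    using less[of i j'] j by (simp add: d_def algebra_simps)
   have "aa h k i j \<le> p * aa h k i' j + q * aa h k i j'"
    using aa_step[OF h k, of i' j'] unfolding i j p_def q_def .
   hence "(aa h k i j)\<^sup>2 \<le> (p * aa h k i' j + q * aa h k i j')\<^sup>2" using aa_nonneg by (intro power_mono)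
   also have "\<dots> \<le> p * (aa h k i' j)\<^sup>2 + q * (aa h k i j')\<^sup>2" by (rule convex_square[OF pq])
   also have "\<dots> \<le> p * (D0\<^sup>2 * ((d - h)\<^sup>2 + (real i - 1) * h\<^sup>2 + real j * k\<^sup>2)) + q * (D0\<^sup>2 * ((d + k)\<^sup>2 + real i * h\<^sup>2 + (real j - 1) * k\<^sup>2))"
    using pq by (intro add_mono mult_left_mono 1 2)
   also have "\<dots> = D0\<^sup>2 * (d\<^sup>2 + real i * h\<^sup>2 + real j * k\<^sup>2)"
   proof -
    define E where "E = real i * h\<^sup>2 + real j * k\<^sup>2"
    have X: "(d - h)\<^sup>2 + (real i - 1) * h\<^sup>2 + real j * k\<^sup>2 = d\<^sup>2 - 2 * d * h + E"
     by (simp add: E_def power2_diff left_diff_distrib)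
    have Y: "(d + k)\<^sup>2 + real i * h\<^sup>2 + (real j - 1) * k\<^sup>2 = d\<^sup>2 + 2 * d * k + E"
     by (simp add: E_def power2_sum left_diff_distrib)
    have "p * (D0\<^sup>2 * (d\<^sup>2 - 2 * d * h + E)) + q * (D0\<^sup>2 * (d\<^sup>2 + 2 * d * k + E)) =
      D0\<^sup>2 * ((p + q) * (d\<^sup>2 + E) - 2 * d * (p * h - q * k))"
     by (rule weighted_identity)
    also have "\<dots> = D0\<^sup>2 * (d\<^sup>2 + E)" unfolding pq ph by simp
    finally show ?thesis unfolding X Y by (simp add: E_def)
   qed
   finally show ?thesis by (simp add: d_def)
  qed
 qed
qed

lemma crandall_liggett:
 assumes h: "h > 0" and k: "k > 0" and b: "(real i * h - real j * k)\<^sup>2 + real i * h\<^sup>2 + real j * k\<^sup>2 \<le> r\<^sup>2" and r: "r \<ge> 0"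
 shows "aa h k i j \<le> D0 * r"
proof -
 define A where "A = aa h k i j"
 have "A\<^sup>2 \<le> D0\<^sup>2 * ((real i * h - real j * k)\<^sup>2 + real i * h\<^sup>2 + real j * k\<^sup>2)"
  unfolding A_def by (rule crandall_liggett_square[OF h k])
 also have "\<dots> \<le> D0\<^sup>2 * r\<^sup>2" by (rule mult_left_mono[OF b zero_le_power2])
 finally have "A\<^sup>2 \<le> (D0 * r)\<^sup>2" by (simp only: power_mult_distrib)
 thus ?thesis unfolding A_def[symmetric] by (rule power2_le_imp_le) (rule mult_nonneg_nonneg[OF D0_nonneg r])
qed

text \<open>The index whose interval ((j - 1) h, j h] contains t > 0, in agreement with the step
  function of \<open>mild_solution\<close>.\<close>

definition ix :: "real \<Rightarrow> real \<Rightarrow> nat" where "ix h t = nat \<lceil>t / h\<rceil>"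

lemma ix_bounds:
 assumes "h > 0" "t \<ge> 0"
 shows "t \<le> real (ix h t) * h" "real (ix h t) * h \<le> t + h"
proof -
 have 0: "0 \<le> t / h" using assms by simp
 have e: "real (ix h t) = of_int \<lceil>t / h\<rceil>" unfolding ix_def using 0 by (simp add: ceiling_mono order_trans[of 0 "\<lceil>0\<rceil>"])
 have "t / h \<le> of_int \<lceil>t / h\<rceil>" by (rule le_of_int_ceiling)
 from mult_right_mono[OF this, of h] show "t \<le> real (ix h t) * h" using assms by (simp add: e)
 have "of_int \<lceil>t / h\<rceil> \<le> t / h + 1" using ceiling_correct[of "t / h"] by linarith
 from mult_right_mono[OF this, of h] show "real (ix h t) * h \<le> t + h" using assms by (simp add: e algebra_simps)
qed

text \<open>Both discrete times overshoot t, by at most h and k <= h, so they differ by at most h.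
  The three terms under the root add up to at most h^2 + 2 (t + h) h = h (3 h + 2 t).\<close>

lemma aa_ix:
 assumes h: "h > 0" and k: "k > 0" "k \<le> h" and t: "t \<ge> 0"
 shows "aa h k (ix h t) (ix k t) \<le> D0 * sqrt (h * (3 * h + 2 * t))"
proof (rule crandall_liggett[OF h k(1)])
 note a = ix_bounds[OF h t] and b = ix_bounds[OF k(1) t]
 define A B where "A = real (ix h t) * h" and "B = real (ix k t) * k"
 have "\<bar>A - B\<bar> \<le> h" using a b k by (simp add: A_def B_def abs_le_iff)
 hence 1: "(A - B)\<^sup>2 \<le> h\<^sup>2" using power_mono[of "\<bar>A - B\<bar>" h 2] by simp
 have 2: "real (ix h t) * h\<^sup>2 \<le> (t + h) * h" using mult_right_mono[OF a(2), of h] h by (simp add: power2_eq_square mult.assoc)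
 have "real (ix k t) * k\<^sup>2 \<le> (t + k) * k" using mult_right_mono[OF b(2), of k] k by (simp add: power2_eq_square mult.assoc)
 also have "\<dots> \<le> (t + h) * h" using k t h by (intro mult_mono) auto
 finally have 3: "real (ix k t) * k\<^sup>2 \<le> (t + h) * h" .
 have "(A - B)\<^sup>2 + real (ix h t) * h\<^sup>2 + real (ix k t) * k\<^sup>2 \<le> h\<^sup>2 + (t + h) * h + (t + h) * h"
  using 1 2 3 by (intro add_mono)
 also have "\<dots> = h * (3 * h + 2 * t)" by (simp add: power2_eq_square algebra_simps)
 finally show "(real (ix h t) * h - real (ix k t) * k)\<^sup>2 + real (ix h t) * h\<^sup>2 + real (ix k t) * k\<^sup>2 \<le> (sqrt (h * (3 * h + 2 * t)))\<^sup>2"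
  using h t by (simp add: A_def B_def)
qed (use h t in simp)

text \<open>The root of the step size enters the rate; powers of 1/4 make it 2^(-k), which is
  summable and gives convergence almost everywhere of the whole sequence.\<close>

definition hk :: "nat \<Rightarrow> real" where "hk k = (1 / 4) ^ k"

lemma hk_pos: "hk k > 0" by (simp add: hk_def)
lemma hk_mono: "i \<le> j \<Longrightarrow> hk j \<le> hk i" unfolding hk_def by (intro power_decreasing) auto
lemma hk_le_1: "hk k \<le> 1" unfolding hk_def by (intro power_le_one) auto
lemma hk_lim: "hk \<longlonglongrightarrow> 0" unfolding hk_def by (intro LIMSEQ_power_zero) auto

definition Vk :: "nat \<Rightarrow> real \<Rightarrow> 'a \<Rightarrow> real" where "Vk k t = V (hk k) (ix (hk k) t)"

text \<open>Clipping to [0, M] makes the bounds hold at every point, also on the null set where the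
  limit fails to exist; elsewhere it changes nothing.\<close>

definition mild :: "real \<Rightarrow> 'a \<Rightarrow> real" where "mild t x = max 0 (min M (lim (\<lambda>k. Vk k t x)))"

lemma Vk_integrable: "Lint (Vk k t)" unfolding Vk_def by (rule eul_integrable[OF hk_pos])

lemma Vk_bounds: "0 \<le> Vk k t x" "Vk k t x \<le> M" unfolding Vk_def by (auto intro: eul_bounds hk_pos)

lemma Vk_cauchy:
 assumes t: "t \<ge> 0" and ij: "i \<le> j"
 shows "nL1 (\<lambda>x. Vk i t x - Vk j t x) \<le> D0 * sqrt (3 + 2 * t) * (1 / 2) ^ i"
proof -
 have "nL1 (\<lambda>x. Vk i t x - Vk j t x) = aa (hk i) (hk j) (ix (hk i) t) (ix (hk j) t)"
  by (simp add: aa_def Vk_def)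
 also have "\<dots> \<le> D0 * sqrt (hk i * (3 * hk i + 2 * t))"
  by (rule aa_ix[OF hk_pos hk_pos hk_mono[OF ij] t])
 also have "\<dots> \<le> D0 * sqrt (hk i * (3 + 2 * t))"
  using D0_nonneg hk_pos[of i] hk_le_1[of i] by (intro mult_left_mono real_sqrt_le_mono) auto
 also have "\<dots> = D0 * sqrt (3 + 2 * t) * sqrt (hk i)" by (simp add: real_sqrt_mult)
 also have "sqrt (hk i) = (1 / 2) ^ i" by (simp add: hk_def real_sqrt_power real_sqrt_divide)
 finally show ?thesis .
qed

lemma Vk_tendsto:
 assumes t: "t \<ge> 0"
 shows "AE x in lborel. (\<lambda>k. Vk k t x) \<longlonglongrightarrow> mild t x"
proof -
 have "AE x in lborel. convergent (\<lambda>k. Vk k t x)"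
 proof (rule AE_convergent_of_summable_L1[OF Vk_integrable])
  show "(LBINT x. \<bar>Vk (Suc i) t x - Vk i t x\<bar>) \<le> D0 * sqrt (3 + 2 * t) * (1 / 2) ^ i" for i
   using Vk_cauchy[OF t, of i "Suc i"] by (simp add: abs_minus_commute)
  show "summable (\<lambda>i. D0 * sqrt (3 + 2 * t) * (1 / 2) ^ i)"
   by (intro summable_mult summable_geometric) auto
 qed
 thus ?thesis
 proof eventually_elim
  case (elim x)
  hence l: "(\<lambda>k. Vk k t x) \<longlonglongrightarrow> lim (\<lambda>k. Vk k t x)" by (simp add: convergent_LIMSEQ_iff)
  have "0 \<le> lim (\<lambda>k. Vk k t x)" by (rule LIMSEQ_le_const[OF l]) (auto simp: Vk_bounds)
  moreover have "lim (\<lambda>k. Vk k t x) \<le> M" by (rule LIMSEQ_le_const2[OF l]) (auto simp: Vk_bounds)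
  ultimately have "mild t x = lim (\<lambda>k. Vk k t x)" by (simp add: mild_def)
  with l show ?case by simp
 qed
qed

lemma measurable_Vk: "(\<lambda>(t, x). Vk k t x) \<in> borel_measurable (borel \<Otimes>\<^sub>M borel)"
proof -
 have [measurable]: "V (hk k) j \<in> bm" for j
  by (rule Lint_measurable[OF eul_integrable[OF hk_pos]])
 have "(\<lambda>p. V (hk k) (ix (hk k) (fst p)) (snd p)) \<in> borel_measurable (borel \<Otimes>\<^sub>M borel)"
 proof (rule measurable_compose_countable[where f="\<lambda>j p. V (hk k) j (snd p)" and g="\<lambda>p. ix (hk k) (fst p)"])
  show "(\<lambda>p. V (hk k) j (snd p)) \<in> borel_measurable (borel \<Otimes>\<^sub>M borel)" for j by measurable
  show "(\<lambda>p. ix (hk k) (fst p)) \<in> measurable (borel \<Otimes>\<^sub>M borel) (count_space UNIV)"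
   unfolding ix_def by measurable
 qed
 thus ?thesis by (simp add: Vk_def case_prod_beta')
qed

lemma measurable_mild: "(\<lambda>(t, x). mild t x) \<in> borel_measurable (borel \<Otimes>\<^sub>M borel)"
proof -
 have [measurable]: "(\<lambda>p. Vk k (fst p) (snd p)) \<in> borel_measurable (borel \<Otimes>\<^sub>M borel)" for k
  using measurable_Vk by (simp add: case_prod_beta')
 show ?thesis unfolding mild_def case_prod_beta' by measurable
qed

lemma measurable_mild_slice [measurable]: "mild t \<in> bm"
 using measurable_Pair_compose_split[OF measurable_mild, of "\<lambda>_. t" borel "\<lambda>x. x"] by simp

lemma mild_bounds: "0 \<le> mild t x" "mild t x \<le> M"
 using nice by (auto simp: mild_def nice_def)

text \<open>\<open>aa_ix\<close> compares step h with all finer steps 4^(-k), and Fatou passes to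
  the limit in k. The rate therefore holds for every step size, although the solution was built
  along one sequence.\<close>

lemma eul_mild:
 assumes t: "t \<ge> 0" and h: "h > 0"
 shows "Lint (\<lambda>x. V h (ix h t) x - mild t x)"
  and "nL1 (\<lambda>x. V h (ix h t) x - mild t x) \<le> D0 * sqrt (h * (3 * h + 2 * t))"
proof -
 obtain N where N: "\<And>k. k \<ge> N \<Longrightarrow> hk k \<le> h"
  using order_tendstoD(2)[OF hk_lim h] by (auto simp: eventually_sequentially intro: less_imp_le)
 have f: "Lint (\<lambda>x. V h (ix h t) x - Vk (k + N) t x)" for k
  using eul_integrable[OF h] Vk_integrable by auto
 have b: "nL1 (\<lambda>x. V h (ix h t) x - Vk (k + N) t x) \<le> D0 * sqrt (h * (3 * h + 2 * t))" for k
  using aa_ix[OF h hk_pos N t, of "k + N"] by (simp add: aa_def Vk_def)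
 have l: "AE x in lborel. (\<lambda>k. V h (ix h t) x - Vk (k + N) t x) \<longlonglongrightarrow> V h (ix h t) x - mild t x"
  using Vk_tendsto[OF t] by eventually_elim (intro tendsto_intros LIMSEQ_ignore_initial_segment)
 have [measurable]: "V h (ix h t) \<in> bm" by (rule Lint_measurable[OF eul_integrable[OF h]])
 have mm: "(\<lambda>x. V h (ix h t) x - mild t x) \<in> borel_measurable lborel" by measurable
 show "Lint (\<lambda>x. V h (ix h t) x - mild t x)" "nL1 (\<lambda>x. V h (ix h t) x - mild t x) \<le> D0 * sqrt (h * (3 * h + 2 * t))"
  by (rule L1_fatou[OF f b l mm])+
qed

lemma mild_integrable: "t \<ge> 0 \<Longrightarrow> Lint (mild t)"
 using integrable_diff[OF eul_integrable[of 1 "ix 1 t"] eul_mild(1)[of t 1]] by simp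

lemma Vk_mild: "t \<ge> 0 \<Longrightarrow> (\<lambda>k. nL1 (\<lambda>x. Vk k t x - mild t x)) \<longlonglongrightarrow> 0"
proof (rule tendsto_sandwich[where f="\<lambda>_. 0" and h="\<lambda>k. D0 * sqrt (hk k * (3 * hk k + 2 * t))"])
 assume t: "t \<ge> 0"
 show "\<forall>\<^sub>F k in sequentially. nL1 (\<lambda>x. Vk k t x - mild t x) \<le> D0 * sqrt (hk k * (3 * hk k + 2 * t))"
  using eul_mild(2)[OF t hk_pos] by (simp add: Vk_def)
 have "(\<lambda>k. D0 * sqrt (hk k * (3 * hk k + 2 * t))) \<longlonglongrightarrow> D0 * sqrt (0 * (3 * 0 + 2 * t))"
  by (intro tendsto_intros hk_lim)
 thus "(\<lambda>k. D0 * sqrt (hk k * (3 * hk k + 2 * t))) \<longlonglongrightarrow> 0" by simp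
qed auto

text \<open>\<open>crandall_liggett\<close> for equal step sizes at the two indices: the discrete
  times differ by at most |t - r| + 2 h, and the remaining terms under the root vanish with
  h.\<close>

lemma mild_lipschitz:
 assumes t: "t \<ge> 0" and r: "r \<ge> 0"
 shows "nL1 (\<lambda>x. mild t x - mild r x) \<le> D0 * \<bar>t - r\<bar>"
proof -
 define e where "e = (\<lambda>k. nL1 (\<lambda>x. Vk k t x - mild t x) + nL1 (\<lambda>x. Vk k r x - mild r x))"
 have b: "nL1 (\<lambda>x. mild t x - mild r x) \<le> D0 * sqrt ((\<bar>t - r\<bar> + 2 * hk k)\<^sup>2 + (t + r + 2) * hk k) + e k" for k
 proof -
  let ?h = "hk k"
  note I = Vk_integrable mild_integrable[OF t] mild_integrable[OF r]
  have "nL1 (\<lambda>x. mild t x - mild r x) \<le> nL1 (\<lambda>x. mild t x - Vk k t x) + nL1 (\<lambda>x. Vk k t x - mild r x)"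
   using I by (intro nL1_triangle) auto
  also have "nL1 (\<lambda>x. Vk k t x - mild r x) \<le> nL1 (\<lambda>x. Vk k t x - Vk k r x) + nL1 (\<lambda>x. Vk k r x - mild r x)"
   using I by (intro nL1_triangle) auto
  also have "nL1 (\<lambda>x. Vk k t x - Vk k r x) \<le> D0 * sqrt ((\<bar>t - r\<bar> + 2 * ?h)\<^sup>2 + (t + r + 2) * ?h)"
  proof -
   note a = ix_bounds[OF hk_pos[of k] t] and b = ix_bounds[OF hk_pos[of k] r]
   have hp: "?h > 0" "?h \<le> 1" by (rule hk_pos, rule hk_le_1)
   define A B where "A = real (ix ?h t) * ?h" and "B = real (ix ?h r) * ?h"
   have "\<bar>A - B\<bar> \<le> \<bar>t - r\<bar> + 2 * ?h" using a b hp unfolding A_def B_def by linarith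
   hence 1: "(A - B)\<^sup>2 \<le> (\<bar>t - r\<bar> + 2 * ?h)\<^sup>2" using power_mono[of "\<bar>A - B\<bar>" "\<bar>t - r\<bar> + 2 * ?h" 2] by simp
   have 2: "real (ix ?h t) * ?h\<^sup>2 \<le> (t + 1) * ?h"
    using mult_right_mono[of "real (ix ?h t) * ?h" "t + 1" ?h] a hp by (simp add: power2_eq_square mult.assoc)
   have 3: "real (ix ?h r) * ?h\<^sup>2 \<le> (r + 1) * ?h"
    using mult_right_mono[of "real (ix ?h r) * ?h" "r + 1" ?h] b hp by (simp add: power2_eq_square mult.assoc)
   have le: "(A - B)\<^sup>2 + real (ix ?h t) * ?h\<^sup>2 + real (ix ?h r) * ?h\<^sup>2 \<le> (\<bar>t - r\<bar> + 2 * ?h)\<^sup>2 + (t + r + 2) * ?h"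
    using 1 2 3 by (simp add: algebra_simps)
   have nn: "0 \<le> (\<bar>t - r\<bar> + 2 * ?h)\<^sup>2 + (t + r + 2) * ?h" using hp t r by simp
   have "aa ?h ?h (ix ?h t) (ix ?h r) \<le> D0 * sqrt ((\<bar>t - r\<bar> + 2 * ?h)\<^sup>2 + (t + r + 2) * ?h)"
    by (rule crandall_liggett[OF hp(1) hp(1)]) (use le nn in \<open>auto simp: A_def B_def\<close>)
   thus ?thesis by (simp add: aa_def Vk_def)
  qed
  finally show ?thesis unfolding e_def by (simp add: abs_minus_commute)
 qed
 have "(\<lambda>k. D0 * sqrt ((\<bar>t - r\<bar> + 2 * hk k)\<^sup>2 + (t + r + 2) * hk k) + e k) \<longlonglongrightarrow> D0 * sqrt ((\<bar>t - r\<bar> + 2 * 0)\<^sup>2 + (t + r + 2) * 0) + (0 + 0)"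
  unfolding e_def by (intro tendsto_intros hk_lim Vk_mild t r)
 from LIMSEQ_le_const[OF this, of "nL1 (\<lambda>x. mild t x - mild r x)"] b show ?thesis by auto
qed

lemma mild_0: "mild 0 x = w x"
proof -
 have "Vk k 0 x = w x" for k by (simp add: Vk_def ix_def)
 thus ?thesis using nice by (simp add: mild_def nice_def)
qed

end

end

section \<open>Comparison and the dual identity for mild solutions\<close>

lemma integrable_indicator_Ioc: "Lint (indicator {a<..b::real} :: real \<Rightarrow> real)"
 by (cases "a \<le> b") (auto simp: integrable_indicator_iff)

context pme
begin

lemma eul_contraction:
 assumes n1: "nice M1 w1 g1" and n2: "nice M2 w2 g2" and ex: "excessive P" and h: "h > 0"
 shows "(LBINT x. max 0 (eul M1 w1 h j x - eul M2 w2 h j x) * P x) \<le> (LBINT x. max 0 (w1 x - w2 x) * P x)"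
proof (induction j)
 case (Suc j)
 have "(LBINT x. max 0 (eul M1 w1 h (Suc j) x - eul M2 w2 h (Suc j) x) * P x) \<le> (LBINT x. max 0 (eul M1 w1 h j x - eul M2 w2 h j x) * P x)"
  by (rule step_contraction[OF eul_fpair[OF n1 h] eul_fpair[OF n2 h] _ _ _ _ _ _ less_imp_le[OF h] _ _ ex])
    (use eul_basic[OF n1 h] eul_basic[OF n2 h] h in \<open>auto simp del: eul.simps\<close>)
 with Suc show ?case by linarith
qed simp

text \<open>The scheme contracts in the weight P at each step size; since P is bounded by B, L1
  convergence of the scheme changes the weighted integral by at most B times the error.\<close>

lemma mild_contraction:
 assumes n1: "nice M1 w1 g1" and n2: "nice M2 w2 g2" and ex: "excessive P" and t: "t \<ge> 0"
 shows "(LBINT x. max 0 (mild M1 w1 t x - mild M2 w2 t x) * P x) \<le> (LBINT x. max 0 (w1 x - w2 x) * P x)"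
proof -
 obtain B where B: "\<And>x. P x \<le> B" "\<And>x. 0 \<le> P x" using ex by (auto simp: excessive_def)
 have [measurable]: "P \<in> bm" using ex by (simp add: excessive_def)
 note I1 = Vk_integrable[OF n1, of _ t] mild_integrable[OF n1 t] and I2 = Vk_integrable[OF n2, of _ t] mild_integrable[OF n2 t]
 define e where "e = (\<lambda>k. nL1 (\<lambda>x. Vk M1 w1 k t x - mild M1 w1 t x) + nL1 (\<lambda>x. Vk M2 w2 k t x - mild M2 w2 t x))"
 have "(LBINT x. max 0 (mild M1 w1 t x - mild M2 w2 t x) * P x) \<le> (LBINT x. max 0 (w1 x - w2 x) * P x) + B * e k" for k
 proof -
  let ?a = "\<lambda>x. mild M1 w1 t x - mild M2 w2 t x" and ?b = "\<lambda>x. Vk M1 w1 k t x - Vk M2 w2 k t x"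
  have iab: "Lint ?a" "Lint ?b" using I1 I2 by auto
  have J: "Lint (\<lambda>x. max 0 (?b x) * P x)" "Lint (\<lambda>x. max 0 (?a x) * P x)"
   using iab by (auto intro!: excessive_integrable[OF ex])
  have K: "Lint (\<lambda>x. B * (\<bar>Vk M1 w1 k t x - mild M1 w1 t x\<bar> + \<bar>Vk M2 w2 k t x - mild M2 w2 t x\<bar>))"
   using I1 I2 by auto
  have "(LBINT x. max 0 (?a x) * P x) \<le> (LBINT x. max 0 (?b x) * P x + B * (\<bar>Vk M1 w1 k t x - mild M1 w1 t x\<bar> + \<bar>Vk M2 w2 k t x - mild M2 w2 t x\<bar>))"
  proof (rule integral_mono[OF J(2) integrable_add[OF J(1) K]])
   fix x
   have "max 0 (?a x) \<le> max 0 (?b x) + (\<bar>Vk M1 w1 k t x - mild M1 w1 t x\<bar> + \<bar>Vk M2 w2 k t x - mild M2 w2 t x\<bar>)"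
    by linarith
   hence "max 0 (?a x) * P x \<le> (max 0 (?b x) + (\<bar>Vk M1 w1 k t x - mild M1 w1 t x\<bar> + \<bar>Vk M2 w2 k t x - mild M2 w2 t x\<bar>)) * P x"
    using B by (intro mult_right_mono) auto
   also have "\<dots> = max 0 (?b x) * P x + P x * (\<bar>Vk M1 w1 k t x - mild M1 w1 t x\<bar> + \<bar>Vk M2 w2 k t x - mild M2 w2 t x\<bar>)"
    by (simp add: algebra_simps)
   also have "\<dots> \<le> max 0 (?b x) * P x + B * (\<bar>Vk M1 w1 k t x - mild M1 w1 t x\<bar> + \<bar>Vk M2 w2 k t x - mild M2 w2 t x\<bar>)"
    using B by (intro add_left_mono mult_right_mono) auto
   finally show "max 0 (?a x) * P x \<le> max 0 (?b x) * P x + B * (\<bar>Vk M1 w1 k t x - mild M1 w1 t x\<bar> + \<bar>Vk M2 w2 k t x - mild M2 w2 t x\<bar>)" .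
  qed
  also have "\<dots> = (LBINT x. max 0 (?b x) * P x) + B * e k"
   using J K I1 I2 by (subst integral_add) (auto simp: e_def)
  also have "(LBINT x. max 0 (?b x) * P x) \<le> (LBINT x. max 0 (w1 x - w2 x) * P x)"
   unfolding Vk_def[OF n1] Vk_def[OF n2] ix_def[OF n1] ix_def[OF n2] hk_def[OF n1] hk_def[OF n2]
   by (rule eul_contraction[OF n1 n2 ex]) simp
  finally show ?thesis by simp
 qed
 moreover have "(\<lambda>k. (LBINT x. max 0 (w1 x - w2 x) * P x) + B * e k) \<longlonglongrightarrow> (LBINT x. max 0 (w1 x - w2 x) * P x) + B * (0 + 0)"
  unfolding e_def by (intro tendsto_intros Vk_mild[OF n1 t] Vk_mild[OF n2 t])
 ultimately show ?thesis using LIMSEQ_le_const by fastforce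
qed

lemma mild_mono:
 assumes n1: "nice M1 w1 g1" and n2: "nice M2 w2 g2" and le: "\<And>x. w1 x \<le> w2 x" and t: "t \<ge> 0"
 shows "AE x in lborel. mild M1 w1 t x \<le> mild M2 w2 t x"
proof -
 have I: "Lint (\<lambda>x. max 0 (mild M1 w1 t x - mild M2 w2 t x))"
  using mild_integrable[OF n1 t] mild_integrable[OF n2 t] by auto
 have "(LBINT x. max 0 (mild M1 w1 t x - mild M2 w2 t x) * 1) \<le> (LBINT x. max 0 (w1 x - w2 x) * 1)"
  by (rule mild_contraction[OF n1 n2 excessive_one t])
 also have "(\<lambda>x. max 0 (w1 x - w2 x) * 1) = (\<lambda>x. 0)" using le by (auto simp: fun_eq_iff max_def intro: antisym)
 finally have "(LBINT x. max 0 (mild M1 w1 t x - mild M2 w2 t x)) = 0"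
  by (intro antisym) (auto intro!: integral_nonneg_AE)
 hence "AE x in lborel. max 0 (mild M1 w1 t x - mild M2 w2 t x) = 0"
  using integral_nonneg_eq_0_iff_AE[OF I] by auto
 thus ?thesis by eventually_elim linarith
qed

section \<open>Duality with the Green function\<close>

lemma green_adjoint:
 assumes f: "Lint f" and c: "Lint \<eta>" and B: "\<And>x. \<bar>\<eta> x\<bar> \<le> B"
 shows "(LBINT x. \<eta> x * conv G f x) = (LBINT y. f y * conv G \<eta> y)"
proof -
 have [measurable]: "f \<in> bm" "\<eta> \<in> bm"
  using f c by (auto intro: Lint_measurable)
 have ac: "Lint (\<lambda>x. \<bar>\<eta> x\<bar>)" "\<And>x. \<bar>\<bar>\<eta> x\<bar>\<bar> \<le> B" using c B by auto
 have ev: "G (x - y) = G (y - x)" for x y :: 'a using kern_even[of s 0 "x - y"] by simp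
 have I: "integrable lborel2 (\<lambda>(y, x). \<eta> x * (G (x - y) * f y))"
 proof (rule lborel_pair.Fubini_integrable)
  have "(LBINT x. norm (\<eta> x * (G (x - y) * f y))) = conv G (\<lambda>x. \<bar>\<eta> x\<bar>) y * \<bar>f y\<bar>" for y
  proof -
   have "(LBINT x. norm (\<eta> x * (G (x - y) * f y))) = (LBINT x. (G (y - x) * \<bar>\<eta> x\<bar>) * \<bar>f y\<bar>)"
    by (intro integral_cong) (auto simp: abs_mult kern_nonneg ev[of y])
   thus ?thesis by (simp add: conv_def)
  qed
  moreover have "Lint (\<lambda>y. conv G (\<lambda>x. \<bar>\<eta> x\<bar>) y * \<bar>f y\<bar>)"
  proof (rule integrable_bound)
   define C where "C = gc * (LBINT y. \<bar>\<bar>\<eta> y\<bar>\<bar>) + gm * B"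
   have C: "\<bar>conv G (\<lambda>x. \<bar>\<eta> x\<bar>) y\<bar> \<le> C" for y unfolding C_def by (rule green_conv_bound[OF ac])
   show "Lint (\<lambda>y. C * f y)" using f by simp
   have "C \<ge> 0" using C[of undefined] by linarith
   thus "AE y in lborel. norm (conv G (\<lambda>x. \<bar>\<eta> x\<bar>) y * \<bar>f y\<bar>) \<le> norm (C * f y)"
    using C by (intro AE_I2) (simp add: abs_mult mult_right_mono)
  qed measurable
  ultimately show "Lint (\<lambda>y. LBINT x. norm (case (y, x) of (y, x) \<Rightarrow> \<eta> x * (G (x - y) * f y)))" by simp
  have "Lint (\<lambda>x. \<eta> x * (G (x - y) * f y))" for y
   using integrable_mult_right[OF integrable_green_conv[OF c B, of y], of "f y"] by (simp add: mult_ac ev[of y])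
  thus "AE y in lborel. Lint (\<lambda>x. case (y, x) of (y, x) \<Rightarrow> \<eta> x * (G (x - y) * f y))" by simp
 qed measurable
 have "(LBINT x. \<eta> x * conv G f x) = (LBINT x. (LBINT y. \<eta> x * (G (x - y) * f y)))"
  by (simp add: conv_def)
 also have "\<dots> = (LBINT y. (LBINT x. \<eta> x * (G (x - y) * f y)))"
  by (rule lborel_pair.Fubini_integral[OF I])
 also have "\<dots> = (LBINT y. f y * conv G \<eta> y)"
 proof (rule integral_cong[OF refl])
  fix y
  have "(LBINT x. \<eta> x * (G (x - y) * f y)) = (LBINT x. f y * (G (y - x) * \<eta> x))"
   by (intro integral_cong) (auto simp: ev[of y])
  thus "(LBINT x. \<eta> x * (G (x - y) * f y)) = f y * conv G \<eta> y" by (simp add: conv_def)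
 qed
 finally show ?thesis .
qed

context
 fixes M :: real and w g \<eta> :: "'a \<Rightarrow> real" and B :: real
 assumes nice: "nice M w g" and chi: "Lint \<eta>" and chiB: "\<And>x. 0 \<le> \<eta> x" "\<And>x. \<eta> x \<le> B"
begin

abbreviation V' where "V' \<equiv> eul M w"

lemma measurable_chi [measurable]: "\<eta> \<in> bm" by (rule Lint_measurable[OF chi])

lemma chi_abs: "\<bar>\<eta> x\<bar> \<le> B" using chiB by (simp add: abs_of_nonneg)

lemma chi_bounded_integrable:
 assumes "f \<in> bm" "\<And>x. \<bar>f x\<bar> \<le> C"
 shows "Lint (\<lambda>x. \<eta> x * f x)"
proof (rule integrable_bound)
 show "Lint (\<lambda>x. C * \<eta> x)" using chi by simp
 show "AE x in lborel. norm (\<eta> x * f x) \<le> norm (C * \<eta> x)"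
 proof (rule AE_I2)
  fix x
  have "\<bar>f x\<bar> \<le> \<bar>C\<bar>" using assms(2)[of x] by linarith
  thus "norm (\<eta> x * f x) \<le> norm (C * \<eta> x)" by (simp add: abs_mult mult.commute[of "\<bar>C\<bar>"] mult_left_mono)
 qed
qed (use assms in measurable)

lemma powr_bounds: "0 \<le> v \<Longrightarrow> v \<le> M \<Longrightarrow> \<bar>v powr m\<bar> \<le> M powr m"
 using m_gt by (simp add: powr_mono2)

text \<open>Each step says that (-\<Delta>)^s of h v^m is the decrement of v. Summation telescopes
  to w - V_N, and \<open>fpair_green\<close> inverts the operator; pairing with \<eta> moves the
  Green function onto \<eta>.\<close>

lemma eul_dual:
 assumes h: "h > 0"
 shows "h * (\<Sum>j<N. LBINT x. \<eta> x * V' h (Suc j) x powr m) + (LBINT x. V' h N x * conv G \<eta> x) = (LBINT x. w x * conv G \<eta> x)"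
proof -
 define S where "S = (\<lambda>x. \<Sum>j<N. h * V' h (Suc j) x powr m)"
 have pj: "fpair (\<lambda>x. h * V' h (Suc j) x powr m) (\<lambda>x. V' h j x - V' h (Suc j) x)" for j
  using fpair_scale[OF eul_fpair[OF nice h, of j], of h] h by (simp del: eul.simps)
 have "fpair S (\<lambda>x. \<Sum>j<N. V' h j x - V' h (Suc j) x)"
  unfolding S_def by (intro fpair_sum pj) auto
 also have "(\<lambda>x. \<Sum>j<N. V' h j x - V' h (Suc j) x) = (\<lambda>x. w x - V' h N x)"
  using sum_lessThan_telescope'[of "\<lambda>j. V' h j _" N] by simp
 finally have pS: "fpair S (\<lambda>x. w x - V' h N x)" .
 have VI[simp]: "Lint (V' h j)" for j by (rule eul_integrable[OF nice h])
 have [measurable]: "V' h j \<in> bm" for j by (rule Lint_measurable[OF VI])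
 have [measurable]: "w \<in> bm" using VI[of 0] by (simp add: Lint_measurable)
 have wb: "0 \<le> w x" "w x \<le> M" for x using nice by (auto simp: nice_def)
 have Sb: "\<bar>S x\<bar> \<le> real N * h * M powr m" for x
 proof -
  have "\<bar>S x\<bar> \<le> (\<Sum>j<N. \<bar>h * V' h (Suc j) x powr m\<bar>)" unfolding S_def by (rule sum_abs)
  also have "\<dots> \<le> (\<Sum>j<N. h * M powr m)"
   using powr_bounds[OF eul_bounds[OF nice h]] h by (intro sum_mono) (simp add: abs_mult del: eul.simps)
  finally show ?thesis by (simp add: mult_ac)
 qed
 have gb: "\<bar>w x - V' h N x\<bar> \<le> M" for x using wb[of x] eul_bounds[OF nice h, of N x] by linarith
 define L where "L = max (real N * h * M powr m) M"
 have "AE x in lborel. S x = conv G (\<lambda>x. w x - V' h N x) x"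
  by (rule fpair_green[OF pS, of L]) (unfold L_def, rule max.coboundedI1[OF Sb], rule max.coboundedI2[OF gb])
 hence "(LBINT x. \<eta> x * S x) = (LBINT x. \<eta> x * conv G (\<lambda>x. w x - V' h N x) x)"
  by (intro integral_cong_AE) (auto simp: S_def simp del: eul.simps)
 also have "\<dots> = (LBINT x. (w x - V' h N x) * conv G \<eta> x)"
  by (rule green_adjoint[OF fpairD(2)[OF pS] chi chi_abs])
 also have "\<dots> = (LBINT x. w x * conv G \<eta> x) - (LBINT x. V' h N x * conv G \<eta> x)"
 proof -
  define C where "C = gc * (LBINT y. \<bar>\<eta> y\<bar>) + gm * B"
  have C: "\<bar>conv G \<eta> y\<bar> \<le> C" for y unfolding C_def by (rule green_conv_bound[OF chi chi_abs])
  have I: "Lint (\<lambda>x. f x * conv G \<eta> x)" if f: "Lint f" for f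
  proof (rule integrable_bound)
   show "Lint (\<lambda>y. C * f y)" using f by simp
   have [measurable]: "f \<in> bm" by (rule Lint_measurable[OF f])
   show "(\<lambda>x. f x * conv G \<eta> x) \<in> borel_measurable lborel" by measurable
   have "C \<ge> 0" using C[of undefined] by linarith
   thus "AE y in lborel. norm (f y * conv G \<eta> y) \<le> norm (C * f y)"
    using C by (intro AE_I2) (simp add: abs_mult mult.commute[of C] mult_left_mono)
  qed
  have "Lint w" using VI[of 0] by simp
  thus ?thesis using I[of w] I[OF VI[of N]] by (simp add: left_diff_distrib del: eul.simps)
 qed
 also have "(LBINT x. \<eta> x * S x) = h * (\<Sum>j<N. LBINT x. \<eta> x * V' h (Suc j) x powr m)"
 proof -
  have I: "Lint (\<lambda>x. \<eta> x * V' h j x powr m)" for j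
   by (rule chi_bounded_integrable[where C="M powr m"]) (use m_gt in \<open>auto intro!: powr_mono2 eul_bounds[OF nice h] simp del: eul.simps\<close>)
  have "(LBINT x. \<eta> x * S x) = (LBINT x. (\<Sum>j<N. h * (\<eta> x * V' h (Suc j) x powr m)))"
   by (simp add: S_def sum_distrib_left mult.left_commute del: eul.simps)
  also have "\<dots> = (\<Sum>j<N. LBINT x. h * (\<eta> x * V' h (Suc j) x powr m))"
   using I by (intro integral_sum integrable_mult_right)
  finally show ?thesis by (simp add: sum_distrib_left del: eul.simps)
 qed
 finally show ?thesis by simp
qed

lemma integral_step_function:
 fixes F :: "nat \<Rightarrow> real"
 assumes h: "h > 0"
 shows "Lint (\<lambda>\<tau>. indicator {0<..real N * h} \<tau> * F (ix h \<tau>)) \<and>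
     (LBINT \<tau>. indicator {0<..real N * h} \<tau> * F (ix h \<tau>)) = h * (\<Sum>j<N. F (Suc j))"
proof (induction N)
 case (Suc N)
 have ixv: "ix h \<tau> = Suc N" if "\<tau> \<in> {real N * h<..real (Suc N) * h}" for \<tau>
 proof -
  have "real N < \<tau> / h" "\<tau> / h \<le> real N + 1" using that h by (auto simp: field_simps)
  hence "\<lceil>\<tau> / h\<rceil> = int N + 1" by (intro ceiling_unique) auto
  thus ?thesis by (simp add: ix_def[OF nice])
 qed
 have eq: "indicator {0<..real (Suc N) * h} \<tau> * F (ix h \<tau>) = indicator {0<..real N * h} \<tau> * F (ix h \<tau>) + F (Suc N) * indicator {real N * h<..real (Suc N) * h} \<tau>" for \<tau>
 proof -
  have le: "real N * h \<le> real (Suc N) * h" "0 \<le> real N * h" using h by auto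
  show ?thesis
  proof (cases "\<tau> \<in> {real N * h<..real (Suc N) * h}")
   case True thus ?thesis using ixv[OF True] le by (auto simp: indicator_def)
  next
   case False thus ?thesis using le by (auto simp: indicator_def)
  qed
 qed
 have I: "Lint (\<lambda>\<tau>. F (Suc N) * indicator {real N * h<..real (Suc N) * h} \<tau>)"
  by (intro integrable_mult_right integrable_indicator_Ioc)
 have v: "(LBINT \<tau>. F (Suc N) * indicator {real N * h<..real (Suc N) * h} \<tau>) = F (Suc N) * h"
  using h by (simp add: algebra_simps)
 show ?case unfolding eq using Suc I v by (simp add: algebra_simps)
qed simp

text \<open>The sum over steps is the time integral of a step function
  (\<open>integral_step_function\<close>), so this is the limit of \<open>eul_dual\<close> along the
  step sizes \<open>hk\<close>, the power being dominated by M^m \<eta>.\<close>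

lemma mild_dual:
 assumes t: "t \<ge> 0"
 shows "(LBINT \<tau>. indicator {0<..t} \<tau> * (LBINT x. \<eta> x * mild M w \<tau> x powr m)) + (LBINT x. mild M w t x * conv G \<eta> x)
   = (LBINT x. w x * conv G \<eta> x)"
proof -
 let ?U = "mild M w" and ?h = "hk" and ?V = "Vk M w"
 define C where "C = gc * (LBINT y. \<bar>\<eta> y\<bar>) + gm * B"
 have C: "\<bar>conv G \<eta> y\<bar> \<le> C" for y unfolding C_def by (rule green_conv_bound[OF chi chi_abs])
 have Cnn: "C \<ge> 0" using C[of undefined] by linarith
 define N where "N = (\<lambda>k. ix (?h k) t)"
 have hp: "?h k > 0" for k by (rule hk_pos[OF nice])
 have [measurable]: "?V k r \<in> bm" for k r by (rule Lint_measurable[OF Vk_integrable[OF nice]])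
 have [measurable]: "?U r \<in> bm" for r by (rule measurable_mild_slice[OF nice])
 define \<phi> where "\<phi> = (\<lambda>k \<tau>. LBINT x. \<eta> x * ?V k \<tau> x powr m)"
 define \<phi>0 where "\<phi>0 = (\<lambda>\<tau>. LBINT x. \<eta> x * ?U \<tau> x powr m)"
 have fI: "Lint (\<lambda>x. M powr m * \<eta> x)" using chi by simp
 have bnd: "norm (\<eta> x * v powr m) \<le> M powr m * \<eta> x" if "0 \<le> v" "v \<le> M" for v x
  using powr_bounds[OF that] chiB(1)[of x] by (simp add: abs_mult mult.commute[of "M powr m"] mult_left_mono)
 have \<phi>b: "\<bar>\<phi> k \<tau>\<bar> \<le> (LBINT x. M powr m * \<eta> x)" for k \<tau>
 proof -
  have "norm (\<phi> k \<tau>) \<le> (LBINT x. norm (\<eta> x * ?V k \<tau> x powr m))"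
   unfolding \<phi>_def by (rule integral_norm_bound)
  also have "\<dots> \<le> (LBINT x. M powr m * \<eta> x)"
  proof (rule integral_mono[OF _ fI])
   show "Lint (\<lambda>x. norm (\<eta> x * ?V k \<tau> x powr m))"
    by (intro integrable_norm chi_bounded_integrable[where C="M powr m"]) (use m_gt in \<open>auto intro!: powr_mono2 Vk_bounds[OF nice]\<close>)
  qed (intro bnd Vk_bounds[OF nice])
  finally show ?thesis by simp
 qed
 have id: "(LBINT \<tau>. indicator {0<..real (N k) * ?h k} \<tau> * \<phi> k \<tau>) + (LBINT x. ?V k t x * conv G \<eta> x) = (LBINT x. w x * conv G \<eta> x)" for k
 proof -
  have "(LBINT \<tau>. indicator {0<..real (N k) * ?h k} \<tau> * \<phi> k \<tau>) = ?h k * (\<Sum>j<N k. LBINT x. \<eta> x * V' (?h k) (Suc j) x powr m)"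
   using integral_step_function[OF hp, of "N k" k "\<lambda>j. LBINT x. \<eta> x * V' (?h k) j x powr m"]
   by (simp add: \<phi>_def Vk_def[OF nice] del: eul.simps)
  thus ?thesis using eul_dual[OF hp, of k "N k"] by (simp add: Vk_def[OF nice] N_def del: eul.simps)
 qed
 have ptw: "(\<lambda>k. \<phi> k \<tau>) \<longlonglongrightarrow> \<phi>0 \<tau>" if "\<tau> > 0" for \<tau>
  unfolding \<phi>_def \<phi>0_def
 proof (rule integral_dominated_convergence[OF _ _ fI])
  show "AE x in lborel. (\<lambda>k. \<eta> x * ?V k \<tau> x powr m) \<longlonglongrightarrow> \<eta> x * ?U \<tau> x powr m"
   using Vk_tendsto[OF nice less_imp_le[OF that]] m_gt
   by (auto elim!: eventually_mono intro!: tendsto_intros tendsto_powr2 simp: Vk_bounds[OF nice])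
  show "AE x in lborel. norm (\<eta> x * ?V k \<tau> x powr m) \<le> M powr m * \<eta> x" for k
   by (intro AE_I2 bnd Vk_bounds[OF nice])
 qed measurable
 have hlim: "(\<lambda>k. ?h k) \<longlonglongrightarrow> 0" by (rule hk_lim[OF nice])
 have [measurable]: "(\<lambda>p. ?V k (fst p) (snd p)) \<in> borel_measurable (borel \<Otimes>\<^sub>M borel)" for k
  using measurable_Vk[OF nice] by (simp add: case_prod_beta')
 have [measurable]: "(\<lambda>p. ?U (fst p) (snd p)) \<in> borel_measurable (borel \<Otimes>\<^sub>M borel)"
  using measurable_mild[OF nice] by (simp add: case_prod_beta')
 have [measurable]: "\<phi> k \<in> bm" for k
  unfolding \<phi>_def by (rule lborel.borel_measurable_lebesgue_integral) (simp add: case_prod_beta')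
 have [measurable]: "\<phi>0 \<in> bm"
  unfolding \<phi>0_def by (rule lborel.borel_measurable_lebesgue_integral) (simp add: case_prod_beta')
 have 1: "(\<lambda>k. LBINT \<tau>. indicator {0<..real (N k) * ?h k} \<tau> * \<phi> k \<tau>) \<longlonglongrightarrow> (LBINT \<tau>. indicator {0<..t} \<tau> * \<phi>0 \<tau>)"
 proof (rule integral_dominated_convergence[where w="\<lambda>\<tau>. (LBINT x. M powr m * \<eta> x) * indicator {0<..t + 1} \<tau>"])
  show "Lint (\<lambda>\<tau>. (LBINT x. M powr m * \<eta> x) * indicator {0<..t + 1} \<tau>)"
   by (intro integrable_mult_right integrable_indicator_Ioc)
  show "AE \<tau> in lborel. (\<lambda>k. indicator {0<..real (N k) * ?h k} \<tau> * \<phi> k \<tau>) \<longlonglongrightarrow> indicator {0<..t} \<tau> * \<phi>0 \<tau>"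
  proof (rule AE_I2)
   fix \<tau> :: real
   \<comment> \<open>The upper limit of the time integral is \<open>N k * hk k\<close>, at least t,
     so no time up to t is lost; times beyond t drop out once \<open>hk k\<close> is smaller than
     their distance to t.\<close>
   consider "\<tau> \<le> 0" | "0 < \<tau>" "\<tau> \<le> t" | "0 < \<tau>" "t < \<tau>" by linarith
   thus "(\<lambda>k. indicator {0<..real (N k) * ?h k} \<tau> * \<phi> k \<tau>) \<longlonglongrightarrow> indicator {0<..t} \<tau> * \<phi>0 \<tau>"
   proof cases
    case 1 thus ?thesis by (simp add: indicator_def)
   next
    case 2
    have "\<tau> \<le> real (N k) * ?h k" for k using ix_bounds(1)[OF nice hp t, of k] 2 by (simp add: N_def)
    thus ?thesis using ptw[OF 2(1)] 2 by (simp add: indicator_def)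
   next
    case 3
    have "\<forall>\<^sub>F k in sequentially. ?h k < \<tau> - t" using order_tendstoD(2)[OF hlim, of "\<tau> - t"] 3 by simp
    hence ev: "\<forall>\<^sub>F k in sequentially. indicator {0<..real (N k) * ?h k} \<tau> * \<phi> k \<tau> = 0"
    proof eventually_elim
     case (elim k)
     have "real (N k) * ?h k \<le> t + ?h k" using ix_bounds(2)[OF nice hp t, of k] by (simp add: N_def)
     hence "real (N k) * ?h k < \<tau>" using elim by linarith
     thus ?case by (simp add: indicator_def)
    qed
    have z: "indicator {0<..t} \<tau> * \<phi>0 \<tau> = 0" using 3 by (simp add: indicator_def)
    show ?thesis unfolding z by (rule tendsto_eventually[OF ev])
   qed
  qed
  show "AE \<tau> in lborel. norm (indicator {0<..real (N k) * ?h k} \<tau> * \<phi> k \<tau>) \<le> (LBINT x. M powr m * \<eta> x) * indicator {0<..t + 1} \<tau>" for k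
  proof (rule AE_I2)
   fix \<tau> :: real
   have "real (N k) * ?h k \<le> t + 1" using ix_bounds(2)[OF nice hp t, of k] hk_le_1[OF nice, of k] by (simp add: N_def)
   thus "norm (indicator {0<..real (N k) * ?h k} \<tau> * \<phi> k \<tau>) \<le> (LBINT x. M powr m * \<eta> x) * indicator {0<..t + 1} \<tau>"
    using \<phi>b[of k \<tau>] by (auto simp: indicator_def)
  qed
 qed measurable
 have 2: "(\<lambda>k. LBINT x. ?V k t x * conv G \<eta> x) \<longlonglongrightarrow> (LBINT x. ?U t x * conv G \<eta> x)"
 proof -
  have I: "Lint (\<lambda>x. f x * conv G \<eta> x)" if f: "Lint f" for f
  proof (rule integrable_bound)
   show "Lint (\<lambda>y. C * f y)" using f by simp
   have [measurable]: "f \<in> bm" by (rule Lint_measurable[OF f])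
   show "(\<lambda>x. f x * conv G \<eta> x) \<in> borel_measurable lborel" by measurable
   show "AE y in lborel. norm (f y * conv G \<eta> y) \<le> norm (C * f y)"
    using C Cnn by (intro AE_I2) (simp add: abs_mult mult.commute[of C] mult_left_mono)
  qed
  have "(\<lambda>k. (LBINT x. ?V k t x * conv G \<eta> x) - (LBINT x. ?U t x * conv G \<eta> x)) \<longlonglongrightarrow> 0"
  proof (rule Lim_null_comparison)
   show "\<forall>\<^sub>F k in sequentially. norm ((LBINT x. ?V k t x * conv G \<eta> x) - (LBINT x. ?U t x * conv G \<eta> x)) \<le> C * nL1 (\<lambda>x. ?V k t x - ?U t x)"
   proof (intro always_eventually allI)
    fix k
    note IV = Vk_integrable[OF nice, of k t] and IU = mild_integrable[OF nice t]
    have eq: "(LBINT x. ?V k t x * conv G \<eta> x) - (LBINT x. ?U t x * conv G \<eta> x) = (LBINT x. (?V k t x - ?U t x) * conv G \<eta> x)"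
     using I[OF IV] I[OF IU] by (simp add: left_diff_distrib)
    have "norm (LBINT x. (?V k t x - ?U t x) * conv G \<eta> x) \<le> (LBINT x. norm ((?V k t x - ?U t x) * conv G \<eta> x))" by (rule integral_norm_bound)
    also have "\<dots> \<le> (LBINT x. C * \<bar>?V k t x - ?U t x\<bar>)"
    proof (rule integral_mono)
     show "Lint (\<lambda>x. norm ((?V k t x - ?U t x) * conv G \<eta> x))"
      using I[of "\<lambda>x. ?V k t x - ?U t x"] IV IU by auto
     show "Lint (\<lambda>x. C * \<bar>?V k t x - ?U t x\<bar>)" using IV IU by auto
     show "norm ((?V k t x - ?U t x) * conv G \<eta> x) \<le> C * \<bar>?V k t x - ?U t x\<bar>" for x
      using C[of x] by (simp add: abs_mult mult.commute[of C] mult_left_mono)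
    qed
    finally show "norm ((LBINT x. ?V k t x * conv G \<eta> x) - (LBINT x. ?U t x * conv G \<eta> x)) \<le> C * nL1 (\<lambda>x. ?V k t x - ?U t x)" unfolding eq by simp
   qed
   show "(\<lambda>k. C * nL1 (\<lambda>x. ?V k t x - ?U t x)) \<longlonglongrightarrow> 0"
    using tendsto_mult_right_zero[OF Vk_mild[OF nice t]] .
  qed
  thus ?thesis by (simp add: LIM_zero_iff)
 qed
 have "(\<lambda>k. LBINT x. w x * conv G \<eta> x) \<longlonglongrightarrow> (LBINT \<tau>. indicator {0<..t} \<tau> * \<phi>0 \<tau>) + (LBINT x. ?U t x * conv G \<eta> x)"
  using tendsto_add[OF 1 2] unfolding id .
 hence "(LBINT x. w x * conv G \<eta> x) = (LBINT \<tau>. indicator {0<..t} \<tau> * \<phi>0 \<tau>) + (LBINT x. ?U t x * conv G \<eta> x)"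
  by (simp add: LIMSEQ_const_iff)
 thus ?thesis by (simp add: \<phi>0_def)
qed

end

end

section \<open>Monotone limits of mild solutions\<close>

context frac
begin

lemma Phi_pos: "0 < \<Phi> x"
proof -
 obtain c where c: "c > 0" "\<And>x. c * (1 + norm x) powr (- (n - 2 * s)) \<le> \<Phi> x" using Phi_lower by blast
 have "0 < c * (1 + norm x) powr (- (n - 2 * s))" proof (rule mult_pos_pos[OF c(1)])
  have "1 + norm x > 0" by (simp add: add_pos_nonneg)
  thus "0 < (1 + norm x) powr (- (n - 2 * s))" by simp
 qed
 with c(2)[of x] show ?thesis by linarith
qed

text \<open>Gaussian domination is the condition under which the Green potential of q is at most C
  \<Phi>. It covers both the Gaussian itself and bounded functions of compact support.\<close>

definition gdom :: "real \<Rightarrow> ('a \<Rightarrow> real) \<Rightarrow> bool" where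
 "gdom C q \<longleftrightarrow> q \<in> bm \<and> (\<forall>x. \<bar>q x\<bar> \<le> C * gauss1 x)"

lemma gdom_nonneg: "gdom C q \<Longrightarrow> 0 \<le> C"
proof -
 assume "gdom C q"
 hence "\<bar>q 0\<bar> \<le> C * gauss1 0" unfolding gdom_def by blast
 thus "0 \<le> C" by (simp add: gauss1_def)
qed

lemma
 assumes q: "gdom C q"
 shows gdom_measurable: "q \<in> bm" and gdom_integrable: "Lint q"
  and gdom_bounded: "\<bar>q x\<bar> \<le> C" and gdom_abs: "gdom C (\<lambda>x. \<bar>q x\<bar>)"
  and gdom_pos: "gdom C (\<lambda>x. max 0 (q x))" and gdom_neg: "gdom C (\<lambda>x. max 0 (- q x))"
proof -
 show m[measurable]: "q \<in> bm" using q by (simp add: gdom_def)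
 have b: "\<bar>q x\<bar> \<le> C * gauss1 x" for x using q by (simp add: gdom_def)
 show "Lint q"
  by (rule integrable_bound[of _ "\<lambda>x. C * gauss1 x"])
    (use integrable_gauss1 b in \<open>auto intro!: AE_I2 order_trans[OF b abs_ge_self]\<close>)
 have "C * gauss1 x \<le> C * 1" using gdom_nonneg[OF q] gauss1_bounds by (intro mult_left_mono)
 thus "\<bar>q x\<bar> \<le> C" using b[of x] by simp
 show "gdom C (\<lambda>x. \<bar>q x\<bar>)" using b by (simp add: gdom_def)
 have "\<bar>max 0 (q x)\<bar> \<le> \<bar>q x\<bar>" "\<bar>max 0 (- q x)\<bar> \<le> \<bar>q x\<bar>" for x by auto
 thus "gdom C (\<lambda>x. max 0 (q x))" "gdom C (\<lambda>x. max 0 (- q x))"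
  unfolding gdom_def using order_trans[OF _ b] by auto
qed

lemma gdom_conv: "gdom C q \<Longrightarrow> \<bar>conv G q x\<bar> \<le> C * \<Phi> x"
proof -
 assume q: "gdom C q"
 have Ig: "Lint (\<lambda>y. G (x - y) * gauss1 y)"
  by (rule integrable_green_conv[OF integrable_gauss1, of 1]) (simp add: gauss1_bounds)
 have Iq: "Lint (\<lambda>y. G (x - y) * q y)"
  by (rule integrable_green_conv[OF gdom_integrable[OF q] gdom_bounded[OF q]])
 have "norm (conv G q x) \<le> (LBINT y. norm (G (x - y) * q y))" unfolding conv_def by (rule integral_norm_bound)
 also have "\<dots> \<le> (LBINT y. C * (G (x - y) * gauss1 y))"
 proof (rule integral_mono)
  show "Lint (\<lambda>y. norm (G (x - y) * q y))" using Iq by (rule integrable_norm)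
  show "Lint (\<lambda>y. C * (G (x - y) * gauss1 y))" using Ig by (rule integrable_mult_right)
  fix y
  have "G (x - y) * \<bar>q y\<bar> \<le> G (x - y) * (C * gauss1 y)" using q by (intro mult_left_mono kern_nonneg) (simp add: gdom_def)
  thus "norm (G (x - y) * q y) \<le> C * (G (x - y) * gauss1 y)" by (simp add: abs_mult kern_nonneg mult.left_commute)
 qed
 finally show ?thesis by (simp add: \<Phi>_def conv_def)
qed

lemma gdom_conv_integrable:
 assumes q: "gdom C q" and f: "Lint (\<lambda>x. f x * \<Phi> x)" and [measurable]: "f \<in> bm"
 shows "Lint (\<lambda>x. f x * conv G q x)"
proof (rule integrable_bound)
 have [measurable]: "q \<in> bm" by (rule gdom_measurable[OF q])
 show "(\<lambda>x. f x * conv G q x) \<in> borel_measurable lborel" by measurable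
 show "Lint (\<lambda>x. C * (f x * \<Phi> x))" using f by (rule integrable_mult_right)
 show "AE x in lborel. norm (f x * conv G q x) \<le> norm (C * (f x * \<Phi> x))"
 proof (rule AE_I2)
  fix x
  have "\<bar>f x\<bar> * \<bar>conv G q x\<bar> \<le> \<bar>f x\<bar> * (C * \<Phi> x)" by (intro mult_left_mono gdom_conv[OF q]) simp
  thus "norm (f x * conv G q x) \<le> norm (C * (f x * \<Phi> x))"
   using gdom_nonneg[OF q] Phi_nonneg[of x] by (simp add: abs_mult mult.left_commute)
 qed
qed

text \<open>Fubini for f in the weighted space only: integrating |q(x)| G(x - y) in x gives at most
  C \<Phi>(y), and f \<Phi> is integrable. Existence of the potential of f is learnt only at points
  where q does not vanish.\<close>

lemma
 assumes q: "gdom C q" and f: "Lint (\<lambda>x. f x * \<Phi> x)" and [measurable]: "f \<in> bm"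
 shows green_adjoint_Phi: "(LBINT x. q x * conv G f x) = (LBINT y. f y * conv G q y)"
  and integrable_green_Phi: "Lint (\<lambda>x. q x * conv G f x)"
  and AE_green_Phi: "AE x in lborel. q x \<noteq> 0 \<longrightarrow> Lint (\<lambda>y. G (x - y) * f y)"
proof -
 have [measurable]: "q \<in> bm" by (rule gdom_measurable[OF q])
 have ev: "G (x - y) = G (y - x)" for x y :: 'a using kern_even[of s 0 "x - y"] by simp
 have I: "integrable lborel2 (\<lambda>(y, x). q x * (G (x - y) * f y))"
 proof (rule lborel_pair.Fubini_integrable)
  have "(LBINT x. norm (q x * (G (x - y) * f y))) = \<bar>f y\<bar> * conv G (\<lambda>x. \<bar>q x\<bar>) y" for y
  proof -
   have "(LBINT x. norm (q x * (G (x - y) * f y))) = (LBINT x. \<bar>f y\<bar> * (G (y - x) * \<bar>q x\<bar>))"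
    by (intro integral_cong) (auto simp: abs_mult kern_nonneg ev[of y])
   thus ?thesis by (simp add: conv_def)
  qed
  moreover have "Lint (\<lambda>x. \<bar>f x\<bar> * conv G (\<lambda>x. \<bar>q x\<bar>) x)"
  proof (rule gdom_conv_integrable[OF gdom_abs[OF q]])
   show "Lint (\<lambda>x. \<bar>f x\<bar> * \<Phi> x)"
    using integrable_abs[OF f] Phi_nonneg by (simp add: abs_mult)
  qed measurable
  ultimately show "Lint (\<lambda>y. LBINT x. norm (case (y, x) of (y, x) \<Rightarrow> q x * (G (x - y) * f y)))" by simp
  have "Lint (\<lambda>x. q x * (G (x - y) * f y))" for y
   using integrable_mult_right[OF integrable_green_conv[OF gdom_integrable[OF q] gdom_bounded[OF q], of y], of "f y"]
   by (simp add: mult_ac ev[of y])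
  thus "AE y in lborel. Lint (\<lambda>x. case (y, x) of (y, x) \<Rightarrow> q x * (G (x - y) * f y))" by simp
 qed measurable
 have "(LBINT x. q x * conv G f x) = (LBINT x. (LBINT y. q x * (G (x - y) * f y)))"
  by (simp add: conv_def)
 also have "\<dots> = (LBINT y. (LBINT x. q x * (G (x - y) * f y)))"
  by (rule lborel_pair.Fubini_integral[OF I])
 also have "\<dots> = (LBINT y. f y * conv G q y)"
 proof (rule integral_cong[OF refl])
  fix y
  have "(LBINT x. q x * (G (x - y) * f y)) = (LBINT x. f y * (G (y - x) * q x))"
   by (intro integral_cong) (auto simp: ev[of y])
  thus "(LBINT x. q x * (G (x - y) * f y)) = f y * conv G q y" by (simp add: conv_def)
 qed
 finally show "(LBINT x. q x * conv G f x) = (LBINT y. f y * conv G q y)" .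
 show "Lint (\<lambda>x. q x * conv G f x)"
  using lborel_pair.integrable_snd[OF I] by (simp add: conv_def)
 show "AE x in lborel. q x \<noteq> 0 \<longrightarrow> Lint (\<lambda>y. G (x - y) * f y)"
  using lborel_pair.AE_integrable_snd[OF I] by eventually_elim auto
qed

end

locale pme_data = pme s n TA m for s n :: real and TA :: "'a::euclidean_space itself" and m :: real +
 fixes MM :: "nat \<Rightarrow> real" and w g :: "nat \<Rightarrow> 'a \<Rightarrow> real" and u0 :: "'a \<Rightarrow> real"
 assumes nice: "nice (MM k) (w k) (g k)" and w_mono: "w k x \<le> w (Suc k) x" and w_lim: "(\<lambda>k. w k x) \<longlonglongrightarrow> u0 x"
  and u0_Phi: "Lint (\<lambda>x. u0 x * \<Phi> x)"
begin

abbreviation U where "U k \<equiv> mild (MM k) (w k)"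

lemma w_integrable: "Lint (w k)" using nice by (simp add: nice_def)
lemma measurable_w [measurable]: "w k \<in> bm" by (rule Lint_measurable[OF w_integrable])
lemma w_nonneg: "0 \<le> w k x" using nice by (simp add: nice_def)
lemma w_le: "w k x \<le> u0 x"
 by (rule incseq_le[OF _ w_lim]) (intro incseq_SucI w_mono)
lemma u0_nonneg: "0 \<le> u0 x" by (rule order_trans[OF w_nonneg w_le])
lemma measurable_u0 [measurable]: "u0 \<in> bm"
 by (rule borel_measurable_LIMSEQ_real[OF w_lim]) measurable

lemma U_mono: "t \<ge> 0 \<Longrightarrow> AE x in lborel. U k t x \<le> U (Suc k) t x"
 by (rule mild_mono[OF nice nice w_mono])

text \<open>U_k is monotone in k only up to a null set depending on t. The running maximum is
  monotone everywhere and keeps joint measurability in time and space.\<close>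

primrec Um :: "nat \<Rightarrow> real \<Rightarrow> 'a \<Rightarrow> real" where
 "Um 0 t x = U 0 t x"
| "Um (Suc k) t x = max (Um k t x) (U (Suc k) t x)"

lemma Um_eq: "t \<ge> 0 \<Longrightarrow> AE x in lborel. \<forall>k. Um k t x = U k t x \<and> U k t x \<le> U (Suc k) t x"
proof -
 assume t: "t \<ge> 0"
 have "AE x in lborel. \<forall>k. U k t x \<le> U (Suc k) t x"
  unfolding AE_all_countable using U_mono[OF t] by blast
 thus ?thesis
 proof eventually_elim
  case (elim x)
  have "Um k t x = U k t x" for k using elim by (induction k) (auto simp: max_def intro: antisym)
  with elim show ?case by blast
 qed
qed

lemma measurable_U [measurable]: "(\<lambda>p. U k (fst p) (snd p)) \<in> borel_measurable (borel \<Otimes>\<^sub>M borel)"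
 using measurable_mild[OF nice, of k] by (simp add: case_prod_beta')

lemma measurable_Um [measurable]: "(\<lambda>p. Um k (fst p) (snd p)) \<in> borel_measurable (borel \<Otimes>\<^sub>M borel)"
 by (induction k) auto

text \<open>The supremum is taken in the extended reals because finiteness is known only almost
  everywhere; \<open>enn2real\<close> sends the exceptional value to 0.\<close>

definition E :: "real \<Rightarrow> 'a \<Rightarrow> ennreal" where "E t x = (SUP k. ennreal (Um k t x))"

definition u :: "real \<Rightarrow> 'a \<Rightarrow> real" where "u t x = enn2real (E t x)"

lemma measurable_u: "(\<lambda>p. u (fst p) (snd p)) \<in> borel_measurable (borel \<Otimes>\<^sub>M borel)"
 unfolding u_def E_def by measurable

lemma measurable_u' [measurable (raw)]:
 assumes [measurable]: "f \<in> measurable N borel" "h \<in> measurable N borel"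
 shows "(\<lambda>x. u (f x) (h x)) \<in> borel_measurable N"
 using measurable_compose[OF measurable_Pair[OF assms] measurable_u] by simp

lemma measurable_U' [measurable (raw)]:
 assumes [measurable]: "f \<in> measurable N borel" "h \<in> measurable N borel"
 shows "(\<lambda>x. U k (f x) (h x)) \<in> borel_measurable N"
 using measurable_compose[OF measurable_Pair[OF assms] measurable_U] by simp

lemma measurable_Um' [measurable (raw)]:
 assumes [measurable]: "f \<in> measurable N borel" "h \<in> measurable N borel"
 shows "(\<lambda>x. Um k (f x) (h x)) \<in> borel_measurable N"
 using measurable_compose[OF measurable_Pair[OF assms] measurable_Um] by simp

lemma u_nonneg: "0 \<le> u t x" by (simp add: u_def)

lemma U_Phi_integrable: "t \<ge> 0 \<Longrightarrow> Lint (\<lambda>x. U k t x * \<Phi> x)"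
 by (rule excessive_integrable[OF excessive_Phi mild_integrable[OF nice]])

lemma w_Phi_integrable: "Lint (\<lambda>x. w k x * \<Phi> x)"
 by (rule excessive_integrable[OF excessive_Phi w_integrable])

text \<open>The dual identity with \<eta> = \<open>gauss1\<close>, from which the nonnegative time
  integral is dropped: the \<Phi>-weighted mass does not increase.\<close>

lemma U_Phi_le: "t \<ge> 0 \<Longrightarrow> (LBINT x. U k t x * \<Phi> x) \<le> (LBINT x. u0 x * \<Phi> x)"
proof -
 assume t: "t \<ge> 0"
 have "0 \<le> (LBINT \<tau>. indicator {0<..t} \<tau> * (LBINT x. gauss1 x * U k \<tau> x powr m))"
  by (intro integral_nonneg_AE AE_I2 mult_nonneg_nonneg) (auto simp: gauss1_bounds)
 with mild_dual[OF nice integrable_gauss1 gauss1_bounds t, of k]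
 have "(LBINT x. U k t x * \<Phi> x) \<le> (LBINT x. w k x * \<Phi> x)" by (simp add: \<Phi>_def)
 also have "\<dots> \<le> (LBINT x. u0 x * \<Phi> x)"
  by (intro integral_mono w_Phi_integrable u0_Phi mult_right_mono w_le Phi_nonneg)
 finally show ?thesis .
qed

text \<open>Monotone convergence gives the supremum a finite \<Phi>-weighted integral, and \<Phi> >
  0 makes it finite almost everywhere.\<close>

lemma U_tendsto:
 assumes t: "t \<ge> 0"
 shows "AE x in lborel. (\<lambda>k. U k t x) \<longlonglongrightarrow> u t x \<and> incseq (\<lambda>k. U k t x) \<and> (\<forall>k. U k t x \<le> u t x)"
proof -
 have inc: "incseq (\<lambda>k. ennreal (Um k t x))" for x by (intro incseq_SucI ennreal_leI) simp
 have "(LBNN x. E t x * ennreal (\<Phi> x)) = (SUP k. LBNN x. ennreal (Um k t x) * ennreal (\<Phi> x))"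
  unfolding E_def SUP_mult_right_ennreal
 proof (rule nn_integral_monotone_convergence_SUP)
  show "incseq (\<lambda>k x. ennreal (Um k t x) * ennreal (\<Phi> x))"
   by (intro incseq_SucI le_funI mult_right_mono ennreal_leI) auto
  show "(\<lambda>x. ennreal (Um k t x) * ennreal (\<Phi> x)) \<in> borel_measurable lborel" for k
   by measurable
 qed
 also have "\<dots> \<le> ennreal (LBINT x. u0 x * \<Phi> x)"
 proof (rule SUP_least)
  fix k
  have "(LBNN x. ennreal (Um k t x) * ennreal (\<Phi> x)) = (LBNN x. ennreal (U k t x * \<Phi> x))"
   using Um_eq[OF t] by (intro nn_integral_cong_AE) (auto elim!: eventually_mono simp: ennreal_mult' Phi_nonneg mild_bounds[OF nice])
  also have "\<dots> = ennreal (LBINT x. U k t x * \<Phi> x)"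
   by (intro nn_integral_eq_integral U_Phi_integrable t) (auto simp: Phi_nonneg mild_bounds[OF nice])
  also have "\<dots> \<le> ennreal (LBINT x. u0 x * \<Phi> x)" by (intro ennreal_leI U_Phi_le t)
  finally show "(LBNN x. ennreal (Um k t x) * ennreal (\<Phi> x)) \<le> ennreal (LBINT x. u0 x * \<Phi> x)" .
 qed
 finally have "(LBNN x. E t x * ennreal (\<Phi> x)) \<noteq> \<infinity>" by (auto simp: top_unique)
 moreover have "(\<lambda>x. E t x * ennreal (\<Phi> x)) \<in> borel_measurable lborel"
  unfolding E_def by measurable
 ultimately have "AE x in lborel. E t x * ennreal (\<Phi> x) \<noteq> \<infinity>" by (rule nn_integral_noteq_infinite[rotated])
 thus ?thesis using Um_eq[OF t]
 proof eventually_elim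
  case (elim x)
  have fin: "E t x \<noteq> \<infinity>" using elim(1) Phi_pos[of x] by (auto simp: ennreal_mult_eq_top_iff)
  hence Eu: "E t x = ennreal (u t x)" by (simp add: u_def less_top)
  have "(\<lambda>k. ennreal (Um k t x)) \<longlonglongrightarrow> E t x" unfolding E_def by (rule LIMSEQ_SUP[OF inc])
  hence l: "(\<lambda>k. U k t x) \<longlonglongrightarrow> u t x"
   unfolding Eu by (subst (asm) tendsto_ennreal_iff) (use elim(2) u_nonneg mild_bounds[OF nice] in auto)
  moreover have i: "incseq (\<lambda>k. U k t x)" using elim(2) by (intro incseq_SucI) auto
  moreover have "\<forall>k. U k t x \<le> u t x" using incseq_le[OF i l] by blast
  ultimately show ?case by blast
 qed
qed

lemma u_Phi_integrable: "t \<ge> 0 \<Longrightarrow> Lint (\<lambda>x. u t x * \<Phi> x)"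
proof (rule L1_fatou(1)[OF U_Phi_integrable[of t]])
 assume t: "t \<ge> 0"
 show "(LBINT x. \<bar>U i t x * \<Phi> x\<bar>) \<le> (LBINT x. u0 x * \<Phi> x)" for i
  using U_Phi_le[OF t, of i] mild_bounds(1)[OF nice] Phi_nonneg by simp
 show "AE x in lborel. (\<lambda>k. U k t x * \<Phi> x) \<longlonglongrightarrow> u t x * \<Phi> x"
  using U_tendsto[OF t] by eventually_elim (auto intro!: tendsto_intros)
qed auto

definition eps :: "nat \<Rightarrow> real" where "eps k = (LBINT x. (u0 x - w k x) * \<Phi> x)"

lemma eps_lim: "eps \<longlonglongrightarrow> 0"
proof -
 have "(\<lambda>k. LBINT x. (u0 x - w k x) * \<Phi> x) \<longlonglongrightarrow> (\<integral>x. 0 \<partial>(lborel::'a measure))"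
 proof (rule integral_dominated_convergence[OF _ _ u0_Phi])
  show "AE x in lborel. (\<lambda>k. (u0 x - w k x) * \<Phi> x) \<longlonglongrightarrow> 0"
  proof (rule AE_I2)
   fix x
   have "(\<lambda>k. (u0 x - w k x) * \<Phi> x) \<longlonglongrightarrow> (u0 x - u0 x) * \<Phi> x" by (intro tendsto_intros w_lim)
   thus "(\<lambda>k. (u0 x - w k x) * \<Phi> x) \<longlonglongrightarrow> 0" by simp
  qed
  show "AE x in lborel. norm ((u0 x - w k x) * \<Phi> x) \<le> u0 x * \<Phi> x" for k
   using w_le[of k] w_nonneg[of k] Phi_nonneg by (intro AE_I2) (auto simp: abs_mult intro!: mult_right_mono)
 qed measurable
 thus ?thesis by (simp add: eps_def[abs_def])
qed

text \<open>Contraction in the excessive weight bounds the distance of U_(j+k) to U_k by that of the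
  data, and Fatou lets j tend to infinity. The bound \<open>eps k\<close> does not depend on
  t.\<close>

lemma u_U_close:
 assumes t: "t \<ge> 0"
 shows "Lint (\<lambda>x. (u t x - U k t x) * \<Phi> x)" "(LBINT x. \<bar>(u t x - U k t x) * \<Phi> x\<bar>) \<le> eps k"
proof -
 have I: "Lint (\<lambda>x. max 0 (U (j + k) t x - U k t x) * \<Phi> x)" for j
  using mild_integrable[OF nice t] by (intro excessive_integrable[OF excessive_Phi]) auto
 have b: "(LBINT x. \<bar>max 0 (U (j + k) t x - U k t x) * \<Phi> x\<bar>) \<le> eps k" for j
 proof -
  have "(LBINT x. \<bar>max 0 (U (j + k) t x - U k t x) * \<Phi> x\<bar>) = (LBINT x. max 0 (U (j + k) t x - U k t x) * \<Phi> x)"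
   by (simp add: Phi_nonneg)
  also have "\<dots> \<le> (LBINT x. max 0 (w (j + k) x - w k x) * \<Phi> x)"
   by (rule mild_contraction[OF nice nice excessive_Phi t])
  also have "\<dots> \<le> eps k" unfolding eps_def
  proof (rule integral_mono)
   show "Lint (\<lambda>x. max 0 (w (j + k) x - w k x) * \<Phi> x)"
    using w_integrable by (intro excessive_integrable[OF excessive_Phi]) auto
   show "Lint (\<lambda>x. (u0 x - w k x) * \<Phi> x)"
    using integrable_diff[OF u0_Phi w_Phi_integrable[of k]] by (simp add: left_diff_distrib)
   show "max 0 (w (j + k) x - w k x) * \<Phi> x \<le> (u0 x - w k x) * \<Phi> x" for x
    using w_le[of "j + k" x] w_le[of k x] by (intro mult_right_mono Phi_nonneg) auto
  qed
  finally show ?thesis .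
 qed
 have l: "AE x in lborel. (\<lambda>j. max 0 (U (j + k) t x - U k t x) * \<Phi> x) \<longlonglongrightarrow> (u t x - U k t x) * \<Phi> x"
  using U_tendsto[OF t]
 proof eventually_elim
  case (elim x)
  have "(\<lambda>j. max 0 (U (j + k) t x - U k t x) * \<Phi> x) \<longlonglongrightarrow> max 0 (u t x - U k t x) * \<Phi> x"
   using elim by (intro tendsto_intros tendsto_max LIMSEQ_ignore_initial_segment) auto
  moreover have "max 0 (u t x - U k t x) = u t x - U k t x" using elim by (simp add: max_def)
  ultimately show ?case by simp
 qed
 show "Lint (\<lambda>x. (u t x - U k t x) * \<Phi> x)" "(LBINT x. \<bar>(u t x - U k t x) * \<Phi> x\<bar>) \<le> eps k"
  by (rule L1_fatou[OF I b l], measurable)+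
qed

text \<open>A three-term estimate: u is within \<open>eps k\<close> of U_k at both times, and U_k is
  Lipschitz in L1 with the norm of \<open>g k\<close> as constant. That constant may grow with k, so
  k is fixed before the distance d.\<close>

lemma u_continuous:
 assumes t: "t \<ge> 0" and e: "e > 0"
 shows "\<exists>d>0. \<forall>r\<ge>0. \<bar>r - t\<bar> < d \<longrightarrow> (LBINT x. \<bar>u r x - u t x\<bar> * \<Phi> x) < e"
proof -
 have le: "(LBINT x. \<bar>u r x - u t x\<bar> * \<Phi> x) \<le> 2 * eps k + PhiB * (nL1 (g k) * \<bar>r - t\<bar>)" if r: "r \<ge> 0" for r k
 proof -
  have J: "Lint (\<lambda>x. PhiB * \<bar>U k r x - U k t x\<bar>)"
   using mild_integrable[OF nice r, of k] mild_integrable[OF nice t, of k] by auto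
  note c1 = u_U_close[OF r, of k] and c2 = u_U_close[OF t, of k]
  have "(LBINT x. \<bar>u r x - u t x\<bar> * \<Phi> x) \<le> (LBINT x. \<bar>(u r x - U k r x) * \<Phi> x\<bar> + \<bar>(u t x - U k t x) * \<Phi> x\<bar> + PhiB * \<bar>U k r x - U k t x\<bar>)"
  proof (rule integral_mono)
   have "Lint (\<lambda>x. \<bar>u r x * \<Phi> x - u t x * \<Phi> x\<bar>)"
    using u_Phi_integrable[OF r] u_Phi_integrable[OF t] by auto
   also have "(\<lambda>x. \<bar>u r x * \<Phi> x - u t x * \<Phi> x\<bar>) = (\<lambda>x. \<bar>u r x - u t x\<bar> * \<Phi> x)"
    using Phi_nonneg by (auto simp: left_diff_distrib[symmetric] abs_mult)
   finally show "Lint (\<lambda>x. \<bar>u r x - u t x\<bar> * \<Phi> x)" .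
   show "Lint (\<lambda>x. \<bar>(u r x - U k r x) * \<Phi> x\<bar> + \<bar>(u t x - U k t x) * \<Phi> x\<bar> + PhiB * \<bar>U k r x - U k t x\<bar>)"
    by (intro integrable_add integrable_abs c1(1) c2(1) J)
   fix x
   have "\<bar>u r x - u t x\<bar> \<le> \<bar>u r x - U k r x\<bar> + \<bar>u t x - U k t x\<bar> + \<bar>U k r x - U k t x\<bar>" by linarith
   hence "\<bar>u r x - u t x\<bar> * \<Phi> x \<le> (\<bar>u r x - U k r x\<bar> + \<bar>u t x - U k t x\<bar> + \<bar>U k r x - U k t x\<bar>) * \<Phi> x"
    by (rule mult_right_mono[OF _ Phi_nonneg])
   also have "\<dots> = \<bar>(u r x - U k r x) * \<Phi> x\<bar> + \<bar>(u t x - U k t x) * \<Phi> x\<bar> + \<Phi> x * \<bar>U k r x - U k t x\<bar>"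
   proof -
    have ab: "\<bar>a * \<Phi> x\<bar> = \<bar>a\<bar> * \<Phi> x" for a using Phi_nonneg[of x] by (simp add: abs_mult)
    show ?thesis unfolding ab by (simp only: distrib_right mult.commute[of "\<Phi> x"])
   qed
   also have "\<dots> \<le> \<bar>(u r x - U k r x) * \<Phi> x\<bar> + \<bar>(u t x - U k t x) * \<Phi> x\<bar> + PhiB * \<bar>U k r x - U k t x\<bar>"
    by (intro add_left_mono mult_right_mono Phi_le) simp
   finally show "\<bar>u r x - u t x\<bar> * \<Phi> x \<le> \<bar>(u r x - U k r x) * \<Phi> x\<bar> + \<bar>(u t x - U k t x) * \<Phi> x\<bar> + PhiB * \<bar>U k r x - U k t x\<bar>" .
  qed
  also have "\<dots> = (LBINT x. \<bar>(u r x - U k r x) * \<Phi> x\<bar>) + (LBINT x. \<bar>(u t x - U k t x) * \<Phi> x\<bar>) + PhiB * nL1 (\<lambda>x. U k r x - U k t x)"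
  proof -
   have i: "Lint (\<lambda>x. \<bar>(u r x - U k r x) * \<Phi> x\<bar>)" "Lint (\<lambda>x. \<bar>(u t x - U k t x) * \<Phi> x\<bar>)"
    using c1(1) c2(1) by (auto intro: integrable_abs)
   show ?thesis
    by (subst integral_add[OF integrable_add[OF i] J], subst integral_add[OF i]) simp
  qed
  also have "\<dots> \<le> eps k + eps k + PhiB * (nL1 (g k) * \<bar>r - t\<bar>)"
  proof (intro add_mono mult_left_mono c1(2) c2(2))
   show "nL1 (\<lambda>x. U k r x - U k t x) \<le> nL1 (g k) * \<bar>r - t\<bar>"
    using mild_lipschitz[OF nice r t, of k] by (simp add: D0_def[OF nice])
   show "0 \<le> PhiB" using order_trans[OF Phi_nonneg Phi_le] .
  qed
  finally show ?thesis by simp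
 qed
 obtain k where k: "eps k < e / 4" using order_tendstoD(2)[OF eps_lim, of "e / 4"] e by (auto simp: eventually_sequentially)
 \<comment> \<open>Adding 1 keeps L positive when the Lipschitz constant is 0.\<close>
 define L where "L = PhiB * nL1 (g k) + 1"
 have L: "L > 0" unfolding L_def using order_trans[OF Phi_nonneg Phi_le] by (intro add_nonneg_pos mult_nonneg_nonneg) auto
 show ?thesis
 proof (intro exI[of _ "e / (2 * L)"] conjI allI impI)
  show "0 < e / (2 * L)" using e L by simp
  fix r :: real assume r: "0 \<le> r" "\<bar>r - t\<bar> < e / (2 * L)"
  have "PhiB * (nL1 (g k) * \<bar>r - t\<bar>) \<le> L * \<bar>r - t\<bar>" unfolding L_def by (simp add: algebra_simps)
  also have "\<dots> \<le> L * (e / (2 * L))" using r L by (intro mult_left_mono) auto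
  also have "\<dots> = e / 2" using L by simp
  finally have "PhiB * (nL1 (g k) * \<bar>r - t\<bar>) \<le> e / 2" .
  moreover have "2 * eps k < e / 2" using k by simp
  ultimately show "(LBINT x. \<bar>u r x - u t x\<bar> * \<Phi> x) < e" using le[OF r(1), of k] by linarith
 qed
qed

lemma u_0: "u 0 x = u0 x"
proof -
 have "Um k 0 x = w k x" for k
  using w_mono by (induction k) (auto simp: mild_0[OF nice] max_def intro: antisym)
 hence "E 0 x = (SUP k. ennreal (w k x))" by (simp add: E_def)
 also have "\<dots> = ennreal (u0 x)"
  by (rule LIMSEQ_unique[OF LIMSEQ_SUP]) (auto intro!: incseq_SucI ennreal_leI w_mono tendsto_ennrealI w_lim)
 finally show ?thesis by (simp add: u_def u0_nonneg)
qed

text \<open>Stated in the extended nonnegative reals, where all three terms are monotone in k and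
  the limit needs no integrability; finiteness of the time integral is then read off from the
  right-hand side.\<close>

lemma nn_dual:
 assumes q: "gdom C q" and qn: "\<And>x. 0 \<le> q x" and t: "t \<ge> 0"
 shows "(LBNN \<tau>. indicator {0<..t} \<tau> * (LBNN x. ennreal (q x * u \<tau> x powr m))) + (LBNN x. ennreal (u t x * conv G q x))
   = (LBNN x. ennreal (u0 x * conv G q x))"
proof -
 let ?I = "\<lambda>k \<tau>. LBNN x. ennreal (q x * U k \<tau> x powr m)" and ?J = "\<lambda>\<tau>. LBNN x. ennreal (q x * u \<tau> x powr m)"
  and ?L = "\<lambda>k \<tau>. LBINT x. q x * U k \<tau> x powr m"
 have [measurable]: "q \<in> bm" by (rule gdom_measurable[OF q])
 have qB: "q x \<le> C" for x using gdom_bounded[OF q, of x] by simp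
 have gq: "0 \<le> conv G q x" for x unfolding conv_def by (intro integral_nonneg_AE AE_I2 mult_nonneg_nonneg kern_nonneg qn)
 have powm: "a powr m \<le> b powr m" if "0 \<le> a" "a \<le> b" for a b using that m_gt by (intro powr_mono2) auto
 define a where "a = (\<lambda>k. LBNN \<tau>. indicator {0<..t} \<tau> * ?I k \<tau>)"
 define b where "b = (\<lambda>k. LBNN x. ennreal (U k t x * conv G q x))"
 define c where "c = (\<lambda>k. LBNN x. ennreal (w k x * conv G q x))"
 have inner_mono: "?I k \<tau> \<le> ?I (Suc k) \<tau>" if "\<tau> \<ge> 0" for k \<tau>
  by (intro nn_integral_mono_AE, rule eventually_mono[OF U_mono[OF that, of k]])
    (auto intro!: ennreal_leI mult_left_mono powm qn mild_bounds[OF nice])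
 have inner: "?J \<tau> = (SUP k. LBNN x. ennreal (q x * U k \<tau> x powr m))" if tau: "\<tau> \<ge> 0" for \<tau>
 proof -
  have "?J \<tau> = (LBNN x. (SUP k. ennreal (q x * U k \<tau> x powr m)))"
  proof (rule nn_integral_cong_AE)
   show "AE x in lborel. ennreal (q x * u \<tau> x powr m) = (SUP k. ennreal (q x * U k \<tau> x powr m))"
    using U_tendsto[OF tau]
   proof eventually_elim
    case (elim x)
    have "(\<lambda>k. ennreal (q x * U k \<tau> x powr m)) \<longlonglongrightarrow> ennreal (q x * u \<tau> x powr m)"
     using elim m_gt by (intro tendsto_ennrealI tendsto_intros tendsto_powr2) (auto simp: mild_bounds[OF nice])
    moreover have "incseq (\<lambda>k. ennreal (q x * U k \<tau> x powr m))"
     using elim by (auto simp: incseq_def intro!: ennreal_leI mult_left_mono powm qn mild_bounds[OF nice])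
    ultimately show ?case using LIMSEQ_SUP LIMSEQ_unique by blast
   qed
  qed
  also have "\<dots> = (SUP k. LBNN x. ennreal (q x * U k \<tau> x powr m))"
  proof (rule nn_integral_monotone_convergence_SUP_AE)
   show "AE x in lborel. ennreal (q x * U k \<tau> x powr m) \<le> ennreal (q x * U (Suc k) \<tau> x powr m)" for k
    by (rule eventually_mono[OF U_mono[OF tau, of k]]) (auto intro!: ennreal_leI mult_left_mono powm qn mild_bounds[OF nice])
  qed measurable
  finally show ?thesis .
 qed
 have A: "(LBNN \<tau>. indicator {0<..t} \<tau> * ?J \<tau>) = (SUP k. a k)"
 proof -
  have "(LBNN \<tau>. indicator {0<..t} \<tau> * ?J \<tau>) =
    (LBNN \<tau>. (SUP k. indicator {0<..t} \<tau> * ?I k \<tau>))"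
  proof (rule nn_integral_cong)
   fix \<tau> :: real
   show "indicator {0<..t} \<tau> * ?J \<tau> = (SUP k. indicator {0<..t} \<tau> * ?I k \<tau>)"
    using inner[of \<tau>] by (cases "\<tau> \<in> {0<..t}") (auto simp: indicator_def)
  qed
  also have "\<dots> = (SUP k. a k)" unfolding a_def
  proof (rule nn_integral_monotone_convergence_SUP)
   show "incseq (\<lambda>k \<tau>. indicator {0<..t} \<tau> * ?I k \<tau>)"
    using inner_mono by (intro incseq_SucI le_funI) (auto simp: indicator_def)
  qed measurable
  finally show ?thesis .
 qed
 have B: "(LBNN x. ennreal (u t x * conv G q x)) = (SUP k. b k)"
 proof -
  have "(LBNN x. ennreal (u t x * conv G q x)) = (LBNN x. (SUP k. ennreal (U k t x * conv G q x)))"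
  proof (rule nn_integral_cong_AE)
   show "AE x in lborel. ennreal (u t x * conv G q x) = (SUP k. ennreal (U k t x * conv G q x))"
    using U_tendsto[OF t]
   proof eventually_elim
    case (elim x)
    have "(\<lambda>k. ennreal (U k t x * conv G q x)) \<longlonglongrightarrow> ennreal (u t x * conv G q x)"
     using elim by (intro tendsto_ennrealI tendsto_intros) auto
    moreover have "incseq (\<lambda>k. ennreal (U k t x * conv G q x))"
     using elim by (auto simp: incseq_def intro!: ennreal_leI mult_right_mono gq)
    ultimately show ?case using LIMSEQ_SUP LIMSEQ_unique by blast
   qed
  qed
  also have "\<dots> = (SUP k. b k)" unfolding b_def
  proof (rule nn_integral_monotone_convergence_SUP_AE)
   show "AE x in lborel. ennreal (U k t x * conv G q x) \<le> ennreal (U (Suc k) t x * conv G q x)" for k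
    by (rule eventually_mono[OF U_mono[OF t, of k]]) (auto intro!: ennreal_leI mult_right_mono gq)
  qed measurable
  finally show ?thesis .
 qed
 have Cc: "(LBNN x. ennreal (u0 x * conv G q x)) = (SUP k. c k)"
 proof -
  have "ennreal (u0 x * conv G q x) = (SUP k. ennreal (w k x * conv G q x))" for x
   by (rule LIMSEQ_unique[OF _ LIMSEQ_SUP]) (auto intro!: incseq_SucI ennreal_leI mult_right_mono gq w_mono tendsto_ennrealI tendsto_intros w_lim)
  thus ?thesis unfolding c_def
   by (simp, intro nn_integral_monotone_convergence_SUP) (auto intro!: incseq_SucI le_funI ennreal_leI mult_right_mono gq w_mono)
 qed
 have abc: "a k + b k = c k" for k
 proof -
  have Iq: "Lint q" by (rule gdom_integrable[OF q])
  have MM: "MM k > 0" using nice[of k] by (simp add: nice_def)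
  have i1: "Lint (\<lambda>x. q x * U k \<tau> x powr m)" for \<tau>
   by (rule chi_bounded_integrable[OF nice[of k] Iq qn qB, where C="MM k powr m"]) (auto intro!: powm mild_bounds[OF nice])
  have bd: "(?L k \<tau>) \<le> MM k powr m * (LBINT x. q x)" for \<tau>
  proof -
   have "(?L k \<tau>) \<le> (LBINT x. MM k powr m * q x)"
    using Iq by (intro integral_mono i1) (auto simp: mult.commute[of "MM k powr m"] intro!: mult_left_mono qn powm mild_bounds[OF nice])
   thus ?thesis by simp
  qed
  have nn1: "0 \<le> (?L k \<tau>)" for \<tau> by (intro integral_nonneg_AE) (auto simp: qn)
  have "a k = (LBNN \<tau>. ennreal (indicator {0<..t} \<tau> * (?L k \<tau>)))"
   unfolding a_def
  proof (rule nn_integral_cong)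
   fix \<tau>
   have "?I k \<tau> = ennreal (?L k \<tau>)"
    by (intro nn_integral_eq_integral i1) (auto simp: qn)
   thus "indicator {0<..t} \<tau> * ?I k \<tau> = ennreal (indicator {0<..t} \<tau> * (?L k \<tau>))"
    by (simp add: indicator_def)
  qed
  also have "\<dots> = ennreal (LBINT \<tau>. indicator {0<..t} \<tau> * (?L k \<tau>))"
  proof (rule nn_integral_eq_integral)
   show "Lint (\<lambda>\<tau>. indicator {0<..t} \<tau> * (?L k \<tau>))"
   proof (rule integrable_bound)
    show "Lint (\<lambda>\<tau>. (MM k powr m * (LBINT x. q x)) * indicator {0<..t} \<tau>)"
     by (intro integrable_mult_right integrable_indicator_Ioc)
    show "AE \<tau> in lborel. norm (indicator {0<..t} \<tau> * (?L k \<tau>)) \<le> norm ((MM k powr m * (LBINT x. q x)) * indicator {0<..t} \<tau>)"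
     using bd nn1 by (intro AE_I2) (auto simp: indicator_def intro: order_trans[OF _ abs_ge_self])
   qed measurable
  qed (use nn1 in auto)
  finally have ak: "a k = ennreal (LBINT \<tau>. indicator {0<..t} \<tau> * (?L k \<tau>))" .
  have bk: "b k = ennreal (LBINT x. U k t x * conv G q x)"
   unfolding b_def by (intro nn_integral_eq_integral gdom_conv_integrable[OF q] U_Phi_integrable t) (auto simp: mild_bounds[OF nice] gq)
  have ck: "c k = ennreal (LBINT x. w k x * conv G q x)"
   unfolding c_def by (intro nn_integral_eq_integral gdom_conv_integrable[OF q] w_Phi_integrable) (auto simp: w_nonneg gq)
  show ?thesis unfolding ak bk ck
   by (subst ennreal_plus[symmetric])
     (auto intro!: integral_nonneg_AE AE_I2 mult_nonneg_nonneg nn1 simp: mild_bounds[OF nice] gq mild_dual[OF nice Iq qn qB t])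
 qed
 have "incseq a" unfolding a_def using inner_mono by (intro incseq_SucI nn_integral_mono) (auto simp: indicator_def)
 moreover have "incseq b" unfolding b_def
  by (intro incseq_SucI nn_integral_mono_AE, rule eventually_mono[OF U_mono[OF t]]) (auto intro!: ennreal_leI mult_right_mono gq)
 ultimately have "(SUP k. a k) + (SUP k. b k) = (SUP k. a k + b k)" by (rule ennreal_SUP_add[symmetric])
 thus ?thesis unfolding A B Cc abc .
qed

text \<open>\<open>nn_dual\<close> for |q| supplies integrability of q u^m on the product space, as
  its right-hand side is finite. A signed q is handled through its positive and negative parts, both
  Gaussian dominated.\<close>

lemma
 assumes q: "gdom C q" and t: "t \<ge> 0"
 shows u_powr_integrable: "integrable lborel2 (\<lambda>(\<tau>, x). indicator {0<..t} \<tau> * (q x * u \<tau> x powr m))"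
  and u_dual: "(LBINT \<tau>. indicator {0<..t} \<tau> * (LBINT x. q x * u \<tau> x powr m)) + (LBINT x. u t x * conv G q x)
   = (LBINT x. u0 x * conv G q x)"
proof -
 let ?R = "\<lambda>p \<tau> x. indicator {0<..t} \<tau> * (p x * u \<tau> x powr m) :: real"
 let ?P = "\<lambda>p \<tau>. LBINT x. ?R p \<tau> x" and ?Q = "\<lambda>p \<tau>. indicator {0<..t} \<tau> * (LBINT x. p x * u \<tau> x powr m)"
 have [measurable]: "q \<in> bm" by (rule gdom_measurable[OF q])
 have I: "integrable lborel2 (\<lambda>(\<tau>, x). ?R p \<tau> x)" if p: "gdom C p" for p
 proof (rule integrableI_bounded)
  have [measurable]: "p \<in> bm" by (rule gdom_measurable[OF p])
  show "(\<lambda>(\<tau>, x). ?R p \<tau> x) \<in> borel_measurable lborel2" by measurable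
  have "(\<integral>\<^sup>+z. ennreal (norm (case z of (\<tau>, x) \<Rightarrow> ?R p \<tau> x)) \<partial>lborel2) =
   (LBNN \<tau>. (LBNN x. ennreal (norm (?R p \<tau> x))))"
   by (subst lborel.nn_integral_fst[symmetric]) (auto simp: case_prod_beta')
  also have "\<dots> = (LBNN \<tau>. indicator {0<..t} \<tau> * (LBNN x. ennreal (\<bar>p x\<bar> * u \<tau> x powr m)))"
   by (intro nn_integral_cong) (auto simp: indicator_def abs_mult)
  also have "\<dots> \<le> (LBNN x. ennreal (u0 x * conv G (\<lambda>x. \<bar>p x\<bar>) x))"
   unfolding nn_dual[OF gdom_abs[OF p] abs_ge_zero t, symmetric] by (rule add_increasing2) auto
  also have "\<dots> < \<infinity>"
  proof -
   have gq: "0 \<le> conv G (\<lambda>x. \<bar>p x\<bar>) x" for x unfolding conv_def by (intro integral_nonneg_AE AE_I2 mult_nonneg_nonneg kern_nonneg) auto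
   have "Lint (\<lambda>x. u0 x * conv G (\<lambda>x. \<bar>p x\<bar>) x)" by (rule gdom_conv_integrable[OF gdom_abs[OF p] u0_Phi]) measurable
   thus ?thesis using gq u0_nonneg by (subst nn_integral_eq_integral) auto
  qed
  finally show "(\<integral>\<^sup>+z. ennreal (norm (case z of (\<tau>, x) \<Rightarrow> ?R p \<tau> x)) \<partial>lborel2) < \<infinity>" .
 qed
 show "integrable lborel2 (\<lambda>(\<tau>, x). ?R q \<tau> x)" by (rule I[OF q])
 have pos: "(LBINT \<tau>. ?Q p \<tau>) + (LBINT x. u t x * conv G p x)
   = (LBINT x. u0 x * conv G p x)" if p: "gdom C p" and pn: "\<And>x. 0 \<le> p x" for p
 proof -
  have [measurable]: "p \<in> bm" by (rule gdom_measurable[OF p])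
  have gq: "0 \<le> conv G p x" for x unfolding conv_def by (intro integral_nonneg_AE AE_I2 mult_nonneg_nonneg kern_nonneg pn)
  have J: "Lint (\<lambda>\<tau>. ?P p \<tau>)"
   using lborel_pair.integrable_fst'[OF I[OF p]] by simp
  have ae: "AE \<tau> in lborel. Lint (\<lambda>x. ?R p \<tau> x)"
   using lborel_pair.AE_integrable_fst'[OF I[OF p]] by simp
  have "ennreal (LBINT \<tau>. ?Q p \<tau>)
   = (LBNN \<tau>. ennreal (?P p \<tau>))"
   using J by (subst nn_integral_eq_integral) (auto intro!: integral_nonneg_AE AE_I2 simp: pn)
  also have "\<dots> = (LBNN \<tau>. indicator {0<..t} \<tau> * (LBNN x. ennreal (p x * u \<tau> x powr m)))"
  proof (rule nn_integral_cong_AE)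
   show "AE \<tau> in lborel. ennreal (?P p \<tau>) = indicator {0<..t} \<tau> * (LBNN x. ennreal (p x * u \<tau> x powr m))"
    using ae
   proof eventually_elim
    case (elim \<tau>)
    show ?case
    proof (cases "\<tau> \<in> {0<..t}")
     case True
     thus ?thesis using elim by (subst nn_integral_eq_integral) (auto simp: pn)
    qed simp
   qed
  qed
  finally have 1: "ennreal (LBINT \<tau>. ?Q p \<tau>) = \<dots>" .
  have 2: "ennreal (LBINT x. u t x * conv G p x) = (LBNN x. ennreal (u t x * conv G p x))"
   by (intro nn_integral_eq_integral[symmetric] gdom_conv_integrable[OF p] u_Phi_integrable t) (auto simp: u_nonneg gq)
  have 3: "ennreal (LBINT x. u0 x * conv G p x) = (LBNN x. ennreal (u0 x * conv G p x))"
   by (intro nn_integral_eq_integral[symmetric] gdom_conv_integrable[OF p] u0_Phi) (auto simp: u0_nonneg gq)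
  have nn: "0 \<le> (LBINT \<tau>. ?Q p \<tau>)" "0 \<le> (LBINT x. u t x * conv G p x)" "0 \<le> (LBINT x. u0 x * conv G p x)"
   by (auto intro!: integral_nonneg_AE AE_I2 mult_nonneg_nonneg simp: pn gq u_nonneg u0_nonneg)
  have "ennreal ((LBINT \<tau>. ?Q p \<tau>) + (LBINT x. u t x * conv G p x)) = ennreal (LBINT x. u0 x * conv G p x)"
   using nn_dual[OF p pn t] nn unfolding 1[symmetric] 2[symmetric] 3[symmetric] by simp
  thus ?thesis using nn by (subst (asm) ennreal_inj) auto
 qed
 define p1 p2 where "p1 = (\<lambda>x. max 0 (q x))" and "p2 = (\<lambda>x. max 0 (- q x))"
 have p: "gdom C p1" "gdom C p2" "\<And>x. 0 \<le> p1 x" "\<And>x. 0 \<le> p2 x"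
  using gdom_pos[OF q] gdom_neg[OF q] by (auto simp: p1_def p2_def)
 have q12: "q = (\<lambda>x. 1 * p1 x + (-1) * p2 x)" by (auto simp: p1_def p2_def)
 have cq: "conv G q x = conv G p1 x - conv G p2 x" for x
 proof -
  have "Lint (\<lambda>y. G (x - y) * p1 y)" "Lint (\<lambda>y. G (x - y) * p2 y)"
   by (rule integrable_green_conv[OF gdom_integrable[OF p(1)] gdom_bounded[OF p(1)]],
     rule integrable_green_conv[OF gdom_integrable[OF p(2)] gdom_bounded[OF p(2)]])
  from conv_diff[OF this, of 1 "-1"] show ?thesis unfolding q12 by simp
 qed
 have J: "Lint (\<lambda>\<tau>. ?P p \<tau>)" if "gdom C p" for p
  using lborel_pair.integrable_fst'[OF I[OF that]] by simp
 have "(LBINT \<tau>. ?Q q \<tau>) =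
   (LBINT \<tau>. (?P p1 \<tau>) - (?P p2 \<tau>))"
 proof (rule integral_cong_AE)
  have [measurable]: "p1 \<in> bm" "p2 \<in> bm" using p by (auto intro: gdom_measurable)
  show "(\<lambda>\<tau>. (?P p1 \<tau>) - (?P p2 \<tau>)) \<in> borel_measurable lborel" by measurable
  show "(\<lambda>\<tau>. ?Q q \<tau>) \<in> borel_measurable lborel" by measurable
  have "AE \<tau> in lborel. Lint (\<lambda>x. ?R p1 \<tau> x)"
   "AE \<tau> in lborel. Lint (\<lambda>x. ?R p2 \<tau> x)"
   using lborel_pair.AE_integrable_fst'[OF I[OF p(1)]] lborel_pair.AE_integrable_fst'[OF I[OF p(2)]] by auto
  thus "AE \<tau> in lborel. ?Q q \<tau> = (?P p1 \<tau>) - (?P p2 \<tau>)"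
  proof eventually_elim
   case (elim \<tau>)
   show ?case
   proof (cases "\<tau> \<in> {0<..t}")
    case True
    thus ?thesis using elim unfolding q12 by (simp add: left_diff_distrib)
   qed simp
  qed
 qed
 also have "\<dots> = (LBINT \<tau>. (?P p1 \<tau>)) - (LBINT \<tau>. (?P p2 \<tau>))"
  by (intro integral_diff J p)
 finally have e1: "(LBINT \<tau>. ?Q q \<tau>) =
  (LBINT \<tau>. ?Q p1 \<tau>) - (LBINT \<tau>. ?Q p2 \<tau>)"
  by simp
 have e2: "(LBINT x. f x * conv G q x) = (LBINT x. f x * conv G p1 x) - (LBINT x. f x * conv G p2 x)"
  if "Lint (\<lambda>x. f x * \<Phi> x)" "f \<in> bm" for f
  unfolding cq right_diff_distrib using that p by (intro integral_diff gdom_conv_integrable[OF p(1)] gdom_conv_integrable[OF p(2)]) auto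
 have "u t \<in> bm" by measurable
 thus "(LBINT \<tau>. ?Q q \<tau>) + (LBINT x. u t x * conv G q x)
   = (LBINT x. u0 x * conv G q x)"
  unfolding e1 e2[OF u0_Phi measurable_u0] using e2[OF u_Phi_integrable[OF t]] pos[OF p(1,3)] pos[OF p(2,4)] by simp
qed

end

section \<open>Gaussian subsolutions\<close>

lemma ft_shift:
 fixes f :: "'a::euclidean_space \<Rightarrow> real"
 assumes "Lint f"
 shows "ft (\<lambda>x. f (x - c)) \<xi> = cis (- (c \<bullet> \<xi>)) * ft f \<xi>"
proof -
 have "ft (\<lambda>x. f (x - c)) \<xi> = (LBINT x. cis (- (c \<bullet> \<xi>)) * (complex_of_real (f (x - c)) * cis (- ((x - c) \<bullet> \<xi>))))"
  unfolding ft_def by (intro integral_cong refl) (simp add: cis_mult inner_diff_left mult.left_commute)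
 also have "\<dots> = cis (- (c \<bullet> \<xi>)) * (LBINT x. complex_of_real (f (x - c)) * cis (- ((x - c) \<bullet> \<xi>)))" by simp
 also have "(LBINT x. complex_of_real (f (x - c)) * cis (- ((x - c) \<bullet> \<xi>))) = ft f \<xi>"
  unfolding ft_def by (rule integral_lborel_shift[OF integrable_ft[OF assms]]) measurable
 finally show ?thesis .
qed

lemma powr_subadd:
 fixes a b r :: real
 assumes "0 \<le> a" "0 \<le> b" "0 < r" "r \<le> 1"
 shows "(a + b) powr r \<le> a powr r + b powr r"
proof (cases "a = 0 \<or> b = 0")
 case False
 hence p: "a > 0" "b > 0" using assms by auto
 have "(a + b) powr r = a * (a + b) powr (r - 1) + b * (a + b) powr (r - 1)"
 proof -
  have "(a + b) powr r = (a + b) * (a + b) powr (r - 1)" using p by (simp add: powr_diff)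
  thus ?thesis by (simp only: distrib_right)
 qed
 also have "\<dots> \<le> a * a powr (r - 1) + b * b powr (r - 1)"
  using p assms by (intro add_mono mult_left_mono powr_mono2') auto
 also have "\<dots> = a powr r + b powr r" using p by (simp add: powr_diff)
 finally show ?thesis .
qed (use assms in auto)

lemma powr_sum_subadd:
 fixes f :: "'i \<Rightarrow> real"
 assumes "finite I" "\<And>i. i \<in> I \<Longrightarrow> 0 \<le> f i" "0 < r" "r \<le> 1"
 shows "(\<Sum>i\<in>I. f i) powr r \<le> (\<Sum>i\<in>I. f i powr r)"
 using assms(1,2)
proof (induction I)
 case (insert i I)
 have "(f i + (\<Sum>i\<in>I. f i)) powr r \<le> f i powr r + (\<Sum>i\<in>I. f i) powr r"
  using insert assms by (intro powr_subadd sum_nonneg) auto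
 thus ?case using insert by (auto intro: order_trans)
qed simp

context frac
begin

lemma fpair_shift: "fpair w g \<Longrightarrow> fpair (\<lambda>x. w (x - c)) (\<lambda>x. g (x - c))"
 unfolding fpair_def by (auto simp: ft_shift intro!: integrable_lborel_shift)

section \<open>Gaussians under the heat flow\<close>

definition gss :: "real \<Rightarrow> 'a \<Rightarrow> real" where "gss a x = exp (- a * (norm x)\<^sup>2)"

text \<open>\<open>gev a t\<close> is the solution of the heat equation at time \<open>t\<close> starting from \<open>gss a\<close>.\<close>

definition gev :: "real \<Rightarrow> real \<Rightarrow> 'a \<Rightarrow> real" where
 "gev a t x = (1 + 4 * a * t) powr (- n / 2) * exp (- (a / (1 + 4 * a * t)) * (norm x)\<^sup>2)"

lemma measurable_gss [measurable]: "gss a \<in> bm" unfolding gss_def by measurable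

lemma measurable_gev [measurable (raw)]:
 assumes [measurable]: "f \<in> borel_measurable N" "h \<in> borel_measurable N"
 shows "(\<lambda>x. gev a (f x) (h x)) \<in> borel_measurable N"
 unfolding gev_def by measurable

lemma gss_pos: "0 < gss a x" by (simp add: gss_def)

context
 fixes a :: real assumes a: "a > 0"
begin

lemma integrable_gss: "Lint (gss a)" unfolding gss_def by (rule integrable_gauss[OF a])

lemma gss_le_1: "gss a x \<le> 1" using a by (simp add: gss_def)

lemma a_t_pos: "t \<ge> 0 \<Longrightarrow> 1 + 4 * a * t > 0" using a by (simp add: add_pos_nonneg)

lemma integrable_gev: "t \<ge> 0 \<Longrightarrow> Lint (gev a t)"
 unfolding gev_def using a a_t_pos[of t] by (intro integrable_mult_right integrable_gauss divide_pos_pos)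

lemma ft_gev:
 assumes t: "t \<ge> 0"
 shows "ft (gev a t) \<xi> = complex_of_real (exp (- t * (norm \<xi>)\<^sup>2)) * ft (gss a) \<xi>"
proof -
 define b where "b = 1 + 4 * a * t"
 have b: "b > 0" unfolding b_def by (rule a_t_pos[OF t])
 have ab: "a / b > 0" using a b by simp
 have e: "(norm \<xi>)\<^sup>2 / (4 * (a / b)) = t * (norm \<xi>)\<^sup>2 + (norm \<xi>)\<^sup>2 / (4 * a)"
  using a b by (simp add: b_def field_simps)
 have p: "b powr (- n / 2) * sqrt (pi / (a / b)) ^ DIM('a) = sqrt (pi / a) ^ DIM('a)"
 proof -
  have "sqrt (pi / (a / b)) ^ DIM('a) = sqrt (pi / a) ^ DIM('a) * sqrt b ^ DIM('a)"
   by (simp add: power_mult_distrib[symmetric] real_sqrt_mult[symmetric])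
  also have "sqrt b ^ DIM('a) = b powr (n / 2)" using b by (simp add: sqrt_power_powr dim_eq)
  finally show ?thesis using b by (simp add: powr_minus field_simps)
 qed
 have "ft (gev a t) \<xi> = complex_of_real (b powr (- n / 2)) * ft (\<lambda>x. exp (- (a / b) * (norm x)\<^sup>2)) \<xi>"
  unfolding gev_def b_def[symmetric] by (rule ft_scale)
 also have "\<dots> = complex_of_real ((b powr (- n / 2) * sqrt (pi / (a / b)) ^ DIM('a)) * exp (- (norm \<xi>)\<^sup>2 / (4 * (a / b))))"
  unfolding ft_gauss[OF ab] by simp
 also have "\<dots> = complex_of_real (exp (- t * (norm \<xi>)\<^sup>2)) * complex_of_real (sqrt (pi / a) ^ DIM('a) * exp (- (norm \<xi>)\<^sup>2 / (4 * a)))"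
  unfolding p using e by (simp add: exp_add[symmetric] mult_ac add.commute flip: of_real_mult)
 also have "complex_of_real (sqrt (pi / a) ^ DIM('a) * exp (- (norm \<xi>)\<^sup>2 / (4 * a))) = ft (gss a) \<xi>"
  unfolding gss_def using ft_gauss[OF a, of \<xi>] by simp
 finally show ?thesis .
qed

lemma integral_gev: "t \<ge> 0 \<Longrightarrow> (LBINT x. gev a t x) = (LBINT x. gss a x)"
proof -
 assume t: "t \<ge> 0"
 have "complex_of_real (LBINT x. gev a t x) = complex_of_real (LBINT x. gss a x)"
  using ft_gev[OF t, of 0] unfolding ft_def by simp
 thus ?thesis by (simp only: of_real_eq_iff)
qed

definition mn :: "real \<Rightarrow> real" where "mn t = min 1 (2 * n * a * t)"

lemma mn_nonneg: "t \<ge> 0 \<Longrightarrow> 0 \<le> mn t" using a n_pos by (simp add: mn_def)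

text \<open>The flow widens the Gaussian, so it lies above b^(-n/2) times the initial one, and 1 -
  b^(-n/2) <= 1 - exp(- 2 n a t) <= 2 n a t. The relative loss is independent of x, whence
  (-\<Delta>)^s F <= \<epsilon> F pointwise.\<close>

lemma gss_gev_le:
 assumes t: "t \<ge> 0" shows "gss a x - gev a t x \<le> mn t * gss a x"
proof -
 define b where "b = 1 + 4 * a * t"
 have b: "b \<ge> 1" using a t by (simp add: b_def)
 have "gss a x \<le> exp (- (a / b) * (norm x)\<^sup>2)"
 proof -
  have "a / b \<le> a" using a b by (simp add: divide_le_eq mult_le_cancel_left1)
  hence "a / b * (norm x)\<^sup>2 \<le> a * (norm x)\<^sup>2" by (intro mult_right_mono) auto
  thus ?thesis by (simp add: gss_def)
 qed
 hence "b powr (- n / 2) * gss a x \<le> gev a t x"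
  unfolding gev_def b_def[symmetric] by (intro mult_left_mono) auto
 moreover have "1 - b powr (- n / 2) \<le> mn t"
 proof -
  have "ln b \<le> 4 * a * t" using ln_le_minus_one[of b] b by (simp add: b_def)
  hence "n / 2 * ln b \<le> n / 2 * (4 * a * t)" using n_pos by (intro mult_left_mono) auto
  also have "\<dots> = 2 * n * a * t" by simp
  finally have "exp (- (2 * n * a * t)) \<le> exp (- n / 2 * ln b)" by simp
  also have "\<dots> = b powr (- n / 2)" using b by (simp add: powr_def)
  finally have "exp (- (2 * n * a * t)) \<le> b powr (- n / 2)" .
  moreover have "1 - exp (- (2 * n * a * t)) \<le> 2 * n * a * t" using exp_ge_add_one_self[of "- (2 * n * a * t)"] by simp
  ultimately show ?thesis by (simp add: mn_def)
 qed
 hence "(1 - b powr (- n / 2)) * gss a x \<le> mn t * gss a x" using gss_pos by (intro mult_right_mono) (auto intro: less_imp_le)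
 ultimately show ?thesis by (simp add: algebra_simps)
qed

text \<open>The heat flow preserves the integral, so the L1 norm of the difference is twice the
  integral of its positive part.\<close>

lemma nL1_gss_gev:
 assumes t: "t \<ge> 0" shows "nL1 (\<lambda>x. gss a x - gev a t x) \<le> 2 * mn t * (LBINT x. gss a x)"
proof -
 have I: "Lint (\<lambda>x. gss a x - gev a t x)" using integrable_gss integrable_gev[OF t] by auto
 have "nL1 (\<lambda>x. gss a x - gev a t x) = (LBINT x. 2 * max 0 (gss a x - gev a t x) - (gss a x - gev a t x))"
  by (intro integral_cong refl) (simp add: max_def abs_if)
 also have "\<dots> = 2 * (LBINT x. max 0 (gss a x - gev a t x))"
  using I integrable_gss integrable_gev[OF t] integral_gev[OF t] by simp
 also have "(LBINT x. max 0 (gss a x - gev a t x)) \<le> (LBINT x. mn t * gss a x)"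
 proof (rule integral_mono)
  show "Lint (\<lambda>x. max 0 (gss a x - gev a t x))" "Lint (\<lambda>x. mn t * gss a x)"
   using I integrable_gss by auto
  show "max 0 (gss a x - gev a t x) \<le> mn t * gss a x" for x
   using gss_gev_le[OF t, of x] mult_nonneg_nonneg[OF mn_nonneg[OF t] less_imp_le[OF gss_pos[of a x]]] by simp
 qed
 finally show ?thesis by simp
qed

end

lemma integrable_min_powr:
 assumes s1: "s < 1" and b: "b \<ge> 0"
 shows "Lint (\<lambda>t. indicator {0<..} t * (min 1 (b * t) * t powr (- 1 - s)))"
proof -
 have h1: "((\<lambda>t. t powr (- s)) has_integral (1 powr (- s + 1) / (- s + 1))) {0..1}"
  using s1 by (intro has_integral_powr_from_0) auto
 have h2: "((\<lambda>t. t powr (- 1 - s)) has_integral - (1 powr (- 1 - s + 1)) / (- 1 - s + 1)) {1..}"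
  using s_pos by (intro has_integral_powr_to_inf) auto
 have n1: "(LBNN t. ennreal (t powr (- s)) * indicator {0..1} t) < \<infinity>"
  using nn_integral_has_integral_lebesgue'[OF _ h1] by simp
 have n2: "(LBNN t. ennreal (t powr (- 1 - s)) * indicator {1..} t) < \<infinity>"
  using nn_integral_has_integral_lebesgue'[OF _ h2] by simp
 show ?thesis
 proof (rule integrableI_bounded)
  have "(LBNN t. ennreal (norm (indicator {0<..} t * (min 1 (b * t) * t powr (- 1 - s)))))
   \<le> (LBNN t. ennreal b * (ennreal (t powr (- s)) * indicator {0..1} t) + ennreal (t powr (- 1 - s)) * indicator {1..} t)"
  proof (rule nn_integral_mono)
   fix t :: real
   show "ennreal (norm (indicator {0<..} t * (min 1 (b * t) * t powr (- 1 - s)))) \<le> ennreal b * (ennreal (t powr (- s)) * indicator {0..1} t) + ennreal (t powr (- 1 - s)) * indicator {1..} t"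
   proof (cases "t > 0")
    case True
    have nn: "0 \<le> min 1 (b * t)" using True b by simp
    show ?thesis
    proof (cases "t \<le> 1")
     case t1: True
     have "min 1 (b * t) * t powr (- 1 - s) \<le> (b * t) * t powr (- 1 - s)" by (intro mult_right_mono) auto
     also have "\<dots> = b * t powr (- s)" using True by (simp add: powr_diff powr_minus field_simps)
     finally have "ennreal (norm (indicator {0<..} t * (min 1 (b * t) * t powr (- 1 - s)))) \<le> ennreal b * (ennreal (t powr (- s)) * indicator {0..1} t)"
      using True t1 nn b by (simp add: ennreal_mult'[symmetric] abs_mult ennreal_leI)
     thus ?thesis by (rule order_trans) simp
    next
     case False
     have "min 1 (b * t) * t powr (- 1 - s) \<le> 1 * t powr (- 1 - s)" by (intro mult_right_mono) auto
     thus ?thesis using True False nn by (simp add: abs_mult ennreal_leI)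
    qed
   qed simp
  qed
  also have "\<dots> < \<infinity>" using n1 n2 by (simp add: nn_integral_add nn_integral_cmult ennreal_mult_less_top)
  finally show "(LBNN t. ennreal (norm (indicator {0<..} t * (min 1 (b * t) * t powr (- 1 - s))))) < \<infinity>" .
 qed measurable
qed

text \<open>By scaling this is r^s times its value at r = 1 (\<open>lk_scale\<close>). It turns
  powers of |\<xi>|^2 into differences w - exp(t \<Delta>) w, as in Balakrishnan's formula.\<close>

definition lk :: "real \<Rightarrow> real" where "lk r = (LBINT t. indicator {0<..} t * ((1 - exp (- (r * t))) * t powr (- 1 - s)))"

lemma lk_integrable:
 assumes s1: "s < 1" and r: "r \<ge> 0"
 shows "Lint (\<lambda>t. indicator {0<..} t * ((1 - exp (- (r * t))) * t powr (- 1 - s)))"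
proof (rule integrable_bound[OF integrable_min_powr[OF s1 r]])
 show "AE t in lborel. norm (indicator {0<..} t * ((1 - exp (- (r * t))) * t powr (- 1 - s))) \<le> norm (indicator {0<..} t * (min 1 (r * t) * t powr (- 1 - s)))"
 proof (rule AE_I2)
  fix t :: real
  show "norm (indicator {0<..} t * ((1 - exp (- (r * t))) * t powr (- 1 - s))) \<le> norm (indicator {0<..} t * (min 1 (r * t) * t powr (- 1 - s)))"
  proof (cases "t > 0")
   case True
   have "0 \<le> 1 - exp (- (r * t))" using True r by simp
   moreover have "1 - exp (- (r * t)) \<le> min 1 (r * t)" using exp_ge_add_one_self[of "- (r * t)"] by simp
   ultimately show ?thesis using True by (simp add: abs_mult mult_right_mono)
  qed simp
 qed
qed measurable

lemma lk_scale:
 assumes s1: "s < 1" and r: "r \<ge> 0"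
 shows "lk r = r powr s * lk 1"
proof (cases "r = 0")
 case False
 hence r0: "r > 0" using r by simp
 define f where "f = (\<lambda>t. indicator {0<..} t * ((1 - exp (- (1 * t))) * t powr (- 1 - s)))"
 have "lk 1 = (LBINT t. f t)" by (simp add: lk_def f_def)
 also have "\<dots> = r *\<^sub>R (LBINT t. f (0 + r * t))"
  using lborel_integral_real_affine[of r f 0] r0 by simp
 also have "(\<lambda>t. f (0 + r * t)) = (\<lambda>t. r powr (- 1 - s) * (indicator {0<..} t * ((1 - exp (- (r * t))) * t powr (- 1 - s))))"
  using r0 by (auto simp: f_def fun_eq_iff indicator_def powr_mult zero_less_mult_iff)
 also have "r *\<^sub>R (LBINT t. r powr (- 1 - s) * (indicator {0<..} t * ((1 - exp (- (r * t))) * t powr (- 1 - s)))) = (r * r powr (- 1 - s)) * lk r"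
  by (simp add: lk_def)
 also have "r * r powr (- 1 - s) = r powr (- s)" using r0 by (simp add: powr_diff powr_minus field_simps)
 finally show ?thesis using r0 by (simp add: powr_minus field_simps)
qed (simp add: lk_def)

lemma lk_pos: assumes s1: "s < 1" shows "lk 1 > 0"
proof -
 let ?f = "\<lambda>t. indicator {0<..} t * ((1 - exp (- (1 * t))) * t powr (- 1 - s))"
 have I: "Lint ?f" by (rule lk_integrable[OF s1]) simp
 have nn: "AE t in lborel. 0 \<le> ?f t" by (intro AE_I2) (auto simp: indicator_def)
 have "lk 1 \<noteq> 0"
 proof
  assume "lk 1 = 0"
  hence "AE t in lborel. ?f t = 0" using integral_nonneg_eq_0_iff_AE[OF I nn] by (simp add: lk_def)
  hence "AE t in lborel. t \<notin> {1..2::real}" by eventually_elim (auto simp: indicator_def)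
  hence "emeasure lborel {1..2::real} = 0" by (subst (asm) AE_iff_measurable[of "{1..2::real}"]) auto
  thus False by simp
 qed
 moreover have "lk 1 \<ge> 0" unfolding lk_def by (intro integral_nonneg_AE nn)
 ultimately show ?thesis by simp
qed

text \<open>Balakrishnan's formula: (-\<Delta>)^s w is the integral of (w - exp(t \<Delta>) w)
  t^(-1-s) divided by \<open>lk 1\<close>. For a Gaussian the integrand is bounded by
  \<open>gss_gev_le\<close>, so the fractional Laplacian is at most a constant times the Gaussian
  itself.\<close>

lemma gauss_fpair_lt1:
 assumes s1: "s < 1" and a: "a > 0"
 shows "\<exists>g. fpair (gss a) g \<and> (\<forall>x. g x \<le> (LBINT t. indicator {0<..} t * (min 1 (2 * n * a * t) * t powr (- 1 - s))) / lk 1 * gss a x)"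
proof -
 define I where "I = (LBINT x. gss a x)"
 define h where "h = (\<lambda>t x. indicator {0<..} t * ((gss a x - gev a t x) * t powr (- 1 - s)))"
 have bI: "Lint (\<lambda>t. indicator {0<..} t * (min 1 (2 * n * a * t) * t powr (- 1 - s)))"
  using a n_pos by (intro integrable_min_powr s1) auto
 have hI: "integrable lborel2 (\<lambda>(t, x). h t x)"
 proof (rule lborel_pair.Fubini_integrable)
  show "(\<lambda>(t, x). h t x) \<in> borel_measurable lborel2" unfolding h_def by measurable
  show "Lint (\<lambda>t. LBINT x. norm (case (t, x) of (t, x) \<Rightarrow> h t x))"
  proof (rule integrable_bound)
   show "Lint (\<lambda>t. 2 * I * (indicator {0<..} t * (min 1 (2 * n * a * t) * t powr (- 1 - s))))"
    using bI by (rule integrable_mult_right)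
   show "(\<lambda>t. LBINT x. norm (case (t, x) of (t, x) \<Rightarrow> h t x)) \<in> borel_measurable lborel" unfolding h_def by measurable
   show "AE t in lborel. norm (LBINT x. norm (case (t, x) of (t, x) \<Rightarrow> h t x)) \<le> norm (2 * I * (indicator {0<..} t * (min 1 (2 * n * a * t) * t powr (- 1 - s))))"
   proof (rule AE_I2)
    fix t :: real
    show "norm (LBINT x. norm (case (t, x) of (t, x) \<Rightarrow> h t x)) \<le> norm (2 * I * (indicator {0<..} t * (min 1 (2 * n * a * t) * t powr (- 1 - s))))"
    proof (cases "t > 0")
     case True
     have "(LBINT x. norm (h t x)) = t powr (- 1 - s) * nL1 (\<lambda>x. gss a x - gev a t x)"
      using True by (simp add: h_def abs_mult mult.commute)
     also have "\<dots> \<le> t powr (- 1 - s) * (2 * mn a t * I)"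
      unfolding I_def using nL1_gss_gev[OF a, of t] True by (intro mult_left_mono) auto
     finally have "(LBINT x. norm (h t x)) \<le> 2 * I * (indicator {0<..} t * (min 1 (2 * n * a * t) * t powr (- 1 - s)))"
      using True by (simp add: mn_def[OF a] mult_ac)
     moreover have "0 \<le> (LBINT x. norm (h t x))" by simp
     ultimately show ?thesis unfolding prod.case by (simp only: real_norm_def abs_of_nonneg)
    qed (simp add: h_def)
   qed
  qed
  show "AE t in lborel. Lint (\<lambda>x. case (t, x) of (t, x) \<Rightarrow> h t x)"
  proof (rule AE_I2)
   fix t :: real
   show "Lint (\<lambda>x. case (t, x) of (t, x) \<Rightarrow> h t x)"
    using integrable_gss[OF a] integrable_gev[OF a, of t] by (cases "t > 0") (auto simp: h_def)
  qed
 qed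
 define g where "g = (\<lambda>x. (LBINT t. h t x) / lk 1)"
 have gI: "Lint g" unfolding g_def using lborel_pair.integrable_snd[OF hI] by simp
 have ftg: "ft g \<xi> = complex_of_real (norm \<xi> powr (2 * s)) * ft (gss a) \<xi>" for \<xi>
 proof -
  define r where "r = (norm \<xi>)\<^sup>2"
  define H where "H = (\<lambda>t x. complex_of_real (h t x) * cis (- (x \<bullet> \<xi>)))"
  have HI: "integrable lborel2 (\<lambda>(t, x). H t x)"
  proof (rule integrable_bound[OF hI])
   show "(\<lambda>(t, x). H t x) \<in> borel_measurable lborel2" unfolding H_def h_def by measurable
  qed (auto simp: H_def norm_mult)
  have "ft (\<lambda>x. LBINT t. h t x) \<xi> = (LBINT x. (LBINT t. H t x))"
  proof -
   have "complex_of_real (LBINT t. h t x) * cis (- (x \<bullet> \<xi>)) = (LBINT t. H t x)" for x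
    by (simp add: H_def flip: integral_complex_of_real)
   thus ?thesis by (simp add: ft_def)
  qed
  also have "\<dots> = (LBINT t. (LBINT x. H t x))" by (rule lborel_pair.Fubini_integral[OF HI])
  also have "\<dots> = (LBINT t. complex_of_real (indicator {0<..} t * ((1 - exp (- (r * t))) * t powr (- 1 - s))) * ft (gss a) \<xi>)"
  proof (rule integral_cong[OF refl])
   fix t :: real
   show "(LBINT x. H t x) = complex_of_real (indicator {0<..} t * ((1 - exp (- (r * t))) * t powr (- 1 - s))) * ft (gss a) \<xi>"
   proof (cases "t > 0")
    case True
    have "(LBINT x. H t x) = ft (\<lambda>x. t powr (- 1 - s) * (1 * gss a x + (-1) * gev a t x)) \<xi>"
     using True by (simp add: H_def h_def ft_def mult.commute)
    also have "\<dots> = complex_of_real (t powr (- 1 - s)) * (ft (gss a) \<xi> - ft (gev a t) \<xi>)"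
     unfolding ft_scale using True by (subst ft_add) (auto intro: integrable_gss[OF a] integrable_gev[OF a])
    also have "\<dots> = complex_of_real (indicator {0<..} t * ((1 - exp (- (r * t))) * t powr (- 1 - s))) * ft (gss a) \<xi>"
     using True by (simp add: ft_gev[OF a] r_def algebra_simps)
    finally show ?thesis .
   qed (simp add: H_def h_def)
  qed
  also have "\<dots> = complex_of_real (lk r) * ft (gss a) \<xi>"
   unfolding integral_mult_left_zero integral_complex_of_real lk_def ..
  also have "lk r = r powr s * lk 1" by (rule lk_scale[OF s1]) (simp add: r_def)
  also have "r powr s = norm \<xi> powr (2 * s)"
  proof (cases "\<xi> = 0")
   case False
   hence "r = norm \<xi> powr 2" by (simp add: r_def)
   thus ?thesis by (simp only: powr_powr)
  qed (use s_pos in \<open>simp add: r_def\<close>)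
  finally have "ft (\<lambda>x. LBINT t. h t x) \<xi> = complex_of_real (norm \<xi> powr (2 * s) * lk 1) * ft (gss a) \<xi>" .
  thus ?thesis unfolding g_def using ft_scale[of "1 / lk 1" "\<lambda>x. LBINT t. h t x" \<xi>] lk_pos[OF s1] by simp
 qed
 have "g x \<le> (LBINT t. indicator {0<..} t * (min 1 (2 * n * a * t) * t powr (- 1 - s))) / lk 1 * gss a x" for x
 proof -
  have "(LBINT t. h t x) \<le> (LBINT t. indicator {0<..} t * (min 1 (2 * n * a * t) * t powr (- 1 - s)) * gss a x)"
  proof (cases "Lint (\<lambda>t. h t x)")
   case True
   show ?thesis
   proof (rule integral_mono[OF True])
    show "Lint (\<lambda>t. indicator {0<..} t * (min 1 (2 * n * a * t) * t powr (- 1 - s)) * gss a x)"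
     using bI by (rule integrable_mult_left)
    fix t :: real
    show "h t x \<le> indicator {0<..} t * (min 1 (2 * n * a * t) * t powr (- 1 - s)) * gss a x"
    proof (cases "t > 0")
     case True
     have "(gss a x - gev a t x) * t powr (- 1 - s) \<le> (mn a t * gss a x) * t powr (- 1 - s)"
      using True by (intro mult_right_mono gss_gev_le[OF a]) auto
     thus ?thesis using True by (simp add: h_def mn_def[OF a] mult_ac)
    qed (simp add: h_def)
   qed
  next
   \<comment> \<open>If the time integral diverges at x, its value is 0 by convention, and the bound
     holds because the right-hand side is nonnegative.\<close>
   case False
   have "0 \<le> (LBINT t. indicator {0<..} t * (min 1 (2 * n * a * t) * t powr (- 1 - s)) * gss a x)"
    using gss_pos[of a x] a n_pos by (intro integral_nonneg_AE AE_I2) (auto simp: indicator_def)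
   with False show ?thesis by (simp add: not_integrable_integral_eq)
  qed
  also have "\<dots> = (LBINT t. indicator {0<..} t * (min 1 (2 * n * a * t) * t powr (- 1 - s))) * gss a x"
   by (rule integral_mult_left_zero)
  finally show ?thesis unfolding g_def using lk_pos[OF s1] by (simp add: divide_right_mono)
 qed
 with gI ftg integrable_gss[OF a] show ?thesis unfolding fpair_def by blast
qed

text \<open>The classical -\<Delta> of the Gaussian is identified on the Fourier side as the limit
  of the difference quotients (w - exp(t \<Delta>) w)/t, both pointwise and under the
  integral.\<close>

lemma gauss_fpair_1:
 assumes s1: "s = 1" and a: "a > 0"
 shows "\<exists>g. fpair (gss a) g \<and> (\<forall>x. g x \<le> 2 * n * a * gss a x)"
proof -
 define g where "g = (\<lambda>x. (2 * n * a - 4 * a\<^sup>2 * (norm x)\<^sup>2) * gss a x)"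
 \<comment> \<open>Times tending to 0 with 4 a d <= 1, so that the widening factor b = 1 + 4 a d
   stays between 1 and 2.\<close>
 define d where "d = (\<lambda>i. min 1 (1 / (4 * a)) / real (Suc i))"
 have c0: "min 1 (1 / (4 * a)) > 0" using a by simp
 have d0: "d i > 0" for i unfolding d_def by (rule divide_pos_pos[OF c0]) simp
 have d1: "4 * a * d i \<le> 1" for i
 proof -
  have "d i \<le> min 1 (1 / (4 * a))" unfolding d_def using c0 divide_left_mono[of 1 "real (Suc i)" "min 1 (1 / (4 * a))"] by simp
  also have "\<dots> \<le> 1 / (4 * a)" by simp
  finally show ?thesis using a by (simp add: field_simps)
 qed
 have dl: "d \<longlonglongrightarrow> 0" unfolding d_def by real_asymp
 define D where "D = (\<lambda>i x. (gss a x - gev a (d i) x) / d i)"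
 have Dlim: "(\<lambda>i. D i x) \<longlonglongrightarrow> g x" for x
 proof -
  have "((\<lambda>t. gev a t x) has_real_derivative (- g x)) (at 0)"
  proof -
   have 1: "((\<lambda>t. 1 + 4 * a * t) has_real_derivative 4 * a) (at 0)"
    by (auto intro!: derivative_eq_intros)
   have 2: "((\<lambda>t. (1 + 4 * a * t) powr (- n / 2)) has_real_derivative - (2 * n * a)) (at 0)"
    using DERIV_fun_powr[OF 1, of "- n / 2"] by (simp add: mult_ac)
   have "((\<lambda>t. inverse (1 + 4 * a * t)) has_real_derivative - (4 * a)) (at 0)"
    using DERIV_inverse_fun[OF 1] by simp
   hence "((\<lambda>t. - a * (norm x)\<^sup>2 * inverse (1 + 4 * a * t)) has_real_derivative (- a * (norm x)\<^sup>2) * (- (4 * a))) (at 0)"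
    by (rule DERIV_cmult)
   moreover have "exp (- a * (norm x)\<^sup>2 * inverse (1 + 4 * a * 0)) * (- a * (norm x)\<^sup>2 * (- (4 * a))) = gss a x * (4 * a\<^sup>2 * (norm x)\<^sup>2)"
    by (simp add: gss_def power2_eq_square)
   ultimately have 3: "((\<lambda>t. exp (- a * (norm x)\<^sup>2 * inverse (1 + 4 * a * t))) has_real_derivative gss a x * (4 * a\<^sup>2 * (norm x)\<^sup>2)) (at 0)"
    using DERIV_fun_exp by metis
   have "gev a t x = (1 + 4 * a * t) powr (- n / 2) * exp (- a * (norm x)\<^sup>2 * inverse (1 + 4 * a * t))" for t
   proof -
    have "- (a / b) * N = - a * N * inverse b" for b N :: real by (simp add: divide_inverse)
    thus ?thesis by (simp only: gev_def)
   qed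
   moreover have "- g x = - (2 * n * a) * exp (- a * (norm x)\<^sup>2 * inverse (1 + 4 * a * 0)) + gss a x * (4 * a\<^sup>2 * (norm x)\<^sup>2) * (1 + 4 * a * 0) powr (- n / 2)"
   proof -
    define E where "E = exp (- a * (norm x)\<^sup>2)"
    have "- ((2 * n * a - 4 * a\<^sup>2 * (norm x)\<^sup>2) * E) = - (2 * n * a) * E + E * (4 * a\<^sup>2 * (norm x)\<^sup>2)"
     by (simp add: algebra_simps)
    thus ?thesis by (simp add: g_def gss_def E_def)
   qed
   ultimately show ?thesis using DERIV_mult[OF 2 3] by (simp only:)
  qed
  hence "((\<lambda>t. (gev a t x - gev a 0 x) / (t - 0)) \<longlongrightarrow> - g x) (at 0)"
   by (simp only: has_field_derivative_iff)
  moreover have "filterlim d (at 0) sequentially"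
   using dl d0 by (auto simp: filterlim_at less_imp_neq[symmetric])
  ultimately have "(\<lambda>i. (gev a (d i) x - gev a 0 x) / (d i - 0)) \<longlonglongrightarrow> - g x" by (rule filterlim_compose)
  hence "(\<lambda>i. - ((gev a (d i) x - gev a 0 x) / (d i - 0))) \<longlonglongrightarrow> - (- g x)" by (rule tendsto_minus)
  moreover have "- ((gev a (d i) x - gev a 0 x) / (d i - 0)) = D i x" for i
  proof -
   have "gev a 0 x = gss a x" by (simp add: gev_def gss_def)
   thus ?thesis by (simp only: D_def diff_0_right minus_divide_left minus_diff_eq)
  qed
  ultimately show ?thesis by (simp only: minus_minus)
 qed
 \<comment> \<open>The leading term dominates the quotient from above, by \<open>gss_gev_le\<close>.
   The second, wider Gaussian dominates it from below: with v = a |x|^2 one has v exp(-v/2) <= 4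
   exp(-v/4).\<close>
 define W where "W = (\<lambda>x. 2 * n * a * gss a x + 16 * a * gss (a / 4) x)"
 have a4: "a / 4 > 0" using a by simp
 have WI: "Lint W" unfolding W_def using integrable_gss[OF a] integrable_gss[OF a4] by simp
 have DW: "\<bar>D i x\<bar> \<le> W x" for i x
 proof -
  define b where "b = 1 + 4 * a * d i"
  define v where "v = a * (norm x)\<^sup>2"
  have b: "1 \<le> b" "b \<le> 2" using a d0[of i] d1[of i] by (auto simp: b_def)
  have v: "v \<ge> 0" using a by (simp add: v_def)
  have g0: "0 < gss a x" "0 < gss (a/4) x" by (rule gss_pos)+
  have "gss a x - gev a (d i) x \<le> 2 * n * a * d i * gss a x"
  proof (rule order_trans[OF gss_gev_le[OF a less_imp_le[OF d0[of i]], of x]])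
   show "mn a (d i) * gss a x \<le> 2 * n * a * d i * gss a x"
    unfolding mn_def[OF a] using g0 by (intro mult_right_mono) auto
  qed
  hence up: "D i x \<le> 2 * n * a * gss a x" using d0[of i] by (simp add: D_def divide_le_eq mult_ac)
  have "gev a (d i) x \<le> exp (- (v / b))"
  proof -
   have "b powr (- n / 2) \<le> 1 powr (- n / 2)" using b n_pos by (intro powr_mono2') auto
   thus ?thesis unfolding gev_def b_def[symmetric] v_def by (simp add: mult_left_le_one_le)
  qed
  moreover have "exp (- (v / b)) - exp (- v) \<le> exp (- (v / b)) * (v * (4 * a * d i))"
  proof -
   have "v - v / b = v * (b - 1) / b" using b by (simp add: field_simps)
   also have "\<dots> \<le> v * (b - 1) / 1" using b v by (intro divide_left_mono) auto
   finally have "v - v / b \<le> v * (4 * a * d i)" by (simp add: b_def)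
   moreover have "1 - exp (- (v - v / b)) \<le> v - v / b" using exp_ge_add_one_self[of "- (v - v / b)"] by linarith
   ultimately have "exp (- (v / b)) * (1 - exp (- (v - v / b))) \<le> exp (- (v / b)) * (v * (4 * a * d i))" by (intro mult_left_mono) auto
   thus ?thesis by (simp add: right_diff_distrib exp_add[symmetric])
  qed
  moreover have "exp (- (v / b)) \<le> exp (- (v / 2))" using divide_left_mono[of b 2 v] b v by simp
  hence "exp (- (v / b)) * (v * (4 * a * d i)) \<le> exp (- (v / 2)) * (v * (4 * a * d i))" using v a d0[of i] by (intro mult_right_mono) auto
  moreover have "exp (- (v / 2)) * v \<le> 4 * exp (- (v / 4))"
  proof -
   have "v / 4 \<le> exp (v / 4)" using exp_ge_add_one_self[of "v / 4"] by linarith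
   hence "exp (- (v / 2)) * v \<le> exp (- (v / 2)) * (4 * exp (v / 4))" by (intro mult_left_mono) auto
   also have "\<dots> = 4 * exp (- (v / 4))" by (simp add: exp_add[symmetric])
   finally show ?thesis .
  qed
  hence "exp (- (v / 2)) * v * (4 * a * d i) \<le> 4 * exp (- (v / 4)) * (4 * a * d i)" using a d0[of i] by (intro mult_right_mono) auto
  ultimately have "gev a (d i) x - gss a x \<le> 16 * a * d i * gss (a / 4) x"
   by (simp add: gss_def v_def mult_ac)
  hence lo: "- D i x \<le> 16 * a * gss (a / 4) x" using d0[of i] by (simp add: D_def divide_le_eq minus_divide_left mult_ac)
  have "0 \<le> 2 * n * a * gss a x" "0 \<le> 16 * a * gss (a / 4) x" using a n_pos g0 by auto
  with up lo show ?thesis unfolding W_def abs_le_iff by linarith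
 qed
 have [measurable]: "D i \<in> bm" for i unfolding D_def by measurable
 have [measurable]: "g \<in> bm" unfolding g_def by measurable
 have gI: "Lint g"
  by (rule integrable_dominated_convergence[where s=D and w=W]) (use WI Dlim DW in \<open>auto intro!: AE_I2\<close>)
 have ftg: "ft g \<xi> = complex_of_real (norm \<xi> powr (2 * s)) * ft (gss a) \<xi>" for \<xi>
 proof -
  have "(\<lambda>i. ft (D i) \<xi>) \<longlonglongrightarrow> ft g \<xi>" unfolding ft_def
   by (rule integral_dominated_convergence[where w=W])
     (use WI DW in \<open>auto intro!: AE_I2 tendsto_intros Dlim simp: norm_mult\<close>)
  moreover have "ft (D i) \<xi> = complex_of_real ((1 - exp (- d i * (norm \<xi>)\<^sup>2)) / d i) * ft (gss a) \<xi>" for i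
  proof -
   have "D i = (\<lambda>x. 1 / d i * (1 * gss a x + (-1) * gev a (d i) x))" by (auto simp: D_def)
   hence "ft (D i) \<xi> = complex_of_real (1 / d i) * (ft (gss a) \<xi> - ft (gev a (d i)) \<xi>)"
    using ft_scale[of "1 / d i" "\<lambda>x. 1 * gss a x + (-1) * gev a (d i) x" \<xi>]
     ft_add[OF integrable_gss[OF a] integrable_gev[OF a less_imp_le[OF d0[of i]]], of 1 "-1" \<xi>] by simp
   thus ?thesis by (simp add: ft_gev[OF a less_imp_le[OF d0[of i]]] algebra_simps diff_divide_distrib)
  qed
  moreover have "(\<lambda>i. complex_of_real ((1 - exp (- d i * (norm \<xi>)\<^sup>2)) / d i) * ft (gss a) \<xi>) \<longlonglongrightarrow> complex_of_real ((norm \<xi>)\<^sup>2) * ft (gss a) \<xi>"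
  proof (intro tendsto_intros)
   have "((\<lambda>t. - exp (- t * (norm \<xi>)\<^sup>2)) has_real_derivative ((norm \<xi>)\<^sup>2)) (at 0)"
    by (auto intro!: derivative_eq_intros)
   hence "((\<lambda>t. (- exp (- t * (norm \<xi>)\<^sup>2) - (- exp (- 0 * (norm \<xi>)\<^sup>2))) / (t - 0)) \<longlongrightarrow> (norm \<xi>)\<^sup>2) (at 0)"
    by (simp only: has_field_derivative_iff)
   moreover have "filterlim d (at 0) sequentially"
    using dl d0 by (auto simp: filterlim_at less_imp_neq[symmetric])
   ultimately have "(\<lambda>i. (- exp (- d i * (norm \<xi>)\<^sup>2) - (- exp (- 0 * (norm \<xi>)\<^sup>2))) / (d i - 0)) \<longlonglongrightarrow> (norm \<xi>)\<^sup>2" by (rule filterlim_compose)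
   thus "(\<lambda>i. (1 - exp (- d i * (norm \<xi>)\<^sup>2)) / d i) \<longlonglongrightarrow> (norm \<xi>)\<^sup>2" by simp
  qed
  ultimately have "ft g \<xi> = complex_of_real ((norm \<xi>)\<^sup>2) * ft (gss a) \<xi>" using LIMSEQ_unique by simp
  thus ?thesis using s1 by (cases "\<xi> = 0") auto
 qed
 have "g x \<le> 2 * n * a * gss a x" for x
  unfolding g_def using gss_pos[of a x] by (intro mult_right_mono) auto
 with gI ftg integrable_gss[OF a] show ?thesis unfolding fpair_def by blast
qed

text \<open>Widening lowers the constant: it is 2 n a when s = 1, and for s < 1 an integral of
  min(1, 2 n a t) t^(-1-s), which tends to 0 with a by dominated convergence.\<close>

lemma gauss_fpair:
 assumes e: "e > 0"
 shows "\<exists>a>0. \<exists>g. fpair (gss a) g \<and> (\<forall>x. g x \<le> e * gss a x)"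
proof (cases "s = 1")
 case True
 define a where "a = e / (2 * n)"
 have a: "a > 0" "2 * n * a = e" using e n_pos by (auto simp: a_def)
 with gauss_fpair_1[OF True a(1)] show ?thesis by auto
next
 case False
 hence s1: "s < 1" using s_le by simp
 define J where "J = (\<lambda>i. LBINT t. indicator {0<..} t * (min 1 (2 * n * (1 / real (Suc i)) * t) * t powr (- 1 - s)))"
 have "J \<longlonglongrightarrow> (\<integral>t. 0 \<partial>(lborel::real measure))" unfolding J_def
 proof (rule integral_dominated_convergence[where w="\<lambda>t. indicator {0<..} t * (min 1 (2 * n * t) * t powr (- 1 - s))"])
  show "Lint (\<lambda>t. indicator {0<..} t * (min 1 (2 * n * t) * t powr (- 1 - s)))"
   using n_pos by (intro integrable_min_powr s1) auto
  show "AE t in lborel. (\<lambda>i. indicator {0<..} t * (min 1 (2 * n * (1 / real (Suc i)) * t) * t powr (- 1 - s))) \<longlonglongrightarrow> 0"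
  proof (rule AE_I2)
   fix t :: real
   have "(\<lambda>i. 1 / real (Suc i)) \<longlonglongrightarrow> 0" by real_asymp
   hence "(\<lambda>i. indicator {0<..} t * (min 1 (2 * n * (1 / real (Suc i)) * t) * t powr (- 1 - s))) \<longlonglongrightarrow> indicator {0<..} t * (min 1 (2 * n * 0 * t) * t powr (- 1 - s))"
    by (intro tendsto_intros tendsto_min)
   thus "(\<lambda>i. indicator {0<..} t * (min 1 (2 * n * (1 / real (Suc i)) * t) * t powr (- 1 - s))) \<longlonglongrightarrow> 0" by simp
  qed
  show "AE t in lborel. norm (indicator {0<..} t * (min 1 (2 * n * (1 / real (Suc i)) * t) * t powr (- 1 - s))) \<le> indicator {0<..} t * (min 1 (2 * n * t) * t powr (- 1 - s))" for i
  proof (rule AE_I2)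
   fix t :: real
   show "norm (indicator {0<..} t * (min 1 (2 * n * (1 / real (Suc i)) * t) * t powr (- 1 - s))) \<le> indicator {0<..} t * (min 1 (2 * n * t) * t powr (- 1 - s))"
   proof (cases "t > 0")
    case True
    have "0 \<le> 2 * n * (1 / real (Suc i)) * t" using True n_pos by simp
    moreover have "2 * n * (1 / real (Suc i)) * t \<le> 2 * n * t"
    proof (rule mult_right_mono)
     have "2 * n * (1 / real (Suc i)) \<le> 2 * n * 1" using n_pos by (intro mult_left_mono) auto
     thus "2 * n * (1 / real (Suc i)) \<le> 2 * n" by simp
    qed (use True in simp)
    ultimately have "\<bar>min 1 (2 * n * (1 / real (Suc i)) * t)\<bar> \<le> min 1 (2 * n * t)" by linarith
    thus ?thesis using True by (simp add: abs_mult mult_right_mono)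
   qed simp
  qed
 qed measurable
 hence "(\<lambda>i. J i / lk 1) \<longlonglongrightarrow> 0 / lk 1" using lk_pos[OF s1] by (intro tendsto_intros) auto
 hence "\<forall>\<^sub>F i in sequentially. J i / lk 1 < e" using order_tendstoD(2)[of "\<lambda>i. J i / lk 1" 0 sequentially e] e by simp
 then obtain i where i: "J i / lk 1 < e" by (auto simp: eventually_sequentially)
 define a where "a = 1 / real (Suc i)"
 have a: "a > 0" by (simp add: a_def)
 obtain g where g: "fpair (gss a) g" "\<And>x. g x \<le> J i / lk 1 * gss a x"
  using gauss_fpair_lt1[OF s1 a] unfolding J_def a_def by blast
 have "g x \<le> e * gss a x" for x
  using g(2)[of x] mult_right_mono[of "J i / lk 1" e "gss a x"] i gss_pos[of a x] by linarith
 with a g(1) show ?thesis by blast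
qed

end

context pme
begin

section \<open>Separable subsolutions of the equation and of the implicit scheme\<close>

definition pe :: real where "pe = 1 / (m - 1)"

lemma pe_pos: "pe > 0" using m_gt by (simp add: pe_def)

lemma pe_m: "pe * m = pe + 1" using m_gt by (simp add: pe_def field_simps)

text \<open>Mean value theorem. The slope of y^(-pe) decreases in modulus, so its value at the right
  end, the one occurring in the implicit scheme, is a lower bound.\<close>

lemma powr_decrease:
 assumes x: "0 < x" "x < y"
 shows "pe * (y - x) * y powr (- pe - 1) \<le> x powr (- pe) - y powr (- pe)"
proof -
 have "\<exists>z>x. z < y \<and> y powr (- pe) - x powr (- pe) = (y - x) * (- pe * z powr (- pe - 1))"
 proof (rule MVT2[OF x(2)])
  fix z assume "x \<le> z" "z \<le> y"
  hence "z > 0" using x by simp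
  thus "((\<lambda>z. z powr (- pe)) has_real_derivative (- pe * z powr (- pe - 1))) (at z)"
   using has_real_derivative_powr[of z "- pe"] by simp
 qed
 then obtain z where z: "x < z" "z < y" "y powr (- pe) - x powr (- pe) = (y - x) * (- pe * z powr (- pe - 1))" by blast
 have "y powr (- pe - 1) \<le> z powr (- pe - 1)" using z x pe_pos by (intro powr_mono2') auto
 hence "pe * (y - x) * y powr (- pe - 1) \<le> pe * (y - x) * z powr (- pe - 1)"
  using x pe_pos by (intro mult_left_mono) auto
 with z(3) show ?thesis by (simp add: algebra_simps)
qed

text \<open>The separable function \<open>(\<lambda> / (t + 1))\<^bsup>1/(m-1)\<^esup> F\<^bsup>1/m\<^esup>\<close> is a subsolution of the equation, and by convexity
 in time also of the implicit scheme, as soon as \<open>(-\<Delta>)\<^sup>s F \<le> \<epsilon> F\<close> and \<open>\<lambda> \<epsilon> \<le> 1/(m-1)\<close>.\<close>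

definition amp :: "real \<Rightarrow> real \<Rightarrow> real" where "amp l t = (l / (t + 1)) powr pe"

text \<open>Because pe m = pe + 1, the power \<open>amp^m\<close> is proportional to the derivative
  of y^(-pe); l e <= pe matches the constants in \<open>powr_decrease\<close>.\<close>

lemma amp_step:
 assumes l: "l > 0" "l * e \<le> pe" and t: "t \<ge> 0" and h: "h > 0" and e: "e \<ge> 0"
 shows "amp l (t + h) + h * (amp l (t + h) powr m * e) \<le> amp l t"
proof -
 define x y where "x = t + 1" and "y = t + h + 1"
 have xy: "0 < x" "x < y" "y - x = h" using t h by (auto simp: x_def y_def)
 have A: "amp l t = l powr pe * x powr (- pe)" "amp l (t + h) = l powr pe * y powr (- pe)"
  using l xy by (auto simp: amp_def x_def y_def powr_divide powr_minus_divide add.assoc)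
 have "amp l (t + h) powr m = l powr (pe + 1) * y powr (- pe - 1)"
  unfolding A using l xy pe_m by (simp add: powr_mult powr_powr mult.commute[of m])
 hence "h * (amp l (t + h) powr m * e) = l powr pe * ((l * e) * (h * y powr (- pe - 1)))"
  using l by (simp add: powr_add mult_ac)
 also have "\<dots> \<le> l powr pe * (pe * (h * y powr (- pe - 1)))"
  using l h by (intro mult_left_mono mult_right_mono) auto
 also have "\<dots> \<le> l powr pe * (x powr (- pe) - y powr (- pe))"
  using powr_decrease[OF xy(1,2)] unfolding xy(3) by (intro mult_left_mono) (auto simp: mult.assoc)
 finally show ?thesis unfolding A by (simp add: right_diff_distrib)
qed

text \<open>F <= 1 serves F <= F^(1/m); integrability of F^(1/m) permits comparison in L1;
  continuity together with a point of value 1 makes the amplitude a lower bound for the essential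
  supremum.\<close>

definition bump :: "real \<Rightarrow> ('a \<Rightarrow> real) \<Rightarrow> bool" where
 "bump e F \<longleftrightarrow> (\<exists>g. fpair F g \<and> (\<forall>x. g x \<le> e * F x)) \<and> (\<forall>x. 0 < F x \<and> F x \<le> 1) \<and> continuous_on UNIV F \<and> (\<exists>c. F c = 1) \<and>
   Lint (\<lambda>x. F x powr (1 / m))"

lemma bump_gss:
 assumes a: "a > 0" and g: "fpair (gss a) g" "\<And>x. g x \<le> e * gss a x"
 shows "bump e (\<lambda>x. gss a (x - c))"
proof -
 have "fpair (\<lambda>x. gss a (x - c)) (\<lambda>x. g (x - c))" by (rule fpair_shift[OF g(1)])
 moreover have "Lint (\<lambda>x. gss a (x - c) powr (1 / m))"
 proof -
  have "(\<lambda>x. gss a x powr (1 / m)) = gss (a / m)" by (auto simp: gss_def powr_def)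
  hence "Lint (\<lambda>x. gss a x powr (1 / m))" using integrable_gss[of "a / m"] a m_gt by simp
  thus ?thesis by (rule integrable_lborel_shift)
 qed
 moreover have "continuous_on UNIV (\<lambda>x. gss a (x - c))" unfolding gss_def by (intro continuous_intros)
 moreover have "gss a (c - c) = 1" by (simp add: gss_def)
 ultimately show ?thesis unfolding bump_def using g(2) gss_pos gss_le_1[OF a] by blast
qed

text \<open>\<open>step_contraction\<close> between the subsolution and the given steps, with weight
  1, shows that the integrated deficit does not grow from one step to the next. Only the inequality
  for v is assumed, so v may be any nonnegative supersolution of the scheme.\<close>

lemma bump_lower:
 assumes b: "bump e F" and e: "e \<ge> 0" and l: "l > 0" "l * e \<le> pe" and h: "h > 0"
  and v: "\<And>j. j \<le> N \<Longrightarrow> Lint (v j)" "\<And>j x. 0 \<le> v j x"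
  and st: "\<And>j. j < N \<Longrightarrow> fpair (\<lambda>x. v (Suc j) x powr m) (\<gamma> j)" "\<And>j. j < N \<Longrightarrow> AE x in lborel. v j x \<le> v (Suc j) x + h * \<gamma> j x"
 shows "(LBINT x. max 0 (amp l (real N * h) * F x powr (1 / m) - v N x)) \<le> (LBINT x. max 0 (amp l 0 * F x powr (1 / m) - v 0 x))"
proof -
 obtain g where g: "fpair F g" "\<And>x. g x \<le> e * F x" and F: "\<And>x. 0 < F x" "\<And>x. F x \<le> 1" and FI: "Lint (\<lambda>x. F x powr (1 / m))"
  using b by (auto simp: bump_def)
 define z where "z = (\<lambda>j x. amp l (real j * h) * F x powr (1 / m))"
 have zn: "0 \<le> z j x" for j x by (simp add: z_def amp_def)
 have zI: "Lint (z j)" for j unfolding z_def using FI by (rule integrable_mult_right)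
 have zm: "z j x powr m = amp l (real j * h) powr m * F x" for j x
  using F(1)[of x] m_gt by (simp add: z_def powr_mult powr_powr amp_def)
 have zp: "fpair (\<lambda>x. z j x powr m) (\<lambda>x. amp l (real j * h) powr m * g x)" for j
  unfolding zm by (rule fpair_scale[OF g(1)])
 have sub: "z (Suc j) x + h * (amp l (real (Suc j) * h) powr m * g x) \<le> z j x" for j x
 proof -
  define A where "A = amp l (real (Suc j) * h)"
  have A0: "A \<ge> 0" by (simp add: A_def amp_def)
  \<comment> \<open>For values in (0, 1] the root exceeds the function; this trades the F in
    (-\<Delta>)^s F <= e F for the spatial profile F^(1/m) of the subsolution.\<close>
  have FF: "F x \<le> F x powr (1 / m)"
   using powr_mono'[of "1 / m" 1 "F x"] F[of x] m_gt by (simp add: less_imp_le)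
  have "A powr m * g x \<le> A powr m * (e * F x)" by (intro mult_left_mono g(2)) simp
  also have "\<dots> \<le> A powr m * (e * F x powr (1 / m))" using e FF by (intro mult_left_mono) auto
  finally have "z (Suc j) x + h * (A powr m * g x) \<le> A * F x powr (1 / m) + h * (A powr m * (e * F x powr (1 / m)))"
   using h by (simp add: z_def A_def)
  also have "\<dots> = (A + h * (A powr m * e)) * F x powr (1 / m)" by (simp add: algebra_simps)
  also have "\<dots> \<le> amp l (real j * h) * F x powr (1 / m)"
  proof (rule mult_right_mono)
   have "real (Suc j) * h = real j * h + h" by (simp add: algebra_simps)
   thus "A + h * (A powr m * e) \<le> amp l (real j * h)" unfolding A_def using amp_step[OF l, of "real j * h" h] h e by simp
  qed simp
  finally show ?thesis by (simp add: z_def A_def)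
 qed
 have "(LBINT x. max 0 (z j x - v j x) * 1) \<le> (LBINT x. max 0 (z 0 x - v 0 x) * 1)" if "j \<le> N" for j
  using that
 proof (induction j)
  case (Suc j)
  have "(LBINT x. max 0 (z (Suc j) x - v (Suc j) x) * 1) \<le> (LBINT x. max 0 (z j x - v j x) * 1)"
   by (rule step_contraction[OF zp st(1) zI zn v(1) v(2) zI v(1) less_imp_le[OF h] _ st(2) excessive_one])
     (use Suc.prems sub in auto)
  with Suc show ?case by simp
 qed simp
 from this[of N] show ?thesis by (simp add: z_def)
qed

text \<open>Translating the bump to infinity sends its \<Phi>-weighted mass to 0, since \<Phi>
  vanishes at infinity and is bounded. Smallness on the ball of radius R is what lets the series of
  m-th powers converge at every point.\<close>

lemma far_bump:
 assumes a: "a > 0" and H: "H > 0" and d: "d > 0"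
 shows "\<exists>c. (LBINT x. H * gss a (x - c) powr (1 / m) * \<Phi> x) \<le> d \<and> (\<forall>x. norm x \<le> R \<longrightarrow> H powr m * gss a (x - c) \<le> d)"
proof -
 obtain b :: 'a where b: "b \<in> Basis" using nonempty_Basis by blast
 have nb: "norm b = 1" using b by (rule norm_Basis)
 define c where "c = (\<lambda>k::nat. real k *\<^sub>R b)"
 have nc: "norm (c k) = real k" for k by (simp add: c_def nb)
 define f where "f = (\<lambda>x. H * gss a x powr (1 / m))"
 have fe: "f = (\<lambda>x. H * gss (a / m) x)" by (auto simp: f_def gss_def powr_def)
 have fI: "Lint f" unfolding fe using integrable_gss[of "a / m"] a m_gt by simp
 have f0: "0 \<le> f x" for x using H by (simp add: f_def)
 have [measurable]: "f \<in> bm" unfolding f_def by measurable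
 have shift: "(LBINT x. f (x - c k) * \<Phi> x) = (LBINT z. f z * \<Phi> (z + c k))" for k
 proof -
  have "Lint (\<lambda>z. f z * \<Phi> (z + c k))"
  proof (rule integrable_bound)
   show "Lint (\<lambda>z. PhiB * f z)" using fI by simp
   show "AE z in lborel. norm (f z * \<Phi> (z + c k)) \<le> norm (PhiB * f z)"
    using Phi_nonneg Phi_le f0 by (intro AE_I2) (auto simp: abs_mult mult.commute[of "\<bar>PhiB\<bar>"] intro!: mult_left_mono order_trans[OF Phi_le abs_ge_self])
  qed measurable
  from integral_lborel_shift[OF this, of "c k"] show ?thesis by simp
 qed
 have "(\<lambda>k. LBINT z. f z * \<Phi> (z + c k)) \<longlonglongrightarrow> (\<integral>z. 0 \<partial>(lborel::'a measure))"
 proof (rule integral_dominated_convergence[where w="\<lambda>z. PhiB * f z"])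
  show "Lint (\<lambda>z. PhiB * f z)" using fI by simp
  show "AE z in lborel. (\<lambda>k. f z * \<Phi> (z + c k)) \<longlonglongrightarrow> 0"
  proof (rule AE_I2)
   fix z :: 'a
   have "filterlim (\<lambda>k. norm (z + c k)) at_top sequentially"
   proof (rule filterlim_at_top_mono)
    show "filterlim (\<lambda>k::nat. real k - norm z) at_top sequentially" by real_asymp
    show "\<forall>\<^sub>F k in sequentially. real k - norm z \<le> norm (z + c k)"
    proof (intro always_eventually allI)
     fix k show "real k - norm z \<le> norm (z + c k)"
      using norm_triangle_ineq4[of "z + c k" z] nc[of k] by simp
    qed
   qed
   hence "filterlim (\<lambda>k. z + c k) at_infinity sequentially" by (simp add: filterlim_at_infinity_conv_norm_at_top)
   hence "(\<lambda>k. \<Phi> (z + c k)) \<longlonglongrightarrow> 0" by (rule filterlim_compose[OF Phi_vanishes])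
   thus "(\<lambda>k. f z * \<Phi> (z + c k)) \<longlonglongrightarrow> 0" by (rule tendsto_mult_right_zero)
  qed
  show "AE z in lborel. norm (f z * \<Phi> (z + c k)) \<le> PhiB * f z" for k
   using Phi_nonneg Phi_le f0 by (intro AE_I2) (auto simp: abs_mult mult.commute[of PhiB] intro!: mult_left_mono)
 qed measurable
 hence "(\<lambda>k. LBINT x. f (x - c k) * \<Phi> x) \<longlonglongrightarrow> 0" unfolding shift by simp
 hence 1: "\<forall>\<^sub>F k in sequentially. (LBINT x. f (x - c k) * \<Phi> x) < d" using order_tendstoD(2) d by blast
 have "(\<lambda>k. H powr m * exp (- a * (real k - R)\<^sup>2)) \<longlonglongrightarrow> 0" using a H by real_asymp
 hence 2: "\<forall>\<^sub>F k in sequentially. H powr m * exp (- a * (real k - R)\<^sup>2) < d" using order_tendstoD(2) d by blast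
 have 3: "\<forall>\<^sub>F k::nat in sequentially. real k > R" by real_asymp
 from eventually_conj[OF 1 eventually_conj[OF 2 3]] obtain k where k: "(LBINT x. f (x - c k) * \<Phi> x) < d"
  "H powr m * exp (- a * (real k - R)\<^sup>2) < d" "real k > R" by (auto simp: eventually_sequentially)
 have "H powr m * gss a (x - c k) \<le> d" if x: "norm x \<le> R" for x
 proof -
  have "real k - R \<le> norm (x - c k)" using norm_triangle_ineq2[of "c k" x] nc[of k] x by (simp add: norm_minus_commute)
  hence "(real k - R)\<^sup>2 \<le> (norm (x - c k))\<^sup>2" using k(3) by (intro power_mono) auto
  hence "gss a (x - c k) \<le> exp (- a * (real k - R)\<^sup>2)" using a by (simp add: gss_def)
  hence "H powr m * gss a (x - c k) \<le> H powr m * exp (- a * (real k - R)\<^sup>2)" by (intro mult_left_mono) auto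
  thus ?thesis using k(2) by simp
 qed
 with k(1) show ?thesis by (intro exI[of _ "c k"]) (auto simp: f_def)
qed

text \<open>With \<epsilon> = 1/(j + 1) the largest admissible \<lambda> is pe (j + 1); this is the
  amplitude of that subsolution at time 0.\<close>

definition height :: "nat \<Rightarrow> real" where "height j = amp (pe * real (Suc j)) 0"

lemma height_pos: "height j > 0" using pe_pos by (simp add: height_def amp_def)

text \<open>The datum satisfies u0^m = \<Sigma> height^m F_j, so each partial sum has an explicit
  fractional Laplacian. Subadditivity of x^(1/m) bounds its root by the sum of the separate
  profiles, whose weighted integrals are at most 2^(-j); dropping all terms but one leaves the lower
  bound by a single bump.\<close>

lemma data_exists:
 "\<exists>MM w g u0. (\<forall>k. nice (MM k) (w k) (g k)) \<and> (\<forall>k x. w k x \<le> w (Suc k) x) \<and> (\<forall>x. (\<lambda>k. w k x) \<longlonglongrightarrow> u0 x) \<and>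
   Lint (\<lambda>x. u0 x * \<Phi> x) \<and>
   (\<forall>j. \<exists>F. bump (1 / real (Suc j)) F \<and> (\<forall>x. height j * F x powr (1 / m) \<le> u0 x))"
proof -
 let ?P = "\<lambda>j F g. fpair F g \<and> bump (1 / real (Suc j)) F \<and> (LBINT x. height j * F x powr (1 / m) * \<Phi> x) \<le> (1 / 2) ^ j
   \<and> (\<forall>x. norm x \<le> real j \<longrightarrow> height j powr m * F x \<le> (1 / 2) ^ j)"
 have "\<forall>j. \<exists>F g. ?P j F g"
 proof
  fix j
  obtain a g where a: "a > 0" "fpair (gss a) g" "\<And>x. g x \<le> 1 / real (Suc j) * gss a x"
   using gauss_fpair[of "1 / real (Suc j)"] by auto
  obtain c where c: "(LBINT x. height j * gss a (x - c) powr (1 / m) * \<Phi> x) \<le> (1 / 2) ^ j"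
   "\<And>x. norm x \<le> real j \<Longrightarrow> height j powr m * gss a (x - c) \<le> (1 / 2) ^ j"
   using far_bump[OF a(1) height_pos[of j], of "(1/2)^j" "real j"] by auto
  show "\<exists>F g. ?P j F g"
   using bump_gss[OF a] fpair_shift[OF a(2)] c by blast
 qed
 from choice[OF this] obtain F where "\<forall>j. \<exists>g. ?P j (F j) g" ..
 from choice[OF this] obtain gf where A: "\<forall>j. ?P j (F j) (gf j)" ..
 have F: "fpair (F j) (gf j)" "bump (1 / real (Suc j)) (F j)"
  "(LBINT x. height j * F j x powr (1 / m) * \<Phi> x) \<le> (1 / 2) ^ j"
  "norm x \<le> real j \<Longrightarrow> height j powr m * F j x \<le> (1 / 2) ^ j" for j x
  using spec[OF A, of j] by simp_all
 have Fp: "0 < F j x" "F j x \<le> 1" for j x using F(2)[of j] by (auto simp: bump_def)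
 have FI: "Lint (\<lambda>x. F j x powr (1 / m))" for j using F(2)[of j] by (auto simp: bump_def)
 have [measurable]: "F j \<in> bm" for j
  using F(2)[of j] by (intro borel_measurable_continuous_onI) (auto simp: bump_def)
 define q where "q = (\<lambda>j x. height j powr m * F j x)"
 have q0: "0 \<le> q j x" for j x using Fp[of j x] by (simp add: q_def)
 have qr: "q j x powr (1 / m) = height j * F j x powr (1 / m)" for j x
  using Fp[of j x] height_pos[of j] m_gt by (simp add: q_def powr_mult powr_powr)
 have qs: "summable (\<lambda>j. q j x)" for x
 proof (rule summable_comparison_test_ev[of _ "\<lambda>j. (1 / 2) ^ j"])
  have "\<forall>\<^sub>F j::nat in sequentially. norm x \<le> real j" by real_asymp
  thus "\<forall>\<^sub>F j in sequentially. norm (q j x) \<le> (1 / 2) ^ j"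
   by eventually_elim (use F(4) q0 in \<open>auto simp: q_def\<close>)
  show "summable (\<lambda>j. (1 / 2 :: real) ^ j)" by (rule summable_geometric) simp
 qed
 define S where "S = (\<lambda>k x. \<Sum>j\<le>k. q j x)"
 define w where "w = (\<lambda>k x. S k x powr (1 / m))"
 define u0 where "u0 = (\<lambda>x. (\<Sum>j. q j x) powr (1 / m))"
 define MM where "MM = (\<lambda>k. (\<Sum>j\<le>k. height j powr m) powr (1 / m))"
 define g where "g = (\<lambda>k x. \<Sum>j\<le>k. height j powr m * gf j x)"
 have S0: "0 \<le> S k x" for k x unfolding S_def by (intro sum_nonneg q0)
 have m1: "0 < 1 / m" "1 / m \<le> 1" using m_gt by auto
 have wle: "w k x \<le> (\<Sum>j\<le>k. height j * F j x powr (1 / m))" for k x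
  unfolding w_def S_def using powr_sum_subadd[of "{..k}" "\<lambda>j. q j x" "1 / m"] q0 m1 by (simp add: qr)
 have w0: "0 \<le> w k x" for k x by (simp add: w_def)
 have [measurable]: "w k \<in> bm" for k unfolding w_def S_def q_def by measurable
 have sI: "Lint (\<lambda>x. \<Sum>j\<le>k. height j * F j x powr (1 / m))" for k
  using FI by (intro integrable_sum integrable_mult_right)
 have wI: "Lint (w k)" for k
  by (rule integrable_bound[OF sI[of k]])
    (use wle w0 in \<open>auto intro!: AE_I2 order_trans[OF wle abs_ge_self]\<close>)
 have wm: "w k x powr m = S k x" for k x using S0[of k x] m_gt by (cases "S k x = 0") (auto simp: w_def powr_powr)
 have "nice (MM k) (w k) (g k)" for k
 proof -
  have "fpair (S k) (g k)" unfolding S_def g_def q_def by (intro fpair_sum fpair_scale F) auto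
  hence "fpair (\<lambda>x. w k x powr m) (g k)" by (simp add: wm)
  moreover have "w k x \<le> MM k" for x
  proof -
   have "S k x \<le> (\<Sum>j\<le>k. height j powr m)" unfolding S_def q_def using Fp by (intro sum_mono mult_left_le) auto
   thus ?thesis unfolding w_def MM_def using S0 m1 by (intro powr_mono2) auto
  qed
  moreover have "height j \<noteq> 0" for j using height_pos[of j] by simp
  hence "(\<Sum>j\<le>k. height j powr m) > 0" by (intro sum_pos) auto
  hence "MM k > 0" by (simp add: MM_def)
  ultimately show ?thesis using wI w0 by (simp add: nice_def)
 qed
 moreover have "w k x \<le> w (Suc k) x" for k x
  unfolding w_def using S0 q0 m1 by (intro powr_mono2) (auto simp: S_def)
 moreover have wlim: "(\<lambda>k. w k x) \<longlonglongrightarrow> u0 x" for x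
 proof -
  have "(\<lambda>k. S k x) \<longlonglongrightarrow> (\<Sum>j. q j x)" unfolding S_def by (rule summable_LIMSEQ'[OF qs])
  thus ?thesis unfolding w_def u0_def using S0 m1 by (intro tendsto_powr2) (auto intro: always_eventually)
 qed
 moreover have "Lint (\<lambda>x. u0 x * \<Phi> x)"
 proof (rule L1_fatou(1))
  show "Lint (\<lambda>x. w k x * \<Phi> x)" for k by (rule excessive_integrable[OF excessive_Phi wI])
  show "(LBINT x. \<bar>w k x * \<Phi> x\<bar>) \<le> 2" for k
  proof -
   have bI: "Lint (\<lambda>x. height j * F j x powr (1 / m) * \<Phi> x)" for j
    using FI by (intro excessive_integrable[OF excessive_Phi] integrable_mult_right)
   have "(LBINT x. \<bar>w k x * \<Phi> x\<bar>) \<le> (LBINT x. (\<Sum>j\<le>k. height j * F j x powr (1 / m) * \<Phi> x))"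
   proof (rule integral_mono)
    show "Lint (\<lambda>x. \<bar>w k x * \<Phi> x\<bar>)" by (intro integrable_abs excessive_integrable[OF excessive_Phi wI])
    show "Lint (\<lambda>x. \<Sum>j\<le>k. height j * F j x powr (1 / m) * \<Phi> x)" using bI by (intro integrable_sum)
    show "\<bar>w k x * \<Phi> x\<bar> \<le> (\<Sum>j\<le>k. height j * F j x powr (1 / m) * \<Phi> x)" for x
     using mult_right_mono[OF wle[of k x] Phi_nonneg[of x]] w0 Phi_nonneg[of x] by (simp add: abs_mult sum_distrib_right)
   qed
   also have "\<dots> = (\<Sum>j\<le>k. LBINT x. height j * F j x powr (1 / m) * \<Phi> x)"
    using bI by (intro integral_sum)
   also have "\<dots> \<le> (\<Sum>j\<le>k. (1 / 2) ^ j)" by (intro sum_mono F(3))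
   also have "\<dots> \<le> (\<Sum>j. (1 / 2 :: real) ^ j)" by (intro sum_le_suminf summable_geometric) auto
   also have "\<dots> = 2" by (subst suminf_geometric) auto
   finally show ?thesis .
  qed
  show "AE x in lborel. (\<lambda>k. w k x * \<Phi> x) \<longlonglongrightarrow> u0 x * \<Phi> x" by (intro AE_I2 tendsto_intros wlim)
  have [measurable]: "u0 \<in> bm" by (rule borel_measurable_LIMSEQ_real[OF wlim]) auto
  show "(\<lambda>x. u0 x * \<Phi> x) \<in> borel_measurable lborel" by measurable
 qed
 moreover have "\<exists>F. bump (1 / real (Suc j)) F \<and> (\<forall>x. height j * F x powr (1 / m) \<le> u0 x)" for j
 proof (intro exI[of _ "F j"] conjI allI F(2))
  fix x
  have "q j x \<le> (\<Sum>j. q j x)" using sum_le_suminf[OF qs, of "{j}" x] q0 by simp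
  thus "height j * F j x powr (1 / m) \<le> u0 x" unfolding qr[symmetric] u0_def using q0 m1 by (intro powr_mono2) auto
 qed
 ultimately show ?thesis by blast
qed

end

section \<open>The weak dual identity\<close>

lemma (in frac) gdom_compact:
 assumes S: "compact S" and [measurable]: "q \<in> bm" and B: "B \<ge> 0" "\<And>x. \<bar>q x\<bar> \<le> B * indicator S x"
 shows "\<exists>C. gdom C q"
proof -
 obtain R where R: "\<And>x. x \<in> S \<Longrightarrow> norm x \<le> R" using compact_imp_bounded[OF S] by (auto simp: bounded_iff)
 have "\<bar>q x\<bar> \<le> B * exp (R\<^sup>2) * gauss1 x" for x
 proof (cases "x \<in> S")
  case True
  have "(norm x)\<^sup>2 \<le> R\<^sup>2" using R[OF True] by (intro power_mono) auto
  hence "1 \<le> exp (R\<^sup>2) * gauss1 x" by (simp add: gauss1_def flip: exp_add)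
  thus ?thesis using B(2)[of x] True mult_left_mono[of 1 "exp (R\<^sup>2) * gauss1 x" B] B(1) by (simp add: mult.assoc)
 qed (use B in \<open>auto simp: gauss1_def order_trans[OF B(2)]\<close>)
 thus ?thesis unfolding gdom_def by auto
qed

context pme_data
begin

text \<open>The function 1_S u^m, replaced by 0 at the times where its integral is infinite. Those
  times within (0, T] form a null set, and the replacement makes it integrable in x at every
  time.\<close>

definition upow :: "'a set \<Rightarrow> real \<Rightarrow> 'a \<Rightarrow> real" where
 "upow S \<tau> x = (if (LBNN z. ennreal (indicator S z * u \<tau> z powr m)) < \<infinity> then indicator S x * u \<tau> x powr m else 0)"

lemma upow_nonneg: "0 \<le> upow S \<tau> x" by (simp add: upow_def)

lemma measurable_upow [measurable (raw)]:
 assumes [measurable]: "S \<in> sets borel" "f \<in> measurable N borel" "h \<in> measurable N borel"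
 shows "(\<lambda>x. upow S (f x) (h x)) \<in> borel_measurable N"
proof -
 have [measurable]: "(\<lambda>\<tau>. LBNN z. ennreal (indicator S z * u \<tau> z powr m)) \<in> bm" by measurable
 show ?thesis unfolding upow_def by measurable
qed

lemma upow_integrable:
 assumes [measurable]: "S \<in> sets borel"
 shows "Lint (upow S \<tau>)"
proof (cases "(LBNN z. ennreal (indicator S z * u \<tau> z powr m)) < \<infinity>")
 case True
 thus ?thesis unfolding upow_def by (simp add: integrable_iff_bounded)
next
 case False
 hence "upow S \<tau> = (\<lambda>_. 0)" by (auto simp: upow_def fun_eq_iff)
 thus ?thesis by simp
qed

section \<open>Local integrability of u^m on a time interval and a compact set\<close>

context
 fixes T :: real and S :: "'a set"
 assumes T: "T > 0" and S: "compact S"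
begin

lemma S_borel [measurable]: "S \<in> sets borel" using S by (simp add: compact_imp_closed)

lemma gdom_S: "\<exists>C. gdom C (indicator S)"
 by (rule gdom_compact[OF S, of _ 1]) auto

lemma AE_upow: "AE \<tau> in lborel. \<tau> \<in> {0<..T} \<longrightarrow> (\<forall>x. upow S \<tau> x = indicator S x * u \<tau> x powr m)"
proof -
 obtain C where C: "gdom C (indicator S)" using gdom_S by blast
 have "AE \<tau> in lborel. Lint (\<lambda>x. indicator {0<..T} \<tau> * (indicator S x * u \<tau> x powr m))"
  using lborel_pair.AE_integrable_fst'[OF u_powr_integrable[OF C, of T]] T by simp
 thus ?thesis
 proof eventually_elim
  case (elim \<tau>)
  show ?case
  proof
   assume "\<tau> \<in> {0<..T}"
   with elim have "Lint (\<lambda>x. indicator S x * u \<tau> x powr m)" by simp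
   thus "\<forall>x. upow S \<tau> x = indicator S x * u \<tau> x powr m" by (simp add: upow_def integrable_iff_bounded)
  qed
 qed
qed

lemma upow_integral_integrable: "Lint (\<lambda>\<tau>. indicator {0<..T} \<tau> * (LBINT x. upow S \<tau> x))"
proof -
 obtain C where C: "gdom C (indicator S)" using gdom_S by blast
 have 1: "Lint (\<lambda>\<tau>. LBINT x. indicator {0<..T} \<tau> * (indicator S x * u \<tau> x powr m))"
  using lborel_pair.integrable_fst'[OF u_powr_integrable[OF C, of T]] T by simp
 have "AE \<tau> in lborel. (LBINT x. indicator {0<..T} \<tau> * (indicator S x * u \<tau> x powr m)) = indicator {0<..T} \<tau> * (LBINT x. upow S \<tau> x)"
  using AE_upow
 proof eventually_elim
  case (elim \<tau>)
  thus ?case by (cases "\<tau> \<in> {0<..T}") auto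
 qed
 thus ?thesis by (intro integrable_cong_AE_imp[OF 1]) auto
qed

lemma nn_upow_finite: "(LBNN \<tau>. indicator {0<..T} \<tau> * (LBNN x. ennreal (indicator S x * u \<tau> x powr m))) < \<infinity>"
proof -
 obtain C where C: "gdom C (indicator S)" using gdom_S by blast
 have "(LBNN \<tau>. indicator {0<..T} \<tau> * (LBNN x. ennreal (indicator S x * u \<tau> x powr m)))
   \<le> (LBNN \<tau>. indicator {0<..T} \<tau> * (LBNN x. ennreal (indicator S x * u \<tau> x powr m)))
    + (LBNN x. ennreal (u T x * conv G (indicator S) x))" by simp
 also have "\<dots> = (LBNN x. ennreal (u0 x * conv G (indicator S) x))"
  by (rule nn_dual[OF C _ less_imp_le[OF T]]) simp
 also have "\<dots> \<le> (LBNN x. ennreal (norm (u0 x * conv G (indicator S) x)))"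
  by (intro nn_integral_mono ennreal_leI) (simp add: abs_ge_self)
 also have "\<dots> < \<infinity>"
  using gdom_conv_integrable[OF C u0_Phi measurable_u0] unfolding integrable_iff_bounded by (rule conjunct2)
 finally show ?thesis .
qed

section \<open>The weak identity for Borel representatives: q of the time derivative and \<rho> of
  the test function\<close>

context
 fixes q \<rho> :: "real \<Rightarrow> 'a \<Rightarrow> real" and B a b :: real
 assumes q_meas [measurable]: "\<And>t. q t \<in> bm" and q_le: "\<And>t x. \<bar>q t x\<bar> \<le> B * indicator S x"
  and rho_meas [measurable]: "\<And>t. \<rho> t \<in> bm"
  and deriv: "\<And>y t. Lint y \<Longrightarrow> 0 < t \<Longrightarrow> t < T \<Longrightarrow>
    ((\<lambda>t. LBINT x. \<rho> t x * y x) has_real_derivative (LBINT x. q t x * y x)) (at t)"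
  and cont: "\<And>y t. Lint y \<Longrightarrow> 0 < t \<Longrightarrow> t < T \<Longrightarrow> isCont (\<lambda>t. LBINT x. q t x * y x) t"
  and ab: "0 < a" "b < T" and vanish: "\<And>t x. 0 < t \<Longrightarrow> t < T \<Longrightarrow> t \<notin> {a..b} \<Longrightarrow> AE x in lborel. \<rho> t x = 0"
  and B0: "B \<ge> 0"
begin

lemma q_gdom: "\<exists>C. gdom C (q t)" by (rule gdom_compact[OF S q_meas B0 q_le])

lemma q_pair_bound:
 assumes y: "Lint y"
 shows "Lint (\<lambda>x. q t x * y x)" "\<bar>LBINT x. q t x * y x\<bar> \<le> B * nL1 y"
proof -
 have le: "\<bar>q t x * y x\<bar> \<le> B * \<bar>y x\<bar>" for x
 proof -
  have "\<bar>q t x\<bar> \<le> B" using q_le[of t x] B0 by (cases "x \<in> S") auto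
  thus ?thesis by (simp add: abs_mult mult_right_mono)
 qed
 have [measurable]: "y \<in> bm" by (rule Lint_measurable[OF y])
 show I: "Lint (\<lambda>x. q t x * y x)"
 proof (rule integrable_bound)
  show "Lint (\<lambda>x. B * \<bar>y x\<bar>)" using y by simp
  show "AE x in lborel. norm (q t x * y x) \<le> norm (B * \<bar>y x\<bar>)" using le B0 by (intro AE_I2) (simp add: abs_mult)
 qed measurable
 have "\<bar>LBINT x. q t x * y x\<bar> \<le> (LBINT x. \<bar>q t x * y x\<bar>)" by (rule integral_abs_bound)
 also have "\<dots> \<le> (LBINT x. B * \<bar>y x\<bar>)" using I y le by (intro integral_mono) auto
 finally show "\<bar>LBINT x. q t x * y x\<bar> \<le> B * nL1 y" by simp
qed

text \<open>The pairing with \<rho> is a primitive of that with q and vanishes near T, so only the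
  value at \<tau> survives. For \<tau> = 0 it also vanishes near the left end; the case distinction
  uses the limit 0 there, as nothing is assumed about \<rho> at time 0.\<close>

lemma pairing_FTC:
 assumes y: "Lint y" and \<tau>: "0 \<le> \<tau>" "\<tau> < T"
 shows "(LBINT t. indicator {\<tau><..<T} t * (LBINT x. q t x * y x)) = - (if \<tau> = 0 then 0 else LBINT x. \<rho> \<tau> x * y x)"
proof -
 define f where "f = (\<lambda>t. LBINT x. q t x * y x)"
 define F where "F = (\<lambda>t. LBINT x. \<rho> t x * y x)"
 have F0: "F t = 0" if "0 < t" "t < T" "t \<notin> {a..b}" for t
 proof -
  have [measurable]: "y \<in> bm" by (rule Lint_measurable[OF y])
  have "F t = (\<integral>x. 0 \<partial>(lborel :: 'a measure))" unfolding F_def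
   using vanish[OF that] by (intro integral_cong_AE) auto
  thus ?thesis by simp
 qed
 have "continuous_on {\<tau><..<T} f" unfolding f_def using cont[OF y] \<tau> by (auto simp: continuous_on_eq_continuous_at)
 hence fm: "set_borel_measurable borel {\<tau><..<T} f" by (intro borel_measurable_continuous_on_indicator[folded set_borel_measurable_def]) auto
 have fb: "\<bar>f t\<bar> \<le> B * nL1 y" for t unfolding f_def by (rule q_pair_bound(2)[OF y])
 have fi: "set_integrable lborel {\<tau><..<T} f" unfolding set_integrable_def
 proof (rule integrable_bound)
  show "Lint (\<lambda>t. indicator {\<tau><..<T} t * (B * nL1 y))" by (intro integrable_mult_left integrable_real_indicator) (use T \<tau> in auto)
  show "AE t in lborel. norm (indicator {\<tau><..<T} t *\<^sub>R f t) \<le> norm (indicator {\<tau><..<T} t * (B * nL1 y))"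
   using fb by (intro AE_I2) (auto simp: indicator_def intro: order_trans[OF _ abs_ge_self])
 qed (use fm in \<open>simp add: set_borel_measurable_def\<close>)
 have Fd: "(F has_real_derivative f t) (at t)" if "0 < t" "t < T" for t unfolding F_def f_def by (rule deriv[OF y that])
 have "(LBINT t=ereal \<tau>..ereal T. f t) = 0 - (if \<tau> = 0 then 0 else F \<tau>)"
 proof (rule interval_integral_FTC_integrable)
  show "(F has_vector_derivative f t) (at t)" if "ereal \<tau> < ereal t" "ereal t < ereal T" for t
   using Fd[of t] that \<tau> by (simp add: has_real_derivative_iff_has_vector_derivative)
  show "isCont f t" if "ereal \<tau> < ereal t" "ereal t < ereal T" for t
   unfolding f_def using cont[OF y, of t] that \<tau> by simp
  show "set_integrable lborel (einterval (ereal \<tau>) (ereal T)) f" using fi by simp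
  show "((F \<circ> real_of_ereal) \<longlongrightarrow> (if \<tau> = 0 then 0 else F \<tau>)) (at_right (ereal \<tau>))"
  proof (cases "\<tau> = 0")
   case True
   have "\<forall>\<^sub>F t in at_right 0. F t = 0"
    using ab T F0 by (intro eventually_at_rightI[of 0 "min a T"]) auto
   hence "(F \<longlongrightarrow> 0) (at_right \<tau>)" unfolding True by (rule tendsto_eventually)
   thus ?thesis using True by (simp add: ereal_tendsto_simps)
  next
   case False
   hence "isCont F \<tau>" using Fd[of \<tau>] \<tau> by (intro DERIV_isCont) auto
   hence "(F \<longlongrightarrow> F \<tau>) (at_right \<tau>)" by (simp add: isCont_def filterlim_at_split)
   thus ?thesis using False by (simp add: ereal_tendsto_simps)
  qed
  have "\<forall>\<^sub>F t in at_left T. F t = 0"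
   using ab \<tau> F0 T by (intro eventually_at_leftI[of "max b 0"]) auto
  hence "(F \<longlongrightarrow> 0) (at_left T)" by (rule tendsto_eventually)
  thus "((F \<circ> real_of_ereal) \<longlongrightarrow> 0) (at_left (ereal T))" by (simp add: ereal_tendsto_simps)
 qed (use \<tau> in auto)
 thus ?thesis using \<tau> by (simp add: interval_lebesgue_integral_def set_lebesgue_integral_def f_def F_def)
qed

definition HH :: "real \<Rightarrow> real \<Rightarrow> real" where "HH t \<tau> = (LBINT x. q t x * upow S \<tau> x)"

lemma HH_bound: "\<bar>HH t \<tau>\<bar> \<le> B * (LBINT x. upow S \<tau> x)"
 unfolding HH_def using q_pair_bound(2)[OF upow_integrable[OF S_borel]] by (simp add: abs_of_nonneg[OF upow_nonneg])

lemma measurable_HH_slice [measurable]: "HH t \<in> bm"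
 unfolding HH_def by measurable

text \<open>The integrand over 0 < \<tau> <= t < T whose two orders of integration are the two sides
  of the weak identity.\<close>

definition PP :: "real \<Rightarrow> real \<Rightarrow> real" where
 "PP t \<tau> = indicator {0<..<T} t * (indicator {0<..T} \<tau> * (indicator {..0} (\<tau> - t) * HH t \<tau>))"

text \<open>The representatives q t are chosen separately for each t, so q need not be jointly
  measurable. The pairing is continuous in t, however, and is the limit of its values at the grid
  times \<lceil>k t\<rceil>/k.\<close>

lemma measurable_PP: "(\<lambda>p. PP (fst p) (snd p)) \<in> borel_measurable lborel2"
proof (rule borel_measurable_LIMSEQ_real)
 define P where "P = (\<lambda>k p. indicator {0<..<T} (fst p) * (indicator {0<..T} (snd p) * (indicator {..0} (snd p - fst p) * HH (real_of_int \<lceil>real k * fst p\<rceil> / real k) (snd p))) :: real)"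
 show "P k \<in> borel_measurable lborel2" for k
 proof -
  have [measurable]: "(\<lambda>p::real\<times>real. HH (real_of_int \<lceil>real k * fst p\<rceil> / real k) (snd p)) \<in> borel_measurable lborel2"
  proof (rule measurable_compose_countable[where f="\<lambda>i p. HH (real_of_int i / real k) (snd p)"])
   show "(\<lambda>p::real\<times>real. \<lceil>real k * fst p\<rceil>) \<in> measurable lborel2 (count_space UNIV)" by measurable
  qed measurable
  show ?thesis unfolding P_def by measurable
 qed
 fix p :: "real \<times> real"
 show "(\<lambda>k. P k p) \<longlonglongrightarrow> PP (fst p) (snd p)"
 proof (cases "fst p \<in> {0<..<T}")
  case True
  have "(\<lambda>k. real_of_int \<lceil>real k * fst p\<rceil> / real k) \<longlonglongrightarrow> fst p"
  proof (rule tendsto_sandwich)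
   have "\<forall>\<^sub>F k::nat in sequentially. k > 0" by (rule eventually_gt_at_top)
   thus "\<forall>\<^sub>F k in sequentially. fst p \<le> real_of_int \<lceil>real k * fst p\<rceil> / real k"
    by eventually_elim (simp add: field_simps)
   have "\<forall>\<^sub>F k::nat in sequentially. k > 0" by (rule eventually_gt_at_top)
   thus "\<forall>\<^sub>F k in sequentially. real_of_int \<lceil>real k * fst p\<rceil> / real k \<le> fst p + 1 / real k"
   proof eventually_elim
    case (elim k)
    have "real_of_int \<lceil>real k * fst p\<rceil> \<le> real k * fst p + 1" by linarith
    thus ?case using elim by (simp add: field_simps)
   qed
   show "(\<lambda>k. fst p + 1 / real k) \<longlonglongrightarrow> fst p" by real_asymp
  qed simp
  moreover have "isCont (\<lambda>t. HH t (snd p)) (fst p)"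
   unfolding HH_def by (rule cont[OF upow_integrable[OF S_borel]]) (use True in auto)
  ultimately have "(\<lambda>k. HH (real_of_int \<lceil>real k * fst p\<rceil> / real k) (snd p)) \<longlonglongrightarrow> HH (fst p) (snd p)"
   by (intro isCont_tendsto_compose[of "fst p" "\<lambda>t. HH t (snd p)"])
  thus ?thesis unfolding P_def PP_def by (intro tendsto_intros)
 qed (simp add: P_def PP_def)
qed

lemma integrable_PP: "integrable lborel2 (\<lambda>(t, \<tau>). PP t \<tau>)"
proof -
 define k where "k = (\<lambda>\<tau>. indicator {0<..T} \<tau> * (LBINT x. upow S \<tau> x) :: real)"
 have "integrable lborel2 (\<lambda>(t, \<tau>). indicator {0<..<T} t * (B * k \<tau>))"
 proof (rule lborel_pair.Fubini_integrable)
  have [measurable]: "k \<in> bm" unfolding k_def by measurable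
  show "(\<lambda>(t, \<tau>). indicator {0<..<T} t * (B * k \<tau>)) \<in> borel_measurable lborel2" by measurable
  have kI: "Lint k" unfolding k_def by (rule upow_integral_integrable)
  thus "AE t in lborel. Lint (\<lambda>\<tau>. case (t, \<tau>) of (t, \<tau>) \<Rightarrow> indicator {0<..<T} t * (B * k \<tau>))" by simp
  have "Lint (\<lambda>t. indicator {0<..<T} t * (LBINT \<tau>. \<bar>B * k \<tau>\<bar>))"
   by (intro integrable_mult_left integrable_real_indicator) (use T in auto)
  thus "Lint (\<lambda>t. LBINT \<tau>. norm (case (t, \<tau>) of (t, \<tau>) \<Rightarrow> indicator {0<..<T} t * (B * k \<tau>)))"
   by (simp add: abs_mult)
 qed
 thus ?thesis
 proof (rule integrable_bound)
  show "(\<lambda>(t, \<tau>). PP t \<tau>) \<in> borel_measurable lborel2" using measurable_PP by (simp add: case_prod_beta')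
  have k0: "0 \<le> k \<tau>" for \<tau> unfolding k_def by (intro mult_nonneg_nonneg integral_nonneg upow_nonneg) auto
  have "\<bar>PP t \<tau>\<bar> \<le> indicator {0<..<T} t * (B * k \<tau>)" for t \<tau>
   using HH_bound[of t \<tau>] order_trans[OF abs_ge_zero HH_bound[of t \<tau>]] by (auto simp: PP_def k_def indicator_def)
  thus "AE p in lborel \<Otimes>\<^sub>M lborel. norm (case p of (t, \<tau>) \<Rightarrow> PP t \<tau>) \<le> norm (case p of (t, \<tau>) \<Rightarrow> indicator {0<..<T} t * (B * k \<tau>))"
   by (intro AE_I2) (auto simp: case_prod_beta' intro: order_trans[OF _ abs_ge_self])
 qed
qed

text \<open>The integrated identity \<open>u_dual\<close> on (0, t] with weight q t, read after both
  potentials have been moved back from q t by symmetry.\<close>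

lemma weak_integrand:
 assumes t: "0 < t" "t < T"
 shows "(LBINT x. q t x * conv G (u t) x) = (LBINT x. q t x * (indicator S x * conv G u0 x)) - (LBINT \<tau>. PP t \<tau>)"
proof -
 obtain C where C: "gdom C (q t)" using q_gdom by blast
 have "(LBINT \<tau>. indicator {0<..t} \<tau> * (LBINT x. q t x * u \<tau> x powr m)) = (LBINT \<tau>. PP t \<tau>)"
 proof (rule integral_cong_AE)
  show "PP t \<in> borel_measurable lborel" unfolding PP_def by measurable
  show "AE \<tau> in lborel. indicator {0<..t} \<tau> * (LBINT x. q t x * u \<tau> x powr m) = PP t \<tau>"
   using AE_upow
  proof eventually_elim
   case (elim \<tau>)
   show ?case
   proof (cases "\<tau> \<in> {0<..t}")
    case True
    hence "upow S \<tau> x = indicator S x * u \<tau> x powr m" for x using elim t by auto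
    hence 1: "q t x * u \<tau> x powr m = q t x * upow S \<tau> x" for x
     using q_le[of t x] by (cases "x \<in> S") auto
    show ?thesis unfolding PP_def HH_def 1 using True t by simp
   qed (use t in \<open>auto simp: PP_def indicator_def\<close>)
  qed
 qed measurable
 moreover have 1: "q t x * (indicator S x * conv G u0 x) = q t x * conv G u0 x" for x
  using q_le[of t x] by (cases "x \<in> S") auto
 moreover have "(LBINT x. q t x * conv G u0 x) = (LBINT x. u0 x * conv G (q t) x)"
  by (rule green_adjoint_Phi[OF C u0_Phi measurable_u0])
 moreover have "(LBINT x. q t x * conv G (u t) x) = (LBINT x. u t x * conv G (q t) x)"
  using t by (intro green_adjoint_Phi[OF C u_Phi_integrable]) auto
 ultimately show ?thesis unfolding 1 using u_dual[OF C less_imp_le[OF t(1)]] by linarith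
qed

text \<open>By \<open>weak_integrand\<close> the left side is a term with the fixed function 1_S (G
  * u0) minus the integral of \<open>PP\<close>. The fixed term integrates to 0 by
  \<open>pairing_FTC\<close> from \<tau> = 0; in the other order of integration
  \<open>pairing_FTC\<close> at \<tau> turns q into - \<rho> \<tau>.\<close>

lemma
 shows weak_identity: "(LBINT t. indicator {0<..<T} t * (LBINT x. q t x * conv G (u t) x)) =
   (LBINT \<tau>. indicator {0<..<T} \<tau> * (LBINT x. \<rho> \<tau> x * upow S \<tau> x))" (is ?A)
  and measurable_weak_lhs: "(\<lambda>t. indicator {0<..<T} t * (LBINT x. q t x * conv G (u t) x)) \<in> bm" (is ?B)
  and measurable_weak_rhs: "(\<lambda>\<tau>. indicator {0<..<T} \<tau> * (LBINT x. \<rho> \<tau> x * upow S \<tau> x)) \<in> bm" (is ?C)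
proof -
 define y where "y = (\<lambda>x. indicator S x * conv G u0 x)"
 obtain C where C: "gdom C (indicator S)" using gdom_S by blast
 have y: "Lint y" unfolding y_def by (rule integrable_green_Phi[OF C u0_Phi measurable_u0])
 have L: "indicator {0<..<T} t * (LBINT x. q t x * conv G (u t) x) =
   indicator {0<..<T} t * (LBINT x. q t x * y x) - (LBINT \<tau>. PP t \<tau>)" for t
  using weak_integrand[of t] unfolding y_def by (cases "t \<in> {0<..<T}") (auto simp: PP_def)
 have pI: "Lint (\<lambda>t. LBINT \<tau>. PP t \<tau>)" using lborel_pair.integrable_fst'[OF integrable_PP] by simp
 have "continuous_on {0<..<T} (\<lambda>t. LBINT x. q t x * y x)" using cont[OF y] by (auto simp: continuous_on_eq_continuous_at)
 hence ym: "(\<lambda>t. indicator {0<..<T} t * (LBINT x. q t x * y x)) \<in> bm"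
  using borel_measurable_continuous_on_indicator[of "{0<..<T}" "\<lambda>t. LBINT x. q t x * y x"] by simp
 have yI: "Lint (\<lambda>t. indicator {0<..<T} t * (LBINT x. q t x * y x))"
 proof (rule integrable_bound)
  show "Lint (\<lambda>t. indicator {0<..<T} t * (B * nL1 y))" by (intro integrable_mult_left integrable_real_indicator) (use T in auto)
  show "AE t in lborel. norm (indicator {0<..<T} t * (LBINT x. q t x * y x)) \<le> norm (indicator {0<..<T} t * (B * nL1 y))"
   using q_pair_bound(2)[OF y] by (intro AE_I2) (auto simp: indicator_def intro: order_trans[OF _ abs_ge_self])
 qed (use ym in simp)
 show ?B unfolding L using borel_measurable_diff[OF ym Lint_measurable[OF pI]] .
 have R: "(LBINT t. PP t \<tau>) = - (indicator {0<..<T} \<tau> * (LBINT x. \<rho> \<tau> x * upow S \<tau> x))" for \<tau>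
 proof (cases "\<tau> \<in> {0<..<T}")
  case True
  have "(LBINT t. PP t \<tau>) = (LBINT t. indicator {\<tau><..<T} t * (LBINT x. q t x * upow S \<tau> x))"
  proof (rule integral_cong_AE)
   have "continuous_on {0<..<T} (\<lambda>t. HH t \<tau>)" unfolding HH_def using cont[OF upow_integrable[OF S_borel]] by (auto simp: continuous_on_eq_continuous_at)
   hence hm: "(\<lambda>t. indicator {0<..<T} t * HH t \<tau>) \<in> bm"
    using borel_measurable_continuous_on_indicator[of "{0<..<T}" "\<lambda>t. HH t \<tau>"] by simp
   have "PP t \<tau> = indicator {0<..T} \<tau> * (indicator {..0} (\<tau> - t) * (indicator {0<..<T} t * HH t \<tau>))" for t
    by (simp add: PP_def)
   thus "(\<lambda>t. PP t \<tau>) \<in> borel_measurable lborel" using hm by simp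
   have eq: "indicator {\<tau><..<T} t * (LBINT x. q t x * upow S \<tau> x) = indicator {\<tau><..<T} t * (indicator {0<..<T} t * HH t \<tau>)" for t
    using True by (auto simp: HH_def indicator_def)
   show "(\<lambda>t. indicator {\<tau><..<T} t * (LBINT x. q t x * upow S \<tau> x)) \<in> borel_measurable lborel"
    unfolding eq by (rule borel_measurable_times) (use hm in simp_all)
   have "AE t in lborel. t \<noteq> \<tau>" by (rule AE_lborel_singleton)
   thus "AE t in lborel. PP t \<tau> = indicator {\<tau><..<T} t * (LBINT x. q t x * upow S \<tau> x)"
    by eventually_elim (use True in \<open>auto simp: PP_def HH_def indicator_def\<close>)
  qed
  also have "\<dots> = - (LBINT x. \<rho> \<tau> x * upow S \<tau> x)"
   using pairing_FTC[OF upow_integrable[OF S_borel], of \<tau> \<tau>] True by simp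
  finally show ?thesis using True by simp
 next
  case False
  have "AE t in lborel. PP t \<tau> = 0" using False by (intro AE_I2) (auto simp: PP_def indicator_def)
  hence "(LBINT t. PP t \<tau>) = 0" by (rule integral_eq_zero_AE)
  thus ?thesis using False by simp
 qed
 have rI: "Lint (\<lambda>\<tau>. LBINT t. PP t \<tau>)" using lborel_pair.integrable_snd[OF integrable_PP] by simp
 show ?C using borel_measurable_uminus[OF Lint_measurable[OF rI]] unfolding R by simp
 have "(LBINT t. indicator {0<..<T} t * (LBINT x. q t x * conv G (u t) x)) =
   (LBINT t. indicator {0<..<T} t * (LBINT x. q t x * y x)) - (LBINT t. (LBINT \<tau>. PP t \<tau>))"
  unfolding L using yI pI by (rule integral_diff)
 also have "(LBINT t. (LBINT \<tau>. PP t \<tau>)) = (LBINT \<tau>. (LBINT t. PP t \<tau>))"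
  using lborel_pair.Fubini_integral[OF integrable_PP] by simp
 also have "\<dots> = - (LBINT \<tau>. indicator {0<..<T} \<tau> * (LBINT x. \<rho> \<tau> x * upow S \<tau> x))" unfolding R by simp
 also have "(LBINT t. indicator {0<..<T} t * (LBINT x. q t x * y x)) = 0" using pairing_FTC[OF y, of 0] T by simp
 finally show ?A by simp
qed

end
end
end

section \<open>From Borel to Lebesgue measurable functions\<close>

lemma lebesgue_borel: "f \<in> bm \<Longrightarrow> f \<in> borel_measurable lebesgue"
 by (rule measurable_completion) simp

lemma borel_rep:
 fixes f :: "'a::euclidean_space \<Rightarrow> real"
 assumes "f \<in> borel_measurable lebesgue"
 shows "\<exists>g\<in>bm. AE x in lborel. f x = g x"
 using completion_ex_borel_measurable_real[OF assms] by simp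

text \<open>Completion: agreement almost everywhere with a Borel function makes f Lebesgue
  measurable, so all integrals of the definitions may be taken over Borel representatives.\<close>

lemma integral_lebesgue:
 fixes f :: "'a::euclidean_space \<Rightarrow> 'b::euclidean_space"
 assumes [measurable]: "g \<in> bm" and eq: "AE x in lborel. f x = g x"
 shows "(\<integral>x. f x \<partial>lebesgue) = (LBINT x. g x)"
proof -
 have g: "g \<in> borel_measurable lebesgue" by (rule lebesgue_borel) simp
 have ae: "AE x in lebesgue. g x = f x" using eq unfolding AE_completion_iff by eventually_elim simp
 have "(\<integral>x. f x \<partial>lebesgue) = (\<integral>x. g x \<partial>lebesgue)"
  using ae by (intro integral_cong_AE borel_measurable_AE[OF g ae] g) auto
 also have "\<dots> = (LBINT x. g x)" by (rule integral_completion) simp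
 finally show ?thesis .
qed

lemma L1_norm_eq: "L1_norm f = (LBNN x. ennreal \<bar>f x\<bar>)"
 by (simp add: L1_norm_def nn_integral_completion)

lemma L1_norm_integrable: "Lint f \<Longrightarrow> L1_norm f = ennreal (nL1 f)"
 by (simp add: L1_norm_eq nn_integral_eq_integral)

lemma integrable_L1:
 assumes "Lint f"
 shows "f \<in> L1"
 using lebesgue_borel[OF Lint_measurable[OF assms]] L1_norm_integrable[OF assms] by (simp add: L1_def)

lemma L1_rep_integrable:
 assumes f: "f \<in> L1" and [measurable]: "g \<in> bm" and eq: "AE x in lborel. f x = g x"
 shows "Lint g"
proof -
 have "(LBNN x. ennreal (norm (g x))) = (LBNN x. ennreal \<bar>f x\<bar>)"
  using eq by (intro nn_integral_cong_AE) (auto elim: AE_mp)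
 thus ?thesis using f unfolding integrable_iff_bounded L1_def L1_norm_eq by simp
qed

lemma Linf_norm_AE:
 assumes "Linf_norm f < ennreal e"
 shows "AE x in lborel. \<bar>f x\<bar> \<le> e"
proof -
 have "AE x in lebesgue. ennreal \<bar>f x\<bar> \<le> Linf_norm f" unfolding Linf_norm_def by (rule esssup_AE)
 thus ?thesis unfolding AE_completion_iff
 proof eventually_elim
  case (elim x)
  hence "ennreal \<bar>f x\<bar> < ennreal e" using assms by (rule le_less_trans)
  thus ?case by (simp add: ennreal_less_iff)
 qed
qed

lemma bounded_Linf:
 assumes f: "f \<in> bm" and C: "\<And>x. \<bar>f x\<bar> \<le> C"
 shows "f \<in> Linf"
proof -
 have m: "f \<in> borel_measurable lebesgue" by (rule lebesgue_borel[OF f])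
 have "Linf_norm f \<le> ennreal C" unfolding Linf_norm_def
  using m C by (intro esssup_I AE_I2 ennreal_leI) measurable
 also have "\<dots> < \<infinity>" by simp
 finally show ?thesis using m by (simp add: Linf_def)
qed

lemma bounded_L2:
 assumes f: "Lint f" and C: "\<And>x. \<bar>f x\<bar> \<le> C"
 shows "f \<in> L2"
proof -
 have "(LBNN x. ennreal ((f x)\<^sup>2)) \<le> (LBNN x. ennreal (C * \<bar>f x\<bar>))"
 proof (intro nn_integral_mono ennreal_leI)
  fix x show "(f x)\<^sup>2 \<le> C * \<bar>f x\<bar>"
   using mult_right_mono[OF C[of x] abs_ge_zero[of "f x"]] by (simp add: power2_eq_square abs_mult_self_eq)
 qed
 also have "\<dots> \<le> (LBNN x. ennreal (norm (C * f x)))"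
  by (intro nn_integral_mono ennreal_leI) (simp add: abs_mult mult_right_mono)
 also have "\<dots> < \<infinity>" using integrable_mult_right[OF f, of C] unfolding integrable_iff_bounded by blast
 finally show ?thesis
  using lebesgue_borel[OF Lint_measurable[OF f]] by (simp add: L2_def nn_integral_completion)
qed

lemma fourier_eq:
 assumes [measurable]: "g \<in> bm" and eq: "AE x in lborel. f x = g x"
 shows "fourier f \<xi> = ft g \<xi>"
 unfolding fourier_def ft_def
proof (rule integral_lebesgue)
 have [measurable]: "(\<lambda>x. cis (- (x \<bullet> \<xi>))) \<in> bm"
  by (intro borel_measurable_continuous_onI continuous_intros)
 show "(\<lambda>x. complex_of_real (g x) * cis (- (x \<bullet> \<xi>))) \<in> bm" by measurable
 show "AE x in lborel. complex_of_real (f x) * cis (- (x \<bullet> \<xi>)) = complex_of_real (g x) * cis (- (x \<bullet> \<xi>))"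
  using eq by eventually_elim simp
qed

section \<open>Comparison for schemes and solutions in the sense of the given definitions\<close>

locale pme_vec = pme s n TA m for s n :: real and TA :: "(real^'k) itself" and m :: real
begin

lemma frac_laplacian_eqI:
 assumes p: "fpair w g" and b: "\<And>x. \<bar>w x\<bar> \<le> C" "\<And>x. \<bar>g x\<bar> \<le> D"
 shows "frac_laplacian_eq s w g"
proof -
 note I = fpairD[OF p]
 have "fourier g \<xi> = complex_of_real (norm \<xi> powr (2 * s)) * fourier w \<xi>" for \<xi>
  using p fourier_eq[OF Lint_measurable[OF I(1)], of w] fourier_eq[OF Lint_measurable[OF I(2)], of g]
  by (simp add: fpair_def)
 thus ?thesis unfolding frac_laplacian_eq_def
  using integrable_L1[OF I(1)] integrable_L1[OF I(2)] bounded_L2[OF I(1) b(1)] bounded_L2[OF I(2) b(2)] by simp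
qed

lemma frac_laplacian_eqD:
 assumes p: "frac_laplacian_eq s w g" and [measurable]: "w' \<in> bm" "g' \<in> bm"
  and eq: "AE x in lborel. w x = w' x" "AE x in lborel. g x = g' x"
 shows "fpair w' g'"
 using p L1_rep_integrable[OF _ _ eq(1)] L1_rep_integrable[OF _ _ eq(2)] fourier_eq[OF _ eq(1)] fourier_eq[OF _ eq(2)]
 by (auto simp: fpair_def frac_laplacian_eq_def)

text \<open>The error bound of \<open>eul_mild\<close> increases with t, so its value at T is
  uniform on [0, T]; continuity in time is \<open>mild_lipschitz\<close>.\<close>

lemma mild_solution_mild:
 assumes nice: "nice M w g"
 shows "mild_solution s m w (mild M w)"
 unfolding mild_solution_def
proof (intro allI impI conjI)
 fix T :: real assume T: "T > 0"
 show "\<forall>t\<in>{0..T}. mild M w t \<in> L1" using mild_integrable[OF nice] by (auto intro: integrable_L1)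
 show "continuous_in_norm L1_norm {0..T} (mild M w)" unfolding continuous_in_norm_def
 proof
  fix t assume t: "t \<in> {0..T}"
  have "((\<lambda>\<tau>. ennreal (D0 g * \<bar>\<tau> - t\<bar>)) \<longlongrightarrow> ennreal (D0 g * \<bar>t - t\<bar>)) (at t within {0..T})"
   by (intro tendsto_ennrealI tendsto_intros)
  hence "((\<lambda>\<tau>. ennreal (D0 g * \<bar>\<tau> - t\<bar>)) \<longlongrightarrow> 0) (at t within {0..T})" by simp
  moreover have "\<forall>\<^sub>F \<tau> in at t within {0..T}. L1_norm (\<lambda>x. mild M w \<tau> x - mild M w t x) \<le> ennreal (D0 g * \<bar>\<tau> - t\<bar>)"
   unfolding eventually_at_filter
  proof (intro always_eventually allI impI)
   fix \<tau> assume \<tau>: "\<tau> \<in> {0..T}"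
   have "Lint (\<lambda>x. mild M w \<tau> x - mild M w t x)"
    using \<tau> t by (intro integrable_diff mild_integrable[OF nice]) auto
   thus "L1_norm (\<lambda>x. mild M w \<tau> x - mild M w t x) \<le> ennreal (D0 g * \<bar>\<tau> - t\<bar>)"
    using mild_lipschitz[OF nice, of \<tau> t] \<tau> t by (simp add: L1_norm_integrable ennreal_leI)
  qed
  ultimately show "((\<lambda>\<tau>. L1_norm (\<lambda>x. mild M w \<tau> x - mild M w t x)) \<longlongrightarrow> 0) (at t within {0..T})"
   using tendsto_sandwich[of "\<lambda>_. 0" "\<lambda>\<tau>. L1_norm (\<lambda>x. mild M w \<tau> x - mild M w t x)" "at t within {0..T}" "\<lambda>\<tau>. ennreal (D0 g * \<bar>\<tau> - t\<bar>)" 0]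
   by simp
 qed
 define v where "v = (\<lambda>l j. eul M w (T / real l) j)"
 have "euler_scheme s m (T / real l) l w (v l)" if l: "l \<ge> 1" for l
 proof -
  define h where "h = T / real l"
  have h: "h > 0" using T l by (simp add: h_def)
  have V: "v l j = eul M w h j" for j by (simp add: v_def h_def)
  note b = eul_bounds[OF nice h]
  have vm: "eul M w h j \<in> bm" for j by (rule Lint_measurable[OF eul_integrable[OF nice h]])
  have "\<exists>g. frac_laplacian_eq s (\<lambda>x. v l (Suc j) x powr m) g \<and> (AE x in lebesgue. h * g x + v l (Suc j) x = v l j x)" for j
  proof (intro exI conjI)
   show "frac_laplacian_eq s (\<lambda>x. v l (Suc j) x powr m) (\<lambda>x. (eul M w h j x - eul M w h (Suc j) x) / h)" unfolding V
   proof (rule frac_laplacian_eqI[OF eul_fpair[OF nice h]])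
    show "\<bar>eul M w h (Suc j) x powr m\<bar> \<le> M powr m" for x
     using powr_mono2[OF _ b(1)[of "Suc j" x] b(2)[of "Suc j" x], of m] m_gt by (simp del: eul.simps)
    show "\<bar>(eul M w h j x - eul M w h (Suc j) x) / h\<bar> \<le> M / h" for x
    proof -
     have "\<bar>eul M w h j x - eul M w h (Suc j) x\<bar> \<le> M" using b(1)[of "Suc j" x] b(2)[of "Suc j" x] b(1)[of j x] b(2)[of j x] by linarith
     from divide_right_mono[OF this, of h] show ?thesis using h by (simp del: eul.simps)
    qed
   qed
  qed (use h in \<open>simp add: V\<close>)
  moreover have "v l j \<in> Linf" for j unfolding V by (rule bounded_Linf[OF vm, of _ M]) (use b in \<open>simp add: abs_of_nonneg\<close>)
  ultimately show ?thesis unfolding euler_scheme_def h_def[symmetric]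
   using b integrable_L1[OF eul_integrable[OF nice h]] by (auto simp: V)
 qed
 moreover have "(\<lambda>l. SUP t\<in>{0..T}. L1_norm (\<lambda>x. v l (nat \<lceil>t * real l / T\<rceil>) x - mild M w t x)) \<longlonglongrightarrow> 0"
 proof (rule tendsto_sandwich[OF _ _ tendsto_const])
  have "(\<lambda>l. D0 g * sqrt (T / real l * (3 * (T / real l) + 2 * T))) \<longlonglongrightarrow> D0 g * sqrt 0"
   by (intro tendsto_intros) (use T in real_asymp)
  hence "(\<lambda>l. ennreal (D0 g * sqrt (T / real l * (3 * (T / real l) + 2 * T)))) \<longlonglongrightarrow> ennreal 0"
   by (intro tendsto_ennrealI) simp
  thus "(\<lambda>l. ennreal (D0 g * sqrt (T / real l * (3 * (T / real l) + 2 * T)))) \<longlonglongrightarrow> 0" by simp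
  show "\<forall>\<^sub>F l in sequentially. (SUP t\<in>{0..T}. L1_norm (\<lambda>x. v l (nat \<lceil>t * real l / T\<rceil>) x - mild M w t x))
    \<le> ennreal (D0 g * sqrt (T / real l * (3 * (T / real l) + 2 * T)))"
   using eventually_gt_at_top[of 0]
  proof eventually_elim
   case (elim l)
   hence h: "T / real l > 0" using T by simp
   show ?case
   proof (rule SUP_least)
    fix t assume t: "t \<in> {0..T}"
    have i: "nat \<lceil>t * real l / T\<rceil> = ix (T / real l) t" by (simp add: ix_def[OF nice])
    have t0: "t \<ge> 0" using t by simp
    have "D0 g * sqrt (T / real l * (3 * (T / real l) + 2 * t)) \<le> D0 g * sqrt (T / real l * (3 * (T / real l) + 2 * T))"
     using t h D0_nonneg[OF nice] by (intro mult_left_mono real_sqrt_le_mono) auto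
    thus "L1_norm (\<lambda>x. v l (nat \<lceil>t * real l / T\<rceil>) x - mild M w t x) \<le> ennreal (D0 g * sqrt (T / real l * (3 * (T / real l) + 2 * T)))"
     unfolding i v_def L1_norm_integrable[OF eul_mild(1)[OF nice t0 h]]
     using eul_mild(2)[OF nice t0 h] by (intro ennreal_leI) linarith
   qed
  qed
 qed simp
 ultimately show "\<exists>v. (\<forall>l\<ge>1. euler_scheme s m (T / real l) l w (v l)) \<and>
   (\<lambda>l. SUP t\<in>{0..T}. L1_norm (\<lambda>x. v l (nat \<lceil>t * real l / T\<rceil>) x - mild M w t x)) \<longlonglongrightarrow> 0" by blast
qed

text \<open>Any scheme satisfying the definition qualifies, not only the one constructed above: its
  iterates and operator values are replaced by Borel representatives, made nonnegative everywhere,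
  and \<open>bump_lower\<close> applies.\<close>

lemma euler_scheme_lower:
 assumes sch: "euler_scheme s m h N f v" and h: "h > 0" and b: "bump e F" and e: "e \<ge> 0" and l: "l > 0" "l * e \<le> pe"
 shows "(LBNN x. ennreal (amp l (real N * h) * F x powr (1 / m) - v N x)) \<le> (LBNN x. ennreal (amp l 0 * F x powr (1 / m) - f x))"
proof -
 have "\<forall>j. \<exists>v'. j \<le> N \<longrightarrow> v' \<in> bm \<and> (AE x in lborel. v j x = v' x) \<and> (\<forall>x. 0 \<le> v' x) \<and> Lint v'"
 proof (intro allI)
  fix j
  show "\<exists>v'. j \<le> N \<longrightarrow> v' \<in> bm \<and> (AE x in lborel. v j x = v' x) \<and> (\<forall>x. 0 \<le> v' x) \<and> Lint v'"
  proof (cases "j \<le> N")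
  case j: True
  have vj: "v j \<in> L1" "AE x in lborel. 0 \<le> v j x" using sch j by (auto simp: euler_scheme_def AE_completion_iff)
  obtain v' where [measurable]: "v' \<in> bm" and v': "AE x in lborel. v j x = v' x"
   using borel_rep[of "v j"] vj(1) by (auto simp: L1_def)
  have eq: "AE x in lborel. v j x = max 0 (v' x)" using v' vj(2) by eventually_elim auto
  have "Lint (\<lambda>x. max 0 (v' x))" by (rule L1_rep_integrable[OF vj(1) _ eq]) measurable
  with eq show ?thesis by (intro exI[of _ "\<lambda>x. max 0 (v' x)"]) auto
  qed auto
 qed
 from choice[OF this] obtain v' where "\<forall>j. j \<le> N \<longrightarrow> v' j \<in> bm \<and> (AE x in lborel. v j x = v' j x) \<and> (\<forall>x. 0 \<le> v' j x) \<and> Lint (v' j)" ..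
 hence v': "\<And>j. j \<le> N \<Longrightarrow> v' j \<in> bm" "\<And>j. j \<le> N \<Longrightarrow> AE x in lborel. v j x = v' j x"
  "\<And>j x. j \<le> N \<Longrightarrow> 0 \<le> v' j x" "\<And>j. j \<le> N \<Longrightarrow> Lint (v' j)" by simp_all
 have "\<forall>j. \<exists>\<gamma>. j < N \<longrightarrow> fpair (\<lambda>x. v' (Suc j) x powr m) \<gamma> \<and> (AE x in lborel. v' j x = v' (Suc j) x + h * \<gamma> x)"
 proof (intro allI)
  fix j
  show "\<exists>\<gamma>. j < N \<longrightarrow> fpair (\<lambda>x. v' (Suc j) x powr m) \<gamma> \<and> (AE x in lborel. v' j x = v' (Suc j) x + h * \<gamma> x)"
  proof (cases "j < N")
  case j: True
  obtain g where g: "frac_laplacian_eq s (\<lambda>x. v (Suc j) x powr m) g" "AE x in lborel. h * g x + v (Suc j) x = v j x"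
   using sch j by (auto simp: euler_scheme_def AE_completion_iff)
  hence "g \<in> borel_measurable lebesgue" by (simp add: frac_laplacian_eq_def L1_def)
  then obtain \<gamma> where gm: "\<gamma> \<in> bm" "AE x in lborel. g x = \<gamma> x" using borel_rep by blast
  have e1: "AE x in lborel. v j x = v' j x" "AE x in lborel. v (Suc j) x = v' (Suc j) x" using v'(2) j by auto
  have [measurable]: "v' (Suc j) \<in> bm" using v'(1) j by simp
  have "AE x in lborel. v (Suc j) x powr m = v' (Suc j) x powr m" using e1(2) by eventually_elim simp
  from frac_laplacian_eqD[OF g(1) _ gm(1) this gm(2)] have "fpair (\<lambda>x. v' (Suc j) x powr m) \<gamma>" by simp
  moreover have "AE x in lborel. v' j x = v' (Suc j) x + h * \<gamma> x"
   using g(2) gm(2) e1 by eventually_elim simp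
  ultimately show ?thesis by blast
  qed auto
 qed
 from choice[OF this] obtain \<gamma> where "\<forall>j. j < N \<longrightarrow> fpair (\<lambda>x. v' (Suc j) x powr m) (\<gamma> j) \<and> (AE x in lborel. v' j x = v' (Suc j) x + h * \<gamma> j x)" ..
 hence \<gamma>: "\<And>j. j < N \<Longrightarrow> fpair (\<lambda>x. v' (Suc j) x powr m) (\<gamma> j)"
  "\<And>j. j < N \<Longrightarrow> AE x in lborel. v' j x = v' (Suc j) x + h * \<gamma> j x" by simp_all
 \<comment> \<open>The scheme ends at index N, whereas \<open>bump_lower\<close> asks for
   nonnegativity at all indices; beyond N the sequence is continued by 0.\<close>
 define V where "V = (\<lambda>j. if j \<le> N then v' j else (\<lambda>_. 0))"
 have V: "V j = v' j" if "j \<le> N" for j using that by (simp add: V_def)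
 have FI: "Lint (\<lambda>x. F x powr (1 / m))" using b by (simp add: bump_def)
 have le: "(LBINT x. max 0 (amp l (real N * h) * F x powr (1 / m) - V N x)) \<le> (LBINT x. max 0 (amp l 0 * F x powr (1 / m) - V 0 x))"
 proof (rule bump_lower[OF b e l h])
  show "Lint (V j)" if "j \<le> N" for j using v'(4)[OF that] V[OF that] by simp
  show "0 \<le> V j x" for j x using v'(3) by (simp add: V_def)
  show "fpair (\<lambda>x. V (Suc j) x powr m) (\<gamma> j)" if "j < N" for j using \<gamma>(1)[OF that] V[of "Suc j"] that by simp
  show "AE x in lborel. V j x \<le> V (Suc j) x + h * \<gamma> j x" if "j < N" for j
   using \<gamma>(2)[OF that] V[of "Suc j"] V[of j] that by (auto elim: AE_mp)
 qed
 \<comment> \<open>\<open>ennreal\<close> sends negative numbers to 0, so the extended integral of a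
   difference is the integral of its positive part.\<close>
 have cv: "(LBNN x. ennreal (A * F x powr (1 / m) - V j x)) = ennreal (LBINT x. max 0 (A * F x powr (1 / m) - V j x))" if j: "j \<le> N" for A j
 proof -
  have "Lint (\<lambda>x. max 0 (A * F x powr (1 / m) - V j x))"
   using FI v'(4)[OF j] V[OF j] by (intro integrable_max integrable_zero integrable_diff integrable_mult_right) auto
  hence "(LBNN x. ennreal (max 0 (A * F x powr (1 / m) - V j x))) = ennreal (LBINT x. max 0 (A * F x powr (1 / m) - V j x))"
   by (intro nn_integral_eq_integral) auto
  moreover have "ennreal (max 0 y) = ennreal y" for y by (cases "y \<ge> 0") (auto simp: ennreal_neg)
  ultimately show ?thesis by simp
 qed
 have eN: "AE x in lborel. v N x = V N x" using v'(2) V by simp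
 have e0: "AE x in lborel. f x = V 0 x"
 proof -
  have "AE x in lborel. v 0 x = f x" using sch by (simp add: euler_scheme_def AE_completion_iff)
  with v'(2)[of 0] show ?thesis by (simp add: V) (erule AE_mp, erule AE_mp, simp)
 qed
 have "(LBNN x. ennreal (amp l (real N * h) * F x powr (1 / m) - v N x)) = (LBNN x. ennreal (amp l (real N * h) * F x powr (1 / m) - V N x))"
  using eN by (intro nn_integral_cong_AE) (auto elim: AE_mp)
 also have "\<dots> \<le> (LBNN x. ennreal (amp l 0 * F x powr (1 / m) - V 0 x))"
  using le by (simp add: cv ennreal_leI)
 also have "\<dots> = (LBNN x. ennreal (amp l 0 * F x powr (1 / m) - f x))"
  using e0 by (intro nn_integral_cong_AE) (auto elim: AE_mp)
 finally show ?thesis .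
qed

text \<open>With the horizon T = t the last iterate \<open>v k k\<close> belongs to time t exactly,
  without rounding. The deficit at time t then exceeds that of the scheme by at most the uniform L1
  error.\<close>

lemma mild_solution_lower:
 assumes sol: "mild_solution s m f U" and t: "t > 0" and b: "bump e F" and e: "e \<ge> 0" and l: "l > 0" "l * e \<le> pe"
 shows "(LBNN x. ennreal (amp l t * F x powr (1 / m) - U t x)) \<le> (LBNN x. ennreal (amp l 0 * F x powr (1 / m) - f x))"
proof -
 obtain v where v: "\<And>k. k \<ge> 1 \<Longrightarrow> euler_scheme s m (t / real k) k f (v k)"
  and lim: "(\<lambda>k. SUP \<tau>\<in>{0..t}. L1_norm (\<lambda>x. v k (nat \<lceil>\<tau> * real k / t\<rceil>) x - U \<tau> x)) \<longlonglongrightarrow> 0"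
  using sol t unfolding mild_solution_def by blast
 let ?S = "\<lambda>k. SUP \<tau>\<in>{0..t}. L1_norm (\<lambda>x. v k (nat \<lceil>\<tau> * real k / t\<rceil>) x - U \<tau> x)"
 let ?B = "LBNN x. ennreal (amp l 0 * F x powr (1 / m) - f x)" and ?A = "LBNN x. ennreal (amp l t * F x powr (1 / m) - U t x)"
 have Um: "U t \<in> borel_measurable lebesgue" using sol t by (auto simp: mild_solution_def L1_def)
 then obtain U' where [measurable]: "U' \<in> bm" and U': "AE x in lborel. U t x = U' x" using borel_rep by blast
 have Fc: "continuous_on UNIV F" using b by (simp add: bump_def)
 have [measurable]: "F \<in> bm" by (rule borel_measurable_continuous_onI[OF Fc])
 have "?A
   \<le> ?S k + ?B"
  if k: "k \<ge> 1" for k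
 proof -
  have "v k k \<in> borel_measurable lebesgue" using v[OF k] by (auto simp: euler_scheme_def L1_def)
  then obtain W where [measurable]: "W \<in> bm" and W: "AE x in lborel. v k k x = W x" using borel_rep by blast
  have "?A = (LBNN x. ennreal (amp l t * F x powr (1 / m) - U' x))"
   using U' by (intro nn_integral_cong_AE) (auto elim: AE_mp)
  also have "\<dots> \<le> (LBNN x. ennreal \<bar>W x - U' x\<bar> + ennreal (amp l t * F x powr (1 / m) - W x))"
  proof (rule nn_integral_mono)
   fix x
   have "ennreal (amp l t * F x powr (1 / m) - U' x) \<le> ennreal (\<bar>W x - U' x\<bar> + max 0 (amp l t * F x powr (1 / m) - W x))"
    by (intro ennreal_leI) linarith
   also have "\<dots> = ennreal \<bar>W x - U' x\<bar> + ennreal (max 0 (amp l t * F x powr (1 / m) - W x))" by (rule ennreal_plus) auto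
   also have "ennreal (max 0 (amp l t * F x powr (1 / m) - W x)) = ennreal (amp l t * F x powr (1 / m) - W x)"
    by (cases "amp l t * F x powr (1 / m) - W x \<ge> 0") (auto simp: ennreal_neg)
   finally show "ennreal (amp l t * F x powr (1 / m) - U' x) \<le> ennreal \<bar>W x - U' x\<bar> + ennreal (amp l t * F x powr (1 / m) - W x)" .
  qed
  also have "\<dots> = (LBNN x. ennreal \<bar>W x - U' x\<bar>) + (LBNN x. ennreal (amp l t * F x powr (1 / m) - W x))"
   by (rule nn_integral_add) measurable
  also have "(LBNN x. ennreal \<bar>W x - U' x\<bar>) = L1_norm (\<lambda>x. v k k x - U t x)"
   unfolding L1_norm_eq using U' W by (intro nn_integral_cong_AE) (auto elim!: AE_mp)
  also have "\<dots> \<le> ?S k"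
   by (rule SUP_upper2[of t]) (use t in auto)
  also have "(LBNN x. ennreal (amp l t * F x powr (1 / m) - W x)) = (LBNN x. ennreal (amp l t * F x powr (1 / m) - v k k x))"
   using W by (intro nn_integral_cong_AE) (auto elim: AE_mp)
  also have "\<dots> \<le> ?B"
   using euler_scheme_lower[OF v[OF k] _ b e l] k t by simp
  finally show ?thesis by (simp add: add_left_mono)
 qed
 hence "\<forall>\<^sub>F k in sequentially. ?A
   \<le> ?S k + ?B"
  by (auto simp: eventually_sequentially)
 moreover have "(\<lambda>k. ?S k + ?B)
   \<longlonglongrightarrow> 0 + ?B"
  by (intro tendsto_add lim tendsto_const)
 ultimately show ?thesis by (intro tendsto_lowerbound) auto
qed

text \<open>The approximating data lie below u0 and may lie below the bump too, so no ordering is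
  available at level k. The deficit of w_k below the bump controls that of the solution and tends to
  0 by dominated convergence, since the limit u0 is above the bump.\<close>

lemma monotone_solution_lower:
 assumes sol: "monotone_weak_dual_solution s m u0 u" and t: "t > 0" and b: "bump e F" and e: "e \<ge> 0" and l: "l > 0" "l * e \<le> pe"
  and le: "\<And>x. amp l 0 * F x powr (1 / m) \<le> u0 x"
 shows "AE x in lborel. amp l t * F x powr (1 / m) \<le> u t x"
proof -
 obtain w U where w: "approximating_data u0 w" and U: "\<And>k. mild_solution s m (w k) (U k)"
  and lim: "\<And>t. t \<ge> 0 \<Longrightarrow> AE x in lborel. incseq (\<lambda>k. U k t x) \<and> (\<lambda>k. U k t x) \<longlonglongrightarrow> u t x"
  using sol unfolding monotone_weak_dual_solution_def AE_completion_iff by blast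
 have Fc: "continuous_on UNIV F" and FI: "Lint (\<lambda>x. F x powr (1 / m))" using b by (auto simp: bump_def)
 have [measurable]: "F \<in> bm" by (rule borel_measurable_continuous_onI[OF Fc])
 have ut: "u t \<in> borel_measurable lebesgue"
  using sol t unfolding monotone_weak_dual_solution_def weak_dual_solution_def L1G_def by fastforce
 define I where "I = (LBNN x. ennreal (amp l t * F x powr (1 / m) - u t x))"
 have "I \<le> (LBNN x. ennreal (amp l 0 * F x powr (1 / m) - w k x))" for k
 proof -
  have "AE x in lborel. U k t x \<le> u t x"
   using lim[OF less_imp_le[OF t]] by eventually_elim (auto intro: incseq_le)
  hence "I \<le> (LBNN x. ennreal (amp l t * F x powr (1 / m) - U k t x))" unfolding I_def
   by (intro nn_integral_mono_AE) (erule AE_mp, intro AE_I2 impI ennreal_leI, simp)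
  also have "\<dots> \<le> (LBNN x. ennreal (amp l 0 * F x powr (1 / m) - w k x))"
   by (rule mild_solution_lower[OF U t b e l])
  finally show ?thesis .
 qed
 moreover have "(\<lambda>k. LBNN x. ennreal (amp l 0 * F x powr (1 / m) - w k x)) \<longlonglongrightarrow> 0"
 proof -
  have wm: "w k \<in> borel_measurable lebesgue" for k using w by (auto simp: approximating_data_def L1_def)
  have wl: "AE x in lborel. (\<forall>k. 0 \<le> w k x) \<and> (\<lambda>k. w k x) \<longlonglongrightarrow> u0 x"
   using w by (auto simp: approximating_data_def AE_completion_iff elim: AE_mp)
  have Fm: "(\<lambda>x. F x powr (1 / m)) \<in> borel_measurable lebesgue" by (rule lebesgue_borel) measurable
  have "(\<lambda>k. \<integral>\<^sup>+x. ennreal (amp l 0 * F x powr (1 / m) - w k x) \<partial>lebesgue) \<longlonglongrightarrow> (\<integral>\<^sup>+x. 0 \<partial>(lebesgue :: (real^'k) measure))"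
  proof (rule nn_integral_dominated_convergence[where w="\<lambda>x. ennreal (amp l 0 * F x powr (1 / m))"])
   show "(\<lambda>x. ennreal (amp l 0 * F x powr (1 / m) - w k x)) \<in> borel_measurable lebesgue" for k
    using Fm wm[of k] by measurable
   show "(\<lambda>x. ennreal (amp l 0 * F x powr (1 / m))) \<in> borel_measurable lebesgue" using Fm by measurable
   show "AE x in lebesgue. ennreal (amp l 0 * F x powr (1 / m) - w k x) \<le> ennreal (amp l 0 * F x powr (1 / m))" for k
    unfolding AE_completion_iff using wl by eventually_elim (auto intro: ennreal_leI)
   have "(LBNN x. ennreal (amp l 0 * F x powr (1 / m))) = ennreal (LBINT x. amp l 0 * F x powr (1 / m))"
    using FI by (intro nn_integral_eq_integral) (auto simp: amp_def)
   thus "(\<integral>\<^sup>+x. ennreal (amp l 0 * F x powr (1 / m)) \<partial>lebesgue) < \<infinity>" by (simp add: nn_integral_completion)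
   show "AE x in lebesgue. (\<lambda>k. ennreal (amp l 0 * F x powr (1 / m) - w k x)) \<longlonglongrightarrow> 0"
    unfolding AE_completion_iff using wl
   proof eventually_elim
    case (elim x)
    hence "(\<lambda>k. ennreal (amp l 0 * F x powr (1 / m) - w k x)) \<longlonglongrightarrow> ennreal (amp l 0 * F x powr (1 / m) - u0 x)"
     by (intro tendsto_ennrealI tendsto_intros) auto
    thus ?case using le[of x] by (simp add: ennreal_neg)
   qed
  qed simp
  thus ?thesis by (simp add: nn_integral_completion)
 qed
 ultimately have "I \<le> 0" by (intro tendsto_lowerbound[of _ 0 sequentially I]) (auto intro: always_eventually)
 hence "(\<integral>\<^sup>+x. ennreal (amp l t * F x powr (1 / m) - u t x) \<partial>lebesgue) = 0" by (simp add: I_def nn_integral_completion)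
 moreover have "(\<lambda>x. ennreal (amp l t * F x powr (1 / m) - u t x)) \<in> borel_measurable lebesgue"
 proof -
  have "(\<lambda>x. F x powr (1 / m)) \<in> borel_measurable lebesgue" by (rule lebesgue_borel) measurable
  thus ?thesis using ut by measurable
 qed
 ultimately have "AE x in lebesgue. ennreal (amp l t * F x powr (1 / m) - u t x) = 0" by (simp add: nn_integral_0_iff_AE)
 thus ?thesis unfolding AE_completion_iff by eventually_elim (simp add: ennreal_eq_0_iff)
qed

text \<open>At a fixed time the amplitude (pe (j + 1)/(t + 1))^pe is unbounded in j, so some bump
  exceeds any proposed bound.\<close>

lemma Linf_norm_infinite:
 assumes sol: "monotone_weak_dual_solution s m u0 u" and t: "t > 0"
  and F: "\<And>j. \<exists>F. bump (1 / real (Suc j)) F \<and> (\<forall>x. height j * F x powr (1 / m) \<le> u0 x)"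
 shows "Linf_norm (u t) = \<infinity>"
proof (rule ccontr)
 assume "Linf_norm (u t) \<noteq> \<infinity>"
 then obtain B where B: "Linf_norm (u t) = ennreal B" "B \<ge> 0" by (cases "Linf_norm (u t)") auto
 hence "Linf_norm (u t) < ennreal (B + 1)" by (simp add: ennreal_less_iff)
 from Linf_norm_AE[OF this] have uB: "AE x in lborel. \<bar>u t x\<bar> \<le> B + 1" .
 have "filterlim (\<lambda>j. amp (pe * real (Suc j)) t) at_top sequentially"
  unfolding amp_def using pe_pos t by real_asymp
 hence "\<forall>\<^sub>F j in sequentially. amp (pe * real (Suc j)) t > B + 1" by (simp add: filterlim_at_top_dense)
 then obtain j where j: "amp (pe * real (Suc j)) t > B + 1" by (auto simp: eventually_sequentially)
 define A where "A = amp (pe * real (Suc j)) t"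
 obtain F where F: "bump (1 / real (Suc j)) F" "\<And>x. height j * F x powr (1 / m) \<le> u0 x" using F[of j] by blast
 have "AE x in lborel. A * F x powr (1 / m) \<le> u t x" unfolding A_def
  by (rule monotone_solution_lower[OF sol t F(1)]) (use F(2) pe_pos in \<open>auto simp: height_def\<close>)
 hence ae: "AE x in lebesgue. A * F x powr (1 / m) \<le> B + 1" unfolding AE_completion_iff using uB by eventually_elim linarith
 obtain c where c: "F c = 1" using F(1) by (auto simp: bump_def)
 have Fpos: "F x > 0" for x using F(1) by (auto simp: bump_def)
 have cA: "continuous_on UNIV (\<lambda>x. A * F x powr (1 / m))"
 proof -
  have "F x \<noteq> 0" for x using Fpos[of x] by simp
  moreover have "continuous_on UNIV F" using F(1) by (simp add: bump_def)
  ultimately show ?thesis by (intro continuous_on_mult continuous_on_powr continuous_on_const) auto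
 qed
 \<comment> \<open>The bump attains the amplitude at c; by continuity it exceeds the bound on an
   open set around c, and nonempty open sets are not negligible.\<close>
 have "open {x. A * F x powr (1 / m) > B + 1}" by (rule open_Collect_less[OF continuous_on_const cA])
 moreover have "c \<in> {x. A * F x powr (1 / m) > B + 1}" using c j by (simp add: A_def)
 ultimately have "\<not> negligible {x. A * F x powr (1 / m) > B + 1}" using open_not_negligible by blast
 moreover have "{x. A * F x powr (1 / m) > B + 1} \<in> null_sets lebesgue"
  using ae AE_iff_null_sets[of "{x. A * F x powr (1 / m) > B + 1}" lebesgue] \<open>open _\<close> by (simp add: not_less)
 ultimately show False by (simp add: negligible_iff_null_sets)
qed

end

section \<open>Test functions, their bounds and their Borel representatives\<close>

lemma bounded_mult_integrable:
 fixes f y :: "'a::euclidean_space \<Rightarrow> real"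
 assumes f: "f \<in> bm" "\<And>x. \<bar>f x\<bar> \<le> C" and y: "Lint y"
 shows "Lint (\<lambda>x. f x * y x)"
proof (rule integrable_bound)
 show "Lint (\<lambda>x. C * \<bar>y x\<bar>)" using y by simp
 show "(\<lambda>x. f x * y x) \<in> borel_measurable lborel" using f(1) Lint_measurable[OF y] by simp
 show "AE x in lborel. norm (f x * y x) \<le> norm (C * \<bar>y x\<bar>)"
 proof (rule AE_I2)
  fix x show "norm (f x * y x) \<le> norm (C * \<bar>y x\<bar>)"
   using mult_right_mono[OF order_trans[OF f(2)[of x] abs_ge_self] abs_ge_zero[of "y x"]] by (simp add: abs_mult)
 qed
qed

lemma pairing_le:
 fixes f y :: "'a::euclidean_space \<Rightarrow> real"
 assumes f: "f \<in> bm" "\<And>x. \<bar>f x\<bar> \<le> C" and y: "Lint y" and e: "AE x in lborel. \<bar>f x\<bar> \<le> e"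
 shows "\<bar>LBINT x. f x * y x\<bar> \<le> e * nL1 y"
proof -
 note I = bounded_mult_integrable[OF f y]
 have "\<bar>LBINT x. f x * y x\<bar> \<le> (LBINT x. \<bar>f x * y x\<bar>)" by (rule integral_abs_bound)
 also have "\<dots> \<le> (LBINT x. e * \<bar>y x\<bar>)"
 proof (rule integral_mono_AE)
  show "AE x in lborel. \<bar>f x * y x\<bar> \<le> e * \<bar>y x\<bar>" using e by eventually_elim (simp add: abs_mult mult_right_mono)
 qed (use I y in simp_all)
 finally show ?thesis by simp
qed

text \<open>Clipping a Borel representative at C and cutting it off outside S turns the bound and
  the support condition from almost everywhere into everywhere.\<close>

lemma bounded_rep:
 fixes f :: "'a::euclidean_space \<Rightarrow> real"
 assumes "f \<in> borel_measurable lebesgue" and [measurable]: "S \<in> sets borel"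
  and z: "AE x in lborel. x \<notin> S \<longrightarrow> f x = 0" and C: "AE x in lborel. \<bar>f x\<bar> \<le> C" "C \<ge> 0"
 shows "\<exists>g. g \<in> bm \<and> (\<forall>x. \<bar>g x\<bar> \<le> C * indicator S x) \<and> (AE x in lborel. f x = g x)"
proof -
 obtain g where [measurable]: "g \<in> bm" and g: "AE x in lborel. f x = g x" using borel_rep[OF assms(1)] by blast
 have "AE x in lborel. f x = indicator S x * max (- C) (min C (g x))"
  using g z C(1)
 proof eventually_elim
  case (elim x)
  thus ?case by (cases "x \<in> S") auto
 qed
 thus ?thesis using C(2) by (intro exI[of _ "\<lambda>x. indicator S x * max (- C) (min C (g x))"]) (auto simp: indicator_def)
qed

lemma Linf_bounded: "f \<in> Linf \<Longrightarrow> \<exists>C\<ge>0. AE x in lborel. \<bar>f x\<bar> \<le> C"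
proof -
 assume "f \<in> Linf"
 then obtain C where "Linf_norm f = ennreal C" "C \<ge> 0" by (cases "Linf_norm f") (auto simp: Linf_def)
 hence "Linf_norm f < ennreal (C + 1)" by (simp add: ennreal_less_iff)
 from Linf_norm_AE[OF this] show ?thesis using \<open>C \<ge> 0\<close> by (intro exI[of _ "C + 1"]) simp
qed

lemma eventually_translate:
 fixes t :: real
 assumes "open A" "t \<in> A"
 shows "\<forall>\<^sub>F h in at 0. t + h \<in> A"
proof -
 have "((\<lambda>h. t + h) \<longlongrightarrow> t + 0) (at 0)" by (intro tendsto_intros)
 thus ?thesis using topological_tendstoD[of "\<lambda>h. t + h" "t + 0" "at 0" A] assms by simp
qed

context
 fixes T :: real and \<psi> d\<psi> :: "real \<Rightarrow> real^'k \<Rightarrow> real"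
 assumes test: "test_function T \<psi> d\<psi>"
begin

lemma test_vanish: "\<exists>a b. 0 < a \<and> b < T \<and> (\<forall>t. 0 < t \<longrightarrow> t < T \<longrightarrow> t \<notin> {a..b} \<longrightarrow> (AE x in lborel. \<psi> t x = 0))"
proof -
 have "\<exists>a b. 0 < a \<and> b < T \<and> (\<forall>t\<in>{0<..<T} - {a..b}. AE x in lborel. \<psi> t x = 0)"
  using test unfolding test_function_def AE_completion_iff by (elim conjE)
 then obtain a b where ab: "0 < a" "b < T" and z: "\<forall>t\<in>{0<..<T} - {a..b}. AE x in lborel. \<psi> t x = 0" by (elim exE conjE)
 show ?thesis by (rule exI[of _ a], rule exI[of _ b]) (use ab z in simp)
qed

lemma test_support: "\<exists>S. compact S \<and> (\<forall>t. 0 < t \<longrightarrow> t < T \<longrightarrow> (AE x in lborel. x \<notin> S \<longrightarrow> \<psi> t x = 0))"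
proof -
 have "\<exists>S. compact S \<and> (\<forall>t\<in>{0<..<T}. AE x in lborel. x \<notin> S \<longrightarrow> \<psi> t x = 0)"
  using test unfolding test_function_def AE_completion_iff by (elim conjE)
 then obtain S where "compact S" "\<forall>t\<in>{0<..<T}. AE x in lborel. x \<notin> S \<longrightarrow> \<psi> t x = 0" by (elim exE conjE)
 thus ?thesis by (intro exI[of _ S]) simp
qed

lemma test_derivative:
 assumes t: "0 < t" "t < T" and e: "e > 0"
 shows "\<forall>\<^sub>F h in at 0. AE x in lborel. \<bar>(\<psi> (t + h) x - \<psi> t x) / h - d\<psi> t x\<bar> \<le> e"
proof -
 have "((\<lambda>h. Linf_norm (\<lambda>x. (\<psi> (t + h) x - \<psi> t x) / h - d\<psi> t x)) \<longlongrightarrow> 0) (at 0)"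
  using test t by (auto simp: test_function_def)
 from order_tendstoD(2)[OF this, of "ennreal e"] e show ?thesis by (simp add: eventually_mono Linf_norm_AE)
qed

lemma test_continuous:
 assumes t: "0 < t" "t < T" and e: "e > 0"
 shows "\<forall>\<^sub>F r in at t. AE x in lborel. \<bar>d\<psi> r x - d\<psi> t x\<bar> \<le> e"
proof -
 have "((\<lambda>r. Linf_norm (\<lambda>x. d\<psi> r x - d\<psi> t x)) \<longlongrightarrow> 0) (at t within {0<..<T})"
  using test t by (auto simp: test_function_def continuous_in_norm_def)
 moreover have "at t within {0<..<T} = at t" using t by (intro at_within_open) auto
 ultimately have "((\<lambda>r. Linf_norm (\<lambda>x. d\<psi> r x - d\<psi> t x)) \<longlongrightarrow> 0) (at t)" by (simp only:)
 from order_tendstoD(2)[OF this, of "ennreal e"] e show ?thesis by (simp add: eventually_mono Linf_norm_AE)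
qed

text \<open>On Z the difference quotient is 0, so |d\<psi>| is at most any tolerance there. One
  suitable h for each tolerance 1/(i + 1) is enough, which keeps the exceptional null sets countable
  in number.\<close>

lemma test_derivative_zero:
 assumes t: "0 < t" "t < T" and ev: "\<forall>\<^sub>F h in at 0. AE x in lborel. x \<in> Z \<longrightarrow> \<psi> (t + h) x = 0"
  and z: "AE x in lborel. x \<in> Z \<longrightarrow> \<psi> t x = 0"
 shows "AE x in lborel. x \<in> Z \<longrightarrow> d\<psi> t x = 0"
proof -
 have "AE x in lborel. x \<in> Z \<longrightarrow> \<bar>d\<psi> t x\<bar> \<le> 1 / real (Suc i)" for i
 proof -
  have p: "0 < 1 / real (Suc i)" by simp
  have "\<forall>\<^sub>F h in at (0::real). AE x in lborel. x \<in> Z \<longrightarrow> \<bar>d\<psi> t x\<bar> \<le> 1 / real (Suc i)"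
   using ev test_derivative[OF t p]
  proof eventually_elim
   case (elim h)
   from elim z show ?case by eventually_elim auto
  qed
  from eventually_happens'[OF at_neq_bot this] show ?thesis by simp
 qed
 hence "AE x in lborel. \<forall>i. x \<in> Z \<longrightarrow> \<bar>d\<psi> t x\<bar> \<le> 1 / real (Suc i)" unfolding AE_all_countable by (rule allI)
 thus ?thesis
 proof eventually_elim
  case (elim x)
  show ?case
  proof
   assume "x \<in> Z"
   hence "\<bar>d\<psi> t x\<bar> \<le> 1 / real (Suc i)" for i using elim by blast
   moreover have "(\<lambda>i. 1 / real (Suc i)) \<longlonglongrightarrow> 0" by real_asymp
   ultimately have "\<bar>d\<psi> t x\<bar> \<le> 0" by (intro tendsto_lowerbound[of _ 0 sequentially "\<bar>d\<psi> t x\<bar>"]) (auto intro: always_eventually)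
   thus "d\<psi> t x = 0" by simp
  qed
 qed
qed

text \<open>Outside [a, b] the derivative vanishes by \<open>test_derivative_zero\<close>. On the
  compact interval local boundedness, from continuity in the supremum norm, is patched together by
  Bolzano's bisection principle.\<close>

lemma test_derivative_bounded: "\<exists>B\<ge>0. \<forall>t. 0 < t \<longrightarrow> t < T \<longrightarrow> (AE x in lborel. \<bar>d\<psi> t x\<bar> \<le> B)"
proof -
 let ?P = "\<lambda>\<alpha> \<beta>. \<exists>C\<ge>0. \<forall>r. \<alpha> \<le> r \<longrightarrow> r \<le> \<beta> \<longrightarrow> (AE x in lborel. \<bar>d\<psi> r x\<bar> \<le> C)"
 obtain a b where ab: "0 < a" "b < T" and van: "\<And>t. 0 < t \<Longrightarrow> t < T \<Longrightarrow> t \<notin> {a..b} \<Longrightarrow> AE x in lborel. \<psi> t x = 0"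
  using test_vanish by blast
 have out: "AE x in lborel. d\<psi> t x = 0" if t: "0 < t" "t < T" "t \<notin> {a..b}" for t
 proof -
  have "\<forall>\<^sub>F h in at 0. t + h \<in> {0<..<T} - {a..b}" using t by (intro eventually_translate open_Diff) auto
  hence "\<forall>\<^sub>F h in at 0. AE x in lborel. x \<in> UNIV \<longrightarrow> \<psi> (t + h) x = 0" by eventually_elim (use van in auto)
  from test_derivative_zero[OF t(1,2) this] van[OF t] show ?thesis by simp
 qed
 show ?thesis
 proof (cases "a \<le> b")
  case True
  have "?P a b"
  proof (rule Bolzano[OF True, where P="?P"])
   fix \<alpha> \<beta> \<gamma> :: real
   assume "?P \<alpha> \<beta>" "?P \<beta> \<gamma>"
   then obtain C D where C: "C \<ge> 0" "\<And>r. \<alpha> \<le> r \<Longrightarrow> r \<le> \<beta> \<Longrightarrow> AE x in lborel. \<bar>d\<psi> r x\<bar> \<le> C"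
    and D: "D \<ge> 0" "\<And>r. \<beta> \<le> r \<Longrightarrow> r \<le> \<gamma> \<Longrightarrow> AE x in lborel. \<bar>d\<psi> r x\<bar> \<le> D" by blast
   have "AE x in lborel. \<bar>d\<psi> r x\<bar> \<le> max C D" if r: "\<alpha> \<le> r" "r \<le> \<gamma>" for r
   proof (cases "r \<le> \<beta>")
    case True
    from C(2)[OF r(1) True] show ?thesis by eventually_elim simp
   next
    case False
    hence "\<beta> \<le> r" by simp
    from D(2)[OF this r(2)] show ?thesis by eventually_elim simp
   qed
   thus "?P \<alpha> \<gamma>" using C(1) by (intro exI[of _ "max C D"]) auto
  next
   fix z assume z: "a \<le> z" "z \<le> b"
   hence z': "0 < z" "z < T" using ab by auto
   from test_continuous[OF z', of 1] obtain d where d: "d > 0" "\<And>r. r \<noteq> z \<Longrightarrow> dist r z < d \<Longrightarrow> AE x in lborel. \<bar>d\<psi> r x - d\<psi> z x\<bar> \<le> 1"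
    by (auto simp: eventually_at)
   obtain C where C: "C \<ge> 0" "AE x in lborel. \<bar>d\<psi> z x\<bar> \<le> C"
    using Linf_bounded[of "d\<psi> z"] test z' by (auto simp: test_function_def)
   have "AE x in lborel. \<bar>d\<psi> r x\<bar> \<le> C + 1" if r: "dist r z < d" for r
   proof (cases "r = z")
    case True
    from C(2) show ?thesis unfolding True by eventually_elim simp
   next
    case False
    from d(2)[OF False r] C(2) show ?thesis by eventually_elim simp
   qed
   thus "\<exists>d>0. \<forall>\<alpha> \<beta>. \<alpha> \<le> z \<and> z \<le> \<beta> \<and> \<beta> - \<alpha> < d \<longrightarrow> (?P \<alpha> \<beta>)"
    using d(1) C(1) by (intro exI[of _ d] conjI allI impI exI[of _ "C + 1"]) (auto simp: dist_real_def)
  qed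
  then obtain C where C: "C \<ge> 0" "\<And>r. a \<le> r \<Longrightarrow> r \<le> b \<Longrightarrow> AE x in lborel. \<bar>d\<psi> r x\<bar> \<le> C" by blast
  have "AE x in lborel. \<bar>d\<psi> t x\<bar> \<le> C" if t: "0 < t" "t < T" for t
  proof (cases "t \<in> {a..b}")
   case False
   from out[OF t False] show ?thesis by eventually_elim (use C(1) in simp)
  qed (use C in auto)
  with C(1) show ?thesis by blast
 next
  case False
  have "AE x in lborel. \<bar>d\<psi> t x\<bar> \<le> 0" if t: "0 < t" "t < T" for t
  proof -
   have "t \<notin> {a..b}" using False by auto
   from out[OF t this] show ?thesis by eventually_elim simp
  qed
  thus ?thesis by (intro exI[of _ 0]) simp
 qed
qed

text \<open>The derivative inherits the compact support, again by
  \<open>test_derivative_zero\<close>. The constant B is common to all times, as the Fubini argument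
  requires, while the bound on \<rho> may depend on t.\<close>

lemma test_reps:
 "\<exists>S B q \<rho>. compact S \<and> B \<ge> 0 \<and> (\<forall>t. q t \<in> bm) \<and> (\<forall>t. \<rho> t \<in> bm) \<and>
   (\<forall>t x. \<bar>q t x\<bar> \<le> B * indicator S x) \<and> (\<forall>t. \<exists>C. \<forall>x. \<bar>\<rho> t x\<bar> \<le> C * indicator S x) \<and>
   (\<forall>t. 0 < t \<longrightarrow> t < T \<longrightarrow> (AE x in lborel. d\<psi> t x = q t x) \<and> (AE x in lborel. \<psi> t x = \<rho> t x))"
proof -
 obtain S where S: "compact S" and supp: "\<And>t. 0 < t \<Longrightarrow> t < T \<Longrightarrow> AE x in lborel. x \<notin> S \<longrightarrow> \<psi> t x = 0"
  using test_support by blast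
 have [measurable]: "S \<in> sets borel" using S by (simp add: compact_imp_closed)
 have dsupp: "AE x in lborel. x \<notin> S \<longrightarrow> d\<psi> t x = 0" if t: "0 < t" "t < T" for t
 proof -
  have "\<forall>\<^sub>F h in at 0. t + h \<in> {0<..<T}" using t by (intro eventually_translate) auto
  hence "\<forall>\<^sub>F h in at 0. AE x in lborel. x \<in> - S \<longrightarrow> \<psi> (t + h) x = 0" by eventually_elim (use supp in auto)
  from test_derivative_zero[OF t this] supp[OF t] show ?thesis by simp
 qed
 obtain B where B: "B \<ge> 0" "\<And>t. 0 < t \<Longrightarrow> t < T \<Longrightarrow> AE x in lborel. \<bar>d\<psi> t x\<bar> \<le> B" using test_derivative_bounded by blast
 let ?Q = "\<lambda>t q. q \<in> bm \<and> (\<forall>x. \<bar>q x\<bar> \<le> B * indicator S x) \<and> (0 < t \<and> t < T \<longrightarrow> (AE x in lborel. d\<psi> t x = q x))" and ?R = "\<lambda>t r. r \<in> bm \<and> (\<exists>C. \<forall>x. \<bar>r x\<bar> \<le> C * indicator S x) \<and> (0 < t \<and> t < T \<longrightarrow> (AE x in lborel. \<psi> t x = r x))"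
 have "\<forall>t. \<exists>q. ?Q t q"
 proof
  fix t
  show "\<exists>q. ?Q t q"
  proof (cases "0 < t \<and> t < T")
   case True
   hence "d\<psi> t \<in> borel_measurable lebesgue" using test by (auto simp: test_function_def Linf_def)
   from bounded_rep[OF this _ dsupp B(2) B(1)] True show ?thesis by auto
  next
   case False
   thus ?thesis using B(1) by (intro exI[of _ "\<lambda>_. 0"]) (auto simp: indicator_def)
  qed
 qed
 from choice[OF this] obtain q where q: "\<forall>t. q t \<in> bm \<and> (\<forall>x. \<bar>q t x\<bar> \<le> B * indicator S x) \<and> (0 < t \<and> t < T \<longrightarrow> (AE x in lborel. d\<psi> t x = q t x))" ..
 have "\<forall>t. \<exists>r. ?R t r"
 proof
  fix t
  show "\<exists>r. ?R t r"
  proof (cases "0 < t \<and> t < T")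
   case True
   hence p: "\<psi> t \<in> Linf" using test by (auto simp: test_function_def)
   then obtain C where C: "C \<ge> 0" "AE x in lborel. \<bar>\<psi> t x\<bar> \<le> C" using Linf_bounded by blast
   have "\<psi> t \<in> borel_measurable lebesgue" using p by (simp add: Linf_def)
   from bounded_rep[OF this _ supp C(2) C(1)] True show ?thesis by auto
  next
   case False
   thus ?thesis by (intro exI[of _ "\<lambda>_. 0"]) (auto intro!: exI[of _ 0])
  qed
 qed
 from choice[OF this] obtain r where r: "\<forall>t. r t \<in> bm \<and> (\<exists>C. \<forall>x. \<bar>r t x\<bar> \<le> C * indicator S x) \<and> (0 < t \<and> t < T \<longrightarrow> (AE x in lborel. \<psi> t x = r t x))" ..
 show ?thesis using S B(1) q r by (intro exI[of _ S] exI[of _ B] exI[of _ q] exI[of _ r]) simp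
qed

end

lemma measurable_ball_split:
 fixes x0 :: "real^'k"
 assumes [measurable]: "v \<in> bm" "k \<in> bm"
 shows "(\<lambda>x. ennreal \<bar>v x\<bar> * indicator (ball x0 1) x) \<in> borel_measurable lborel"
  and "(\<lambda>x. ennreal (\<bar>v x\<bar> * k (x - x0)) * indicator (- ball x0 1) x) \<in> borel_measurable lborel"
proof -
 have [measurable]: "ball x0 1 \<in> sets borel" by simp
 show "(\<lambda>x. ennreal \<bar>v x\<bar> * indicator (ball x0 1) x) \<in> borel_measurable lborel" by measurable
 show "(\<lambda>x. ennreal (\<bar>v x\<bar> * k (x - x0)) * indicator (- ball x0 1) x) \<in> borel_measurable lborel" by measurable
qed

section \<open>The constructed limit satisfies the definition of a weak dual solution\<close>

locale pme_data_vec = pme_vec s n TA m + pme_data s n TA m MM w g u0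
 for s n :: real and TA :: "(real^'k) itself" and m :: real and MM :: "nat \<Rightarrow> real" and w g :: "nat \<Rightarrow> real^'k \<Rightarrow> real" and u0
begin

lemma green_kern: "green s x y = G (x - y)"
proof -
 have "(\<integral>t. indicator {0<..} t *\<^sub>R (heat_kernel t x y * t powr (s - 1)) \<partial>lebesgue) = (LBINT t. Gamma s * (dens s 0 t * heat t (x - y)))"
 proof (rule integral_lebesgue)
  show "AE t in lborel. indicator {0<..} t *\<^sub>R (heat_kernel t x y * t powr (s - 1)) = Gamma s * (dens s 0 t * heat t (x - y))"
  proof (rule AE_I2)
   fix t :: real
   have "Gamma s > 0" using s_pos by simp
   thus "indicator {0<..} t *\<^sub>R (heat_kernel t x y * t powr (s - 1)) = Gamma s * (dens s 0 t * heat t (x - y))"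
    using dens_0[OF s_pos s_le, of t] by (cases "t > 0") (auto simp: heat_kernel_def heat_def)
  qed
 qed measurable
 also have "\<dots> = Gamma s * G (x - y)" by (simp add: kern_def)
 finally show ?thesis using Gamma_real_pos[OF s_pos] by (simp add: green_def set_lebesgue_integral_def)
qed

lemma inv_frac_laplacian_conv:
 assumes [measurable]: "f \<in> bm"
 shows "inv_frac_laplacian s f x = conv G f x"
 unfolding inv_frac_laplacian_def green_kern conv_def by (rule integral_lebesgue) auto

text \<open>Both parts of the norm are compared with the lower bound (1 + |x|)^(-(n - 2s)) for
  \<Phi>; this gives every centre x0 at once, with a constant depending on x0.\<close>

lemma L1G_norm_le:
 "\<exists>C>0. \<forall>v. v \<in> bm \<longrightarrow> L1G_norm s x0 v \<le> (LBNN x. ennreal (C * (\<bar>v x\<bar> * \<Phi> x)))"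
proof -
 obtain c where c: "c > 0" "\<And>x. c * (1 + norm x) powr (- (n - 2 * s)) \<le> \<Phi> x" using Phi_lower by blast
 define k where "k = n - 2 * s"
 have k: "k > 0" using dim by (simp add: k_def)
 \<comment> \<open>With this R one has 1 + |x| <= R inside the unit ball around x0 and 1 + |x| <= R
   |x - x0| outside it.\<close>
 define R where "R = 2 + norm x0"
 have R: "R > 0" unfolding R_def using norm_ge_zero[of x0] by linarith
 define C where "C = max 1 gc * R powr k / c"
 have C: "C > 0" using c R by (simp add: C_def)
 have in_ball: "1 \<le> C * \<Phi> x" if "x \<in> ball x0 1" for x
 proof -
  have "norm x \<le> norm x0 + 1" using that norm_triangle_ineq2[of x x0] by (simp add: dist_norm norm_minus_commute)
  hence "R powr (- k) \<le> (1 + norm x) powr (- k)" using k by (intro powr_mono2') (auto simp: R_def add_pos_nonneg)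
  hence "c * R powr (- k) \<le> c * (1 + norm x) powr (- k)" using c(1) by (intro mult_left_mono) auto
  also have "\<dots> \<le> \<Phi> x" unfolding k_def by (rule c(2))
  finally have "c * R powr (- k) \<le> \<Phi> x" .
  hence "C * (c * R powr (- k)) \<le> C * \<Phi> x" using C by (intro mult_left_mono) auto
  moreover have "C * (c * R powr (- k)) = max 1 gc" using c(1) R by (simp add: C_def powr_minus field_simps)
  ultimately show ?thesis by linarith
 qed
 have out_ball: "G (x - x0) \<le> C * \<Phi> x" if "x \<notin> ball x0 1" for x
 proof -
  have d: "norm (x - x0) \<ge> 1" using that by (simp add: dist_norm norm_minus_commute)
  hence nz: "x - x0 \<noteq> 0" by auto
  have "norm x \<le> norm x0 + norm (x - x0)" using norm_triangle_ineq2[of x x0] by linarith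
  moreover have "norm x0 * 1 \<le> norm x0 * norm (x - x0)" using d by (intro mult_left_mono) auto
  ultimately have "1 + norm x \<le> R * norm (x - x0)" using d by (simp add: R_def algebra_simps)
  hence "(R * norm (x - x0)) powr (- k) \<le> (1 + norm x) powr (- k)" using k by (intro powr_mono2') (auto intro: add_pos_nonneg)
  hence "c * (R * norm (x - x0)) powr (- k) \<le> c * (1 + norm x) powr (- k)" using c(1) by (intro mult_left_mono) auto
  also have "\<dots> \<le> \<Phi> x" unfolding k_def by (rule c(2))
  finally have "c * (R * norm (x - x0)) powr (- k) \<le> \<Phi> x" .
  hence "C * (c * (R * norm (x - x0)) powr (- k)) \<le> C * \<Phi> x" using C by (intro mult_left_mono) auto
  moreover have "C * (c * (R * norm (x - x0)) powr (- k)) = max 1 gc * norm (x - x0) powr (- k)"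
   using c(1) R by (simp add: C_def powr_mult powr_minus field_simps)
  moreover have "gc * norm (x - x0) powr (- k) \<le> max 1 gc * norm (x - x0) powr (- k)" by (intro mult_right_mono) auto
  ultimately show ?thesis using green_eq[OF nz] by (simp add: k_def)
 qed
 have "L1G_norm s x0 v \<le> (LBNN x. ennreal (C * (\<bar>v x\<bar> * \<Phi> x)))" if [measurable]: "v \<in> bm" for v
 proof -
  have "L1G_norm s x0 v = (LBNN x. ennreal \<bar>v x\<bar> * indicator (ball x0 1) x + ennreal (\<bar>v x\<bar> * G (x - x0)) * indicator (- ball x0 1) x)"
   unfolding L1G_norm_def nn_integral_completion green_kern
   by (rule nn_integral_add[symmetric]) (rule measurable_ball_split[OF that measurable_kern])+
  also have "\<dots> \<le> (LBNN x. ennreal (C * (\<bar>v x\<bar> * \<Phi> x)))"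
  proof (rule nn_integral_mono)
   fix x
   show "ennreal \<bar>v x\<bar> * indicator (ball x0 1) x + ennreal (\<bar>v x\<bar> * G (x - x0)) * indicator (- ball x0 1) x \<le> ennreal (C * (\<bar>v x\<bar> * \<Phi> x))"
    using mult_left_mono[OF in_ball[of x] abs_ge_zero[of "v x"]] mult_left_mono[OF out_ball[of x] abs_ge_zero[of "v x"]]
    by (cases "x \<in> ball x0 1") (auto intro!: ennreal_leI simp: mult_ac)
  qed
  finally show ?thesis .
 qed
 with C show ?thesis by blast
qed

lemma integrable_L1G:
 assumes v: "v \<in> bm" "Lint (\<lambda>x. v x * \<Phi> x)"
 shows "v \<in> L1G s x0"
proof -
 obtain C where C: "C > 0" "L1G_norm s x0 v \<le> (LBNN x. ennreal (C * (\<bar>v x\<bar> * \<Phi> x)))" using L1G_norm_le[of x0] v(1) by blast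
 have "Lint (\<lambda>x. C * \<bar>v x * \<Phi> x\<bar>)" using v(2) by simp
 hence I: "Lint (\<lambda>x. C * (\<bar>v x\<bar> * \<Phi> x))" using Phi_nonneg by (simp add: abs_mult)
 have "(LBNN x. ennreal (C * (\<bar>v x\<bar> * \<Phi> x))) < \<infinity>"
  using C(1) Phi_nonneg by (subst nn_integral_eq_integral[OF I]) auto
 with C(2) have "L1G_norm s x0 v < \<infinity>" by (rule le_less_trans)
 thus ?thesis using lebesgue_borel[OF v(1)] by (simp add: L1G_def)
qed

lemma u_slice: "u t \<in> bm" by measurable

lemma u_L1G_continuous: "continuous_in_norm (L1G_norm s x0) {0..T} u"
 unfolding continuous_in_norm_def
proof
 fix t assume t: "t \<in> {0..T}"
 obtain C where C: "C > 0" "\<And>v. v \<in> bm \<Longrightarrow> L1G_norm s x0 v \<le> (LBNN x. ennreal (C * (\<bar>v x\<bar> * \<Phi> x)))"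
  using L1G_norm_le[of x0] by blast
 have le: "L1G_norm s x0 (\<lambda>x. u r x - u t x) \<le> ennreal (C * (LBINT x. \<bar>u r x - u t x\<bar> * \<Phi> x))" if r: "r \<ge> 0" for r
 proof -
  have "Lint (\<lambda>x. \<bar>u r x * \<Phi> x - u t x * \<Phi> x\<bar>)" using u_Phi_integrable r t by (intro integrable_abs integrable_diff) auto
  hence I: "Lint (\<lambda>x. \<bar>u r x - u t x\<bar> * \<Phi> x)" using Phi_nonneg by (simp add: abs_mult flip: left_diff_distrib)
  have "(LBNN x. ennreal (C * (\<bar>u r x - u t x\<bar> * \<Phi> x))) = ennreal (LBINT x. C * (\<bar>u r x - u t x\<bar> * \<Phi> x))"
   using I C(1) Phi_nonneg by (intro nn_integral_eq_integral integrable_mult_right) auto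
  thus ?thesis using C(2)[of "\<lambda>x. u r x - u t x"] by simp
 qed
 show "((\<lambda>r. L1G_norm s x0 (\<lambda>x. u r x - u t x)) \<longlongrightarrow> 0) (at t within {0..T})"
 proof (rule order_tendstoI)
  fix e :: ennreal assume e: "0 < e"
  then obtain e' where e': "0 < e'" "ennreal e' \<le> e" using ennreal_rat_dense[of 0 e]
   by (cases e) (auto simp: ennreal_less_iff intro: that[of 1])
  obtain d where d: "d > 0" "\<And>r. r \<ge> 0 \<Longrightarrow> \<bar>r - t\<bar> < d \<Longrightarrow> (LBINT x. \<bar>u r x - u t x\<bar> * \<Phi> x) < e' / C"
   using u_continuous[of t "e' / C"] t e' C(1) by auto
  show "\<forall>\<^sub>F r in at t within {0..T}. L1G_norm s x0 (\<lambda>x. u r x - u t x) < e"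
   unfolding eventually_at
  proof (intro exI[of _ d] conjI d ballI impI)
   fix r assume r: "r \<in> {0..T}" "r \<noteq> t \<and> dist r t < d"
   hence "C * (LBINT x. \<bar>u r x - u t x\<bar> * \<Phi> x) < e'" using d(2)[of r] C(1) by (simp add: dist_real_def field_simps)
   hence "ennreal (C * (LBINT x. \<bar>u r x - u t x\<bar> * \<Phi> x)) < ennreal e'" using e'(1) by (simp add: ennreal_lessI)
   thus "L1G_norm s x0 (\<lambda>x. u r x - u t x) < e" using le[of r] r(1) e'(2) by (simp add: order.strict_trans1 order.strict_trans2)
  qed
 qed simp
qed

lemma u_powr_locally_integrable:
 assumes T: "T > 0" and S: "compact S"
 shows "(\<integral>\<^sup>+(t, x)\<in>{0<..<T} \<times> S. ennreal (u t x powr m) \<partial>lebesgue) < \<infinity>"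
proof -
 have [measurable]: "S \<in> sets borel" using S by (simp add: compact_imp_closed)
 define f where "f = (\<lambda>p. ennreal (indicator {0<..<T} (fst p) * (indicator S (snd p) * u (fst p) (snd p) powr m)))"
 have [measurable]: "f \<in> borel_measurable lborel2" unfolding f_def by measurable
 have "(\<integral>\<^sup>+(t, x)\<in>{0<..<T} \<times> S. ennreal (u t x powr m) \<partial>lebesgue) = (\<integral>\<^sup>+p. f p \<partial>lebesgue)"
  by (rule nn_integral_cong) (auto simp: f_def indicator_def)
 also have "\<dots> = (\<integral>\<^sup>+p. f p \<partial>lborel2)" by (simp add: nn_integral_completion lborel_prod)
 also have "\<dots> = (LBNN t. LBNN x. f (t, x))" by (rule lborel.nn_integral_fst[symmetric]) measurable
 also have "\<dots> \<le> (LBNN t. indicator {0<..T} t * (LBNN x. ennreal (indicator S x * u t x powr m)))"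
  by (rule nn_integral_mono) (auto simp: f_def indicator_def)
 also have "\<dots> < \<infinity>" by (rule nn_upow_finite[OF T S])
 finally show ?thesis .
qed

text \<open>Differentiability and continuity of the test function in the supremum norm become, after
  pairing with an integrable y, differentiability and continuity of real functions of t. These are
  the hypotheses of \<open>weak_identity\<close>, and the rest is exchanging functions for their
  representatives.\<close>

lemma u_test_identity:
 assumes T: "T > 0" and test: "test_function T \<psi> d\<psi>"
 shows "(LINT t:{0<..<T}|lebesgue. LINT x|lebesgue. d\<psi> t x * inv_frac_laplacian s (u t) x) =
     (LINT t:{0<..<T}|lebesgue. LINT x|lebesgue. u t x powr m * \<psi> t x)"
proof -
 obtain S B q \<rho> where S: "compact S" and B: "B \<ge> 0" and qm: "\<And>t. q t \<in> bm" and rm: "\<And>t. \<rho> t \<in> bm"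
  and qB: "\<And>t x. \<bar>q t x\<bar> \<le> B * indicator S x" and rB: "\<And>t. \<exists>C. \<forall>x. \<bar>\<rho> t x\<bar> \<le> C * indicator S x"
  and qeq: "\<And>t. 0 < t \<Longrightarrow> t < T \<Longrightarrow> AE x in lborel. d\<psi> t x = q t x" and req: "\<And>t. 0 < t \<Longrightarrow> t < T \<Longrightarrow> AE x in lborel. \<psi> t x = \<rho> t x"
  using test_reps[OF test] by blast
 obtain a b where ab: "0 < a" "b < T" and van: "\<And>t. 0 < t \<Longrightarrow> t < T \<Longrightarrow> t \<notin> {a..b} \<Longrightarrow> AE x in lborel. \<psi> t x = 0"
  using test_vanish[OF test] by blast
 have qb: "\<bar>q t x\<bar> \<le> B" for t x using qB[of t x] B by (cases "x \<in> S") auto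
 have rb: "\<exists>C. \<forall>x. \<bar>\<rho> t x\<bar> \<le> C" for t
 proof -
  obtain C where C: "\<And>x. \<bar>\<rho> t x\<bar> \<le> C * indicator S x" using rB by blast
  have "\<bar>\<rho> t x\<bar> \<le> \<bar>C\<bar>" for x using C[of x] by (cases "x \<in> S") auto
  thus ?thesis by blast
 qed
 have deriv: "((\<lambda>t. LBINT x. \<rho> t x * y x) has_real_derivative (LBINT x. q t x * y x)) (at t)"
  if y: "Lint y" and t: "0 < t" "t < T" for y t
  unfolding DERIV_def
 proof (rule tendstoI)
  fix e :: real assume e: "e > 0"
  define Y where "Y = nL1 y"
  have N: "Y \<ge> 0" by (simp add: Y_def)
  \<comment> \<open>The extra 1 guards against Y = 0 and makes d Y strictly less than e.\<close>
  define d where "d = e / (Y + 1)"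
  have d: "d > 0" "d * Y < e" using e N by (auto simp: d_def field_simps)
  have "\<forall>\<^sub>F h in at 0. t + h \<in> {0<..<T}" using t by (intro eventually_translate) auto
  thus "\<forall>\<^sub>F h in at 0. dist (((LBINT x. \<rho> (t + h) x * y x) - (LBINT x. \<rho> t x * y x)) / h) (LBINT x. q t x * y x) < e"
   using test_derivative[OF test t d(1)]
  proof eventually_elim
   case (elim h)
   obtain C1 where C1: "\<And>x. \<bar>\<rho> (t + h) x\<bar> \<le> C1" using rb by blast
   obtain C2 where C2: "\<And>x. \<bar>\<rho> t x\<bar> \<le> C2" using rb by blast
   define f where "f = (\<lambda>x. (\<rho> (t + h) x - \<rho> t x) / h - q t x)"
   have fm: "f \<in> bm" unfolding f_def using rm qm by measurable
   have fb: "\<bar>f x\<bar> \<le> (C1 + C2) / \<bar>h\<bar> + B" for x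
   proof -
    have "\<bar>(\<rho> (t + h) x - \<rho> t x) / h\<bar> \<le> (C1 + C2) / \<bar>h\<bar>"
     unfolding abs_divide using C1[of x] C2[of x] by (intro divide_right_mono) linarith+
    thus ?thesis using qb[of t x] unfolding f_def by linarith
   qed
   have th: "0 < t + h" "t + h < T" using elim(1) by auto
   have "AE x in lborel. \<bar>f x\<bar> \<le> d"
    using elim(2) qeq[OF t] req[OF t] req[OF th] unfolding f_def by eventually_elim simp
   from pairing_le[OF fm fb y this, folded Y_def] have "\<bar>LBINT x. f x * y x\<bar> < e" using d(2) by linarith
   moreover have "(LBINT x. f x * y x) = ((LBINT x. \<rho> (t + h) x * y x) - (LBINT x. \<rho> t x * y x)) / h - (LBINT x. q t x * y x)"
   proof -
    have I1: "Lint (\<lambda>x. \<rho> (t + h) x * y x)" by (rule bounded_mult_integrable[OF rm C1 y])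
    have I2: "Lint (\<lambda>x. \<rho> t x * y x)" by (rule bounded_mult_integrable[OF rm C2 y])
    have I3: "Lint (\<lambda>x. q t x * y x)" by (rule bounded_mult_integrable[OF qm qb y])
    have "(LBINT x. f x * y x) = (LBINT x. (\<rho> (t + h) x * y x - \<rho> t x * y x) / h - q t x * y x)"
     by (intro integral_cong) (auto simp: f_def algebra_simps diff_divide_distrib)
    thus ?thesis using I1 I2 I3 by simp
   qed
   ultimately show ?case by (simp add: dist_real_def)
  qed
 qed
 have cont: "isCont (\<lambda>t. LBINT x. q t x * y x) t" if y: "Lint y" and t: "0 < t" "t < T" for y t
  unfolding isCont_def
 proof (rule tendstoI)
  fix e :: real assume e: "e > 0"
  define Y where "Y = nL1 y"
  have N: "Y \<ge> 0" by (simp add: Y_def)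
  define d where "d = e / (Y + 1)"
  have d: "d > 0" "d * Y < e" using e N by (auto simp: d_def field_simps)
  have "\<forall>\<^sub>F r in at t. r \<in> {0<..<T}" using t by (intro eventually_at_in_open') auto
  thus "\<forall>\<^sub>F r in at t. dist (LBINT x. q r x * y x) (LBINT x. q t x * y x) < e"
   using test_continuous[OF test t d(1)]
  proof eventually_elim
   case (elim r)
   define f where "f = (\<lambda>x. q r x - q t x)"
   have fm: "f \<in> bm" unfolding f_def using qm by measurable
   have fb: "\<bar>f x\<bar> \<le> 2 * B" for x using qb[of r x] qb[of t x] unfolding f_def by linarith
   have r: "0 < r" "r < T" using elim(1) by auto
   have "AE x in lborel. \<bar>f x\<bar> \<le> d"
    using elim(2) qeq[OF t] qeq[OF r] unfolding f_def by eventually_elim simp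
   from pairing_le[OF fm fb y this, folded Y_def] have "\<bar>LBINT x. f x * y x\<bar> < e" using d(2) by linarith
   moreover have "(LBINT x. f x * y x) = (LBINT x. q r x * y x) - (LBINT x. q t x * y x)"
    unfolding f_def left_diff_distrib
    by (intro integral_diff bounded_mult_integrable[OF qm qb y])
   ultimately show ?case by (simp add: dist_real_def)
  qed
 qed
 have van': "AE x in lborel. \<rho> t x = 0" if t: "0 < t" "t < T" "t \<notin> {a..b}" for t
  using van[OF t] req[OF t(1,2)] by eventually_elim simp
 note hyps = T S qm qB rm deriv cont ab van' B
 have ml: "(\<lambda>t. indicator {0<..<T} t * (LBINT x. q t x * conv G (u t) x)) \<in> bm"
  by (rule measurable_weak_lhs[OF hyps])
 have mr: "(\<lambda>\<tau>. indicator {0<..<T} \<tau> * (LBINT x. \<rho> \<tau> x * upow S \<tau> x)) \<in> bm"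
  by (rule measurable_weak_rhs[OF hyps])
 have "(LINT t:{0<..<T}|lebesgue. LINT x|lebesgue. d\<psi> t x * inv_frac_laplacian s (u t) x) =
   (LBINT t. indicator {0<..<T} t * (LBINT x. q t x * conv G (u t) x))"
  unfolding set_lebesgue_integral_def
 proof (rule integral_lebesgue[OF ml], rule AE_I2)
  fix t
  show "indicator {0<..<T} t *\<^sub>R (LINT x|lebesgue. d\<psi> t x * inv_frac_laplacian s (u t) x) = indicator {0<..<T} t * (LBINT x. q t x * conv G (u t) x)"
  proof (cases "t \<in> {0<..<T}")
   case True
   have "(LINT x|lebesgue. d\<psi> t x * inv_frac_laplacian s (u t) x) = (LBINT x. q t x * conv G (u t) x)"
   proof (rule integral_lebesgue)
    show "(\<lambda>x. q t x * conv G (u t) x) \<in> bm" using qm by measurable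
    have "AE x in lborel. d\<psi> t x = q t x" using qeq True by simp
    thus "AE x in lborel. d\<psi> t x * inv_frac_laplacian s (u t) x = q t x * conv G (u t) x"
     by eventually_elim (simp add: inv_frac_laplacian_conv[OF u_slice])
   qed
   thus ?thesis by simp
  qed simp
 qed
 also have "\<dots> = (LBINT \<tau>. indicator {0<..<T} \<tau> * (LBINT x. \<rho> \<tau> x * upow S \<tau> x))"
  by (rule weak_identity[OF hyps])
 also have "\<dots> = (LINT t:{0<..<T}|lebesgue. LINT x|lebesgue. u t x powr m * \<psi> t x)"
  unfolding set_lebesgue_integral_def
 proof (rule integral_lebesgue[OF mr, symmetric])
  show "AE t in lborel. indicator {0<..<T} t *\<^sub>R (LINT x|lebesgue. u t x powr m * \<psi> t x) = indicator {0<..<T} t * (LBINT x. \<rho> t x * upow S t x)"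
   using AE_upow[OF T S]
  proof eventually_elim
   case (elim t)
   show ?case
   proof (cases "t \<in> {0<..<T}")
    case True
    have up: "\<And>x. upow S t x = indicator S x * u t x powr m" using elim True by auto
    obtain C where C: "\<And>x. \<bar>\<rho> t x\<bar> \<le> C * indicator S x" using rB by blast
    have "(LINT x|lebesgue. u t x powr m * \<psi> t x) = (LBINT x. \<rho> t x * upow S t x)"
    proof (rule integral_lebesgue)
     show "(\<lambda>x. \<rho> t x * upow S t x) \<in> bm" using rm S_borel[OF T S] by measurable
     have "AE x in lborel. \<psi> t x = \<rho> t x" using req True by simp
     thus "AE x in lborel. u t x powr m * \<psi> t x = \<rho> t x * upow S t x"
     proof eventually_elim
      case (elim x)
      show ?case using C[of x] by (cases "x \<in> S") (auto simp: elim up)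
     qed
    qed
    thus ?thesis by simp
   qed simp
  qed
 qed
 finally show ?thesis .
qed

lemma u_weak_dual_solution: "weak_dual_solution s m u0 u"
 unfolding weak_dual_solution_def
proof (intro conjI allI impI ballI)
 have "(\<lambda>p. u (fst p) (snd p)) \<in> bm" using measurable_u by (simp add: borel_prod)
 hence "(\<lambda>p. u (fst p) (snd p)) \<in> borel_measurable lebesgue" by (rule lebesgue_borel)
 thus "(\<lambda>(t, x). u t x) \<in> borel_measurable (lebesgue_on ({0<..} \<times> UNIV))"
  by (simp add: case_prod_beta' measurable_restrict_space1)
 show "AE x in lebesgue. 0 \<le> u t x" for t by (simp add: u_nonneg)
 show "u t \<in> L1G s x0" if "t \<in> {0..T}" for t x0 T
  using that by (intro integrable_L1G u_Phi_integrable u_slice) auto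
 show "AE x in lebesgue. u 0 x = u0 x" by (simp add: u_0)
qed (rule u_L1G_continuous u_powr_locally_integrable u_test_identity; assumption)+

lemma u_monotone_weak_dual_solution: "monotone_weak_dual_solution s m u0 u"
 unfolding monotone_weak_dual_solution_def
proof (intro conjI exI allI impI)
 show "weak_dual_solution s m u0 u" by (rule u_weak_dual_solution)
 show "approximating_data u0 w" unfolding approximating_data_def
 proof (intro conjI allI AE_I2)
  fix k
  have b: "0 \<le> w k x \<and> w k x \<le> MM k" for x using nice by (simp add: nice_def)
  hence "\<bar>w k x\<bar> \<le> MM k" for x by simp
  thus "w k \<in> L1 \<inter> Linf" using integrable_L1[OF w_integrable] bounded_Linf[OF measurable_w] by blast
  show "0 \<le> w k x" for x using b by blast
 qed (auto intro: incseq_SucI w_mono w_lim)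
 show "mild_solution s m (w k) (U k)" for k by (rule mild_solution_mild[OF nice])
 show "AE x in lebesgue. incseq (\<lambda>k. U k t x) \<and> (\<lambda>k. U k t x) \<longlonglongrightarrow> u t x" if "t \<ge> 0" for t
  unfolding AE_completion_iff using U_tendsto[OF that] by eventually_elim blast
qed

end

theorem proposition3p17:
  fixes s m :: real
  assumes "0 < s" and "s \<le> 1" and "m > 1" and "real CARD('n::finite) > 2 * s"
  shows "\<exists>u0 :: real^'n \<Rightarrow> real.
           (\<forall>x. 0 \<le> u0 x) \<and> u0 \<in> L1G s 0 \<and>
           (\<exists>u. monotone_weak_dual_solution s m u0 u) \<and>
           (\<forall>u. monotone_weak_dual_solution s m u0 u \<longrightarrow> (\<forall>t>0. Linf_norm (u t) = \<infinity>))"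
proof -
  interpret pme_vec s "real CARD('n)" "TYPE(real^'n)" m
    using assms by unfold_locales auto
  obtain MM w g u0 where data: "\<And>k. nice (MM k) (w k) (g k)" "\<And>k x. w k x \<le> w (Suc k) x" "\<And>x. (\<lambda>k. w k x) \<longlonglongrightarrow> u0 x"
    "Lint (\<lambda>x. u0 x * \<Phi> x)" and below: "\<And>j. \<exists>F. bump (1 / real (Suc j)) F \<and> (\<forall>x. height j * F x powr (1 / m) \<le> u0 x)"
    using data_exists by blast
  interpret D: pme_data_vec s "real CARD('n)" "TYPE(real^'n)" m MM w g u0
    using data by unfold_locales auto
  show ?thesis
  proof (intro exI[of _ u0] conjI allI impI)
    show "0 \<le> u0 x" for x by (rule D.u0_nonneg)
    show "u0 \<in> L1G s 0" by (rule D.integrable_L1G[OF D.measurable_u0 data(4)])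
    show "\<exists>u. monotone_weak_dual_solution s m u0 u" using D.u_monotone_weak_dual_solution by blast
    show "Linf_norm (u t) = \<infinity>" if "monotone_weak_dual_solution s m u0 u" "t > 0" for u t
      by (rule Linf_norm_infinite[OF that below])
  qed
qed

end
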